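(* Let $m\ge 2$ be an integer. Given any initial data $(\omega_0,\rho_0)\in H_0^m((0,1))\times H_0^{m+1}((0,1))$, there exists $T=T(\|\omega_0\|_{H^m}+\|\rho_0\|_{H^{m+1}})>0$ (depending on the data only through this quantity, for given $m$) such that the system $$\begin{cases}\partial_t\rho(t,x)+u(t,x)\,\partial_x\rho(t,x)=0,\\ \partial_t\omega(t,x)+u(t,x)\,\partial_x\omega(t,x)=\partial_x\rho(t,x),\\ u(t,x)=-x\,\Omega(t,x),\quad \Omega(t,x)=\int_x^1\frac{\omega(t,y)}{y}\,dy,\\ \omega(0,x)=\omega_0(x),\quad \rho(0,x)=\rho_0(x),\end{cases}$$ has a unique classical solution $(\omega,\rho)\in C([0,T];H_0^m\times H_0^{m+1})$.
   Context: The system is posed for $x\in[0,1]$ with Dirichlet boundary conditions $\omega=\rho=0$ at $x=0$ and $x=1$. $H^m=H^m((0,1))$ is the usual $L^2$-based Sobolev space, and $H_0^m=H_0^m((0,1))$ is the completion of $C_0^\infty((0,1))\cap H^m((0,1))$ in the $H^m((0,1))$ topology, where $C_0^\infty((0,1))$ denotes smooth functions compactly supported in $(0,1)$. A classical solution is one for which the equations hold pointwise with all terms continuous; uniqueness is in the space $C([0,T];H_0^m\times H_0^{m+1})$. *)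

theory Defs
  imports "HOL-Analysis.Analysis"
begin

section \<open>Sobolev spaces on the open unit interval\<close>

text \<open>
  Elements of \<open>L\<^sup>2\<close> and of the Sobolev spaces are represented by total functions on the reals.
  Only the restriction to \<open>(0,1)\<close>, up to null sets, is relevant: every notion in this section
  is invariant under changing a function on the complement of \<open>(0,1)\<close> and on a null set
  (except for test functions, which are extended by zero to the real line).
\<close>

abbreviation lebesgue01 :: "real measure" where
  "lebesgue01 \<equiv> lebesgue_on {0<..<1}"

definition test_functions :: "(real \<Rightarrow> real) set" where
  "test_functions =
    {\<phi>. (\<forall>k x. (deriv ^^ k) \<phi> differentiable (at x)) \<and>
         compact (closure {x. \<phi> x \<noteq> 0}) \<and> closure {x. \<phi> x \<noteq> 0} \<subseteq> {0<..<1}}"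

definition L2 :: "(real \<Rightarrow> real) set" where
  "L2 = {f \<in> borel_measurable lebesgue01. integrable lebesgue01 (\<lambda>x. (f x)\<^sup>2)}"

definition L2_norm :: "(real \<Rightarrow> real) \<Rightarrow> real" where
  "L2_norm f = sqrt (LINT x|lebesgue01. (f x)\<^sup>2)"

definition is_weak_deriv :: "nat \<Rightarrow> (real \<Rightarrow> real) \<Rightarrow> (real \<Rightarrow> real) \<Rightarrow> bool" where
  "is_weak_deriv k f g \<longleftrightarrow>
    (\<forall>\<phi> \<in> test_functions.
      (LINT x|lebesgue01. f x * (deriv ^^ k) \<phi> x) = (-1) ^ k * (LINT x|lebesgue01. g x * \<phi> x))"

definition sobolev :: "nat \<Rightarrow> (real \<Rightarrow> real) set" where
  "sobolev m = {f \<in> L2. \<forall>k\<le>m. \<exists>g \<in> L2. is_weak_deriv k f g}"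

text \<open>The weak derivative is unique up to null sets, so the choice does not affect the norm.\<close>

definition weak_deriv :: "nat \<Rightarrow> (real \<Rightarrow> real) \<Rightarrow> real \<Rightarrow> real" where
  "weak_deriv k f = (SOME g. g \<in> L2 \<and> is_weak_deriv k f g)"

definition sobolev_norm :: "nat \<Rightarrow> (real \<Rightarrow> real) \<Rightarrow> real" where
  "sobolev_norm m f = sqrt (\<Sum>k\<le>m. (L2_norm (weak_deriv k f))\<^sup>2)"

text \<open>
  Since \<open>H\<^sup>m\<close> is complete, the completion of the test functions in the \<open>H\<^sup>m\<close> topology is
  their closure in \<open>H\<^sup>m\<close>.
\<close>

definition sobolev0 :: "nat \<Rightarrow> (real \<Rightarrow> real) set" where
  "sobolev0 m =
    {f \<in> sobolev m. \<forall>\<epsilon>>0. \<exists>\<phi> \<in> test_functions \<inter> sobolev m. sobolev_norm m (\<lambda>x. f x - \<phi> x) < \<epsilon>}"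

text \<open>The space \<open>C([0,T]; H\<^sub>0\<^sup>m)\<close>, with values \<open>f t = f(t, \<cdot>)\<close>.\<close>

definition C_sobolev0 :: "real \<Rightarrow> nat \<Rightarrow> (real \<Rightarrow> real \<Rightarrow> real) set" where
  "C_sobolev0 T m =
    {f. \<forall>t \<in> {0..T}. f t \<in> sobolev0 m \<and>
          ((\<lambda>s. sobolev_norm m (\<lambda>x. f s x - f t x)) \<longlongrightarrow> 0) (at t within {0..T})}"


section \<open>The system\<close>

definition Omega_of :: "(real \<Rightarrow> real) \<Rightarrow> real \<Rightarrow> real" where
  "Omega_of w x = (LINT y:{x..1}|lebesgue. w y / y)"

definition velocity :: "(real \<Rightarrow> real) \<Rightarrow> real \<Rightarrow> real" where
  "velocity w x = - x * Omega_of w x"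

text \<open>
  The functions \<open>\<omega>\<^sub>t\<close>, \<open>\<omega>\<^sub>x\<close>, \<open>\<rho>\<^sub>t\<close>, \<open>\<rho>\<^sub>x\<close> are the classical partial derivatives, which are one-sided
  at the boundary of \<open>[0,T] \<times> [0,1]\<close>. Integrability of \<open>\<omega>(t,y) / y\<close> makes \<open>\<Omega>\<close> a genuine
  (not a default) value up to \<open>x = 0\<close>.
\<close>

definition classical_solution ::
    "real \<Rightarrow> (real \<Rightarrow> real \<Rightarrow> real) \<Rightarrow> (real \<Rightarrow> real \<Rightarrow> real) \<Rightarrow> bool" where
  "classical_solution T \<omega> \<rho> \<longleftrightarrow>
    (\<exists>\<omega>\<^sub>t \<omega>\<^sub>x \<rho>\<^sub>t \<rho>\<^sub>x :: real \<Rightarrow> real \<Rightarrow> real.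
      (\<forall>g \<in> {\<omega>, \<rho>, \<omega>\<^sub>t, \<omega>\<^sub>x, \<rho>\<^sub>t, \<rho>\<^sub>x, \<lambda>t. Omega_of (\<omega> t), \<lambda>t. velocity (\<omega> t)}.
         continuous_on ({0..T} \<times> {0..1}) (\<lambda>(t, x). g t x)) \<and>
      (\<forall>t \<in> {0..T}. set_integrable lebesgue {0..1} (\<lambda>y. \<omega> t y / y)) \<and>
      (\<forall>t \<in> {0..T}. \<forall>x \<in> {0..1}.
         ((\<lambda>s. \<omega> s x) has_real_derivative \<omega>\<^sub>t t x) (at t within {0..T}) \<and>
         ((\<lambda>y. \<omega> t y) has_real_derivative \<omega>\<^sub>x t x) (at x within {0..1}) \<and>
         ((\<lambda>s. \<rho> s x) has_real_derivative \<rho>\<^sub>t t x) (at t within {0..T}) \<and>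
         ((\<lambda>y. \<rho> t y) has_real_derivative \<rho>\<^sub>x t x) (at x within {0..1}) \<and>
         \<rho>\<^sub>t t x + velocity (\<omega> t) x * \<rho>\<^sub>x t x = 0 \<and>
         \<omega>\<^sub>t t x + velocity (\<omega> t) x * \<omega>\<^sub>x t x = \<rho>\<^sub>x t x))"

text \<open>
  The initial data are elements of \<open>H\<^sub>0\<^sup>m\<close> and \<open>H\<^sub>0\<^sup>m\<^sup>+\<^sup>1\<close>, that is, functions up to null sets, so
  the initial condition is an almost-everywhere identity; it holds pointwise for the continuous
  representatives of the data.
\<close>

definition solves_ivp ::
    "nat \<Rightarrow> real \<Rightarrow> (real \<Rightarrow> real) \<Rightarrow> (real \<Rightarrow> real) \<Rightarrow>
      (real \<Rightarrow> real \<Rightarrow> real) \<Rightarrow> (real \<Rightarrow> real \<Rightarrow> real) \<Rightarrow> bool" where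
  "solves_ivp m T \<omega>\<^sub>0 \<rho>\<^sub>0 \<omega> \<rho> \<longleftrightarrow>
    \<omega> \<in> C_sobolev0 T m \<and> \<rho> \<in> C_sobolev0 T (m + 1) \<and>
    classical_solution T \<omega> \<rho> \<and>
    (\<forall>t \<in> {0..T}. \<omega> t 0 = 0 \<and> \<omega> t 1 = 0 \<and> \<rho> t 0 = 0 \<and> \<rho> t 1 = 0) \<and>
    (AE x in lebesgue01. \<omega> 0 x = \<omega>\<^sub>0 x \<and> \<rho> 0 x = \<rho>\<^sub>0 x)"

end

theory Submission
  imports Defs
begin

text \<open>
  Existence is proved in Lagrangian coordinates. If \<open>X\<close> is the flow of \<open>u\<close>, then \<open>X = x e\<^sup>-\<^sup>A\<close> and
  \<open>C = ln (e\<^sup>A \<partial>\<^sub>xX)\<close> satisfies the closed equation \<open>C\<^sub>t\<^sub>t = \<rho>\<^sub>0' e\<^sup>A\<^sup>-\<^sup>C\<close> with \<open>A = \<integral>\<^sub>x\<^sup>1 (e\<^sup>C - 1) / y dy\<close>,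
  \<open>C = 0\<close> and \<open>C\<^sub>t = \<omega>\<^sub>0\<close> at time \<open>0\<close>. Its space derivative is a contraction problem on a time interval that
  depends only on bounds for \<open>\<omega>\<^sub>0'\<close> and \<open>\<rho>\<^sub>0''\<close>, and \<open>\<omega> = C\<^sub>t \<circ> X\<^sup>-\<^sup>1\<close>, \<open>\<rho> = \<rho>\<^sub>0 \<circ> X\<^sup>-\<^sup>1\<close>.

  By Hardy's inequality the \<open>j\<close>-th derivatives of the data lie in \<open>x\<^sup>m\<^sup>-\<^sup>j L\<^sup>2\<close>. The operator \<open>x \<partial>\<^sub>x\<close> preserves
  such weights and \<open>x \<partial>\<^sub>xC\<close> solves a linear Volterra equation in time, so that all \<open>(x \<partial>\<^sub>x)\<^sup>j C\<^sub>t\<close>, \<open>j \<le> m\<close>, lie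
  in \<open>x\<^sup>m L\<^sup>2\<close> by a bootstrap; the weight pays for the division by \<open>x\<close> in \<open>\<partial>\<^sub>x = x\<^sup>-\<^sup>1 (x \<partial>\<^sub>x)\<close>. Density of
  test functions gives continuity in time after composition with \<open>X\<^sup>-\<^sup>1\<close>.

  For uniqueness the maximum principle is applied to \<open>\<integral>\<^sub>x\<^sup>1 (\<omega> - \<omega>') dy\<close> and \<open>\<rho> - \<rho>'\<close>: passing to
  the primitive of the vorticity avoids the derivative of \<open>\<rho> - \<rho>'\<close>.
\<close>

section \<open>Primitives of integrable functions\<close>

text \<open>The unknowns come from u_x = \<omega> - \<Omega>. Along the flow, ln X_x has time
  derivative \<omega> - \<Omega>, and X_t = - X \<Omega> means A_t = \<Omega>; hence C_t is the
  vorticity along the flow. Differentiating X = x e^(-A) in x gives e^C = 1 - x A_x, which is the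
  formula for A. Since \<rho> is carried by the flow, its slope there is \<rho>_0' / X_x = \<rho>_0'
  e^(A-C), and this is C_tt. The obstacle in Eulerian variables is that transport costs a derivative
  in an iteration. The Lagrangian right-hand side contains only \<rho>_0', which is as smooth as
  \<omega>_0, and A_x contains C undifferentiated, so a fixed point is reached without regularising
  the data. What remains is the singular factor 1/y at 0, harmless at first order because C vanishes
  there. The life span is settled by the first space derivative alone. Higher derivatives solve
  linear equations with the same coefficient - \<rho>_0' e^(A-C), already small enough on that time
  interval, so T does not shrink with m.\<close>

definition prim :: "real \<Rightarrow> real \<Rightarrow> (real \<Rightarrow> real) \<Rightarrow> (real \<Rightarrow> real) \<Rightarrow> bool" where
  "prim a b F f \<longleftrightarrow> f absolutely_integrable_on {a..b} \<and> (\<forall>x\<in>{a..b}. F x - F a = integral {a..x} f)"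

lemma prim_integrable: "prim a b F f \<Longrightarrow> f absolutely_integrable_on {a..b}"
  by (simp add: prim_def)

lemma prim_integrable_sub:
  assumes "prim a b F f" "a \<le> c" "d \<le> b"
  shows "f absolutely_integrable_on {c..d}"
  by (rule absolutely_integrable_on_subinterval[OF prim_integrable[OF assms(1)]]) (use assms in auto)

lemma prim_diff:
  assumes "prim a b F f" "a \<le> x" "x \<le> y" "y \<le> b"
  shows "F y - F x = integral {x..y} f"
proof -
  have i: "f integrable_on {a..y}"
    using prim_integrable_sub[OF assms(1), of a y] assms set_lebesgue_integral_eq_integral(1) by auto
  have "integral {a..x} f + integral {x..y} f = integral {a..y} f"
    using assms i by (intro Henstock_Kurzweil_Integration.integral_combine) auto
  moreover have "F x - F a = integral {a..x} f" "F y - F a = integral {a..y} f"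
    using assms unfolding prim_def by auto
  ultimately show ?thesis by linarith
qed

lemma primI:
  assumes "f absolutely_integrable_on {a..b}" "\<And>x. a \<le> x \<Longrightarrow> x \<le> b \<Longrightarrow> F x - F a = integral {a..x} f"
  shows "prim a b F f"
  using assms by (auto simp: prim_def)

lemma prim_sub:
  assumes "prim a b F f" "a \<le> c" "d \<le> b"
  shows "prim c d F f"
proof (rule primI)
  show "f absolutely_integrable_on {c..d}" using prim_integrable_sub[OF assms] .
  show "F x - F c = integral {c..x} f" if "c \<le> x" "x \<le> d" for x
    using prim_diff[OF assms(1)] assms that by auto
qed

text \<open>The two end points form a null set, so densities can be rewritten by identities that
  hold only on the open interval, such as those involving 1/x.\<close>

lemma prim_cong:
  assumes "prim a b F f" "\<And>x. x \<in> {a..b} \<Longrightarrow> F x = G x" "\<And>x. x \<in> {a<..<b} \<Longrightarrow> f x = g x"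
  shows "prim a b G g"
proof -
  have n: "negligible {a,b}" by simp
  have "g absolutely_integrable_on {a..b}"
    by (rule absolutely_integrable_spike[OF prim_integrable[OF assms(1)] n]) (use assms(3) in auto)
  moreover have "G x - G a = integral {a..x} g" if "a \<le> x" "x \<le> b" for x
  proof -
    have "integral {a..x} f = integral {a..x} g"
      by (rule integral_spike[OF n]) (use assms(3) that in auto)
    then show ?thesis using assms(1,2) that unfolding prim_def by auto
  qed
  ultimately show ?thesis by (rule primI)
qed

lemma prim_add:
  assumes "prim a b F f" "prim a b G g"
  shows "prim a b (\<lambda>x. F x + G x) (\<lambda>x. f x + g x)"
proof (rule primI)
  show "(\<lambda>x. f x + g x) absolutely_integrable_on {a..b}"
    using assms unfolding prim_def by (intro set_integral_add) auto
  fix x assume x: "a \<le> x" "x \<le> b"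
  have "f integrable_on {a..x}" "g integrable_on {a..x}"
    using prim_integrable_sub[OF assms(1), of a x] prim_integrable_sub[OF assms(2), of a x] x
      set_lebesgue_integral_eq_integral(1) by auto
  then show "F x + G x - (F a + G a) = integral {a..x} (\<lambda>x. f x + g x)"
    using prim_diff[OF assms(1), of a x] prim_diff[OF assms(2), of a x] x
    by (simp add: Henstock_Kurzweil_Integration.integral_add)
qed

lemma prim_cmult:
  assumes "prim a b F f"
  shows "prim a b (\<lambda>x. c * F x) (\<lambda>x. c * f x)"
proof (rule primI)
  show "(\<lambda>x. c * f x) absolutely_integrable_on {a..b}"
    using assms unfolding prim_def by (intro set_integrable_mult_right) auto
  fix x assume x: "a \<le> x" "x \<le> b"
  show "c * F x - c * F a = integral {a..x} (\<lambda>x. c * f x)"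
    using prim_diff[OF assms, of a x] x by (simp add: right_diff_distrib[symmetric])
qed

lemma prim_diff_fun:
  assumes "prim a b F f" "prim a b G g"
  shows "prim a b (\<lambda>x. F x - G x) (\<lambda>x. f x - g x)"
  using prim_add[OF assms(1) prim_cmult[OF assms(2), of "-1"]] by simp

lemma prim_const: "prim a b (\<lambda>x. c) (\<lambda>x. 0)"
  by (rule primI) simp_all

lemma prim_sum:
  assumes "finite I" "\<And>i. i \<in> I \<Longrightarrow> prim a b (F i) (f i)"
  shows "prim a b (\<lambda>x. \<Sum>i\<in>I. F i x) (\<lambda>x. \<Sum>i\<in>I. f i x)"
  using assms
proof (induction I rule: finite_induct)
  case empty then show ?case using prim_const[of a b 0] by simp
next
  case (insert i I)
  then show ?case using prim_add[of a b "F i" "f i"] by simp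
qed

lemma prim_cont:
  assumes "prim a b F f"
  shows "continuous_on {a..b} F"
proof -
  have "f integrable_on {a..b}" using assms unfolding prim_def
    using set_lebesgue_integral_eq_integral(1) by auto
  then have "continuous_on {a..b} (\<lambda>x. integral {a..x} f)"
    by (rule indefinite_integral_continuous_1)
  then have "continuous_on {a..b} (\<lambda>x. F a + integral {a..x} f)"
    by (intro continuous_intros)
  moreover have "F x = F a + integral {a..x} f" if "x \<in> {a..b}" for x
  proof -
    have "F x - F a = integral {a..x} f" using assms that unfolding prim_def by blast
    then show ?thesis by simp
  qed
  ultimately show ?thesis using continuous_on_cong[OF refl, of "{a..b}" F "\<lambda>x. F a + integral {a..x} f"] by blast
qed

lemma prim_of_deriv:
  assumes "\<And>x. x \<in> {a..b} \<Longrightarrow> (F has_real_derivative f x) (at x within {a..b})" "continuous_on {a..b} f"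
  shows "prim a b F f"
proof (rule primI)
  show "f absolutely_integrable_on {a..b}"
    using assms(2) absolutely_integrable_continuous_real by blast
  fix x assume x: "a \<le> x" "x \<le> b"
  have "(f has_integral F x - F a) {a..x}"
  proof (rule fundamental_theorem_of_calculus[OF x(1)])
    fix y assume "y \<in> {a..x}"
    then have "(F has_real_derivative f y) (at y within {a..x})"
      using assms(1)[of y] x by (auto intro: DERIV_subset)
    then show "(F has_vector_derivative f y) (at y within {a..x})"
      by (simp add: has_real_derivative_iff_has_vector_derivative)
  qed
  then show "F x - F a = integral {a..x} f" by (simp add: integral_unique)
qed

lemma prim_deriv:
  assumes "prim a b F f" "continuous_on {a..b} f" "x \<in> {a..b}"
  shows "(F has_real_derivative f x) (at x within {a..b})"
proof -
  have "((\<lambda>u. integral {a..u} f) has_real_derivative f x) (at x within {a..b})"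
    using integral_has_real_derivative[OF assms(2,3)] .
  then have "((\<lambda>u. F a + integral {a..u} f) has_real_derivative f x) (at x within {a..b})"
    using DERIV_add[OF DERIV_const[of "F a"]] by fastforce
  moreover have "F a + integral {a..u} f = F u" if "u \<in> {a..b}" for u
  proof -
    have "F u - F a = integral {a..u} f" using assms that unfolding prim_def by blast
    then show ?thesis by simp
  qed
  ultimately show ?thesis
    using assms(3) by (subst has_field_derivative_cong_eventually[of _ "\<lambda>u. F a + integral {a..u} f"])
      (auto simp: eventually_at_filter)
qed

lemma abs_integrable_cont_mult:
  fixes f g :: "real \<Rightarrow> real"
  assumes "f absolutely_integrable_on {a..b}" "continuous_on {a..b} g"
  shows "(\<lambda>x. f x * g x) absolutely_integrable_on {a..b}" "(\<lambda>x. g x * f x) absolutely_integrable_on {a..b}"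
proof -
  have "g \<in> borel_measurable (lebesgue_on {a..b})"
    using assms(2) by (intro continuous_imp_measurable_on_sets_lebesgue) auto
  moreover have "bounded (g ` {a..b})"
    using assms(2) compact_continuous_image compact_imp_bounded by blast
  ultimately show "(\<lambda>x. g x * f x) absolutely_integrable_on {a..b}"
    by (intro absolutely_integrable_bounded_measurable_product_real assms) auto
  then show "(\<lambda>x. f x * g x) absolutely_integrable_on {a..b}" by (simp add: mult.commute)
qed

text \<open>Both sides are additive over adjacent intervals, so an estimate on short intervals
  propagates. In the product rule the error on a short interval is an arbitrarily small multiple of
  the increment of a fixed majorant.\<close>

lemma small_steps_bound:
  fixes D \<mu> :: "real \<Rightarrow> real"
  assumes "\<delta> > 0"
    and "\<And>x y. a \<le> x \<Longrightarrow> x \<le> y \<Longrightarrow> y \<le> b \<Longrightarrow> y - x \<le> \<delta> \<Longrightarrow> \<bar>D y - D x\<bar> \<le> \<mu> y - \<mu> x"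
    and "a \<le> x" "x \<le> y" "y \<le> b"
  shows "\<bar>D y - D x\<bar> \<le> \<mu> y - \<mu> x"
proof -
  obtain n :: nat where n: "y - x \<le> n * \<delta>"
    using real_arch_simple[of "(y-x)/\<delta>"] assms(1) by (auto simp: field_simps)
  from n assms(3-5) show ?thesis
  proof (induction n arbitrary: y)
    case 0 then show ?case by simp
  next
    case (Suc n)
    show ?case
    proof (cases "y - x \<le> \<delta>")
      case True then show ?thesis using assms(2) Suc by auto
    next
      case False
      have "\<bar>D (y - \<delta>) - D x\<bar> \<le> \<mu> (y - \<delta>) - \<mu> x"
        by (rule Suc.IH) (use Suc.prems False assms(1) in \<open>auto simp: algebra_simps\<close>)
      moreover have "\<bar>D y - D (y - \<delta>)\<bar> \<le> \<mu> y - \<mu> (y - \<delta>)"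
        by (rule assms(2)) (use Suc.prems False assms(1) in auto)
      ultimately show ?thesis by linarith
    qed
  qed
qed

text \<open>No almost-everywhere differentiation is used. On a short interval the increment of F G
  minus the integral of the expected density is an integral of f times an oscillation of G plus g
  times an oscillation of F, hence at most \<epsilon> times the mass of |f| + |g|. These errors add
  up to \<epsilon> times the total mass.\<close>

lemma prim_mult:
  assumes F: "prim a b F f" and G: "prim a b G g"
  shows "prim a b (\<lambda>x. F x * G x) (\<lambda>x. f x * G x + F x * g x)"
proof (rule primI)
  have cF: "continuous_on {a..b} F" and cG: "continuous_on {a..b} G"
    using prim_cont F G by auto
  have fi: "f absolutely_integrable_on {a..b}" and gi: "g absolutely_integrable_on {a..b}"
    using F G by (auto simp: prim_def)
  let ?h = "\<lambda>x. f x * G x + F x * g x"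
  show hi: "?h absolutely_integrable_on {a..b}"
    by (intro set_integral_add abs_integrable_cont_mult fi gi cF cG)
  fix x assume x: "a \<le> x" "x \<le> b"
  define D where "D y = F y * G y - integral {a..y} ?h" for y
  define \<mu> where "\<mu> y = integral {a..y} (\<lambda>s. \<bar>f s\<bar> + \<bar>g s\<bar>)" for y
  have nfi: "(\<lambda>s. \<bar>f s\<bar> + \<bar>g s\<bar>) absolutely_integrable_on {a..b}"
    using absolutely_integrable_norm[OF fi] absolutely_integrable_norm[OF gi]
    by (intro set_integral_add) (auto simp: o_def)
  have pmu: "prim a b \<mu> (\<lambda>s. \<bar>f s\<bar> + \<bar>g s\<bar>)"
    by (rule primI[OF nfi]) (simp add: \<mu>_def)
  have ph: "prim a b (\<lambda>y. integral {a..y} ?h) ?h"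
    by (rule primI[OF hi]) simp
  have key: "\<bar>D x - D a\<bar> \<le> \<epsilon> * \<mu> x - \<epsilon> * \<mu> a" if "\<epsilon> > 0" for \<epsilon>
  proof -
    have uF: "uniformly_continuous_on {a..b} F" and uG: "uniformly_continuous_on {a..b} G"
      using cF cG compact_uniformly_continuous by blast+
    obtain d1 where d1: "d1 > 0" "\<And>u v. u \<in> {a..b} \<Longrightarrow> v \<in> {a..b} \<Longrightarrow> dist u v < d1 \<Longrightarrow> dist (F u) (F v) < \<epsilon>"
      using uF \<open>\<epsilon> > 0\<close> unfolding uniformly_continuous_on_def by metis
    obtain d2 where d2: "d2 > 0" "\<And>u v. u \<in> {a..b} \<Longrightarrow> v \<in> {a..b} \<Longrightarrow> dist u v < d2 \<Longrightarrow> dist (G u) (G v) < \<epsilon>"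
      using uG \<open>\<epsilon> > 0\<close> unfolding uniformly_continuous_on_def by metis
    \<comment> \<open>Halved because \<open>small_steps_bound\<close> admits steps equal to
      \<delta>, while uniform continuity asks for strict inequality.\<close>
    define \<delta> where "\<delta> = min d1 d2 / 2"
    have "\<delta> > 0" using d1 d2 by (simp add: \<delta>_def)
    show ?thesis
    proof (rule small_steps_bound[OF \<open>\<delta> > 0\<close> _ order.refl x, of _ ])
      fix u v assume uv: "a \<le> u" "u \<le> v" "v \<le> b" "v - u \<le> \<delta>"
      have I: "k integrable_on {u..v}" if "k absolutely_integrable_on {a..b}" for k :: "real \<Rightarrow> real"
        using uv absolutely_integrable_on_subinterval[OF that, of u v] set_lebesgue_integral_eq_integral(1)
        by auto
      have "F v * G v - F u * G u = (F v - F u) * G v + F u * (G v - G u)" by (simp add: algebra_simps)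
      also have "\<dots> = integral {u..v} f * G v + F u * integral {u..v} g"
        using prim_diff[OF F] prim_diff[OF G] uv by simp
      also have "\<dots> = integral {u..v} (\<lambda>s. f s * G v + F u * g s)"
        using I[OF fi] I[OF gi] by (subst Henstock_Kurzweil_Integration.integral_add) (auto intro: integrable_on_mult_right integrable_on_mult_left)
      finally have "D v - D u = integral {u..v} (\<lambda>s. f s * G v + F u * g s) - integral {u..v} ?h"
        using prim_diff[OF ph uv(1-3)] by (simp add: D_def)
      also have "\<dots> = integral {u..v} (\<lambda>s. (f s * G v + F u * g s) - ?h s)"
        using I[OF hi] I[OF fi] I[OF gi]
        by (subst Henstock_Kurzweil_Integration.integral_diff) (auto intro!: integrable_on_mult_right integrable_on_mult_left Henstock_Kurzweil_Integration.integrable_add)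
      finally have e: "D v - D u = integral {u..v} (\<lambda>s. f s * (G v - G s) + g s * (F u - F s))"
        by (simp add: algebra_simps)
      have "norm (integral {u..v} (\<lambda>s. f s * (G v - G s) + g s * (F u - F s)))
             \<le> integral {u..v} (\<lambda>s. \<epsilon> * (\<bar>f s\<bar> + \<bar>g s\<bar>))"
      proof (rule integral_norm_bound_integral)
        have "(\<lambda>s. f s * (G v - G s) + g s * (F u - F s)) absolutely_integrable_on {a..b}"
          by (intro set_integral_add abs_integrable_cont_mult fi gi continuous_intros cF cG)
        then show "(\<lambda>s. f s * (G v - G s) + g s * (F u - F s)) integrable_on {u..v}" by (rule I)
        show "(\<lambda>s. \<epsilon> * (\<bar>f s\<bar> + \<bar>g s\<bar>)) integrable_on {u..v}"
          using I[OF nfi] by (intro integrable_on_mult_right) auto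
        fix s assume s: "s \<in> {u..v}"
        have "\<bar>G v - G s\<bar> \<le> \<epsilon>" using d2(2)[of v s] s uv d1(1) d2(1) by (auto simp: dist_real_def \<delta>_def)
        moreover have "\<bar>F u - F s\<bar> \<le> \<epsilon>" using d1(2)[of u s] s uv d1(1) d2(1) by (auto simp: dist_real_def \<delta>_def)
        ultimately have "\<bar>f s * (G v - G s)\<bar> \<le> \<bar>f s\<bar> * \<epsilon>" "\<bar>g s * (F u - F s)\<bar> \<le> \<bar>g s\<bar> * \<epsilon>"
          by (simp_all add: abs_mult mult_left_mono)
        then show "norm (f s * (G v - G s) + g s * (F u - F s)) \<le> \<epsilon> * (\<bar>f s\<bar> + \<bar>g s\<bar>)"
          by (simp add: algebra_simps)
      qed
      then show "\<bar>D v - D u\<bar> \<le> \<epsilon> * \<mu> v - \<epsilon> * \<mu> u"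
        using prim_diff[OF prim_cmult[OF pmu, of \<epsilon>] uv(1-3)] e by simp
    qed
  qed
  have mu: "0 \<le> \<mu> x - \<mu> a"
    using prim_diff[OF pmu, of a x] x by (simp add: integral_nonneg[OF set_lebesgue_integral_eq_integral(1)[OF prim_integrable_sub[OF pmu]]])
  have "\<bar>D x - D a\<bar> \<le> 0"
  proof (rule field_le_epsilon)
    fix e :: real assume "e > 0"
    define \<epsilon> where "\<epsilon> = e / (1 + (\<mu> x - \<mu> a))"
    have "\<epsilon> > 0" using mu \<open>e > 0\<close> by (simp add: \<epsilon>_def)
    from key[OF this] have "\<bar>D x - D a\<bar> \<le> \<epsilon> * (\<mu> x - \<mu> a)" by (simp add: algebra_simps)
    also have "\<dots> \<le> \<epsilon> * (1 + (\<mu> x - \<mu> a))" using \<open>\<epsilon> > 0\<close> by (intro mult_left_mono) auto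
    also have "\<dots> = e" using mu by (simp add: \<epsilon>_def)
    finally show "\<bar>D x - D a\<bar> \<le> 0 + e" by simp
  qed
  then show "F x * G x - F a * G a = integral {a..x} ?h"
    by (simp add: D_def)
qed

section \<open>Square integrable functions on the unit interval\<close>

lemma L2_measurable: "f \<in> L2 \<Longrightarrow> f \<in> borel_measurable lebesgue01"
  and L2_square: "f \<in> L2 \<Longrightarrow> integrable lebesgue01 (\<lambda>x. (f x)\<^sup>2)"
  by (auto simp: L2_def)

lemma L2_bound:
  assumes "g \<in> L2" "f \<in> borel_measurable lebesgue01" "\<And>x. x \<in> {0<..<1} \<Longrightarrow> \<bar>f x\<bar> \<le> \<bar>g x\<bar>"
  shows "f \<in> L2"
proof -
  have "integrable lebesgue01 (\<lambda>x. (f x)\<^sup>2)"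
  proof (rule Bochner_Integration.integrable_bound[OF L2_square[OF assms(1)]])
    show "(\<lambda>x. (f x)\<^sup>2) \<in> borel_measurable lebesgue01" using assms(2) by measurable
    show "AE x in lebesgue01. norm ((f x)\<^sup>2) \<le> norm ((g x)\<^sup>2)"
      using assms(3) by (intro AE_I2) (auto simp: space_restrict_space abs_le_square_iff)
  qed
  then show ?thesis using assms(2) by (simp add: L2_def)
qed

lemma finite_measure_lebesgue01: "finite_measure lebesgue01"
  by (rule finite_measureI) (simp add: emeasure_restrict_space space_restrict_space)

lemma measure_lebesgue01: "measure lebesgue01 (space lebesgue01) = 1"
  by (simp add: measure_restrict_space space_restrict_space)

lemma L2_bounded:
  assumes "f \<in> borel_measurable lebesgue01" "\<And>x. x \<in> {0<..<1} \<Longrightarrow> \<bar>f x\<bar> \<le> K"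
  shows "f \<in> L2"
proof -
  have "(\<lambda>x. K) \<in> L2"
    unfolding L2_def using finite_measure.integrable_const[OF finite_measure_lebesgue01] by auto
  then show ?thesis by (rule L2_bound) (use assms in fastforce)+
qed

lemma continuous_L2:
  assumes "continuous_on {0..1} f" shows "f \<in> L2"
proof -
  obtain K where K: "\<And>x. x \<in> {0..1} \<Longrightarrow> \<bar>f x\<bar> \<le> K"
    using compact_imp_bounded[OF compact_continuous_image[OF assms compact_Icc]]
    unfolding bounded_iff by fastforce
  have "f \<in> borel_measurable lebesgue01"
    using assms by (intro continuous_imp_measurable_on_sets_lebesgue) (auto intro: continuous_on_subset)
  then show ?thesis by (rule L2_bounded[of _ K]) (use K in auto)
qed

lemma L2_mult_integrable:
  assumes "f \<in> L2" "g \<in> L2" shows "integrable lebesgue01 (\<lambda>x. f x * g x)"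
proof (rule Bochner_Integration.integrable_bound)
  show "integrable lebesgue01 (\<lambda>x. (f x)\<^sup>2 + (g x)\<^sup>2)" using assms by (auto simp: L2_square)
  show "(\<lambda>x. f x * g x) \<in> borel_measurable lebesgue01"
    by (intro borel_measurable_times L2_measurable assms)
  have "\<bar>a * b\<bar> \<le> a\<^sup>2 + b\<^sup>2" for a b :: real
  proof -
    have "2 * \<bar>a\<bar> * \<bar>b\<bar> \<le> a\<^sup>2 + b\<^sup>2" using sum_squares_bound[of "\<bar>a\<bar>" "\<bar>b\<bar>"] by simp
    moreover have "0 \<le> \<bar>a\<bar> * \<bar>b\<bar>" by simp
    ultimately show ?thesis by (simp only: abs_mult)
  qed
  then show "AE x in lebesgue01. norm (f x * g x) \<le> norm ((f x)\<^sup>2 + (g x)\<^sup>2)" by auto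
qed

lemma L2_add: assumes "f \<in> L2" "g \<in> L2" shows "(\<lambda>x. f x + g x) \<in> L2"
proof -
  have "integrable lebesgue01 (\<lambda>x. (f x)\<^sup>2 + (g x)\<^sup>2 + 2 * (f x * g x))"
    using assms L2_mult_integrable[OF assms] by (intro Bochner_Integration.integrable_add) (auto simp: L2_square)
  moreover have "(f x)\<^sup>2 + (g x)\<^sup>2 + 2 * (f x * g x) = (f x + g x)\<^sup>2" for x
    by (simp add: power2_sum)
  ultimately have "integrable lebesgue01 (\<lambda>x. (f x + g x)\<^sup>2)" by (simp only:)
  moreover have "(\<lambda>x. f x + g x) \<in> borel_measurable lebesgue01"
    by (intro borel_measurable_add L2_measurable assms)
  ultimately show ?thesis unfolding L2_def by blast
qed

lemma L2_cmult: assumes "f \<in> L2" shows "(\<lambda>x. c * f x) \<in> L2"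
  using assms unfolding L2_def by (auto simp: power_mult_distrib)

lemma L2_diff: assumes "f \<in> L2" "g \<in> L2" shows "(\<lambda>x. f x - g x) \<in> L2"
  using L2_add[OF assms(1) L2_cmult[OF assms(2), of "-1"]] by simp

lemma L2_integrable: assumes "f \<in> L2" shows "integrable lebesgue01 f"
  using L2_mult_integrable[OF assms continuous_L2[of "\<lambda>x. 1"]] by simp

lemma L2_norm_nonneg [simp]: "L2_norm f \<ge> 0"
  by (simp add: L2_norm_def)

lemma L2_norm_square: "(L2_norm f)\<^sup>2 = (LINT x|lebesgue01. (f x)\<^sup>2)"
  by (simp add: L2_norm_def)

lemma L2_Cauchy_Schwarz:
  assumes f: "f \<in> L2" and g: "g \<in> L2"
  shows "\<bar>LINT x|lebesgue01. f x * g x\<bar> \<le> L2_norm f * L2_norm g"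
proof -
  define A B D where "A = (LINT x|lebesgue01. (f x)\<^sup>2)" and "B = (LINT x|lebesgue01. f x * g x)"
    and "D = (LINT x|lebesgue01. (g x)\<^sup>2)"
  have nn: "A \<ge> 0" "D \<ge> 0" by (auto simp: A_def D_def)
  have q: "0 \<le> A - 2 * l * B + l\<^sup>2 * D" for l
  proof -
    have e: "(f x - l * g x)\<^sup>2 = (f x)\<^sup>2 - (2 * l) * (f x * g x) + l\<^sup>2 * (g x)\<^sup>2" for x
      by (simp add: power2_eq_square algebra_simps)
    have "0 \<le> (LINT x|lebesgue01. (f x - l * g x)\<^sup>2)" by simp
    also have "\<dots> = (LINT x|lebesgue01. (f x)\<^sup>2 - (2 * l) * (f x * g x) + l\<^sup>2 * (g x)\<^sup>2)"
      by (simp only: e)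
    also have "\<dots> = A - 2 * l * B + l\<^sup>2 * D"
      using L2_square[OF f] L2_square[OF g] L2_mult_integrable[OF f g]
      by (simp add: A_def B_def D_def)
    finally show ?thesis .
  qed
  have "B\<^sup>2 \<le> A * D"
  proof (cases "D = 0")
    case True
    have "B = 0"
    proof (rule ccontr)
      assume "B \<noteq> 0"
      then obtain l where l: "l * B = A + 1" by (metis nonzero_eq_divide_eq)
      have "0 \<le> A - 2 * (l * B) + l\<^sup>2 * D" using q[of l] by (simp add: mult.assoc)
      then show False using nn True unfolding l by simp
    qed
    then show ?thesis using True by simp
  next
    case False
    then have "D > 0" using nn by simp
    then have "2 * (B / D) * B = 2 * (B\<^sup>2 / D)" "(B / D)\<^sup>2 * D = B\<^sup>2 / D"
      by (simp_all add: power2_eq_square)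
    then have "B\<^sup>2 / D \<le> A" using q[of "B / D"] by linarith
    then show ?thesis using \<open>D > 0\<close> by (simp add: pos_divide_le_eq)
  qed
  then have "\<bar>B\<bar> \<le> sqrt (A * D)" by (metis real_sqrt_abs real_sqrt_le_mono)
  then show ?thesis by (simp add: L2_norm_def A_def B_def D_def real_sqrt_mult)
qed

lemma L2_norm_triangle:
  assumes f: "f \<in> L2" and g: "g \<in> L2"
  shows "L2_norm (\<lambda>x. f x + g x) \<le> L2_norm f + L2_norm g"
proof -
  have "(L2_norm (\<lambda>x. f x + g x))\<^sup>2 = (LINT x|lebesgue01. (f x)\<^sup>2 + (g x)\<^sup>2 + 2 * (f x * g x))"
    by (simp add: L2_norm_square power2_sum mult.assoc)
  also have "\<dots> = (L2_norm f)\<^sup>2 + (L2_norm g)\<^sup>2 + 2 * (LINT x|lebesgue01. f x * g x)"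
    using L2_square[OF f] L2_square[OF g] L2_mult_integrable[OF f g] by (simp add: L2_norm_square)
  also have "\<dots> \<le> (L2_norm f + L2_norm g)\<^sup>2"
    using L2_Cauchy_Schwarz[OF f g] by (simp add: power2_sum)
  finally show ?thesis by (rule power2_le_imp_le) simp
qed

lemma L2_norm_cmult: "L2_norm (\<lambda>x. c * f x) = \<bar>c\<bar> * L2_norm f"
  by (simp add: L2_norm_def power_mult_distrib real_sqrt_mult)

lemma L2_norm_triangle3:
  assumes "f \<in> L2" "g \<in> L2" "h \<in> L2"
  shows "L2_norm (\<lambda>x. f x - h x) \<le> L2_norm (\<lambda>x. f x - g x) + L2_norm (\<lambda>x. g x - h x)"
  using L2_norm_triangle[OF L2_diff[OF assms(1,2)] L2_diff[OF assms(2,3)]] by simp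

lemma L2_norm_minus_commute: "L2_norm (\<lambda>x. f x - g x) = L2_norm (\<lambda>x. g x - f x)"
  by (simp add: L2_norm_def power2_commute)

lemma L2_norm_mono:
  assumes "g \<in> L2" "f \<in> borel_measurable lebesgue01" "\<And>x. x \<in> {0<..<1} \<Longrightarrow> \<bar>f x\<bar> \<le> \<bar>g x\<bar>"
  shows "L2_norm f \<le> L2_norm g"
  unfolding L2_norm_def
proof (intro real_sqrt_le_mono integral_mono)
  show "integrable lebesgue01 (\<lambda>x. (f x)\<^sup>2)" "integrable lebesgue01 (\<lambda>x. (g x)\<^sup>2)"
    using L2_bound[OF assms] assms(1) by (auto simp: L2_square)
  show "(f x)\<^sup>2 \<le> (g x)\<^sup>2" if "x \<in> space lebesgue01" for x
    using that assms(3)[of x] by (simp add: space_restrict_space abs_le_square_iff)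
qed

lemma L2_norm_le_bound:
  assumes "f \<in> borel_measurable lebesgue01" "\<And>x. x \<in> {0<..<1} \<Longrightarrow> \<bar>f x\<bar> \<le> K" "K \<ge> 0"
  shows "L2_norm f \<le> K"
proof -
  have "L2_norm f \<le> L2_norm (\<lambda>x. K)"
    by (rule L2_norm_mono) (use assms in \<open>auto intro: continuous_L2\<close>)
  also have "\<dots> = K" using assms(3) measure_lebesgue01 by (simp add: L2_norm_def)
  finally show ?thesis .
qed

lemma L2_norm_cong_AE:
  assumes "f \<in> borel_measurable lebesgue01" "g \<in> borel_measurable lebesgue01"
    "AE x in lebesgue01. f x = g x" shows "L2_norm f = L2_norm g"
  unfolding L2_norm_def
  by (rule arg_cong[where f=sqrt], rule integral_cong_AE) (use assms in auto)

lemma L2_norm_zero_AE: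
  assumes "f \<in> L2" "L2_norm f = 0" shows "AE x in lebesgue01. f x = 0"
proof -
  have "(LINT x|lebesgue01. (f x)\<^sup>2) = 0" using assms(2) by (simp add: L2_norm_def)
  then show ?thesis
    using integral_nonneg_eq_0_iff_AE[OF L2_square[OF assms(1)]] by simp
qed

section \<open>Lebesgue integrals over (0,1) as gauge integrals over [0,1]\<close>

lemma integrable01_iff:
  fixes f :: "real \<Rightarrow> real"
  shows "integrable lebesgue01 f \<longleftrightarrow> f absolutely_integrable_on {0..1}"
proof -
  have "integrable lebesgue01 f \<longleftrightarrow> f absolutely_integrable_on {0<..<1}"
    by (simp add: integrable_restrict_space set_integrable_def)
  also have "\<dots> \<longleftrightarrow> f absolutely_integrable_on {0..1}"
    using absolutely_integrable_on_open_interval[where f=f and a=0 and b="1::real"] by simp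
  finally show ?thesis .
qed

lemma integral01_eq:
  fixes f :: "real \<Rightarrow> real"
  assumes "integrable lebesgue01 f"
  shows "(LINT x|lebesgue01. f x) = integral {0..1} f"
proof -
  have "f absolutely_integrable_on {0<..<1}"
    using assms by (simp add: integrable_restrict_space set_integrable_def)
  then have "set_lebesgue_integral lebesgue {0<..<1} f = integral {0<..<1} f"
    by (rule set_lebesgue_integral_eq_integral(2))
  moreover have "(LINT x|lebesgue01. f x) = set_lebesgue_integral lebesgue {0<..<1} f"
    by (simp add: integral_restrict_space set_lebesgue_integral_def)
  ultimately show ?thesis using integral_open_interval_real[where f=f and a=0 and b=1] by simp
qed

lemma L2_abs_integrable: "f \<in> L2 \<Longrightarrow> f absolutely_integrable_on {0..1}"
  using L2_integrable integrable01_iff by blast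

lemma L2_prim: "f \<in> L2 \<Longrightarrow> prim 0 1 (\<lambda>x. c + integral {0..x} f) f"
  by (rule primI[OF L2_abs_integrable]) auto

text \<open>Cauchy-Schwarz against the indicator of [x, y]. The factor sqrt (y - x) is the source of
  the half power of x gained near 0 in the Hardy estimates.\<close>

lemma L2_integral_bound:
  assumes "f \<in> L2" "0 \<le> x" "x \<le> y" "y \<le> 1"
  shows "\<bar>integral {x..y} f\<bar> \<le> sqrt (y - x) * L2_norm f"
proof -
  let ?i = "indicat_real {x..y}"
  have m: "?i \<in> borel_measurable lebesgue01"
    by (rule measurable_restrict_space1) (auto intro: borel_measurable_indicator)
  have iL: "?i \<in> L2" by (rule L2_bounded[of _ 1]) (use m in \<open>auto simp: indicator_def\<close>)
  have "f absolutely_integrable_on {x..y}"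
    using absolutely_integrable_on_subinterval[OF L2_abs_integrable[OF assms(1)]] assms by auto
  then have fi: "f integrable_on {x..y}" using set_lebesgue_integral_eq_integral(1) by auto
  have "integral {x..y} f = integral {0..1} (\<lambda>s. if s \<in> {x..y} then f s else 0)"
    using assms integral_restrict_Int[of "{0..1}" "{x..y}" f] by auto
  also have "\<dots> = integral {0..1} (\<lambda>s. ?i s * f s)"
    by (rule integral_cong) (auto simp: indicator_def)
  also have "\<dots> = (LINT s|lebesgue01. ?i s * f s)"
    using integral01_eq[OF L2_mult_integrable[OF iL assms(1)]] by simp
  finally have "\<bar>integral {x..y} f\<bar> \<le> L2_norm ?i * L2_norm f"
    using L2_Cauchy_Schwarz[OF iL assms(1)] by simp
  moreover have "L2_norm ?i = sqrt (y - x)"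
  proof -
    have "(LINT s|lebesgue01. (?i s)\<^sup>2) = integral {0..1} (\<lambda>s. (?i s)\<^sup>2)"
      by (rule integral01_eq[OF L2_square[OF iL]])
    also have "\<dots> = integral {0..1} (\<lambda>s. if s \<in> {x..y} then 1 else 0)"
      by (rule integral_cong) (auto simp: indicator_def)
    also have "\<dots> = integral {x..y} (\<lambda>s. 1)"
      using assms integral_restrict_Int[of "{0..1}" "{x..y}" "\<lambda>s. 1::real"] by auto
    also have "\<dots> = y - x" using assms by simp
    finally show ?thesis by (simp add: L2_norm_def)
  qed
  ultimately show ?thesis by simp
qed

section \<open>Test functions\<close>

text \<open>Recursion on the derivative makes the closure properties inductions in which the
  function is generalised; \<open>smooth_iff\<close> matches it with the iterated derivatives in
  \<open>test_functions\<close>.\<close>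

primrec smooth_upto :: "nat \<Rightarrow> (real \<Rightarrow> real) \<Rightarrow> bool" where
  "smooth_upto 0 f \<longleftrightarrow> True"
| "smooth_upto (Suc n) f \<longleftrightarrow> (\<forall>x. f differentiable (at x)) \<and> smooth_upto n (deriv f)"

definition smooth :: "(real \<Rightarrow> real) \<Rightarrow> bool" where
  "smooth f \<longleftrightarrow> (\<forall>n. smooth_upto n f)"

lemma smooth_upto_iff: "smooth_upto n f \<longleftrightarrow> (\<forall>k<n. \<forall>x. (deriv ^^ k) f differentiable (at x))"
proof (induction n arbitrary: f)
  case 0 then show ?case by simp
next
  case (Suc n)
  have "(\<forall>k<Suc n. \<forall>x. (deriv ^^ k) f differentiable (at x)) \<longleftrightarrow>
    (\<forall>x. f differentiable (at x)) \<and> (\<forall>k<n. \<forall>x. (deriv ^^ Suc k) f differentiable (at x))"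
    by (subst All_less_Suc2) simp
  also have "\<dots> \<longleftrightarrow> smooth_upto (Suc n) f"
    using Suc[of "deriv f"] by (simp add: funpow_swap1)
  finally show ?case by simp
qed

lemma smooth_iff: "smooth f \<longleftrightarrow> (\<forall>k x. (deriv ^^ k) f differentiable (at x))"
  unfolding smooth_def smooth_upto_iff by blast

lemma smooth_upto_mono: "smooth_upto (Suc n) f \<Longrightarrow> smooth_upto n f"
  unfolding smooth_upto_iff by simp

lemma real_differentiable_deriv:
  fixes f :: "real \<Rightarrow> real"
  assumes "f differentiable (at x)" shows "(f has_real_derivative deriv f x) (at x)"
  using assms DERIV_deriv_iff_real_differentiable by blast

lemma smooth_upto_add: "smooth_upto n f \<Longrightarrow> smooth_upto n g \<Longrightarrow> smooth_upto n (\<lambda>x. f x + g x)"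
proof (induction n arbitrary: f g)
  case 0 then show ?case by simp
next
  case (Suc n)
  have d: "((\<lambda>x. f x + g x) has_real_derivative deriv f x + deriv g x) (at x)" for x
    using Suc.prems by (intro DERIV_add real_differentiable_deriv) auto
  have "deriv (\<lambda>x. f x + g x) = (\<lambda>x. deriv f x + deriv g x)"
    using d DERIV_imp_deriv by blast
  then show ?case using Suc d by (auto simp: real_differentiable_def)
qed

lemma smooth_upto_mult: "smooth_upto n f \<Longrightarrow> smooth_upto n g \<Longrightarrow> smooth_upto n (\<lambda>x. f x * g x)"
proof (induction n arbitrary: f g)
  case 0 then show ?case by simp
next
  case (Suc n)
  have d: "((\<lambda>x. f x * g x) has_real_derivative deriv f x * g x + deriv g x * f x) (at x)" for x
    using Suc.prems by (intro DERIV_mult real_differentiable_deriv) auto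
  have "deriv (\<lambda>x. f x * g x) = (\<lambda>x. deriv f x * g x + deriv g x * f x)"
    using d DERIV_imp_deriv by blast
  moreover have "smooth_upto n (\<lambda>x. deriv f x * g x + deriv g x * f x)"
    using Suc.prems smooth_upto_mono by (intro smooth_upto_add Suc.IH) auto
  ultimately show ?case using d by (auto simp: real_differentiable_def)
qed

lemma smooth_upto_const: "smooth_upto n (\<lambda>x. c)"
proof (induction n arbitrary: c)
  case (Suc n)
  have "deriv (\<lambda>x::real. c) = (\<lambda>x. 0)" by (auto intro!: DERIV_imp_deriv)
  then show ?case using Suc by simp
qed simp

lemma smooth_upto_affine: "smooth_upto n f \<Longrightarrow> smooth_upto n (\<lambda>x. f (c * x + d))"
proof (induction n arbitrary: f)
  case 0 then show ?case by simp
next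
  case (Suc n)
  have d: "((\<lambda>x. f (c * x + d)) has_real_derivative deriv f (c * x + d) * c) (at x)" for x
  proof (rule DERIV_chain2[where f=f and g="\<lambda>x. c * x + d"])
    show "(f has_real_derivative deriv f (c * x + d)) (at (c * x + d))"
      using Suc.prems by (intro real_differentiable_deriv) auto
    show "((\<lambda>x. c * x + d) has_real_derivative c) (at x)"
      by (auto intro!: derivative_eq_intros)
  qed
  have "deriv (\<lambda>x. f (c * x + d)) = (\<lambda>x. deriv f (c * x + d) * c)"
    using d DERIV_imp_deriv by blast
  moreover have "smooth_upto n (\<lambda>x. deriv f (c * x + d) * c)"
    using Suc by (intro smooth_upto_mult smooth_upto_const) auto
  ultimately show ?case using d by (auto simp: real_differentiable_def)
qed

lemma smooth_upto_ident: "smooth_upto n (\<lambda>x. x)"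
proof (cases n)
  case (Suc k)
  have "deriv (\<lambda>x::real. x) = (\<lambda>x. 1)" by (auto intro!: DERIV_imp_deriv)
  then show ?thesis using Suc smooth_upto_const by simp
qed simp

lemma smooth_add: "smooth f \<Longrightarrow> smooth g \<Longrightarrow> smooth (\<lambda>x. f x + g x)"
  and smooth_mult: "smooth f \<Longrightarrow> smooth g \<Longrightarrow> smooth (\<lambda>x. f x * g x)"
  and smooth_const: "smooth (\<lambda>x. c)"
  and smooth_affine: "smooth f \<Longrightarrow> smooth (\<lambda>x. f (a * x + b))"
  by (auto simp: smooth_def smooth_upto_add smooth_upto_mult smooth_upto_const smooth_upto_affine)

lemma smooth_deriv: "smooth f \<Longrightarrow> smooth (deriv f)"
  unfolding smooth_def using smooth_upto.simps(2) by blast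

lemma smooth_has_derivative: "smooth f \<Longrightarrow> (f has_real_derivative deriv f x) (at x)"
  unfolding smooth_def using smooth_upto.simps(2) real_differentiable_deriv by blast

lemma smooth_continuous: "smooth f \<Longrightarrow> continuous_on S f"
  by (intro continuous_at_imp_continuous_on ballI DERIV_isCont[OF smooth_has_derivative])

lemma smooth_of_deriv:
  assumes "\<And>x. (f has_real_derivative g x) (at x)" "smooth g"
  shows "smooth f"
  unfolding smooth_def
proof
  fix n
  have "deriv f = g" using assms(1) DERIV_imp_deriv by blast
  then have "smooth_upto (Suc n) f"
    using assms by (auto simp: real_differentiable_def smooth_def)
  then show "smooth_upto n f" by (rule smooth_upto_mono)
qed

lemma smooth_polynomial: "real_polynomial_function p \<Longrightarrow> smooth p" for p :: "real \<Rightarrow> real"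
proof (induction p rule: real_polynomial_function.induct)
  case (linear f)
  then obtain c where "f = (\<lambda>x. x * c)" using real_bounded_linear by auto
  then show ?case by (auto simp: smooth_def intro: smooth_upto_mult smooth_upto_ident smooth_upto_const)
qed (auto intro: smooth_add smooth_mult smooth_const)

text \<open>
  The family is closed under differentiation, which makes \<open>exp (-1/x)\<close>, extended by zero, smooth.
\<close>

definition flat :: "real poly \<Rightarrow> real \<Rightarrow> real" where
  "flat p x = (if x \<le> 0 then 0 else poly p (1 / x) * exp (- (1 / x)))"

lemma poly_exp_tendsto_0: "((\<lambda>y::real. poly p y * exp (- y)) \<longlongrightarrow> 0) at_top"
proof -
  have "((\<lambda>y::real. \<Sum>i\<le>degree p. coeff p i * (y ^ i / exp y)) \<longlongrightarrow> (\<Sum>i\<le>degree p. coeff p i * 0)) at_top"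
    by (intro tendsto_sum tendsto_mult tendsto_const tendsto_power_div_exp_0)
  moreover have "(\<Sum>i\<le>degree p. coeff p i * (y ^ i / exp y)) = poly p y * exp (- y)" for y :: real
    by (simp add: poly_altdef sum_distrib_right exp_minus divide_inverse mult.assoc)
  ultimately show ?thesis by simp
qed

text \<open>With y = 1/x, the derivative of p(y) e^(-y) in x is y^2 (p(y) - p'(y)) e^(-y); the
  polynomial \<open>[:0, 0, 1:]\<close> is y^2. At 0 the exponential beats every polynomial.\<close>

lemma flat_has_derivative: "(flat p has_real_derivative flat ([:0, 0, 1:] * (p - pderiv p)) x) (at x)"
proof -
  let ?q = "[:0, 0, 1:] * (p - pderiv p)"
  consider "x < 0" | "x = 0" | "x > 0" by linarith
  then show ?thesis
  proof cases
    case 1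
    have "((\<lambda>x. 0) has_real_derivative 0) (at x)" by simp
    then have "(flat p has_real_derivative 0) (at x)"
      by (rule has_field_derivative_transform_within_open[of _ _ _ "{..<0}"]) (use 1 in \<open>auto simp: flat_def\<close>)
    then show ?thesis using 1 by (simp add: flat_def)
  next
    case 3
    have "((\<lambda>x. poly p (1 / x) * exp (- (1 / x))) has_real_derivative flat ?q x) (at x)"
      using 3 by (auto intro!: derivative_eq_intros simp: flat_def power2_eq_square field_simps)
    then show ?thesis
      by (rule has_field_derivative_transform_within_open[of _ _ _ "{0<..}"]) (use 3 in \<open>auto simp: flat_def\<close>)
  next
    case 2
    have "((\<lambda>h. (flat p (0 + h) - flat p 0) / h) \<longlongrightarrow> 0) (at 0)"
    proof (rule filterlim_split_at)
      have "eventually (\<lambda>h::real. 0 = (flat p (0 + h) - flat p 0) / h) (at_left 0)"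
        by (auto simp: flat_def eventually_at_filter)
      then show "((\<lambda>h. (flat p (0 + h) - flat p 0) / h) \<longlongrightarrow> 0) (at_left 0)"
        by (rule Lim_transform_eventually[rotated]) simp
      \<comment> \<open>\<open>pCons 0 p\<close> is y p(y), the extra y being the 1/h of the
        difference quotient.\<close>
      have "((\<lambda>h::real. poly (pCons 0 p) (inverse h) * exp (- inverse h)) \<longlongrightarrow> 0) (at_right 0)"
        by (rule filterlim_compose[OF poly_exp_tendsto_0 filterlim_inverse_at_top_right])
      moreover have "eventually (\<lambda>h::real. poly (pCons 0 p) (inverse h) * exp (- inverse h)
          = (flat p (0 + h) - flat p 0) / h) (at_right 0)"
        by (auto simp: flat_def eventually_at_filter field_simps)
      ultimately show "((\<lambda>h. (flat p (0 + h) - flat p 0) / h) \<longlongrightarrow> 0) (at_right 0)"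
        by (rule Lim_transform_eventually)
    qed
    then show ?thesis using 2 by (simp add: has_field_derivative_iff flat_def)
  qed
qed

lemma smooth_flat: "smooth (flat p)"
proof -
  have "smooth_upto n (flat p)" for n
  proof (induction n arbitrary: p)
    case (Suc n)
    have "deriv (flat p) = flat ([:0, 0, 1:] * (p - pderiv p))"
      using flat_has_derivative DERIV_imp_deriv by blast
    then show ?case using Suc flat_has_derivative real_differentiable_def by auto
  qed simp
  then show ?thesis by (simp add: smooth_def)
qed

text \<open>One factor is positive to the right of 1/n, the other to the left of 1 - 1/n, and both
  arguments tend to infinity inside (0,1). There is no plateau: pointwise convergence to 1 suffices
  for dominated convergence.\<close>

definition cutoff :: "nat \<Rightarrow> real \<Rightarrow> real" where
  "cutoff n x = flat 1 (n * x + (-1)) * flat 1 ((- real n) * x + (real n - 1))"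

lemma flat1_bounds: "0 \<le> flat 1 x" "flat 1 x \<le> 1"
  by (auto simp: flat_def)

lemma smooth_cutoff: "smooth (cutoff n)"
  unfolding cutoff_def by (intro smooth_mult smooth_affine smooth_flat)

lemma cutoff_bounds: "0 \<le> cutoff n x" "cutoff n x \<le> 1"
  unfolding cutoff_def using flat1_bounds by (auto intro: mult_le_one)

lemma cutoff_outside: "n > 0 \<Longrightarrow> x \<notin> {1 / n..1 - 1 / n} \<Longrightarrow> cutoff n x = 0"
proof -
  assume n: "n > 0" and x: "x \<notin> {1 / n..1 - 1 / n}"
  then have "x < 1 / n \<or> x > 1 - 1 / n" by auto
  then have "n * x + (-1) \<le> 0 \<or> (- real n) * x + (real n - 1) \<le> 0"
  proof
    assume "x < 1 / n"
    then have "x * n < 1" using n by (simp add: pos_less_divide_eq)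
    then show ?thesis by (simp add: mult.commute)
  next
    assume "x > 1 - 1 / n"
    then have "1 / n > 1 - x" by linarith
    then have "(1 - x) * n < 1" using n by (simp add: pos_less_divide_eq)
    then show ?thesis by (simp add: algebra_simps)
  qed
  then show "cutoff n x = 0" by (auto simp: cutoff_def flat_def)
qed

lemma cutoff_tendsto:
  assumes "0 < x" "x < 1" shows "(\<lambda>n. cutoff n x) \<longlonglongrightarrow> 1"
proof -
  have f: "((\<lambda>y. flat 1 y) \<longlongrightarrow> 1) at_top"
  proof -
    have "((\<lambda>y::real. exp (- inverse y)) \<longlongrightarrow> exp (- 0)) at_top"
      by (intro tendsto_intros tendsto_inverse_0_at_top filterlim_ident)
    then have "((\<lambda>y::real. exp (- inverse y)) \<longlongrightarrow> 1) at_top" by simp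
    moreover have "eventually (\<lambda>y::real. exp (- inverse y) = flat 1 y) at_top"
      using eventually_gt_at_top[of 0] by eventually_elim (simp add: flat_def inverse_eq_divide)
    ultimately show ?thesis by (rule Lim_transform_eventually)
  qed
  have l: "filterlim (\<lambda>n. real n * c + d) at_top sequentially" if "c > 0" for c d :: real
  proof -
    have "filterlim (\<lambda>n. d + real n * c) at_top sequentially"
      by (rule filterlim_tendsto_add_at_top[OF tendsto_const])
         (rule filterlim_at_top_mult_tendsto_pos[OF tendsto_const that filterlim_real_sequentially])
    then show ?thesis by (simp add: add.commute)
  qed
  have "(\<lambda>n. flat 1 (real n * x + (-1)) * flat 1 (real n * (1 - x) + (-1))) \<longlonglongrightarrow> 1 * 1"
    by (intro tendsto_mult filterlim_compose[OF f] l) (use assms in auto)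
  then show ?thesis by (simp add: cutoff_def algebra_simps)
qed

section \<open>Closure properties of test functions\<close>

lemma test_functionsI:
  assumes "smooth \<phi>" "0 < a" "b < 1" "\<And>x. x \<notin> {a..b} \<Longrightarrow> \<phi> x = 0"
  shows "\<phi> \<in> test_functions"
proof -
  have "closure {x. \<phi> x \<noteq> 0} \<subseteq> {a..b}"
  proof (rule closure_minimal)
    show "{x. \<phi> x \<noteq> 0} \<subseteq> {a..b}" using assms(4) by blast
  qed simp
  moreover from this have "compact (closure {x. \<phi> x \<noteq> 0})"
    by (meson bounded_closed_interval bounded_subset closed_closure compact_eq_bounded_closed)
  ultimately show ?thesis
    using assms unfolding test_functions_def smooth_iff by fastforce
qed

lemma test_smooth: "\<phi> \<in> test_functions \<Longrightarrow> smooth \<phi>"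
  unfolding test_functions_def smooth_iff by blast

lemma test_support:
  assumes "\<phi> \<in> test_functions"
  obtains a b where "0 < a" "a < b" "b < 1" "\<And>x. x \<notin> {a..b} \<Longrightarrow> \<phi> x = 0"
proof (cases "{x. \<phi> x \<noteq> 0} = {}")
  case True
  then have "\<phi> x = 0" for x by blast
  then show ?thesis using that[of "1/3" "1/2"] by simp
next
  case False
  let ?K = "closure {x. \<phi> x \<noteq> 0}"
  have K: "compact ?K" "?K \<subseteq> {0<..<1}" "?K \<noteq> {}"
    using assms False unfolding test_functions_def by auto
  obtain a where a: "a \<in> ?K" "\<And>t. t \<in> ?K \<Longrightarrow> a \<le> t" using compact_attains_inf[OF K(1,3)] by blast
  obtain b where b: "b \<in> ?K" "\<And>t. t \<in> ?K \<Longrightarrow> t \<le> b" using compact_attains_sup[OF K(1,3)] by blast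
  have ab: "0 < a" "b < 1" "a \<le> b" using K(2) a b by auto
  have "x \<in> {a..b}" if "\<phi> x \<noteq> 0" for x
    using a(2) b(2) closure_subset[of "{x. \<phi> x \<noteq> 0}"] that by auto
  \<comment> \<open>The right end is moved towards 1 so that the interval is not degenerate.\<close>
  then show ?thesis using that[of a "(b + 1) / 2"] ab by force
qed

lemma test_cutoff: "n \<ge> 2 \<Longrightarrow> cutoff n \<in> test_functions"
  by (rule test_functionsI[OF smooth_cutoff, of "1 / n" "1 - 1 / n"]) (auto intro: cutoff_outside)

lemma test_mult_smooth:
  assumes "\<phi> \<in> test_functions" "smooth g" shows "(\<lambda>x. g x * \<phi> x) \<in> test_functions"
proof -
  obtain a b where ab: "0 < a" "a < b" "b < 1" "\<And>x. x \<notin> {a..b} \<Longrightarrow> \<phi> x = 0"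
    using test_support[OF assms(1)] by metis
  show ?thesis
    by (rule test_functionsI[OF smooth_mult[OF assms(2) test_smooth[OF assms(1)]] ab(1,3)]) (simp add: ab(4))
qed

lemma test_cmult: "\<phi> \<in> test_functions \<Longrightarrow> (\<lambda>x. c * \<phi> x) \<in> test_functions"
  by (rule test_mult_smooth[OF _ smooth_const])

lemma test_add:
  assumes "\<phi> \<in> test_functions" "\<psi> \<in> test_functions" shows "(\<lambda>x. \<phi> x + \<psi> x) \<in> test_functions"
proof -
  obtain a b where 1: "0 < a" "a < b" "b < 1" "\<And>x. x \<notin> {a..b} \<Longrightarrow> \<phi> x = 0"
    using test_support[OF assms(1)] by metis
  obtain c d where 2: "0 < c" "c < d" "d < 1" "\<And>x. x \<notin> {c..d} \<Longrightarrow> \<psi> x = 0"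
    using test_support[OF assms(2)] by metis
  show ?thesis
  proof (rule test_functionsI[of _ "min a c" "max b d"])
    show "smooth (\<lambda>x. \<phi> x + \<psi> x)"
      by (rule smooth_add[OF test_smooth[OF assms(1)] test_smooth[OF assms(2)]])
    fix x assume "x \<notin> {min a c..max b d}"
    then have "x \<notin> {a..b}" "x \<notin> {c..d}" by auto
    then show "\<phi> x + \<psi> x = 0" using 1(4) 2(4) by simp
  qed (use 1 2 in auto)
qed

lemma test_deriv:
  assumes "\<phi> \<in> test_functions" shows "deriv \<phi> \<in> test_functions"
proof -
  obtain a b where ab: "0 < a" "a < b" "b < 1" "\<And>x. x \<notin> {a..b} \<Longrightarrow> \<phi> x = 0"
    using test_support[OF assms] by metis
  have "deriv \<phi> x = 0" if "x \<notin> {a..b}" for x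
  proof -
    have "((\<lambda>x. 0) has_real_derivative 0) (at x)" by simp
    then have "(\<phi> has_real_derivative 0) (at x)"
      by (rule has_field_derivative_transform_within_open[of _ _ _ "- {a..b}"]) (use that ab in auto)
    then show ?thesis by (rule DERIV_imp_deriv)
  qed
  then show ?thesis using ab test_smooth[OF assms] smooth_deriv by (intro test_functionsI[of _ a b]) auto
qed

lemma test_deriv_n: "\<phi> \<in> test_functions \<Longrightarrow> (deriv ^^ n) \<phi> \<in> test_functions"
  by (induction n) (auto intro: test_deriv)

lemma test_has_derivative: "\<phi> \<in> test_functions \<Longrightarrow> (\<phi> has_real_derivative deriv \<phi> x) (at x)"
  using test_smooth smooth_has_derivative by blast

lemma test_continuous: "\<phi> \<in> test_functions \<Longrightarrow> continuous_on S \<phi>"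
  using test_smooth smooth_continuous by blast

lemma test_L2: "\<phi> \<in> test_functions \<Longrightarrow> \<phi> \<in> L2"
  by (intro continuous_L2 test_continuous)

lemma test_ends:
  assumes "\<phi> \<in> test_functions" shows "\<phi> 0 = 0" "\<phi> 1 = 0"
proof -
  obtain a b where ab: "0 < a" "a < b" "b < 1" "\<And>x. x \<notin> {a..b} \<Longrightarrow> \<phi> x = 0"
    using test_support[OF assms] by metis
  show "\<phi> 0 = 0" "\<phi> 1 = 0" by (rule ab(4), use ab in simp)+
qed

lemma test_prim: "\<phi> \<in> test_functions \<Longrightarrow> prim a b \<phi> (deriv \<phi>)"
  by (rule prim_of_deriv)
    (auto intro: has_field_derivative_at_within test_has_derivative test_continuous test_deriv)

lemma deriv_n_add:
  assumes "\<phi> \<in> test_functions" "\<psi> \<in> test_functions"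
  shows "(deriv ^^ n) (\<lambda>x. \<phi> x + c * \<psi> x) = (\<lambda>x. (deriv ^^ n) \<phi> x + c * (deriv ^^ n) \<psi> x)"
proof (induction n)
  case (Suc n)
  have "((\<lambda>x. (deriv ^^ n) \<phi> x + c * (deriv ^^ n) \<psi> x) has_real_derivative
      deriv ((deriv ^^ n) \<phi>) x + c * deriv ((deriv ^^ n) \<psi>) x) (at x)" for x
    by (intro DERIV_add DERIV_cmult test_has_derivative test_deriv_n assms)
  then have "deriv (\<lambda>x. (deriv ^^ n) \<phi> x + c * (deriv ^^ n) \<psi> x) =
      (\<lambda>x. deriv ((deriv ^^ n) \<phi>) x + c * deriv ((deriv ^^ n) \<psi>) x)"
    using DERIV_imp_deriv by blast
  then show ?case using Suc by simp
qed simp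

text \<open>Zero mean is what makes the primitive vanish to the right of the support too. Through
  it, approximations of a derivative become approximations of the function.\<close>

lemma test_primitive:
  assumes \<phi>: "\<phi> \<in> test_functions" and i: "integral {0..1} \<phi> = 0"
  shows "(\<lambda>x. integral {0..x} \<phi>) \<in> test_functions" "deriv (\<lambda>x. integral {0..x} \<phi>) = \<phi>"
proof -
  obtain a b where ab: "0 < a" "a < b" "b < 1" "\<And>x. x \<notin> {a..b} \<Longrightarrow> \<phi> x = 0"
    using test_support[OF \<phi>] by metis
  let ?P = "\<lambda>x. integral {0..x} \<phi>"
  have c: "continuous_on S \<phi>" for S by (rule test_continuous[OF \<phi>])
  have left: "?P x = 0" if "x < a" for x
    by (rule integral_unique, rule has_integral_is_0) (use that ab in auto)
  have right: "?P x = 0" if "x > b" for x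
  proof -
    have z: "integral {b..y} \<phi> = 0" for y
      by (rule integral_unique, rule has_integral_spike_finite[of "{b}" _ _ "\<lambda>x. 0"]) (use ab in auto)
    have "?P y = integral {0..b} \<phi>" if "y \<ge> b" for y
    proof -
      have "integral {0..b} \<phi> + integral {b..y} \<phi> = ?P y"
        by (rule Henstock_Kurzweil_Integration.integral_combine) (use ab that c in \<open>auto intro: integrable_continuous_real\<close>)
      then show ?thesis using z[of y] by simp
    qed
    from this[of x] this[of 1] i that ab show ?thesis by simp
  qed
  have d: "(?P has_real_derivative \<phi> x) (at x)" for x
  proof (cases "x < a")
    case True
    have "((\<lambda>x. 0) has_real_derivative 0) (at x)" by simp
    then have "(?P has_real_derivative 0) (at x)"
      by (rule has_field_derivative_transform_within_open[of _ _ _ "{..<a}"]) (use True left in auto)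
    then show ?thesis using True ab(4)[of x] by simp
  next
    case False
    then have "(?P has_real_derivative \<phi> x) (at x within {0..x + 1})"
      using ab by (intro integral_has_real_derivative c) auto
    then show ?thesis using False ab at_within_Icc_at[of 0 x "x + 1"] by simp
  qed
  show "?P \<in> test_functions"
  proof (rule test_functionsI[of _ a b])
    show "smooth ?P" by (rule smooth_of_deriv[OF d test_smooth[OF \<phi>]])
  qed (use ab left right in auto)
  show "deriv ?P = \<phi>" using d DERIV_imp_deriv by blast
qed

section \<open>Density of test functions\<close>

lemma L2_dominated_convergence:
  assumes "\<And>n. f n \<in> borel_measurable lebesgue01" "g \<in> borel_measurable lebesgue01" "G \<in> L2"
    and "\<And>n x. x \<in> {0<..<1} \<Longrightarrow> \<bar>f n x\<bar> \<le> G x"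
    and "AE x in lebesgue01. \<bar>g x\<bar> \<le> G x"
    and "AE x in lebesgue01. (\<lambda>n. f n x) \<longlonglongrightarrow> g x"
  shows "(\<lambda>n. L2_norm (\<lambda>x. f n x - g x)) \<longlonglongrightarrow> 0"
proof -
  have "(\<lambda>n. LINT x|lebesgue01. (f n x - g x)\<^sup>2) \<longlonglongrightarrow> (LINT x|lebesgue01. 0)"
  proof (rule integral_dominated_convergence[where w="\<lambda>x. 4 * (G x)\<^sup>2"])
    show "integrable lebesgue01 (\<lambda>x. 4 * (G x)\<^sup>2)" using L2_square[OF assms(3)] by simp
    show "(\<lambda>x. (f n x - g x)\<^sup>2) \<in> borel_measurable lebesgue01" for n
      using assms(1)[of n] assms(2) by measurable
    show "AE x in lebesgue01. (\<lambda>n. (f n x - g x)\<^sup>2) \<longlonglongrightarrow> 0"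
      using assms(6)
    proof eventually_elim
      case (elim x)
      have "(\<lambda>n. (f n x - g x)\<^sup>2) \<longlonglongrightarrow> (g x - g x)\<^sup>2" by (intro tendsto_intros elim)
      then show ?case by simp
    qed
    show "AE x in lebesgue01. norm ((f n x - g x)\<^sup>2) \<le> 4 * (G x)\<^sup>2" for n
      using assms(5) AE_space
    proof eventually_elim
      case (elim x)
      have "\<bar>f n x - g x\<bar> \<le> 2 * G x"
        using elim assms(4)[of x n] by (simp add: space_restrict_space)
      then have "(f n x - g x)\<^sup>2 \<le> (2 * G x)\<^sup>2" by (metis abs_ge_zero power2_abs power_mono)
      then show ?case by (simp add: power_mult_distrib)
    qed
  qed auto
  then have "(\<lambda>n. sqrt (LINT x|lebesgue01. (f n x - g x)\<^sup>2)) \<longlonglongrightarrow> sqrt 0"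
    by (intro tendsto_real_sqrt) simp
  then show ?thesis by (simp add: L2_norm_def)
qed

definition clamp_at :: "real \<Rightarrow> real \<Rightarrow> real" where
  "clamp_at K y = max (- K) (min K y)"

lemma clamp_at_simps:
  "K \<ge> 0 \<Longrightarrow> \<bar>clamp_at K y\<bar> \<le> K" "K \<ge> 0 \<Longrightarrow> \<bar>clamp_at K y\<bar> \<le> \<bar>y\<bar>" "\<bar>y\<bar> \<le> K \<Longrightarrow> clamp_at K y = y"
  by (auto simp: clamp_at_def)

lemma continuous_clamp_at: "continuous_on S (clamp_at K)"
  unfolding clamp_at_def by (intro continuous_intros)

lemma measurable_clamp_at [measurable]: "clamp_at K \<in> borel_measurable borel"
  unfolding clamp_at_def by measurable

text \<open>Four steps, each costing a quarter of e: truncation, continuous functions, polynomials,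
  cut-off. Polynomials are already smooth, so Weierstrass approximation replaces
  mollification.\<close>

lemma L2_approx_test:
  assumes h: "h \<in> L2" and e: "e > 0"
  obtains \<phi> where "\<phi> \<in> test_functions" "L2_norm (\<lambda>x. h x - \<phi> x) < e"
proof -
  note [measurable] = L2_measurable[OF h]
  have "(\<lambda>n. L2_norm (\<lambda>x. clamp_at (real n) (h x) - h x)) \<longlonglongrightarrow> 0"
  proof (rule L2_dominated_convergence)
    show "(\<lambda>x. \<bar>h x\<bar>) \<in> L2" by (rule L2_bound[OF h]) auto
    have "(\<lambda>n. clamp_at (real n) (h x)) \<longlonglongrightarrow> h x" for x
    proof (rule tendsto_eventually)
      obtain N :: nat where "\<bar>h x\<bar> \<le> N" using real_arch_simple by blast
      then show "\<forall>\<^sub>F n in sequentially. clamp_at (real n) (h x) = h x"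
        by (intro eventually_sequentiallyI[of N]) (auto intro: clamp_at_simps)
    qed
    then show "AE x in lebesgue01. (\<lambda>n. clamp_at (real n) (h x)) \<longlonglongrightarrow> h x" by simp
  qed (use clamp_at_simps(2) in auto)
  then have "\<forall>\<^sub>F n in sequentially. L2_norm (\<lambda>x. clamp_at (real n) (h x) - h x) < e / 4"
    by (rule order_tendstoD) (use e in simp)
  then obtain K :: nat where K: "L2_norm (\<lambda>x. clamp_at (real K) (h x) - h x) < e / 4"
    using eventually_happens'[OF sequentially_bot] by blast
  let ?b = "\<lambda>x. clamp_at (real K) (h x)"
  have b2: "?b \<in> L2" by (rule L2_bounded[of _ K]) (auto intro: clamp_at_simps)
  have "(\<lambda>x. if x \<in> {0<..<1} then ?b x else 0) \<in> borel_measurable lebesgue"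
    using L2_measurable[OF b2] by (subst borel_measurable_if) auto
  then have "(\<lambda>x. if x \<in> {0<..<1} then ?b x else 0) measurable_on UNIV"
    by (rule lebesgue_measurable_imp_measurable_on_real) auto
  then obtain N g where N: "negligible N" and g: "\<And>n. continuous_on UNIV (g n)"
    and lim: "\<And>x. x \<notin> N \<Longrightarrow> (\<lambda>n. g n x) \<longlonglongrightarrow> (if x \<in> {0<..<1} then ?b x else 0)"
    unfolding measurable_on_def by auto
  \<comment> \<open>The approximants are truncated again so that the constant K dominates all of
    them.\<close>
  let ?g = "\<lambda>n x. clamp_at (real K) (g n x)"
  have gc: "continuous_on S (?g n)" for S n
    by (rule continuous_on_compose2[OF continuous_clamp_at[of UNIV] continuous_on_subset[OF g]]) auto
  have "(\<lambda>n. L2_norm (\<lambda>x. ?g n x - ?b x)) \<longlonglongrightarrow> 0"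
  proof (rule L2_dominated_convergence)
    show "?g n \<in> borel_measurable lebesgue01" for n by (rule L2_measurable[OF continuous_L2[OF gc]])
    show "(\<lambda>x. real K) \<in> L2" by (rule continuous_L2) simp
    have "AE x in lebesgue01. x \<notin> N"
      using AE_not_in[of N lebesgue] N by (auto simp: negligible_iff_null_sets AE_restrict_space_iff)
    then show "AE x in lebesgue01. (\<lambda>n. ?g n x) \<longlonglongrightarrow> ?b x"
      using AE_space
    proof eventually_elim
      case (elim x)
      then have "(\<lambda>n. g n x) \<longlonglongrightarrow> ?b x" using lim[of x] by (simp add: space_restrict_space)
      then have "(\<lambda>n. ?g n x) \<longlonglongrightarrow> clamp_at (real K) (?b x)"
        by (rule continuous_on_tendsto_compose[OF continuous_clamp_at[of UNIV]]) auto
      then show ?case by (simp add: clamp_at_simps)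
    qed
  qed (use clamp_at_simps(1) in auto)
  then have "\<forall>\<^sub>F n in sequentially. L2_norm (\<lambda>x. ?g n x - ?b x) < e / 4"
    by (rule order_tendstoD) (use e in simp)
  then obtain n where n: "L2_norm (\<lambda>x. ?g n x - ?b x) < e / 4"
    using eventually_happens'[OF sequentially_bot] by blast
  obtain p where p: "real_polynomial_function p" "\<And>x. x \<in> {0..1} \<Longrightarrow> \<bar>?g n x - p x\<bar> < e / 4"
    using Stone_Weierstrass_real_polynomial_function[OF compact_Icc gc, of "e / 4" 0 1 n] e by auto
  have pc: "continuous_on S p" for S using smooth_continuous[OF smooth_polynomial[OF p(1)]] .
  have pL: "p \<in> L2" and gL: "?g n \<in> L2" by (intro continuous_L2 pc gc)+
  have gp: "L2_norm (\<lambda>x. ?g n x - p x) \<le> e / 4"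
    by (rule L2_norm_le_bound) (use p(2) e L2_measurable[OF L2_diff[OF gL pL]] in \<open>auto intro: less_imp_le\<close>)
  have cL: "(\<lambda>x. p x * cutoff j x) \<in> L2" for j
    by (intro continuous_L2 continuous_intros pc smooth_continuous smooth_cutoff)
  have "(\<lambda>j. L2_norm (\<lambda>x. p x * cutoff j x - p x)) \<longlonglongrightarrow> 0"
  proof (rule L2_dominated_convergence)
    show "(\<lambda>x. \<bar>p x\<bar>) \<in> L2" by (intro continuous_L2 continuous_intros pc)
    show "\<bar>p x * cutoff j x\<bar> \<le> \<bar>p x\<bar>" for j x
      using cutoff_bounds[of j x] by (simp add: abs_mult mult_left_le)
    have "(\<lambda>j. p x * cutoff j x) \<longlonglongrightarrow> p x" if "x \<in> {0<..<1}" for x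
      using tendsto_mult[OF tendsto_const[of "p x"] cutoff_tendsto[of x]] that by simp
    then show "AE x in lebesgue01. (\<lambda>j. p x * cutoff j x) \<longlonglongrightarrow> p x"
      by (intro AE_I2) (simp add: space_restrict_space)
  qed (use L2_measurable[OF cL] L2_measurable[OF pL] in auto)
  then have "\<forall>\<^sub>F j in sequentially. L2_norm (\<lambda>x. p x * cutoff j x - p x) < e / 4"
    by (rule order_tendstoD) (use e in simp)
  then have "\<forall>\<^sub>F j in sequentially. L2_norm (\<lambda>x. p x * cutoff j x - p x) < e / 4 \<and> j \<ge> 2"
    using eventually_ge_at_top[of 2] by eventually_elim simp
  then obtain j where j: "L2_norm (\<lambda>x. p x * cutoff j x - p x) < e / 4" "j \<ge> 2"
    using eventually_happens'[OF sequentially_bot] by blast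
  show ?thesis
  proof (rule that)
    show "(\<lambda>x. p x * cutoff j x) \<in> test_functions"
      by (rule test_mult_smooth[OF test_cutoff[OF j(2)] smooth_polynomial[OF p(1)]])
    have "L2_norm (\<lambda>x. h x - p x * cutoff j x) \<le> L2_norm (\<lambda>x. h x - ?b x) + L2_norm (\<lambda>x. ?b x - p x * cutoff j x)"
      by (rule L2_norm_triangle3[OF h b2 cL])
    also have "L2_norm (\<lambda>x. ?b x - p x * cutoff j x) \<le> L2_norm (\<lambda>x. ?b x - ?g n x) + L2_norm (\<lambda>x. ?g n x - p x * cutoff j x)"
      by (rule L2_norm_triangle3[OF b2 gL cL])
    also have "L2_norm (\<lambda>x. ?g n x - p x * cutoff j x) \<le> L2_norm (\<lambda>x. ?g n x - p x) + L2_norm (\<lambda>x. p x - p x * cutoff j x)"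
      by (rule L2_norm_triangle3[OF gL pL cL])
    finally show "L2_norm (\<lambda>x. h x - p x * cutoff j x) < e"
      using K n gp j(1) by (simp add: L2_norm_minus_commute[of h] L2_norm_minus_commute[of ?b "?g n"] L2_norm_minus_commute[of p])
  qed
qed

text \<open>Orthogonality turns the squared norm of g into the integral of g (g - \<phi>) for every
  test function \<phi>, which density makes arbitrarily small.\<close>

lemma test_orthogonal_zero:
  assumes g: "g \<in> L2" and o: "\<And>\<phi>. \<phi> \<in> test_functions \<Longrightarrow> (LINT x|lebesgue01. g x * \<phi> x) = 0"
  shows "AE x in lebesgue01. g x = 0"
proof (rule L2_norm_zero_AE[OF g])
  have "(L2_norm g)\<^sup>2 \<le> 0 + e" if "e > 0" for e
  proof -
    have "e / (1 + L2_norm g) > 0" using that by (intro divide_pos_pos add_pos_nonneg) auto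
    then obtain \<phi> where \<phi>: "\<phi> \<in> test_functions" "L2_norm (\<lambda>x. g x - \<phi> x) < e / (1 + L2_norm g)"
      using L2_approx_test[OF g] by metis
    have "g x * (g x - \<phi> x) + g x * \<phi> x = (g x)\<^sup>2" for x by (simp add: power2_eq_square algebra_simps)
    then have "(L2_norm g)\<^sup>2 = (LINT x|lebesgue01. g x * (g x - \<phi> x) + g x * \<phi> x)"
      by (simp add: L2_norm_square)
    also have "\<dots> = (LINT x|lebesgue01. g x * (g x - \<phi> x)) + (LINT x|lebesgue01. g x * \<phi> x)"
      by (rule Bochner_Integration.integral_add[OF L2_mult_integrable[OF g L2_diff[OF g test_L2[OF \<phi>(1)]]]
          L2_mult_integrable[OF g test_L2[OF \<phi>(1)]]])
    also have "\<dots> = (LINT x|lebesgue01. g x * (g x - \<phi> x))" using o[OF \<phi>(1)] by simp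
    also have "\<dots> \<le> L2_norm g * L2_norm (\<lambda>x. g x - \<phi> x)"
      using L2_Cauchy_Schwarz[OF g L2_diff[OF g test_L2[OF \<phi>(1)]]] by linarith
    also have "\<dots> \<le> (1 + L2_norm g) * (e / (1 + L2_norm g))"
      using \<phi>(2) by (intro mult_mono) (auto simp: add_nonneg_nonneg)
    also have "\<dots> = e" using L2_norm_nonneg[of g] by (simp add: add_nonneg_eq_0_iff)
    finally show ?thesis by simp
  qed
  then have "(L2_norm g)\<^sup>2 \<le> 0" by (rule field_le_epsilon)
  then show "L2_norm g = 0" by simp
qed

section \<open>Characterisation of the Sobolev spaces\<close>

text \<open>The trace description of \<open>sobolev0 m\<close>, and its working form below: F j is
  the absolutely continuous representative of the j-th weak derivative of F 0. The two directions of
  the equivalence are \<open>chain_sobolev0\<close> and \<open>sobolev0_chain\<close>.\<close>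

definition chain :: "nat \<Rightarrow> (nat \<Rightarrow> real \<Rightarrow> real) \<Rightarrow> bool" where
  "chain m F \<longleftrightarrow> F m \<in> L2 \<and> (\<forall>j<m. prim 0 1 (F j) (F (Suc j)) \<and> F j 0 = 0 \<and> F j 1 = 0)"

lemma chainD:
  assumes "chain m F" "j < m"
  shows "prim 0 1 (F j) (F (Suc j))" "F j 0 = 0" "F j 1 = 0"
  using assms unfolding chain_def by blast+

lemma chain_continuous: "chain m F \<Longrightarrow> j < m \<Longrightarrow> continuous_on {0..1} (F j)"
  unfolding chain_def using prim_cont by blast

lemma chain_L2: "chain m F \<Longrightarrow> j \<le> m \<Longrightarrow> F j \<in> L2"
  using chain_continuous continuous_L2 by (metis chain_def le_neq_implies_less)

lemma chain_Suc: "chain (Suc m) F \<Longrightarrow> chain m (\<lambda>j. F (Suc j))"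
  unfolding chain_def by auto

lemma chain_diff: "chain m F \<Longrightarrow> chain m G \<Longrightarrow> chain m (\<lambda>j x. F j x - G j x)"
  unfolding chain_def by (auto intro: L2_diff prim_diff_fun)

lemma test_chain: "\<phi> \<in> test_functions \<Longrightarrow> chain m (\<lambda>j. (deriv ^^ j) \<phi>)"
  unfolding chain_def using test_prim[OF test_deriv_n] test_ends[OF test_deriv_n] test_L2[OF test_deriv_n]
  by auto

lemma prim_integrate_by_parts:
  assumes F: "prim 0 1 F f" and f: "f \<in> L2" and \<phi>: "\<phi> \<in> test_functions"
  shows "(LINT x|lebesgue01. F x * deriv \<phi> x) = - (LINT x|lebesgue01. f x * \<phi> x)"
proof -
  have FL: "F \<in> L2" by (rule continuous_L2[OF prim_cont[OF F]])
  have i1: "integrable lebesgue01 (\<lambda>x. f x * \<phi> x)" by (rule L2_mult_integrable[OF f test_L2[OF \<phi>]])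
  have i2: "integrable lebesgue01 (\<lambda>x. F x * deriv \<phi> x)"
    by (rule L2_mult_integrable[OF FL test_L2[OF test_deriv[OF \<phi>]]])
  have "0 = integral {0..1} (\<lambda>x. f x * \<phi> x + F x * deriv \<phi> x)"
    using prim_diff[OF prim_mult[OF F test_prim[OF \<phi>]], of 0 1] test_ends[OF \<phi>] by simp
  also have "\<dots> = (LINT x|lebesgue01. f x * \<phi> x + F x * deriv \<phi> x)"
    using integral01_eq[OF Bochner_Integration.integrable_add[OF i1 i2]] by simp
  also have "\<dots> = (LINT x|lebesgue01. f x * \<phi> x) + (LINT x|lebesgue01. F x * deriv \<phi> x)"
    by (rule Bochner_Integration.integral_add[OF i1 i2])
  finally show ?thesis by simp
qed

lemma chain_weak_deriv:
  assumes "chain m F" "k \<le> m" shows "is_weak_deriv k (F 0) (F k)"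
  unfolding is_weak_deriv_def
proof
  fix \<phi> assume "\<phi> \<in> test_functions"
  then show "(LINT x|lebesgue01. F 0 x * (deriv ^^ k) \<phi> x) = (- 1) ^ k * (LINT x|lebesgue01. F k x * \<phi> x)"
    using assms(2)
  proof (induction k arbitrary: \<phi>)
    case 0 then show ?case by simp
  next
    case (Suc k)
    have "(LINT x|lebesgue01. F 0 x * (deriv ^^ Suc k) \<phi> x) = (LINT x|lebesgue01. F 0 x * (deriv ^^ k) (deriv \<phi>) x)"
      by (simp add: funpow_swap1)
    also have "\<dots> = (- 1) ^ k * (LINT x|lebesgue01. F k x * deriv \<phi> x)"
      using Suc test_deriv by simp
    moreover have "(LINT x|lebesgue01. F k x * deriv \<phi> x) = - (LINT x|lebesgue01. F (Suc k) x * \<phi> x)"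
      using Suc.prems assms(1) chain_L2[OF assms(1), of "Suc k"]
      by (intro prim_integrate_by_parts chainD(1)) auto
    ultimately show ?case by simp
  qed
qed

section \<open>Weak derivatives and the Sobolev norm\<close>

lemma weak_deriv_unique:
  assumes "g \<in> L2" "h \<in> L2" "is_weak_deriv k f g" "is_weak_deriv k f h"
  shows "AE x in lebesgue01. g x = h x"
proof -
  have "AE x in lebesgue01. g x - h x = 0"
  proof (rule test_orthogonal_zero[OF L2_diff[OF assms(1,2)]])
    fix \<phi> assume \<phi>: "\<phi> \<in> test_functions"
    have "(-1) ^ k * (LINT x|lebesgue01. g x * \<phi> x) = (-1) ^ k * (LINT x|lebesgue01. h x * \<phi> x)"
      using bspec[OF assms(3)[unfolded is_weak_deriv_def] \<phi>] bspec[OF assms(4)[unfolded is_weak_deriv_def] \<phi>]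
      by simp
    then have z: "(LINT x|lebesgue01. g x * \<phi> x) - (LINT x|lebesgue01. h x * \<phi> x) = 0" by simp
    have "(LINT x|lebesgue01. (g x - h x) * \<phi> x) = (LINT x|lebesgue01. g x * \<phi> x - h x * \<phi> x)"
      by (simp add: left_diff_distrib)
    also have "\<dots> = (LINT x|lebesgue01. g x * \<phi> x) - (LINT x|lebesgue01. h x * \<phi> x)"
      by (rule Bochner_Integration.integral_diff[OF L2_mult_integrable[OF assms(1) test_L2[OF \<phi>]]
            L2_mult_integrable[OF assms(2) test_L2[OF \<phi>]]])
    also note z
    finally show "(LINT x|lebesgue01. (g x - h x) * \<phi> x) = 0" .
  qed
  then show ?thesis by simp
qed

lemma is_weak_deriv_diff:
  assumes "f \<in> L2" "g \<in> L2" "f' \<in> L2" "g' \<in> L2" "is_weak_deriv k f g" "is_weak_deriv k f' g'"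
  shows "is_weak_deriv k (\<lambda>x. f x - f' x) (\<lambda>x. g x - g' x)"
  unfolding is_weak_deriv_def
proof
  fix \<phi> assume \<phi>: "\<phi> \<in> test_functions"
  have d: "(LINT x|lebesgue01. (p x - q x) * \<psi> x) = (LINT x|lebesgue01. p x * \<psi> x) - (LINT x|lebesgue01. q x * \<psi> x)"
    if "p \<in> L2" "q \<in> L2" "\<psi> \<in> test_functions" for p q \<psi>
    unfolding left_diff_distrib
    by (rule Bochner_Integration.integral_diff[OF L2_mult_integrable[OF that(1) test_L2[OF that(3)]]
          L2_mult_integrable[OF that(2) test_L2[OF that(3)]]])
  show "(LINT x|lebesgue01. (f x - f' x) * (deriv ^^ k) \<phi> x) = (- 1) ^ k * (LINT x|lebesgue01. (g x - g' x) * \<phi> x)"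
    using assms(5,6) \<phi> unfolding is_weak_deriv_def
    by (simp add: d assms(1-4) test_deriv_n right_diff_distrib)
qed

lemma weak_deriv_props:
  assumes "g \<in> L2" "is_weak_deriv k f g"
  shows "weak_deriv k f \<in> L2" "is_weak_deriv k f (weak_deriv k f)"
    "L2_norm (weak_deriv k f) = L2_norm g"
proof -
  have "weak_deriv k f \<in> L2 \<and> is_weak_deriv k f (weak_deriv k f)"
    unfolding weak_deriv_def by (rule someI[of _ g]) (use assms in blast)
  then show "weak_deriv k f \<in> L2" "is_weak_deriv k f (weak_deriv k f)" by auto
  then show "L2_norm (weak_deriv k f) = L2_norm g"
    using weak_deriv_unique[of "weak_deriv k f" g] assms
    by (intro L2_norm_cong_AE) (auto intro: L2_measurable)
qed

lemma sobolev_norm_eq: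
  assumes "\<And>k. k \<le> m \<Longrightarrow> g k \<in> L2 \<and> is_weak_deriv k f (g k)"
  shows "sobolev_norm m f = sqrt (\<Sum>k\<le>m. (L2_norm (g k))\<^sup>2)"
  unfolding sobolev_norm_def
  by (rule arg_cong[where f=sqrt], rule sum.cong) (use assms weak_deriv_props(3) in auto)

lemma L2_norm_le_sum:
  fixes k m :: nat
  assumes "k \<le> m" shows "L2_norm (g k) \<le> sqrt (\<Sum>k\<le>m. (L2_norm (g k))\<^sup>2)"
  by (rule real_le_rsqrt, rule member_le_sum[of k "{..m}" "\<lambda>k. (L2_norm (g k))\<^sup>2"]) (use assms in auto)

lemma chain_sobolev:
  assumes "chain m F"
  shows "F 0 \<in> sobolev m" "sobolev_norm m (F 0) = sqrt (\<Sum>k\<le>m. (L2_norm (F k))\<^sup>2)"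
proof -
  have "F k \<in> L2 \<and> is_weak_deriv k (F 0) (F k)" if "k \<le> m" for k
    using chain_L2[OF assms that] chain_weak_deriv[OF assms that] by simp
  then show "F 0 \<in> sobolev m" "sobolev_norm m (F 0) = sqrt (\<Sum>k\<le>m. (L2_norm (F k))\<^sup>2)"
    using sobolev_norm_eq[of m F "F 0"] chain_L2[OF assms, of 0] unfolding sobolev_def by auto
qed

text \<open>If every test function had mean zero, the constant 1 would be orthogonal to all of them
  and vanish almost everywhere.\<close>

lemma unit_mass_test_function:
  obtains \<eta> where "\<eta> \<in> test_functions" "integral {0..1} \<eta> = 1"
proof -
  have "\<exists>\<phi>\<in>test_functions. integral {0..1} \<phi> \<noteq> 0"
  proof (rule ccontr)
    assume n: "\<not> ?thesis"
    have "AE x in lebesgue01. (1::real) = 0"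
    proof (rule test_orthogonal_zero)
      show "(\<lambda>x. 1) \<in> L2" by (rule continuous_L2) simp
      fix \<phi> assume "\<phi> \<in> test_functions"
      then show "(LINT x|lebesgue01. 1 * \<phi> x) = 0"
        using n integral01_eq[OF L2_integrable[OF test_L2]] by simp
    qed
    then have "(LINT x|lebesgue01. (1::real)) = 0" by (rule integral_eq_zero_AE)
    then show False using measure_lebesgue01 by simp
  qed
  then obtain \<phi> where \<phi>: "\<phi> \<in> test_functions" "integral {0..1} \<phi> \<noteq> 0" by blast
  show ?thesis
    by (rule that[OF test_cmult[OF \<phi>(1), of "1 / integral {0..1} \<phi>"]]) (use \<phi>(2) in simp)
qed

text \<open>Induction on m through the derivative: approximate the chain of F 1 by \<phi>1, remove
  the mean of \<phi>1 with a multiple of \<eta>, and integrate. The correction is small because F 1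
  has mean zero, F 0 vanishing at both ends.\<close>

lemma chain_approx_test:
  assumes "chain m F" "e > 0"
  shows "\<exists>\<phi>\<in>test_functions. \<forall>j\<le>m. L2_norm (\<lambda>x. F j x - (deriv ^^ j) \<phi> x) < e"
  using assms
proof (induction m arbitrary: F e)
  case 0
  then have "F 0 \<in> L2" by (simp add: chain_def)
  then obtain \<phi> where "\<phi> \<in> test_functions" "L2_norm (\<lambda>x. F 0 x - \<phi> x) < e"
    using L2_approx_test[OF _ \<open>e > 0\<close>] by metis
  then show ?case by auto
next
  case (Suc m)
  obtain \<eta> where \<eta>: "\<eta> \<in> test_functions" "integral {0..1} \<eta> = 1" by (rule unit_mass_test_function)
  define M where "M = (\<Sum>j\<le>m. L2_norm ((deriv ^^ j) \<eta>))"
  have M: "M \<ge> 0" "\<And>j. j \<le> m \<Longrightarrow> L2_norm ((deriv ^^ j) \<eta>) \<le> M"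
    unfolding M_def by (auto intro: sum_nonneg member_le_sum)
  \<comment> \<open>The approximation costs d and the mean correction d M; together they stay below
    e.\<close>
  define d where "d = e / 2 / (1 + M)"
  have "d > 0" using Suc.prems(2) M(1) by (simp add: d_def)
  moreover have "d * (1 + M) = e / 2" using M(1) by (simp add: d_def nonzero_eq_divide_eq mult_ac)
  ultimately have d: "d > 0" "d * (1 + M) < e" using Suc.prems(2) by auto
  obtain \<phi>1 where \<phi>1: "\<phi>1 \<in> test_functions"
    and ap: "\<And>j. j \<le> m \<Longrightarrow> L2_norm (\<lambda>x. F (Suc j) x - (deriv ^^ j) \<phi>1 x) < d"
    using Suc.IH[OF chain_Suc[OF Suc.prems(1)] d(1)] by blast
  have F1: "F 1 \<in> L2" using chain_L2[OF Suc.prems(1), of 1] by simp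
  define c where "c = integral {0..1} \<phi>1"
  have ends: "prim 0 1 (F 0) (F 1)" "F 0 0 = 0" "F 0 1 = 0"
    using chainD[OF Suc.prems(1), of 0] by simp_all
  have diffint: "integral {0..1} (\<lambda>x. F 1 x - g x) = integral {0..1} (F 1) - integral {0..1} g" if "g \<in> L2" for g
    by (rule Henstock_Kurzweil_Integration.integral_diff[OF
          set_lebesgue_integral_eq_integral(1)[OF L2_abs_integrable[OF F1]]
          set_lebesgue_integral_eq_integral(1)[OF L2_abs_integrable[OF that]]])
  have "\<bar>c\<bar> = \<bar>integral {0..1} (\<lambda>x. F 1 x - \<phi>1 x)\<bar>"
    using prim_diff[OF ends(1), of 0 1] ends diffint[OF test_L2[OF \<phi>1]] by (simp add: c_def)
  also have "\<dots> \<le> sqrt (1 - 0) * L2_norm (\<lambda>x. F 1 x - \<phi>1 x)"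
    by (rule L2_integral_bound[OF L2_diff[OF F1 test_L2[OF \<phi>1]]]) auto
  also have "\<dots> \<le> d" using ap[of 0] by simp
  finally have c: "\<bar>c\<bar> \<le> d" .
  define \<psi> where "\<psi> = (\<lambda>x. \<phi>1 x + (- c) * \<eta> x)"
  have \<psi>: "\<psi> \<in> test_functions" unfolding \<psi>_def by (rule test_add[OF \<phi>1 test_cmult[OF \<eta>(1)]])
  have "integral {0..1} \<psi> = integral {0..1} \<phi>1 + integral {0..1} (\<lambda>x. (- c) * \<eta> x)"
    unfolding \<psi>_def
    by (intro Henstock_Kurzweil_Integration.integral_add integrable_continuous_real test_continuous test_cmult \<phi>1 \<eta>)
  also have "\<dots> = 0" using \<eta>(2) by (simp add: c_def)
  finally have \<psi>0: "integral {0..1} \<psi> = 0" .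
  have \<psi>ap: "L2_norm (\<lambda>x. F (Suc j) x - (deriv ^^ j) \<psi> x) < e" if "j \<le> m" for j
  proof -
    have e1: "(deriv ^^ j) \<psi> = (\<lambda>x. (deriv ^^ j) \<phi>1 x + (- c) * (deriv ^^ j) \<eta> x)"
      unfolding \<psi>_def by (rule deriv_n_add[OF \<phi>1 \<eta>(1)])
    have "L2_norm (\<lambda>x. F (Suc j) x - (deriv ^^ j) \<psi> x) =
        L2_norm (\<lambda>x. (F (Suc j) x - (deriv ^^ j) \<phi>1 x) + c * (deriv ^^ j) \<eta> x)"
      unfolding e1 by (rule arg_cong[where f=L2_norm]) auto
    also have "\<dots> \<le> L2_norm (\<lambda>x. F (Suc j) x - (deriv ^^ j) \<phi>1 x) + L2_norm (\<lambda>x. c * (deriv ^^ j) \<eta> x)"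
    proof (rule L2_norm_triangle)
      have "F (Suc j) \<in> L2" using chain_L2[OF Suc.prems(1)] that by simp
      then show "(\<lambda>x. F (Suc j) x - (deriv ^^ j) \<phi>1 x) \<in> L2"
        by (rule L2_diff[OF _ test_L2[OF test_deriv_n[OF \<phi>1]]])
      show "(\<lambda>x. c * (deriv ^^ j) \<eta> x) \<in> L2"
        by (rule L2_cmult[OF test_L2[OF test_deriv_n[OF \<eta>(1)]]])
    qed
    also have "\<dots> \<le> d + d * M"
      unfolding L2_norm_cmult using ap[OF that] M(2)[OF that] c d(1) by (intro add_mono mult_mono) auto
    also have "\<dots> < e" using d(2) by (simp add: algebra_simps)
    finally show ?thesis .
  qed
  let ?\<phi> = "\<lambda>x. integral {0..x} \<psi>"
  have \<phi>: "?\<phi> \<in> test_functions" "deriv ?\<phi> = \<psi>" by (rule test_primitive[OF \<psi> \<psi>0])+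
  have "L2_norm (\<lambda>x. F j x - (deriv ^^ j) ?\<phi> x) < e" if "j \<le> Suc m" for j
  proof (cases j)
    case (Suc i)
    have "(deriv ^^ j) ?\<phi> = (deriv ^^ i) \<psi>" using \<phi>(2) Suc by (simp add: funpow_swap1)
    then show ?thesis using \<psi>ap[of i] Suc that by simp
  next
    case 0
    have "L2_norm (\<lambda>x. F 0 x - ?\<phi> x) \<le> L2_norm (\<lambda>x. F 1 x - \<psi> x)"
    proof (rule L2_norm_le_bound)
      show "(\<lambda>x. F 0 x - ?\<phi> x) \<in> borel_measurable lebesgue01"
        using L2_measurable[OF L2_diff[OF chain_L2[OF Suc.prems(1), of 0] test_L2[OF \<phi>(1)]]] by simp
      fix x :: real assume x: "x \<in> {0<..<1}"
      have "F 0 x - ?\<phi> x = integral {0..x} (\<lambda>x. F 1 x - \<psi> x)"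
        using prim_diff[OF prim_diff_fun[OF ends(1) test_prim[OF \<phi>(1)]], of 0 x] x ends \<phi>(2) by simp
      then have "\<bar>F 0 x - ?\<phi> x\<bar> \<le> sqrt (x - 0) * L2_norm (\<lambda>x. F 1 x - \<psi> x)"
        using L2_integral_bound[OF L2_diff[OF F1 test_L2[OF \<psi>]], of 0 x] x by simp
      also have "\<dots> \<le> 1 * L2_norm (\<lambda>x. F 1 x - \<psi> x)" using x by (intro mult_right_mono) auto
      finally show "\<bar>F 0 x - ?\<phi> x\<bar> \<le> L2_norm (\<lambda>x. F 1 x - \<psi> x)" by simp
    qed simp
    also have "\<dots> < e" using \<psi>ap[of 0] by simp
    finally show ?thesis using 0 by simp
  qed
  then show ?case using \<phi>(1) by blast
qed

lemma chain_sobolev0: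
  assumes "chain m F" shows "F 0 \<in> sobolev0 m"
proof -
  have "\<exists>\<phi>\<in>test_functions \<inter> sobolev m. sobolev_norm m (\<lambda>x. F 0 x - \<phi> x) < e" if "e > 0" for e
  proof -
    define d where "d = e / (2 * real (Suc m))"
    have "d > 0" using that by (simp add: d_def)
    then obtain \<phi> where \<phi>: "\<phi> \<in> test_functions"
      and ap: "\<And>j. j \<le> m \<Longrightarrow> L2_norm (\<lambda>x. F j x - (deriv ^^ j) \<phi> x) < d"
      using chain_approx_test[OF assms] by blast
    have ch: "chain m (\<lambda>j x. F j x - (deriv ^^ j) \<phi> x)" by (rule chain_diff[OF assms test_chain[OF \<phi>]])
    have "sobolev_norm m (\<lambda>x. F 0 x - \<phi> x) = sqrt (\<Sum>k\<le>m. (L2_norm (\<lambda>x. F k x - (deriv ^^ k) \<phi> x))\<^sup>2)"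
      using chain_sobolev(2)[OF ch] by simp
    also have "\<dots> \<le> (\<Sum>k\<le>m. L2_norm (\<lambda>x. F k x - (deriv ^^ k) \<phi> x))"
      using L2_set_le_sum[of "{..m}" "\<lambda>k. L2_norm (\<lambda>x. F k x - (deriv ^^ k) \<phi> x)"] by (simp add: L2_set_def)
    also have "\<dots> \<le> (\<Sum>k\<le>m. d)" by (rule sum_mono) (use ap in \<open>auto intro: less_imp_le\<close>)
    also have "\<dots> = e / 2" by (simp add: d_def field_simps)
    also have "\<dots> < e" using that by simp
    finally show ?thesis using \<phi> chain_sobolev(1)[OF test_chain[OF \<phi>]] by auto
  qed
  then show ?thesis using chain_sobolev(1)[OF assms] unfolding sobolev0_def by auto
qed

text \<open>Weak derivatives of f are L2 limits of derivatives of test functions. Integrating from 0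
  makes this convergence uniform, so the continuous representatives agree with the weak derivatives
  and inherit the zero boundary values. The pointwise bound is Cauchy-Schwarz on [0, x] with x \<le>
  1.\<close>

lemma sobolev0_chain:
  assumes f: "f \<in> sobolev0 m"
  obtains F where "chain m F" "AE x in lebesgue01. f x = F 0 x"
    "\<And>j. j \<le> m \<Longrightarrow> L2_norm (F j) \<le> sobolev_norm m f"
    "\<And>j x. j < m \<Longrightarrow> x \<in> {0..1} \<Longrightarrow> \<bar>F j x\<bar> \<le> sobolev_norm m f"
proof -
  define g where "g k = weak_deriv k f" for k
  have fL: "f \<in> L2" using f by (auto simp: sobolev0_def sobolev_def)
  have g: "g k \<in> L2" "is_weak_deriv k f (g k)" if "k \<le> m" for k
  proof -
    have "\<exists>h\<in>L2. is_weak_deriv k f h" using f that unfolding sobolev0_def sobolev_def by blast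
    then obtain h where "h \<in> L2" "is_weak_deriv k f h" by blast
    then show "g k \<in> L2" "is_weak_deriv k f (g k)" unfolding g_def by (rule weak_deriv_props)+
  qed
  have norm: "L2_norm (g k) \<le> sobolev_norm m f" if "k \<le> m" for k
    using L2_norm_le_sum[OF that, of g] unfolding sobolev_norm_def g_def .
  have approx: "\<exists>\<phi>\<in>test_functions. \<forall>k\<le>m. L2_norm (\<lambda>x. g k x - (deriv ^^ k) \<phi> x) < e" if "e > 0" for e
  proof -
    obtain \<phi> where \<phi>: "\<phi> \<in> test_functions" "sobolev_norm m (\<lambda>x. f x - \<phi> x) < e"
      using f \<open>e > 0\<close> by (auto simp: sobolev0_def)
    have "sobolev_norm m (\<lambda>x. f x - \<phi> x) = sqrt (\<Sum>k\<le>m. (L2_norm (\<lambda>x. g k x - (deriv ^^ k) \<phi> x))\<^sup>2)"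
    proof (rule sobolev_norm_eq)
      fix k assume k: "k \<le> m"
      have "is_weak_deriv k (\<lambda>x. f x - \<phi> x) (\<lambda>x. g k x - (deriv ^^ k) \<phi> x)"
        using chain_weak_deriv[OF test_chain[OF \<phi>(1)] k]
        using is_weak_deriv_diff[OF fL g(1)[OF k] test_L2[OF \<phi>(1)] test_L2[OF test_deriv_n[OF \<phi>(1)]] g(2)[OF k]]
        by simp
      then show "(\<lambda>x. g k x - (deriv ^^ k) \<phi> x) \<in> L2 \<and> is_weak_deriv k (\<lambda>x. f x - \<phi> x) (\<lambda>x. g k x - (deriv ^^ k) \<phi> x)"
        using L2_diff[OF g(1)[OF k] test_L2[OF test_deriv_n[OF \<phi>(1)]]] by blast
    qed
    then have "L2_norm (\<lambda>x. g k x - (deriv ^^ k) \<phi> x) < e" if "k \<le> m" for k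
      using L2_norm_le_sum[OF that, of "\<lambda>k x. g k x - (deriv ^^ k) \<phi> x"] \<phi>(2) by linarith
    then show ?thesis using \<phi>(1) by blast
  qed
  \<comment> \<open>Below the top order, the representative that vanishes at 0; its vanishing at 1
    is inherited from the test functions through \<open>close\<close>.\<close>
  define F where "F j = (if j = m then g m else (\<lambda>x. integral {0..x} (g (Suc j))))" for j
  have close: "\<bar>integral {0..x} (g (Suc j)) - (deriv ^^ j) \<phi> x\<bar> \<le> L2_norm (\<lambda>x. g (Suc j) x - (deriv ^^ Suc j) \<phi> x)"
    if "j < m" "\<phi> \<in> test_functions" "x \<in> {0..1}" for j \<phi> x
  proof -
    have gj: "g (Suc j) \<in> L2" using g that by auto
    have p: "prim 0 1 (\<lambda>x. 0 + integral {0..x} (g (Suc j))) (g (Suc j))" by (rule L2_prim[OF gj])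
    have "integral {0..x} (g (Suc j)) - (deriv ^^ j) \<phi> x = integral {0..x} (\<lambda>x. g (Suc j) x - (deriv ^^ Suc j) \<phi> x)"
      using prim_diff[OF prim_diff_fun[OF p test_prim[OF test_deriv_n[OF that(2), of j]]], of 0 x] that(3)
        test_ends[OF test_deriv_n[OF that(2), of j]] by simp
    then have "\<bar>integral {0..x} (g (Suc j)) - (deriv ^^ j) \<phi> x\<bar>
        \<le> sqrt (x - 0) * L2_norm (\<lambda>x. g (Suc j) x - (deriv ^^ Suc j) \<phi> x)"
      using L2_integral_bound[OF L2_diff[OF gj test_L2[OF test_deriv_n[OF that(2), of "Suc j"]]], of 0 x] that(3) by simp
    also have "\<dots> \<le> 1 * L2_norm (\<lambda>x. g (Suc j) x - (deriv ^^ Suc j) \<phi> x)"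
      using that by (intro mult_right_mono) auto
    finally show ?thesis by simp
  qed
  have FL: "F j \<in> L2" if "j \<le> m" for j
  proof (cases "j = m")
    case False
    then show ?thesis using that g(1)[of "Suc j"] continuous_L2[OF prim_cont[OF L2_prim[of "g (Suc j)" 0]]]
      by (simp add: F_def)
  qed (use g in \<open>simp add: F_def\<close>)
  have Fg: "AE x in lebesgue01. F j x = g j x" if "j \<le> m" for j
  proof (cases "j = m")
    case False
    then have j: "j < m" using that by simp
    have "L2_norm (\<lambda>x. F j x - g j x) \<le> 0 + e" if "e > 0" for e
    proof -
      obtain \<phi> where \<phi>: "\<phi> \<in> test_functions" "\<And>k. k \<le> m \<Longrightarrow> L2_norm (\<lambda>x. g k x - (deriv ^^ k) \<phi> x) < e / 2"
        using approx[of "e / 2"] \<open>e > 0\<close> by auto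
      have 1: "L2_norm (\<lambda>x. F j x - g j x) \<le> L2_norm (\<lambda>x. F j x - (deriv ^^ j) \<phi> x) + L2_norm (\<lambda>x. (deriv ^^ j) \<phi> x - g j x)"
        using L2_norm_triangle3[OF FL[OF \<open>j \<le> m\<close>] test_L2[OF test_deriv_n[OF \<phi>(1), of j]] g(1)[OF \<open>j \<le> m\<close>]] by simp
      have 2: "L2_norm (\<lambda>x. F j x - (deriv ^^ j) \<phi> x) \<le> e / 2"
      proof (rule L2_norm_le_bound)
        show "(\<lambda>x. F j x - (deriv ^^ j) \<phi> x) \<in> borel_measurable lebesgue01"
          by (rule L2_measurable[OF L2_diff[OF FL[OF \<open>j \<le> m\<close>] test_L2[OF test_deriv_n[OF \<phi>(1), of j]]]])
        fix x :: real assume "x \<in> {0<..<1}"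
        then show "\<bar>F j x - (deriv ^^ j) \<phi> x\<bar> \<le> e / 2"
          using close[OF j \<phi>(1), of x] \<phi>(2)[of "Suc j"] j by (simp add: F_def)
      qed (use \<open>e > 0\<close> in simp)
      have 3: "L2_norm (\<lambda>x. (deriv ^^ j) \<phi> x - g j x) \<le> e / 2"
        using \<phi>(2)[of j] j by (simp add: L2_norm_minus_commute[of "(deriv ^^ j) \<phi>" "g j"])
      show ?thesis using 1 2 3 by linarith
    qed
    then have "L2_norm (\<lambda>x. F j x - g j x) \<le> 0" by (rule field_le_epsilon)
    then have "L2_norm (\<lambda>x. F j x - g j x) = 0" using L2_norm_nonneg by (metis antisym)
    then have "AE x in lebesgue01. F j x - g j x = 0"
      using L2_norm_zero_AE[OF L2_diff[OF FL[OF \<open>j \<le> m\<close>] g(1)[OF \<open>j \<le> m\<close>]]] by simp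
    then show ?thesis by simp
  qed (simp add: F_def)
  have Fnorm: "L2_norm (F j) = L2_norm (g j)" if "j \<le> m" for j
    using Fg[OF that] FL[OF that] g(1)[OF that] by (intro L2_norm_cong_AE L2_measurable)
  have Fint: "integral {0..x} (g (Suc j)) = integral {0..x} (F (Suc j))" if "j < m" "x \<in> {0..1}" for j x
  proof -
    have L: "g (Suc j) \<in> L2" "F (Suc j) \<in> L2" using FL[of "Suc j"] g(1)[of "Suc j"] that by auto
    have "AE x in lebesgue01. g (Suc j) x - F (Suc j) x = 0"
      using Fg[of "Suc j"] that by (auto elim: eventually_mono)
    then have "L2_norm (\<lambda>x. g (Suc j) x - F (Suc j) x) = L2_norm (\<lambda>x. 0)"
      by (intro L2_norm_cong_AE[OF L2_measurable[OF L2_diff[OF L]]]) auto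
    then have z: "L2_norm (\<lambda>x. g (Suc j) x - F (Suc j) x) = 0" by (simp add: L2_norm_def)
    have i: "g (Suc j) integrable_on {0..x}" "F (Suc j) integrable_on {0..x}"
      using that prim_integrable_sub[OF L2_prim[OF L(1), of 0], of 0 x] prim_integrable_sub[OF L2_prim[OF L(2), of 0], of 0 x]
        set_lebesgue_integral_eq_integral(1) by auto
    have "\<bar>integral {0..x} (\<lambda>x. g (Suc j) x - F (Suc j) x)\<bar> \<le> 0"
      using L2_integral_bound[OF L2_diff[OF L], of 0 x] z that by simp
    then show ?thesis using Henstock_Kurzweil_Integration.integral_diff[OF i] by simp
  qed
  have "chain m F"
    unfolding chain_def
  proof (intro conjI allI impI)
    show "F m \<in> L2" using FL by simp
    fix j assume j: "j < m"
    show "prim 0 1 (F j) (F (Suc j))"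
    proof (rule primI)
      show "F (Suc j) absolutely_integrable_on {0..1}" using FL[of "Suc j"] j by (intro L2_abs_integrable) auto
      show "F j x - F j 0 = integral {0..x} (F (Suc j))" if "0 \<le> x" "x \<le> 1" for x
        using j Fint[of j x] that by (simp add: F_def)
    qed
    show "F j 0 = 0" using j by (simp add: F_def)
    have "\<bar>F j 1\<bar> \<le> 0 + e" if "e > 0" for e
    proof -
      obtain \<phi> where \<phi>: "\<phi> \<in> test_functions" "\<And>k. k \<le> m \<Longrightarrow> L2_norm (\<lambda>x. g k x - (deriv ^^ k) \<phi> x) < e"
        using approx[OF \<open>e > 0\<close>] by auto
      show ?thesis
        using close[OF j \<phi>(1), of 1] \<phi>(2)[of "Suc j"] j test_ends(2)[OF test_deriv_n[OF \<phi>(1)], of j]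
        by (simp add: F_def)
    qed
    then have "\<bar>F j 1\<bar> \<le> 0" by (rule field_le_epsilon)
    then show "F j 1 = 0" by simp
  qed
  moreover have "AE x in lebesgue01. f x = F 0 x"
  proof -
    have "is_weak_deriv 0 f f" by (simp add: is_weak_deriv_def)
    then have "AE x in lebesgue01. f x = g 0 x" using weak_deriv_unique[OF fL g(1)] g(2)[of 0] by auto
    moreover have "AE x in lebesgue01. F 0 x = g 0 x" using Fg[of 0] by simp
    ultimately show ?thesis by eventually_elim simp
  qed
  moreover have "\<bar>F j x\<bar> \<le> sobolev_norm m f" if "j < m" "x \<in> {0..1}" for j x
  proof -
    have "\<bar>F j x\<bar> \<le> sqrt (x - 0) * L2_norm (g (Suc j))"
      using L2_integral_bound[OF g(1), of "Suc j" 0 x] that by (simp add: F_def)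
    also have "\<dots> \<le> 1 * L2_norm (g (Suc j))" using that by (intro mult_right_mono) auto
    finally show ?thesis using norm[of "Suc j"] that by simp
  qed
  ultimately show ?thesis using that[of F] Fnorm norm by simp
qed

section \<open>Integrals of continuous functions depending on parameters\<close>

definition cont2 :: "real \<Rightarrow> (real \<Rightarrow> real \<Rightarrow> real) \<Rightarrow> bool" where
  "cont2 T f \<longleftrightarrow> continuous_on ({0..T} \<times> {0..1}) (\<lambda>p. f (fst p) (snd p))"

lemma cont2_compose:
  assumes "cont2 T f" "continuous_on S a" "continuous_on S b"
    "\<And>p. p \<in> S \<Longrightarrow> a p \<in> {0..T}" "\<And>p. p \<in> S \<Longrightarrow> b p \<in> {0..1}"
  shows "continuous_on S (\<lambda>p. f (a p) (b p))"
proof -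
  have "continuous_on S (\<lambda>p. (\<lambda>p. f (fst p) (snd p)) (a p, b p))"
    using assms(1) unfolding cont2_def
    by (rule continuous_on_compose2) (use assms in \<open>auto intro!: continuous_intros\<close>)
  then show ?thesis by simp
qed

lemma cont2_x: "cont2 T f \<Longrightarrow> t \<in> {0..T} \<Longrightarrow> continuous_on {0..1} (f t)"
  using cont2_compose[of T f "{0..1}" "\<lambda>_. t" "\<lambda>x. x"] by auto

lemma cont2_t: "cont2 T f \<Longrightarrow> x \<in> {0..1} \<Longrightarrow> continuous_on {0..T} (\<lambda>t. f t x)"
  using cont2_compose[of T f "{0..T}" "\<lambda>t. t" "\<lambda>_. x"] by auto

lemma cont2_const: "cont2 T (\<lambda>t x. c)"
  and cont2_fst: "cont2 T (\<lambda>t x. t)"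
  and cont2_snd: "cont2 T (\<lambda>t x. x)"
  unfolding cont2_def by (auto intro!: continuous_intros)

lemma cont2_add: "cont2 T f \<Longrightarrow> cont2 T g \<Longrightarrow> cont2 T (\<lambda>t x. f t x + g t x)"
  and cont2_diff: "cont2 T f \<Longrightarrow> cont2 T g \<Longrightarrow> cont2 T (\<lambda>t x. f t x - g t x)"
  and cont2_mult: "cont2 T f \<Longrightarrow> cont2 T g \<Longrightarrow> cont2 T (\<lambda>t x. f t x * g t x)"
  and cont2_minus: "cont2 T f \<Longrightarrow> cont2 T (\<lambda>t x. - f t x)"
  and cont2_exp: "cont2 T f \<Longrightarrow> cont2 T (\<lambda>t x. exp (f t x))"
  unfolding cont2_def by (auto intro!: continuous_intros)

lemma cont2_of_x:
  assumes "continuous_on {0..1} f" shows "cont2 T (\<lambda>t x. f x)"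
  unfolding cont2_def
  by (rule continuous_on_compose2[OF assms]) (auto intro!: continuous_intros)

lemma cont2_comp:
  assumes "cont2 T f" "continuous_on UNIV g" shows "cont2 T (\<lambda>t x. g (f t x))"
  unfolding cont2_def
  by (rule continuous_on_compose2[OF assms(2) assms(1)[unfolded cont2_def]]) auto

lemma cont2_integral:
  fixes f :: "real \<Rightarrow> real \<Rightarrow> real \<Rightarrow> real"
  assumes "continuous_on (({0..T} \<times> {0..1}) \<times> {0..1}) (\<lambda>p. f (fst (fst p)) (snd (fst p)) (snd p))"
  shows "cont2 T (\<lambda>t x. integral {0..1} (f t x))"
proof -
  have "continuous_on ({0..T} \<times> {0..1}) (\<lambda>p. integral (cbox (0::real) 1) (\<lambda>s. f (fst p) (snd p) s))"
    by (rule integral_continuous_on_param) (use assms in \<open>simp add: split_beta' cbox_interval\<close>)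
  then show ?thesis by (simp add: cont2_def)
qed

lemma cont2_bounded:
  assumes "cont2 T f" obtains B where "B > 0" "\<And>t x. t \<in> {0..T} \<Longrightarrow> x \<in> {0..1} \<Longrightarrow> \<bar>f t x\<bar> \<le> B"
proof -
  have "compact ((\<lambda>p. f (fst p) (snd p)) ` ({0..T} \<times> {0..1}))"
    using assms unfolding cont2_def by (intro compact_continuous_image compact_Times) auto
  then obtain B where "B > 0" "\<And>y. y \<in> (\<lambda>p. f (fst p) (snd p)) ` ({0..T} \<times> {0..1}) \<Longrightarrow> norm y \<le> B"
    using compact_imp_bounded bounded_pos by metis
  then show ?thesis using that[of B] by force
qed

lemma integral01_bound:
  fixes f :: "real \<Rightarrow> real"
  assumes "continuous_on {0..1} f" "\<And>s. s \<in> {0..1} \<Longrightarrow> \<bar>f s\<bar> \<le> B"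
  shows "\<bar>integral {0..1} f\<bar> \<le> B"
proof -
  have "norm (integral {0..1} f) \<le> integral {0..1} (\<lambda>s::real. B)"
    by (rule integral_norm_bound_integral) (use assms in \<open>auto intro: integrable_continuous_real\<close>)
  then show ?thesis by simp
qed

lemma integral01_diff_bound:
  fixes f g :: "real \<Rightarrow> real"
  assumes "continuous_on {0..1} f" "continuous_on {0..1} g" "\<And>s. s \<in> {0..1} \<Longrightarrow> \<bar>f s - g s\<bar> \<le> B"
  shows "\<bar>integral {0..1} f - integral {0..1} g\<bar> \<le> B"
proof -
  have "integral {0..1} f - integral {0..1} g = integral {0..1} (\<lambda>s. f s - g s)"
    using assms by (intro Henstock_Kurzweil_Integration.integral_diff[symmetric] integrable_continuous_real) auto
  then show ?thesis
    using integral01_bound[of "\<lambda>s. f s - g s" B] assms by (auto intro: continuous_intros)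
qed

text \<open>Moving the end points into the integrand reduces joint continuity of integrals with
  variable limits to continuity of a parameter integral over [0,1].\<close>

lemma integral_affine01:
  fixes f :: "real \<Rightarrow> real"
  assumes "a \<le> b" "continuous_on {a..b} f"
  shows "(b - a) * integral {0..1} (\<lambda>s. f (a + (b - a) * s)) = integral {a..b} f"
proof -
  have img: "a + (b - a) * s \<in> {a..b}" if "s \<in> {0..1}" for s
    using that assms(1) mult_left_le[of s "b - a"] by auto
  have "((\<lambda>s. f (a + (b - a) * s) * (b - a)) has_integral
      integral {a..a + (b - a) * 1} f - integral {a..a + (b - a) * 0} f) {0..1}"
  proof (rule fundamental_theorem_of_calculus)
    fix s :: real assume s: "s \<in> {0..1}"
    have "((\<lambda>y. integral {a..y} f) has_real_derivative f (a + (b - a) * s)) (at (a + (b - a) * s) within {a..b})"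
      by (rule integral_has_real_derivative[OF assms(2) img[OF s]])
    then have "((\<lambda>y. integral {a..y} f) has_real_derivative f (a + (b - a) * s))
        (at (a + (b - a) * s) within (\<lambda>s. a + (b - a) * s) ` {0..1})"
      by (rule DERIV_subset) (use img in auto)
    moreover have "((\<lambda>s. a + (b - a) * s) has_real_derivative b - a) (at s within {0..1})"
      by (auto intro!: derivative_eq_intros)
    ultimately have "((\<lambda>s. integral {a..a + (b - a) * s} f) has_real_derivative f (a + (b - a) * s) * (b - a)) (at s within {0..1})"
      using DERIV_image_chain[of "\<lambda>y. integral {a..y} f" _ "\<lambda>s. a + (b - a) * s" s "{0..1}"]
      by (simp add: o_def)
    then show "((\<lambda>s. integral {a..a + (b - a) * s} f) has_vector_derivative f (a + (b - a) * s) * (b - a)) (at s within {0..1})"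
      by (simp add: has_real_derivative_iff_has_vector_derivative)
  qed simp
  then have "integral {0..1} (\<lambda>s. f (a + (b - a) * s) * (b - a)) =
      integral {a..a + (b - a) * 1} f - integral {a..a + (b - a) * 0} f"
    by (rule integral_unique)
  then show ?thesis by (simp add: mult.commute)
qed

lemma integral_affine_from_0:
  fixes f :: "real \<Rightarrow> real"
  assumes "0 \<le> x" "continuous_on {0..x} f"
  shows "x * integral {0..1} (\<lambda>s. f (x * s)) = integral {0..x} f"
  using integral_affine01[of 0 x f] assms by simp

section \<open>Integrals in time\<close>

definition time_int :: "(real \<Rightarrow> real \<Rightarrow> real) \<Rightarrow> real \<Rightarrow> real \<Rightarrow> real" where
  "time_int f t x = integral {0..t} (\<lambda>s. f s x)"

lemma time_int_affine:
  assumes "cont2 T f" "t \<in> {0..T}" "x \<in> {0..1}"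
  shows "time_int f t x = t * integral {0..1} (\<lambda>s. f (t * s) x)"
proof -
  have "continuous_on {0..t} (\<lambda>s. f s x)"
    by (rule continuous_on_subset[OF cont2_t[OF assms(1,3)]]) (use assms(2) in auto)
  then show ?thesis using integral_affine01[of 0 t "\<lambda>s. f s x"] assms(2) by (simp add: time_int_def)
qed

lemma cont2_cong:
  assumes "cont2 T f" "\<And>t x. t \<in> {0..T} \<Longrightarrow> x \<in> {0..1} \<Longrightarrow> f t x = g t x" shows "cont2 T g"
  using assms(1) unfolding cont2_def
  by (subst continuous_on_cong[OF refl, of _ _ "\<lambda>p. f (fst p) (snd p)"]) (use assms(2) in auto)

lemma cont2_time_int:
  assumes "cont2 T f" shows "cont2 T (time_int f)"
proof -
  have "cont2 T (\<lambda>t x. t * integral {0..1} (\<lambda>s. f (t * s) x))"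
  proof (rule cont2_mult[OF cont2_fst], rule cont2_integral, rule cont2_compose[OF assms])
    show "fst (fst p) * snd p \<in> {0..T}" if "p \<in> ({0..T} \<times> {0..1}) \<times> {0..1}" for p
      using that mult_left_le[of "snd p" "fst (fst p)"] by (auto intro: order_trans)
  qed (auto intro!: continuous_intros)
  then show ?thesis by (rule cont2_cong) (use time_int_affine[OF assms] in simp)
qed

lemma time_int_deriv:
  assumes "cont2 T f" "t \<in> {0..T}" "x \<in> {0..1}"
  shows "((\<lambda>s. time_int f s x) has_real_derivative f t x) (at t within {0..T})"
  unfolding time_int_def by (rule integral_has_real_derivative[OF cont2_t[OF assms(1,3)] assms(2)])

lemma time_int_0 [simp]: "time_int f 0 x = 0"
  by (simp add: time_int_def)

lemma convex01: "x \<in> {0..1} \<Longrightarrow> s \<in> {0..1} \<Longrightarrow> x + (1 - x) * s \<in> {0..1::real}"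
  using mult_left_le[of s "1 - x"] by auto

section \<open>The Lagrangian equation\<close>

text \<open>Continuous extension of (e^y - 1) / y. In the form c \<open>expm1_quot\<close> (x c) it
  represents (e^(x c) - 1) / x, with value c at x = 0.\<close>

definition expm1_quot :: "real \<Rightarrow> real" where
  "expm1_quot y = (if y = 0 then 1 else (exp y - 1) / y)"

lemma continuous_expm1_quot: "continuous_on UNIV expm1_quot"
proof (intro continuous_at_imp_continuous_on ballI)
  fix y :: real
  show "isCont expm1_quot y"
  proof (cases "y = 0")
    case True
    have "((\<lambda>h. (exp (0 + h) - exp 0) / h) \<longlongrightarrow> exp 0) (at (0::real))"
      using DERIV_exp[of "0::real"] unfolding DERIV_def .
    then have "((\<lambda>h. (exp h - 1) / h) \<longlongrightarrow> 1) (at (0::real))" by simp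
    moreover have "eventually (\<lambda>h::real. (exp h - 1) / h = expm1_quot h) (at 0)"
      by (auto simp: expm1_quot_def eventually_at_filter)
    ultimately have "(expm1_quot \<longlongrightarrow> 1) (at 0)" by (rule Lim_transform_eventually)
    then show ?thesis using True by (simp add: isCont_def expm1_quot_def)
  next
    case False
    have "isCont (\<lambda>y. (exp y - 1) / y) y" using False by (intro continuous_intros) auto
    moreover have "eventually (\<lambda>z. (exp z - 1) / z = expm1_quot z) (nhds y)"
      using t1_space_nhds[OF False] by eventually_elim (simp add: expm1_quot_def)
    ultimately show ?thesis using isCont_cong by fastforce
  qed
qed

lemma exp_diff_le:
  fixes a b B :: real
  assumes "a \<le> B" "b \<le> B" shows "\<bar>exp a - exp b\<bar> \<le> exp B * \<bar>a - b\<bar>"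
proof -
  have *: "exp v - exp u \<le> exp B * (v - u)" if "u \<le> v" "v \<le> B" for u v :: real
  proof -
    have "exp v - exp u = exp v * (1 - exp (u - v))" by (simp add: algebra_simps exp_diff)
    also have "1 - exp (u - v) \<le> v - u"
      using exp_ge_add_one_self[of "u - v"] by linarith
    then have "exp v * (1 - exp (u - v)) \<le> exp v * (v - u)" by (intro mult_left_mono) auto
    also have "\<dots> \<le> exp B * (v - u)" using that by (intro mult_right_mono) auto
    finally show ?thesis .
  qed
  show ?thesis using *[of a b] *[of b a] assms by (cases "a \<le> b") auto
qed

text \<open>The exponential has slope at most e \<le> 3 on [-1, 1], and the division by x cancels
  against the factor x in the arguments.\<close>

lemma expm1_quot_diff:
  assumes "0 \<le> x" "x \<le> 1" "\<bar>c\<bar> \<le> 1" "\<bar>d\<bar> \<le> 1"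
  shows "\<bar>c * expm1_quot (x * c) - d * expm1_quot (x * d)\<bar> \<le> 3 * \<bar>c - d\<bar>"
proof (cases "x = 0")
  case True then show ?thesis by (simp add: expm1_quot_def)
next
  case False
  have e: "c * expm1_quot (x * c) = (exp (x * c) - 1) / x" for c
    using False by (simp add: expm1_quot_def)
  have b: "x * c \<le> 1" if "\<bar>c\<bar> \<le> 1" for c
    using mult_mono[of x 1 "\<bar>c\<bar>" 1] assms that abs_ge_self[of "x * c"] by (simp add: abs_mult)
  have "\<bar>exp (x * c) - exp (x * d)\<bar> \<le> exp 1 * \<bar>x * c - x * d\<bar>"
    by (intro exp_diff_le) (use b assms in auto)
  also have "\<dots> \<le> 3 * (x * \<bar>c - d\<bar>)"
    using exp_le assms by (intro mult_mono) (auto simp: right_diff_distrib[symmetric] abs_mult)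
  finally have "\<bar>exp (x * c) - exp (x * d)\<bar> / x \<le> 3 * \<bar>c - d\<bar>"
    using False assms by (simp add: pos_divide_le_eq mult_ac)
  then show ?thesis unfolding e using False assms by (simp add: diff_divide_distrib[symmetric] abs_divide)
qed

lemma expm1_quot_bound:
  fixes x c :: real
  assumes "0 \<le> x" "x \<le> 1" "\<bar>c\<bar> \<le> 1" shows "\<bar>c * expm1_quot (x * c)\<bar> \<le> 3"
  using expm1_quot_diff[of x c 0] assms by auto

lemma mult_expm1_quot: "x * (c * expm1_quot (x * c)) = exp (x * c) - 1"
  by (simp add: expm1_quot_def)

text \<open>Here w = \<omega>_0, r = \<rho>_0', and w1, r1 are their derivatives. The constant 1000
  is generous: it is used for the bound and the contraction of the Picard map, with constants 405
  and 1944, and for the Volterra equation of the regularity proof, with constant 648.\<close>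

locale lagrangian_data =
  fixes T K :: real and w w1 r r1 :: "real \<Rightarrow> real"
  assumes T_pos: "0 < T" and K_nonneg: "0 \<le> K" and T_small: "T * (1000 * (1 + K)) \<le> 1"
    and w_prim: "prim 0 1 w w1" and r_prim: "prim 0 1 r r1"
    and w1_cont: "continuous_on {0..1} w1" and r1_cont: "continuous_on {0..1} r1"
    and w1_bound: "\<And>x. x \<in> {0..1} \<Longrightarrow> \<bar>w1 x\<bar> \<le> K" and r1_bound: "\<And>x. x \<in> {0..1} \<Longrightarrow> \<bar>r1 x\<bar> \<le> K"
    and w_0: "w 0 = 0" and r_0: "r 0 = 0" and w_1: "w 1 = 0" and r_1: "r 1 = 0"
begin

lemma T_le: "1000 * T \<le> 1" and TK_le: "1000 * (T * K) \<le> 1"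
proof -
  have "T * (1000 * (1 + K)) = 1000 * T + 1000 * (T * K)" by (simp add: algebra_simps)
  moreover have "0 \<le> T * K" using T_pos K_nonneg by simp
  ultimately show "1000 * T \<le> 1" "1000 * (T * K) \<le> 1" using T_small T_pos by linarith+
qed

lemma r_bound: "x \<in> {0..1} \<Longrightarrow> \<bar>r x\<bar> \<le> K"
proof -
  assume x: "x \<in> {0..1}"
  have "continuous_on {0..x} r1" by (rule continuous_on_subset[OF r1_cont]) (use x in auto)
  then have "r x = x * integral {0..1} (\<lambda>s. r1 (x * s))"
    using prim_diff[OF r_prim, of 0 x] integral_affine_from_0[of x r1] x r_0 by auto
  moreover have "\<bar>integral {0..1} (\<lambda>s. r1 (x * s))\<bar> \<le> K"
  proof (rule integral01_bound)
    show "continuous_on {0..1} (\<lambda>s. r1 (x * s))"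
      by (rule continuous_on_compose2[OF r1_cont]) (use x in \<open>auto intro!: continuous_intros mult_le_one\<close>)
    show "\<bar>r1 (x * s)\<bar> \<le> K" if "s \<in> {0..1}" for s
      by (rule r1_bound) (use that x in \<open>auto intro!: mult_le_one\<close>)
  qed
  ultimately show "\<bar>r x\<bar> \<le> K"
    using x mult_mono[of "\<bar>x\<bar>" 1 "\<bar>integral {0..1} (\<lambda>s. r1 (x * s))\<bar>" K] K_nonneg by (simp add: abs_mult)
qed

lemma r_cont: "continuous_on {0..1} r" and w_cont: "continuous_on {0..1} w"
  using prim_cont r_prim w_prim by auto

text \<open>
  The data are \<open>w = \<omega>\<^sub>0\<close> and \<open>r = \<rho>\<^sub>0'\<close>. The unknown is the space derivative \<open>q\<close> of \<open>C = ln (e\<^sup>A \<partial>\<^sub>xX x)\<close>. The map \<open>picard\<close> is the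
  space derivative of \<open>C \<mapsto> t w + r \<integral>\<^sub>0\<^sup>t (t - s) e\<^sup>A\<^sup>-\<^sup>C ds\<close>, where \<open>A = \<integral>\<^sub>x\<^sup>1 (e\<^sup>C - 1) / y dy\<close>.
  All integrals are transported to \<open>[0,1]\<close> and \<open>C = x \<cdot> mean q\<close>, so that nothing is singular at \<open>0\<close>.
\<close>

definition mean :: "(real \<Rightarrow> real \<Rightarrow> real) \<Rightarrow> real \<Rightarrow> real \<Rightarrow> real" where
  "mean q t x = integral {0..1} (\<lambda>s. q t (x * s))"

text \<open>This is (e^C - 1) / x with C = x \<open>mean q\<close>, that is, - A_x.\<close>

definition hfun :: "(real \<Rightarrow> real \<Rightarrow> real) \<Rightarrow> real \<Rightarrow> real \<Rightarrow> real" where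
  "hfun q t x = mean q t x * expm1_quot (x * mean q t x)"

definition Afun :: "(real \<Rightarrow> real \<Rightarrow> real) \<Rightarrow> real \<Rightarrow> real \<Rightarrow> real" where
  "Afun q t x = (1 - x) * integral {0..1} (\<lambda>s. hfun q t (x + (1 - x) * s))"

definition Vfun :: "(real \<Rightarrow> real \<Rightarrow> real) \<Rightarrow> real \<Rightarrow> real \<Rightarrow> real" where
  "Vfun q t x = exp (Afun q t x - x * mean q t x)"

text \<open>The space derivative of r e^(A-C): with V = e^(A-C), A_x = - \<open>hfun\<close> and C_x
  = q, one has V_x = - V (q + \<open>hfun\<close>).\<close>

definition Gfun :: "(real \<Rightarrow> real \<Rightarrow> real) \<Rightarrow> real \<Rightarrow> real \<Rightarrow> real" where
  "Gfun q t x = r1 x * Vfun q t x - r x * Vfun q t x * (q t x + hfun q t x)"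

text \<open>The second term is the double time integral of \<open>Gfun q\<close> in Taylor form,
  rescaled to [0,1]; see \<open>double_time_int\<close>.\<close>

definition picard :: "(real \<Rightarrow> real \<Rightarrow> real) \<Rightarrow> real \<Rightarrow> real \<Rightarrow> real" where
  "picard q t x = t * w1 x + t * (t * integral {0..1} (\<lambda>s. (1 - s) * Gfun q (t * s) x))"

lemma cont2_mean: "cont2 T q \<Longrightarrow> cont2 T (mean q)"
  unfolding mean_def
  by (rule cont2_integral, rule cont2_compose[of T q]) (auto intro!: continuous_intros mult_le_one)

lemma cont2_hfun: "cont2 T q \<Longrightarrow> cont2 T (hfun q)"
  unfolding hfun_def
  by (intro cont2_mult cont2_comp[OF _ continuous_expm1_quot] cont2_snd cont2_mean)

lemma cont2_Afun: "cont2 T q \<Longrightarrow> cont2 T (Afun q)"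
  unfolding Afun_def
  by (intro cont2_mult cont2_diff cont2_const cont2_snd, rule cont2_integral, rule cont2_compose[OF cont2_hfun])
     (use convex01 in \<open>auto intro!: continuous_intros\<close>)

lemma cont2_Vfun: "cont2 T q \<Longrightarrow> cont2 T (Vfun q)"
  unfolding Vfun_def by (intro cont2_exp cont2_diff cont2_mult cont2_Afun cont2_snd cont2_mean)

lemma cont2_Gfun: "cont2 T q \<Longrightarrow> cont2 T (Gfun q)"
  unfolding Gfun_def
  by (intro cont2_diff cont2_add cont2_mult cont2_Vfun cont2_hfun cont2_of_x r1_cont r_cont)

lemma time_scaled: "t \<in> {0..T} \<Longrightarrow> s \<in> {0..1} \<Longrightarrow> t * s \<in> {0..T}"
  using mult_left_le[of s t] by auto

lemma cont2_picard:
  assumes q: "cont2 T q" shows "cont2 T (picard q)"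
proof -
  have "continuous_on (({0..T} \<times> {0..1}) \<times> {0..1}) (\<lambda>p. Gfun q (fst (fst p) * snd p) (snd (fst p)))"
    by (rule cont2_compose[OF cont2_Gfun[OF q]]) (use time_scaled in \<open>auto intro!: continuous_intros\<close>)
  then have "continuous_on (({0..T} \<times> {0..1}) \<times> {0..1}) (\<lambda>p. (1 - snd p) * Gfun q (fst (fst p) * snd p) (snd (fst p)))"
    by (intro continuous_intros)
  then have "cont2 T (\<lambda>t x. integral {0..1} (\<lambda>s. (1 - s) * Gfun q (t * s) x))"
    by (rule cont2_integral[of T "\<lambda>t x s. (1 - s) * Gfun q (t * s) x"])
  then show ?thesis
    unfolding picard_def by (intro cont2_add cont2_mult cont2_fst cont2_of_x[OF w1_cont])
qed

lemma scaled01: "x \<in> {0..1} \<Longrightarrow> s \<in> {0..1} \<Longrightarrow> x * s \<in> {0..1::real}"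
  by (auto intro: mult_le_one)

lemma cont_mean_arg: "cont2 T q \<Longrightarrow> t \<in> {0..T} \<Longrightarrow> x \<in> {0..1} \<Longrightarrow> continuous_on {0..1} (\<lambda>s. q t (x * s))"
  by (rule cont2_compose[of T q]) (use scaled01 in \<open>auto intro!: continuous_intros\<close>)

lemma cont_A_arg: "cont2 T q \<Longrightarrow> t \<in> {0..T} \<Longrightarrow> x \<in> {0..1} \<Longrightarrow>
    continuous_on {0..1} (\<lambda>s. hfun q t (x + (1 - x) * s))"
  by (rule cont2_compose[OF cont2_hfun[of q]]) (use convex01 in \<open>auto intro!: continuous_intros\<close>)

lemma cont_picard_arg: "cont2 T q \<Longrightarrow> t \<in> {0..T} \<Longrightarrow> x \<in> {0..1} \<Longrightarrow>
    continuous_on {0..1} (\<lambda>s. (1 - s) * Gfun q (t * s) x)"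
  by (intro continuous_intros, rule cont2_compose[OF cont2_Gfun[of q]])
     (use time_scaled in \<open>auto intro!: continuous_intros\<close>)

section \<open>Bounds for the Picard map on the unit ball\<close>

context
  fixes q :: "real \<Rightarrow> real \<Rightarrow> real"
  assumes q: "cont2 T q" "\<And>t x. t \<in> {0..T} \<Longrightarrow> x \<in> {0..1} \<Longrightarrow> \<bar>q t x\<bar> \<le> 1"
begin

lemma mean_bound: "t \<in> {0..T} \<Longrightarrow> x \<in> {0..1} \<Longrightarrow> \<bar>mean q t x\<bar> \<le> 1"
  unfolding mean_def by (rule integral01_bound[OF cont_mean_arg[OF q(1)] q(2)[OF _ scaled01]])

lemma hfun_bound: "t \<in> {0..T} \<Longrightarrow> x \<in> {0..1} \<Longrightarrow> \<bar>hfun q t x\<bar> \<le> 3"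
  unfolding hfun_def by (rule expm1_quot_bound) (use mean_bound in auto)

lemma Afun_bound:
  assumes "t \<in> {0..T}" "x \<in> {0..1}" shows "\<bar>Afun q t x\<bar> \<le> 3"
proof -
  have "\<bar>integral {0..1} (\<lambda>s. hfun q t (x + (1 - x) * s))\<bar> \<le> 3"
    by (rule integral01_bound[OF cont_A_arg[OF q(1) assms] hfun_bound[OF assms(1) convex01[OF assms(2)]]])
  then have "\<bar>1 - x\<bar> * \<bar>integral {0..1} (\<lambda>s. hfun q t (x + (1 - x) * s))\<bar> \<le> 1 * 3"
    using assms(2) by (intro mult_mono) auto
  then show ?thesis by (simp add: Afun_def abs_mult)
qed

lemma exponent_bound:
  assumes "t \<in> {0..T}" "x \<in> {0..1}" shows "Afun q t x - x * mean q t x \<le> 4"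
proof -
  have "\<bar>x * mean q t x\<bar> \<le> 1 * 1"
    unfolding abs_mult using mean_bound[OF assms] assms(2) by (intro mult_mono) auto
  then show ?thesis using Afun_bound[OF assms] by linarith
qed

lemma exp4: "exp (4::real) \<le> 81"
proof -
  have "exp (4::real) = exp 1 ^ 4" by (simp flip: exp_of_nat_mult)
  also have "\<dots> \<le> 3 ^ 4" by (intro power_mono exp_le) simp
  finally show ?thesis by simp
qed

text \<open>The exponent is at most 3 + 1 by the bounds on A and C, and e^4 \<le> 3^4.\<close>

lemma Vfun_bound:
  assumes "t \<in> {0..T}" "x \<in> {0..1}" shows "\<bar>Vfun q t x\<bar> \<le> 81"
  using exponent_bound[OF assms] exp4 unfolding Vfun_def
  by (simp add: order_trans[OF iffD2[OF exp_le_cancel_iff]])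

text \<open>405 = 81 + 81 * 4, where 4 = 1 + 3 bounds q + \<open>hfun\<close>.\<close>

lemma Gfun_bound:
  assumes "t \<in> {0..T}" "x \<in> {0..1}" shows "\<bar>Gfun q t x\<bar> \<le> 405 * K"
proof -
  have "\<bar>r1 x * Vfun q t x\<bar> \<le> K * 81"
    unfolding abs_mult using r1_bound[OF assms(2)] Vfun_bound[OF assms] K_nonneg by (intro mult_mono) auto
  moreover have "\<bar>q t x + hfun q t x\<bar> \<le> 4" using q(2)[OF assms] hfun_bound[OF assms] by linarith
  then have "\<bar>r x * Vfun q t x * (q t x + hfun q t x)\<bar> \<le> K * 81 * 4"
    unfolding abs_mult using r_bound[OF assms(2)] Vfun_bound[OF assms] K_nonneg by (intro mult_mono) auto
  ultimately show ?thesis unfolding Gfun_def by linarith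
qed

lemma picard_bound:
  assumes "t \<in> {0..T}" "x \<in> {0..1}" shows "\<bar>picard q t x\<bar> \<le> 1"
proof -
  have t: "\<bar>t\<bar> \<le> T" using assms by auto
  have "\<bar>integral {0..1} (\<lambda>s. (1 - s) * Gfun q (t * s) x)\<bar> \<le> 1 * (405 * K)"
  proof (rule integral01_bound[OF cont_picard_arg[OF q(1) assms]])
    fix s :: real assume "s \<in> {0..1}"
    then show "\<bar>(1 - s) * Gfun q (t * s) x\<bar> \<le> 1 * (405 * K)"
      unfolding abs_mult using Gfun_bound[OF time_scaled[OF assms(1)] assms(2)] by (intro mult_mono) auto
  qed
  then have "\<bar>t * (t * integral {0..1} (\<lambda>s. (1 - s) * Gfun q (t * s) x))\<bar> \<le> T * (T * (1 * (405 * K)))"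
    unfolding abs_mult using t T_pos K_nonneg by (intro mult_mono) auto
  also have "\<dots> = 405 * (T * (T * K))" by simp
  also have "\<dots> \<le> 405 * (1 * (T * K))" using T_le T_pos K_nonneg by (intro mult_left_mono mult_right_mono) auto
  finally have "\<bar>t * (t * integral {0..1} (\<lambda>s. (1 - s) * Gfun q (t * s) x))\<bar> \<le> 405 * (T * K)" by simp
  moreover have "\<bar>t * w1 x\<bar> \<le> T * K"
    unfolding abs_mult using t w1_bound[OF assms(2)] T_pos by (intro mult_mono) auto
  ultimately show ?thesis using TK_le unfolding picard_def by linarith
qed

end

section \<open>Contraction of the Picard map\<close>

context
  fixes q q' :: "real \<Rightarrow> real \<Rightarrow> real" and d :: real
  assumes q: "cont2 T q" "\<And>t x. t \<in> {0..T} \<Longrightarrow> x \<in> {0..1} \<Longrightarrow> \<bar>q t x\<bar> \<le> 1"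
    and q': "cont2 T q'" "\<And>t x. t \<in> {0..T} \<Longrightarrow> x \<in> {0..1} \<Longrightarrow> \<bar>q' t x\<bar> \<le> 1"
    and d: "\<And>t x. t \<in> {0..T} \<Longrightarrow> x \<in> {0..1} \<Longrightarrow> \<bar>q t x - q' t x\<bar> \<le> d"
begin

lemma mean_diff: "t \<in> {0..T} \<Longrightarrow> x \<in> {0..1} \<Longrightarrow> \<bar>mean q t x - mean q' t x\<bar> \<le> d"
  unfolding mean_def
  by (rule integral01_diff_bound[OF cont_mean_arg[OF q(1)] cont_mean_arg[OF q'(1)] d[OF _ scaled01]])

lemma hfun_diff: "t \<in> {0..T} \<Longrightarrow> x \<in> {0..1} \<Longrightarrow> \<bar>hfun q t x - hfun q' t x\<bar> \<le> 3 * d"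
  unfolding hfun_def
  using expm1_quot_diff[of x "mean q t x" "mean q' t x"] mean_bound[OF q] mean_bound[OF q'] mean_diff[of t x]
  by fastforce

lemma Afun_diff:
  assumes "t \<in> {0..T}" "x \<in> {0..1}" shows "\<bar>Afun q t x - Afun q' t x\<bar> \<le> 3 * d"
proof -
  have i: "\<bar>integral {0..1} (\<lambda>s. hfun q t (x + (1 - x) * s)) - integral {0..1} (\<lambda>s. hfun q' t (x + (1 - x) * s))\<bar> \<le> 3 * d"
    by (rule integral01_diff_bound[OF cont_A_arg[OF q(1) assms] cont_A_arg[OF q'(1) assms]
          hfun_diff[OF assms(1) convex01[OF assms(2)]]])
  have "\<bar>1 - x\<bar> * \<bar>integral {0..1} (\<lambda>s. hfun q t (x + (1 - x) * s)) - integral {0..1} (\<lambda>s. hfun q' t (x + (1 - x) * s))\<bar> \<le> 1 * (3 * d)"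
    using assms(2) i by (intro mult_mono) auto
  then show ?thesis by (simp add: Afun_def abs_mult flip: right_diff_distrib)
qed

lemma Vfun_diff:
  assumes "t \<in> {0..T}" "x \<in> {0..1}" shows "\<bar>Vfun q t x - Vfun q' t x\<bar> \<le> 324 * d"
proof -
  have "\<bar>x * mean q t x - x * mean q' t x\<bar> \<le> 1 * d"
    unfolding abs_mult right_diff_distrib[symmetric] using mean_diff[OF assms] assms(2) by (intro mult_mono) auto
  then have "\<bar>(Afun q t x - x * mean q t x) - (Afun q' t x - x * mean q' t x)\<bar> \<le> 4 * d"
    using Afun_diff[OF assms] by linarith
  then have "exp 4 * \<bar>(Afun q t x - x * mean q t x) - (Afun q' t x - x * mean q' t x)\<bar> \<le> 81 * (4 * d)"
    using exp4[OF q] by (intro mult_mono) auto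
  then show ?thesis
    using exp_diff_le[OF exponent_bound[OF q assms] exponent_bound[OF q' assms]] unfolding Vfun_def by linarith
qed

lemma Gfun_diff:
  assumes "t \<in> {0..T}" "x \<in> {0..1}" shows "\<bar>Gfun q t x - Gfun q' t x\<bar> \<le> 1944 * K * d"
proof -
  have d0: "d \<ge> 0" using d[OF assms] by linarith
  have "\<bar>r1 x * (Vfun q t x - Vfun q' t x)\<bar> \<le> K * (324 * d)"
    unfolding abs_mult using r1_bound[OF assms(2)] Vfun_diff[OF assms] K_nonneg by (intro mult_mono) auto
  moreover have "\<bar>r x * (Vfun q t x - Vfun q' t x) * (q t x + hfun q t x)\<bar> \<le> K * (324 * d) * 4"
    unfolding abs_mult using r_bound[OF assms(2)] Vfun_diff[OF assms] q(2)[OF assms] hfun_bound[OF q assms] K_nonneg d0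
    by (intro mult_mono) auto
  moreover have "\<bar>r x * Vfun q' t x * ((q t x - q' t x) + (hfun q t x - hfun q' t x))\<bar> \<le> K * 81 * (4 * d)"
    unfolding abs_mult using r_bound[OF assms(2)] Vfun_bound[OF q' assms] d[OF assms] hfun_diff[OF assms] K_nonneg d0
    by (intro mult_mono) auto
  \<comment> \<open>Telescoping over the factors; the three terms contribute 324, 324 * 4 and 81 *
    4, in total 1944.\<close>
  moreover have "Gfun q t x - Gfun q' t x = r1 x * (Vfun q t x - Vfun q' t x)
      - r x * (Vfun q t x - Vfun q' t x) * (q t x + hfun q t x)
      - r x * Vfun q' t x * ((q t x - q' t x) + (hfun q t x - hfun q' t x))"
    unfolding Gfun_def by (simp add: algebra_simps)
  ultimately have "\<bar>Gfun q t x - Gfun q' t x\<bar> \<le> K * (324 * d) + K * (324 * d) * 4 + K * 81 * (4 * d)"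
    by linarith
  also have "\<dots> = 1944 * K * d" by simp
  finally show ?thesis .
qed

lemma picard_diff:
  assumes "t \<in> {0..T}" "x \<in> {0..1}" shows "\<bar>picard q t x - picard q' t x\<bar> \<le> 1 / 2 * d"
proof -
  have d0: "d \<ge> 0" using d[OF assms] by linarith
  have t: "\<bar>t\<bar> \<le> T" using assms by auto
  let ?I = "\<lambda>q. integral {0..1} (\<lambda>s. (1 - s) * Gfun q (t * s) x)"
  have I: "\<bar>?I q - ?I q'\<bar> \<le> 1 * (1944 * K * d)"
  proof (rule integral01_diff_bound[OF cont_picard_arg[OF q(1) assms] cont_picard_arg[OF q'(1) assms]])
    fix s :: real assume "s \<in> {0..1}"
    then show "\<bar>(1 - s) * Gfun q (t * s) x - (1 - s) * Gfun q' (t * s) x\<bar> \<le> 1 * (1944 * K * d)"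
      unfolding abs_mult right_diff_distrib[symmetric]
      using Gfun_diff[OF time_scaled[OF assms(1)] assms(2)] by (intro mult_mono) auto
  qed
  have "picard q t x - picard q' t x = t * (t * (?I q - ?I q'))"
    unfolding picard_def by (simp add: algebra_simps)
  then have "\<bar>picard q t x - picard q' t x\<bar> \<le> T * (T * (1 * (1944 * K * d)))"
    unfolding abs_mult using t I T_pos K_nonneg d0 by (simp add: abs_mult) (intro mult_mono, auto)
  also have "\<dots> = 1944 * (T * (T * K)) * d" by simp
  also have "\<dots> \<le> 1944 * (1 / 1000 * (1 / 1000)) * d"
    using T_le TK_le T_pos K_nonneg d0 by (intro mult_right_mono mult_left_mono mult_mono) auto
  also have "\<dots> \<le> 1 / 2 * d" using d0 by (intro mult_right_mono) auto
  finally show ?thesis .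
qed

end

text \<open>The fixed point is sought among bounded continuous functions on the whole plane.
  Evaluating the Picard map at the clamped point keeps the image in that space and leaves it
  unchanged on the rectangle.\<close>

definition retract :: "real \<times> real \<Rightarrow> real \<times> real" where
  "retract p = (max 0 (min T (fst p)), max 0 (min 1 (snd p)))"

lemma retract_in: "retract p \<in> {0..T} \<times> {0..1}"
  using T_pos by (auto simp: retract_def)

lemma retract_id: "t \<in> {0..T} \<Longrightarrow> x \<in> {0..1} \<Longrightarrow> retract (t, x) = (t, x)"
  by (auto simp: retract_def)

lemma continuous_retract: "continuous_on S retract"
  unfolding retract_def by (intro continuous_intros)

lemma picard_fixed_point:
  obtains q where "cont2 T q" "\<And>t x. t \<in> {0..T} \<Longrightarrow> x \<in> {0..1} \<Longrightarrow> \<bar>q t x\<bar> \<le> 1"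
    "\<And>t x. t \<in> {0..T} \<Longrightarrow> x \<in> {0..1} \<Longrightarrow> q t x = picard q t x"
proof -
  let ?q = "\<lambda>(f :: (real \<times> real) \<Rightarrow>\<^sub>C real) t x. apply_bcontfun f (t, x)"
  let ?F = "\<lambda>f p. picard (?q f) (fst (retract p)) (snd (retract p))"
  have c: "cont2 T (?q f)" for f
    unfolding cont2_def by simp
  have b: "\<bar>?q f t x\<bar> \<le> 1" if "f \<in> cball 0 1" for f t x
    using norm_bounded[of f "(t, x)"] that by (simp add: dist_norm)
  have F: "?F f \<in> bcontfun" "\<And>p. \<bar>?F f p\<bar> \<le> 1" if f: "f \<in> cball 0 1" for f
  proof -
    show bd: "\<bar>?F f p\<bar> \<le> 1" for p
      by (rule picard_bound[OF c b[OF f]]) (use retract_in[of p] in \<open>auto simp: mem_Times_iff\<close>)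
    have "continuous_on UNIV (?F f)"
      by (rule cont2_compose[OF cont2_picard[OF c]])
         (use retract_in in \<open>auto simp: mem_Times_iff intro!: continuous_intros continuous_retract\<close>)
    then show "?F f \<in> bcontfun" by (rule bcontfun_normI[of _ 1]) (use bd in simp)
  qed
  define \<Phi> where "\<Phi> f = Bcontfun (?F f)" for f
  have ap: "apply_bcontfun (\<Phi> f) = ?F f" if "f \<in> cball 0 1" for f
    unfolding \<Phi>_def by (rule Bcontfun_inverse[OF F(1)[OF that]])
  have "\<exists>!f. f \<in> cball 0 1 \<and> \<Phi> f = f"
  proof (rule Banach_fix[where c = "1/2"])
    show "complete (cball 0 1 :: ((real \<times> real) \<Rightarrow>\<^sub>C real) set)"
      by (simp add: complete_eq_closed)
    show "\<Phi> ` cball 0 1 \<subseteq> cball 0 1"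
    proof
      fix g assume "g \<in> \<Phi> ` cball 0 1"
      then obtain f where f: "f \<in> cball 0 1" "g = \<Phi> f" by auto
      have "norm (\<Phi> f) \<le> 1"
        by (rule norm_bound) (use F(2)[OF f(1)] ap[OF f(1)] in simp)
      then show "g \<in> cball 0 1" using f(2) by (simp add: dist_norm)
    qed
    fix f g :: "(real \<times> real) \<Rightarrow>\<^sub>C real" assume f: "f \<in> cball 0 1" and g: "g \<in> cball 0 1"
    show "dist (\<Phi> f) (\<Phi> g) \<le> 1 / 2 * dist f g"
    proof (rule dist_bound)
      fix p
      have "\<bar>?F f p - ?F g p\<bar> \<le> 1 / 2 * dist f g"
      proof (rule picard_diff[OF c b[OF f] c b[OF g]])
        show "\<bar>?q f t x - ?q g t x\<bar> \<le> dist f g" for t x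
          using dist_bounded[of f "(t, x)" g] by (simp add: dist_real_def)
      qed (use retract_in[of p] in \<open>auto simp: mem_Times_iff\<close>)
      then show "dist (apply_bcontfun (\<Phi> f) p) (apply_bcontfun (\<Phi> g) p) \<le> 1 / 2 * dist f g"
        by (simp only: ap[OF f] ap[OF g] dist_real_def)
    qed
  qed auto
  then obtain f where f: "f \<in> cball 0 1" "\<Phi> f = f" by blast
  show ?thesis
  proof (rule that[of "?q f"])
    fix t x assume tx: "t \<in> {0..T}" "x \<in> {0..1::real}"
    have "apply_bcontfun (\<Phi> f) (t, x) = ?F f (t, x)" by (simp add: ap[OF f(1)])
    then show "?q f t x = picard (?q f) t x" using f(2) tx by (simp add: retract_id)
    show "\<bar>?q f t x\<bar> \<le> 1" by (rule b[OF f(1)])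
  qed (rule c)
qed

end

section \<open>Differentiation on the closed rectangle\<close>

lemma has_real_derivative_transform:
  fixes f g :: "real \<Rightarrow> real"
  assumes "(f has_real_derivative D) (at x within S)" "x \<in> S" "\<And>y. y \<in> S \<Longrightarrow> g y = f y"
  shows "(g has_real_derivative D) (at x within S)"
proof -
  have "eventually (\<lambda>y. g y = f y) (at x within S)"
    unfolding eventually_at_filter by (rule always_eventually) (use assms(3) in simp)
  then show ?thesis
    using has_field_derivative_cong_eventually[of g f x S D] assms by simp
qed

lemma integral_tail:
  assumes "cont2 T f" "t \<in> {0..T}" "x \<in> {0..1}"
  shows "((\<lambda>x. integral {x..1} (f t)) has_real_derivative - f t x) (at x within {0..1})"
proof -
  have c: "continuous_on {0..1} (f t)" by (rule cont2_x[OF assms(1,2)])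
  have "((\<lambda>x. integral {0..1} (f t) - integral {0..x} (f t)) has_real_derivative 0 - f t x) (at x within {0..1})"
    by (intro DERIV_diff DERIV_const integral_has_real_derivative[OF c assms(3)])
  then have "((\<lambda>x. integral {0..1} (f t) - integral {0..x} (f t)) has_real_derivative - f t x) (at x within {0..1})"
    by simp
  then show ?thesis
  proof (rule has_real_derivative_transform[OF _ assms(3)])
    fix y :: real assume y: "y \<in> {0..1}"
    have "integral {0..y} (f t) + integral {y..1} (f t) = integral {0..1} (f t)"
      by (rule Henstock_Kurzweil_Integration.integral_combine) (use y c in \<open>auto intro: integrable_continuous_real\<close>)
    then show "integral {y..1} (f t) = integral {0..1} (f t) - integral {0..y} (f t)" by simp
  qed
qed

lemma cont2_integral_tail:
  assumes "cont2 T f" shows "cont2 T (\<lambda>t x. integral {x..1} (f t))"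
proof -
  have "cont2 T (\<lambda>t x. (1 - x) * integral {0..1} (\<lambda>s. f t (x + (1 - x) * s)))"
    by (intro cont2_mult cont2_diff cont2_const cont2_snd, rule cont2_integral, rule cont2_compose[OF assms])
       (use convex01 in \<open>auto intro!: continuous_intros\<close>)
  then show ?thesis
  proof (rule cont2_cong)
    fix t x assume "t \<in> {0..T}" "x \<in> {0..1::real}"
    then show "(1 - x) * integral {0..1} (\<lambda>s. f t (x + (1 - x) * s)) = integral {x..1} (f t)"
      by (intro integral_affine01 continuous_on_subset[OF cont2_x[OF assms]]) auto
  qed
qed

lemma segment01:
  fixes a b s :: real
  assumes "a \<in> {0..1}" "b \<in> {0..1}" "s \<in> {0..1}"
  shows "a + (b - a) * s \<in> {0..1}"
proof -
  have 1: "(1 - s) * a + s * b \<le> 1"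
    using convex_bound_le[of a 1 b "1 - s" s] assms by simp
  have 2: "0 \<le> (1 - s) * a + s * b" using assms by simp
  have 3: "a + (b - a) * s = (1 - s) * a + s * b" by (simp add: algebra_simps)
  show ?thesis unfolding 3 atLeastAtMost_iff using 1 2 by blast
qed

text \<open>The affine substitution treats both orders of a and b at once, so that a difference of
  flow positions of unknown sign can be inserted.\<close>

lemma ftc_segment:
  fixes f :: "real \<Rightarrow> real"
  assumes "\<And>x. x \<in> {0..1} \<Longrightarrow> (f has_real_derivative f' x) (at x within {0..1})"
    "continuous_on {0..1} f'" "a \<in> {0..1}" "b \<in> {0..1}"
  shows "f b - f a = (b - a) * integral {0..1} (\<lambda>s. f' (a + (b - a) * s))"
proof -
  note img = segment01[OF assms(3,4)]
  have "((\<lambda>s. f' (a + (b - a) * s) * (b - a)) has_integral f (a + (b - a) * 1) - f (a + (b - a) * 0)) {0..1}"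
  proof (rule fundamental_theorem_of_calculus[where f="\<lambda>s. f (a + (b - a) * s)" and a=0 and b=1])
    fix s :: real assume s: "s \<in> {0..1}"
    have "(f has_real_derivative f' (a + (b - a) * s))
        (at (a + (b - a) * s) within (\<lambda>s. a + (b - a) * s) ` {0..1})"
      by (rule DERIV_subset[OF assms(1)[OF img[OF s]] image_subsetI]) (rule img)
    moreover have "((\<lambda>s. a + (b - a) * s) has_real_derivative b - a) (at s within {0..1})"
      by (auto intro!: derivative_eq_intros)
    ultimately have "((\<lambda>s. f (a + (b - a) * s)) has_real_derivative f' (a + (b - a) * s) * (b - a)) (at s within {0..1})"
      using DERIV_image_chain[of f _ "\<lambda>s. a + (b - a) * s" s "{0..1}"] by (simp add: o_def)
    then show "((\<lambda>s. f (a + (b - a) * s)) has_vector_derivative f' (a + (b - a) * s) * (b - a)) (at s within {0..1})"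
      by (simp add: has_real_derivative_iff_has_vector_derivative)
  qed simp
  then have "integral {0..1} (\<lambda>s. f' (a + (b - a) * s) * (b - a)) = f (a + (b - a) * 1) - f (a + (b - a) * 0)"
    by (rule integral_unique)
  then show ?thesis by (simp add: mult.commute)
qed

lemma segment_mean_continuous:
  assumes "cont2 T f" "continuous_on {0..T} y" "\<And>s. s \<in> {0..T} \<Longrightarrow> y s \<in> {0..1}" "b \<in> {0..1}"
  shows "continuous_on {0..T} (\<lambda>s. integral {0..1} (\<lambda>u. f s (b + (y s - b) * u)))"
proof -
  have "continuous_on ({0..T} \<times> cbox 0 1) (\<lambda>(s, u). f s (b + (y s - b) * u))"
    unfolding split_beta'
    by (rule cont2_compose[OF assms(1)])
       (use segment01 assms in \<open>auto intro!: continuous_intros continuous_on_compose2[OF assms(2)]\<close>)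
  from integral_continuous_on_param[OF this] show ?thesis by simp
qed

text \<open>
  The increment in the space variable is written through its mean slope, so that only one-sided
  derivatives on the closed rectangle are needed.
\<close>

lemma has_derivative_along_path:
  assumes f: "cont2 T f'" "\<And>s x. s \<in> {0..T} \<Longrightarrow> x \<in> {0..1} \<Longrightarrow> (f s has_real_derivative f' s x) (at x within {0..1})"
    and ft: "((\<lambda>s. f s (y t)) has_real_derivative ft) (at t within {0..T})"
    and y: "continuous_on {0..T} y" "\<And>s. s \<in> {0..T} \<Longrightarrow> y s \<in> {0..1}"
    and y': "(y has_real_derivative y') (at t within {0..T})" and t: "t \<in> {0..T}"
  shows "((\<lambda>s. f s (y s)) has_real_derivative ft + y' * f' t (y t)) (at t within {0..T})"
proof -
  define M where "M s = integral {0..1} (\<lambda>u. f' s (y t + (y s - y t) * u))" for s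
  have M: "(M \<longlongrightarrow> M t) (at t within {0..T})"
    using segment_mean_continuous[OF f(1) y y(2)[OF t]] t
    unfolding M_def[symmetric] continuous_on_def by blast
  have Mt: "M t = f' t (y t)" by (simp add: M_def)
  have "((\<lambda>s. (f s (y t) - f t (y t)) / (s - t) + ((y s - y t) / (s - t)) * M s) \<longlongrightarrow> ft + y' * M t) (at t within {0..T})"
    using ft y' unfolding has_field_derivative_iff by (intro tendsto_add tendsto_mult M)
  moreover have "eventually (\<lambda>s. (f s (y t) - f t (y t)) / (s - t) + ((y s - y t) / (s - t)) * M s
      = (f s (y s) - f t (y t)) / (s - t)) (at t within {0..T})"
    unfolding eventually_at_filter
  proof (rule always_eventually, intro allI impI)
    fix s assume s: "s \<noteq> t" "s \<in> {0..T}"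
    have "f s (y s) - f s (y t) = (y s - y t) * M s"
      unfolding M_def
      by (rule ftc_segment[OF f(2)[OF s(2)] cont2_x[OF f(1) s(2)] y(2)[OF t] y(2)[OF s(2)]])
    then show "(f s (y t) - f t (y t)) / (s - t) + ((y s - y t) / (s - t)) * M s = (f s (y s) - f t (y t)) / (s - t)"
      by (simp add: add_divide_distrib[symmetric])
  qed
  ultimately show ?thesis unfolding has_field_derivative_iff Mt by (rule Lim_transform_eventually)
qed

lemma time_int_x_deriv:
  assumes "cont2 T f" "cont2 T f'" "t \<in> {0..T}" "x \<in> {0..1}"
    and "\<And>s x. s \<in> {0..T} \<Longrightarrow> x \<in> {0..1} \<Longrightarrow> (f s has_real_derivative f' s x) (at x within {0..1})"
  shows "(time_int f t has_real_derivative time_int f' t x) (at x within {0..1})"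
proof -
  have "((\<lambda>x. integral (cbox 0 t) (\<lambda>s. f s x)) has_field_derivative integral (cbox 0 t) (\<lambda>s. f' s x)) (at x within {0..1})"
  proof (rule leibniz_rule_field_derivative[OF _ _ _ assms(4)])
    show "continuous_on ({0..1} \<times> cbox 0 t) (\<lambda>(x, s). f' s x)"
      unfolding split_beta' by (rule cont2_compose[OF assms(2)]) (use assms(3) in \<open>auto intro!: continuous_intros\<close>)
    show "(\<lambda>s. f s x) integrable_on cbox 0 t" if "x \<in> {0..1}" for x
      using continuous_on_subset[OF cont2_t[OF assms(1) that], of "{0..t}"] assms(3)
      by (auto intro: integrable_continuous_real)
  qed (use assms in auto)
  then show ?thesis by (simp add: time_int_def[abs_def])
qed

lemma time_int_integrable: "cont2 T f \<Longrightarrow> t \<in> {0..T} \<Longrightarrow> x \<in> {0..1} \<Longrightarrow> (\<lambda>s. f s x) integrable_on {0..t}"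
  using continuous_on_subset[OF cont2_t, of T f x "{0..t}"] by (auto intro: integrable_continuous_real)

lemma time_int_linear:
  assumes "cont2 T f" "cont2 T g" "t \<in> {0..T}" "x \<in> {0..1}"
  shows "time_int (\<lambda>s x. a x * f s x + b x * g s x) t x = a x * time_int f t x + b x * time_int g t x"
  unfolding time_int_def
  using time_int_integrable[OF assms(1,3,4)] time_int_integrable[OF assms(2,3,4)]
  by (subst Henstock_Kurzweil_Integration.integral_add) (auto intro: integrable_on_mult_right)

lemma time_int_cong:
  assumes "t \<in> {0..T}" "\<And>s. s \<in> {0..T} \<Longrightarrow> f s x = g s x" shows "time_int f t x = time_int g t x"
  unfolding time_int_def by (rule integral_cong) (use assms in auto)

text \<open>Integration by parts: with F the time integral of f, the function s F(s) minus the
  integral of s f(s) is a primitive of F.\<close>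

lemma double_time_int:
  assumes f: "cont2 T f" and t: "t \<in> {0..T}" and x: "x \<in> {0..1}"
  shows "time_int (time_int f) t x = t * (t * integral {0..1} (\<lambda>s. (1 - s) * f (t * s) x))"
proof -
  let ?g = "\<lambda>s x. s * f s x"
  have g: "cont2 T ?g" by (intro cont2_mult cont2_fst f)
  have "((\<lambda>s. time_int f s x) has_integral (t * time_int f t x - time_int ?g t x) - (0 * time_int f 0 x - time_int ?g 0 x)) {0..t}"
  proof (rule fundamental_theorem_of_calculus[where f="\<lambda>s. s * time_int f s x - time_int ?g s x" and a=0 and b=t])
    fix s assume s: "s \<in> {0..t}"
    then have s': "s \<in> {0..T}" using t by auto
    have "((\<lambda>s. s * time_int f s x - time_int ?g s x) has_real_derivative time_int f s x) (at s within {0..T})"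
      by (auto intro!: derivative_eq_intros time_int_deriv[OF f s' x] time_int_deriv[OF g s' x])
    then have "((\<lambda>s. s * time_int f s x - time_int ?g s x) has_real_derivative time_int f s x) (at s within {0..t})"
      by (rule DERIV_subset) (use t in auto)
    then show "((\<lambda>s. s * time_int f s x - time_int ?g s x) has_vector_derivative time_int f s x) (at s within {0..t})"
      by (simp add: has_real_derivative_iff_has_vector_derivative)
  qed (use t in simp)
  then have "time_int (time_int f) t x = t * time_int f t x - time_int ?g t x"
    by (subst time_int_def) (simp add: integral_unique)
  also have "\<dots> = t * (t * integral {0..1} (\<lambda>s. f (t * s) x)) - t * integral {0..1} (\<lambda>s. (t * s) * f (t * s) x)"
    unfolding time_int_affine[OF f t x] time_int_affine[OF g t x] ..
  also have "integral {0..1} (\<lambda>s. (t * s) * f (t * s) x) = t * integral {0..1} (\<lambda>s. s * f (t * s) x)"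
    by (simp only: mult.assoc Henstock_Kurzweil_Integration.integral_mult_right)
  also have "t * (t * integral {0..1} (\<lambda>s. f (t * s) x)) - t * (t * integral {0..1} (\<lambda>s. s * f (t * s) x)) =
      t * (t * (integral {0..1} (\<lambda>s. f (t * s) x) - integral {0..1} (\<lambda>s. s * f (t * s) x)))"
    by (simp add: algebra_simps)
  also have "integral {0..1} (\<lambda>s. f (t * s) x) - integral {0..1} (\<lambda>s. s * f (t * s) x)
      = integral {0..1} (\<lambda>s. f (t * s) x - s * f (t * s) x)"
  proof (rule Henstock_Kurzweil_Integration.integral_diff[symmetric])
    have c: "continuous_on {0..1} (\<lambda>s. f (t * s) x)"
      by (rule cont2_compose[OF f]) (use t x mult_left_le[of _ t] in \<open>auto intro!: continuous_intros intro: order_trans\<close>)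
    then show "(\<lambda>s. f (t * s) x) integrable_on {0..1}" "(\<lambda>s. s * f (t * s) x) integrable_on {0..1}"
      by (auto intro!: integrable_continuous_real continuous_intros)
  qed
  finally show ?thesis by (simp add: left_diff_distrib)
qed

lemma has_real_derivative_unique_prim:
  assumes "\<And>x. x \<in> {0..1} \<Longrightarrow> (f has_real_derivative g x) (at x within {0..1})"
    "\<And>x. x \<in> {0..1} \<Longrightarrow> (f' has_real_derivative g x) (at x within {0..1})"
    "continuous_on {0..1} g" "f 0 = f' 0" "x \<in> {0..1}"
  shows "f x = f' x"
  using prim_diff[OF prim_of_deriv[of 0 1 f g], of 0 x] prim_diff[OF prim_of_deriv[of 0 1 f' g], of 0 x] assms
  by auto

text \<open>
  \<open>W = \<partial>\<^sub>tC\<close> is the vorticity along the flow, \<open>Wq\<close> its quotient by \<open>x\<close> (finite at \<open>0\<close>), \<open>Om\<close> is \<open>\<Omega>\<close> along the flow,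
  and \<open>V = 1 / \<partial>\<^sub>xX\<close>.
\<close>

locale lagrangian_solution = lagrangian_data +
  fixes q :: "real \<Rightarrow> real \<Rightarrow> real"
  assumes q_cont: "cont2 T q"
    and q_bound: "\<And>t x. t \<in> {0..T} \<Longrightarrow> x \<in> {0..1} \<Longrightarrow> \<bar>q t x\<bar> \<le> 1"
    and q_fixed: "\<And>t x. t \<in> {0..T} \<Longrightarrow> x \<in> {0..1} \<Longrightarrow> q t x = picard q t x"
begin

definition C where "C t x = x * mean q t x"
definition h where "h = hfun q"
definition A where "A = Afun q"
definition V where "V = Vfun q"
definition Vx where "Vx t x = V t x * (- h t x - q t x)"
definition W where "W t x = w x + r x * time_int V t x"
definition Wx where "Wx t x = w1 x + (r1 x * time_int V t x + r x * time_int Vx t x)"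
definition Wq where "Wq t x = mean (\<lambda>_. w1) 0 x + mean (\<lambda>_. r1) 0 x * time_int V t x"
definition Om where "Om t x = integral {x..1} (\<lambda>z. exp (C t z) * Wq t z)"
definition X where "X t x = x * exp (- A t x)"
definition Xx where "Xx t x = exp (C t x - A t x)"

section \<open>Identities satisfied by the fixed point\<close>

lemma mean_integral:
  assumes "cont2 T f" "t \<in> {0..T}" "x \<in> {0..1}" shows "x * mean f t x = integral {0..x} (f t)"
  unfolding mean_def
  by (rule integral_affine_from_0) (use assms continuous_on_subset[OF cont2_x[OF assms(1,2)]] in auto)

lemma cont2_C: "cont2 T C" and cont2_h: "cont2 T h" and cont2_A: "cont2 T A" and cont2_V: "cont2 T V"
  unfolding C_def[abs_def] h_def A_def V_def
  by (intro cont2_mult cont2_snd cont2_mean cont2_hfun cont2_Afun cont2_Vfun q_cont)+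

lemma cont2_Vx: "cont2 T Vx"
  unfolding Vx_def[abs_def] by (intro cont2_mult cont2_diff cont2_minus cont2_V cont2_h q_cont)

lemma cont2_W: "cont2 T W"
  unfolding W_def[abs_def] by (intro cont2_add cont2_mult cont2_of_x w_cont r_cont cont2_time_int cont2_V)

lemma cont2_Wx: "cont2 T Wx"
  unfolding Wx_def[abs_def]
  by (intro cont2_add cont2_mult cont2_of_x w1_cont r1_cont r_cont cont2_time_int cont2_V cont2_Vx)

lemma T0: "0 \<in> {0..T}" using T_pos by simp

lemma mean_x_cont: "continuous_on {0..1} f \<Longrightarrow> cont2 T (\<lambda>t x. mean (\<lambda>_. f) 0 x)"
  using cont2_of_x[OF cont2_x[OF cont2_mean[OF cont2_of_x] T0]] .

lemma cont2_Wq: "cont2 T Wq"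
  unfolding Wq_def[abs_def]
  by (intro cont2_add cont2_mult mean_x_cont w1_cont r1_cont cont2_time_int cont2_V)

lemma w_deriv: "x \<in> {0..1} \<Longrightarrow> (w has_real_derivative w1 x) (at x within {0..1})"
  and r_deriv: "x \<in> {0..1} \<Longrightarrow> (r has_real_derivative r1 x) (at x within {0..1})"
  using prim_deriv[OF w_prim w1_cont] prim_deriv[OF r_prim r1_cont] by auto

lemma C_deriv:
  assumes "t \<in> {0..T}" "x \<in> {0..1}" shows "(C t has_real_derivative q t x) (at x within {0..1})"
proof -
  have "((\<lambda>x. integral {0..x} (q t)) has_real_derivative q t x) (at x within {0..1})"
    by (rule integral_has_real_derivative[OF cont2_x[OF q_cont assms(1)] assms(2)])
  then show ?thesis
    by (rule has_real_derivative_transform[OF _ assms(2)])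
       (simp_all add: C_def mean_integral[OF q_cont assms(1)])
qed

lemma A_eq:
  assumes "t \<in> {0..T}" "x \<in> {0..1}" shows "A t x = integral {x..1} (h t)"
  using integral_affine01[of x 1 "h t"] continuous_on_subset[OF cont2_x[OF cont2_h assms(1)], of "{x..1}"] assms(2)
  by (auto simp: A_def Afun_def h_def)

lemma A_deriv:
  assumes "t \<in> {0..T}" "x \<in> {0..1}" shows "(A t has_real_derivative - h t x) (at x within {0..1})"
  by (rule has_real_derivative_transform[OF integral_tail[OF cont2_h assms] assms(2)]) (rule A_eq[OF assms(1)])

lemma A_1: "A t 1 = 0"
  by (simp add: A_def Afun_def)

lemma V_eq: "V t x = exp (A t x - C t x)"
  by (simp add: V_def Vfun_def A_def C_def)

lemma V_deriv:
  assumes "t \<in> {0..T}" "x \<in> {0..1}" shows "(V t has_real_derivative Vx t x) (at x within {0..1})"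
  unfolding V_eq[abs_def] Vx_def V_eq
  by (auto intro!: derivative_eq_intros A_deriv[OF assms] C_deriv[OF assms])

lemma q_eq:
  assumes t: "t \<in> {0..T}" and x: "x \<in> {0..1}"
  shows "q t x = t * w1 x + (r1 x * time_int (time_int V) t x + r x * time_int (time_int Vx) t x)"
proof -
  have G: "Gfun q = (\<lambda>t x. r1 x * V t x + r x * Vx t x)"
    by (intro ext) (simp add: Gfun_def Vx_def V_def h_def algebra_simps)
  have "q t x = t * w1 x + t * (t * integral {0..1} (\<lambda>s. (1 - s) * Gfun q (t * s) x))"
    using q_fixed[OF t x] by (simp add: picard_def)
  also have "\<dots> = t * w1 x + time_int (time_int (Gfun q)) t x"
    using double_time_int[OF cont2_Gfun[OF q_cont] t x] by simp
  also have "time_int (time_int (Gfun q)) t x = time_int (\<lambda>s x. r1 x * time_int V s x + r x * time_int Vx s x) t x"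
    unfolding G by (rule time_int_cong[OF t]) (rule time_int_linear[OF cont2_V cont2_Vx _ x])
  also have "\<dots> = r1 x * time_int (time_int V) t x + r x * time_int (time_int Vx) t x"
    by (rule time_int_linear[OF cont2_time_int[OF cont2_V] cont2_time_int[OF cont2_Vx] t x])
  finally show ?thesis .
qed

text \<open>Both sides have space derivative q and vanish at 0. This recovers the equation for C
  from the one for its derivative.\<close>

lemma C_eq:
  assumes t: "t \<in> {0..T}" and x: "x \<in> {0..1}"
  shows "C t x = t * w x + r x * time_int (time_int V) t x"
proof (rule has_real_derivative_unique_prim[where g="q t" and f="C t"])
  fix x :: real assume x: "x \<in> {0..1}"
  show "(C t has_real_derivative q t x) (at x within {0..1})" by (rule C_deriv[OF t x])
  have V1: "(time_int V t has_real_derivative time_int Vx t x) (at x within {0..1})" if "t \<in> {0..T}" "x \<in> {0..1}" for t x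
    by (rule time_int_x_deriv[OF cont2_V cont2_Vx that V_deriv])
  have "(time_int (time_int V) t has_real_derivative time_int (time_int Vx) t x) (at x within {0..1})"
    by (rule time_int_x_deriv[OF cont2_time_int[OF cont2_V] cont2_time_int[OF cont2_Vx] t x V1])
  then show "((\<lambda>x. t * w x + r x * time_int (time_int V) t x) has_real_derivative q t x) (at x within {0..1})"
    unfolding q_eq[OF t x] by (auto intro!: derivative_eq_intros w_deriv[OF x] r_deriv[OF x])
next
  show "continuous_on {0..1} (q t)" by (rule cont2_x[OF q_cont t])
qed (use x w_0 r_0 in \<open>auto simp: C_def\<close>)

lemma W_x_deriv:
  assumes "t \<in> {0..T}" "x \<in> {0..1}" shows "(W t has_real_derivative Wx t x) (at x within {0..1})"
  unfolding W_def[abs_def] Wx_def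
  by (auto intro!: derivative_eq_intros w_deriv[OF assms(2)] r_deriv[OF assms(2)]
      time_int_x_deriv[OF cont2_V cont2_Vx assms V_deriv])

lemma W_t_deriv:
  assumes "t \<in> {0..T}" "x \<in> {0..1}" shows "((\<lambda>t. W t x) has_real_derivative r x * V t x) (at t within {0..T})"
  unfolding W_def by (auto intro!: derivative_eq_intros time_int_deriv[OF cont2_V assms])

lemma W_factor: assumes "x \<in> {0..1}" shows "W t x = x * Wq t x"
proof -
  have "w x = x * mean (\<lambda>_. w1) 0 x" "r x = x * mean (\<lambda>_. r1) 0 x"
    using mean_integral[OF cont2_of_x[OF w1_cont] T0 assms] mean_integral[OF cont2_of_x[OF r1_cont] T0 assms]
      prim_diff[OF w_prim, of 0 x] prim_diff[OF r_prim, of 0 x] w_0 r_0 assms by auto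
  then show ?thesis by (simp add: W_def Wq_def algebra_simps)
qed

text \<open>\<open>C_eq\<close> divided by x. At x = 0 the averages are point values and r 0 = 0
  removes the remaining term of \<open>q_eq\<close>.\<close>

lemma mean_q_eq:
  assumes t: "t \<in> {0..T}" and x: "x \<in> {0..1}"
  shows "mean q t x = t * mean (\<lambda>_. w1) 0 x + mean (\<lambda>_. r1) 0 x * time_int (time_int V) t x"
proof (cases "x = 0")
  case True
  have "mean q t 0 = q t 0" "mean (\<lambda>_. w1) 0 0 = w1 0" "mean (\<lambda>_. r1) 0 0 = r1 0" by (simp_all add: mean_def)
  then show ?thesis using True q_eq[OF t x] r_0 by simp
next
  case False
  have "w x = x * mean (\<lambda>_. w1) 0 x" "r x = x * mean (\<lambda>_. r1) 0 x"
    using mean_integral[OF cont2_of_x[OF w1_cont] T0 x] mean_integral[OF cont2_of_x[OF r1_cont] T0 x]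
      prim_diff[OF w_prim, of 0 x] prim_diff[OF r_prim, of 0 x] w_0 r_0 x by auto
  then have "x * mean q t x = x * (t * mean (\<lambda>_. w1) 0 x + mean (\<lambda>_. r1) 0 x * time_int (time_int V) t x)"
    using C_eq[OF t x] by (simp add: C_def algebra_simps)
  then show ?thesis using False by simp
qed

lemma mean_q_t_deriv:
  assumes t: "t \<in> {0..T}" and x: "x \<in> {0..1}"
  shows "((\<lambda>t. mean q t x) has_real_derivative Wq t x) (at t within {0..T})"
proof -
  have "((\<lambda>t. t * mean (\<lambda>_. w1) 0 x + mean (\<lambda>_. r1) 0 x * time_int (time_int V) t x) has_real_derivative Wq t x) (at t within {0..T})"
    unfolding Wq_def by (auto intro!: derivative_eq_intros time_int_deriv[OF cont2_time_int[OF cont2_V] assms])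
  then show ?thesis by (rule has_real_derivative_transform[OF _ t]) (use mean_q_eq[OF _ x] in auto)
qed

lemma h_t_deriv:
  assumes t: "t \<in> {0..T}" and x: "x \<in> {0..1}"
  shows "((\<lambda>t. h t x) has_real_derivative exp (C t x) * Wq t x) (at t within {0..T})"
proof (cases "x = 0")
  case True
  have "h t x = mean q t x" for t using True by (simp add: h_def hfun_def expm1_quot_def)
  then show ?thesis using mean_q_t_deriv[OF assms] True by (simp add: C_def)
next
  case False
  have "h t x = (exp (x * mean q t x) - 1) / x" for t
    using False mult_expm1_quot[of x "mean q t x"] by (simp add: h_def hfun_def nonzero_eq_divide_eq mult.commute)
  moreover have "((\<lambda>t. (exp (x * mean q t x) - 1) / x) has_real_derivative exp (C t x) * Wq t x) (at t within {0..T})"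
    unfolding C_def using False by (auto intro!: derivative_eq_intros mean_q_t_deriv[OF assms])
  ultimately show ?thesis by simp
qed

lemma cont2_Om_integrand: "cont2 T (\<lambda>t x. exp (C t x) * Wq t x)"
  by (intro cont2_mult cont2_exp cont2_C cont2_Wq)

text \<open>The identity A_t = \<Omega> along the flow: it makes X a solution of the flow equation
  of the velocity built from the vorticity.\<close>

lemma A_t_deriv:
  assumes t: "t \<in> {0..T}" and x: "x \<in> {0..1}"
  shows "((\<lambda>t. A t x) has_real_derivative Om t x) (at t within {0..T})"
proof -
  have "((\<lambda>t. integral (cbox x 1) (h t)) has_field_derivative integral (cbox x 1) (\<lambda>z. exp (C t z) * Wq t z)) (at t within {0..T})"
  proof (rule leibniz_rule_field_derivative[OF _ _ _ t])
    show "continuous_on ({0..T} \<times> cbox x 1) (\<lambda>(t, z). exp (C t z) * Wq t z)"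
      unfolding split_beta' by (rule cont2_compose[OF cont2_Om_integrand]) (use x in \<open>auto intro!: continuous_intros\<close>)
    show "h t integrable_on cbox x 1" if "t \<in> {0..T}" for t
      using continuous_on_subset[OF cont2_x[OF cont2_h that], of "{x..1}"] x by (auto intro: integrable_continuous_real)
  qed (use h_t_deriv x in auto)
  then have "((\<lambda>t. integral {x..1} (h t)) has_real_derivative Om t x) (at t within {0..T})" by (simp add: Om_def cbox_interval)
  then show ?thesis by (rule has_real_derivative_transform[OF _ t]) (use A_eq x in auto)
qed

lemma Om_x_deriv:
  assumes t: "t \<in> {0..T}" and x: "x \<in> {0..1}"
  shows "(Om t has_real_derivative - (exp (C t x) * Wq t x)) (at x within {0..1})"
  unfolding Om_def[abs_def] by (rule integral_tail[OF cont2_Om_integrand t x])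

lemma cont2_Om: "cont2 T Om"
  unfolding Om_def[abs_def] by (rule cont2_integral_tail[OF cont2_Om_integrand])

lemma Om_1: "Om t 1 = 0" by (simp add: Om_def)

subsection \<open>The flow\<close>

lemma X_x_deriv:
  assumes "t \<in> {0..T}" "x \<in> {0..1}" shows "(X t has_real_derivative Xx t x) (at x within {0..1})"
proof -
  \<comment> \<open>Turns e^(-A) (1 + x h) into e^(C-A).\<close>
  have e: "x * h t x = exp (C t x) - 1"
    using mult_expm1_quot[of x "mean q t x"] by (simp add: h_def hfun_def C_def)
  have "(X t has_real_derivative 1 * exp (- A t x) + (exp (- A t x) * - (- h t x)) * x) (at x within {0..1})"
    unfolding X_def[abs_def]
    by (rule DERIV_mult[OF DERIV_ident]) (auto intro!: derivative_eq_intros A_deriv[OF assms])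
  also have "1 * exp (- A t x) + (exp (- A t x) * - (- h t x)) * x = exp (- A t x) + (x * h t x) * exp (- A t x)"
    by simp
  also have "exp (- A t x) + (x * h t x) * exp (- A t x) = Xx t x"
    unfolding e Xx_def by (simp add: exp_diff exp_minus field_simps)
  finally show ?thesis .
qed

text \<open>The flow equation, since u = - x \<Omega>.\<close>

lemma X_t_deriv:
  assumes "t \<in> {0..T}" "x \<in> {0..1}" shows "((\<lambda>t. X t x) has_real_derivative - X t x * Om t x) (at t within {0..T})"
  unfolding X_def by (auto intro!: derivative_eq_intros A_t_deriv[OF assms])

lemma cont2_X: "cont2 T X" and cont2_Xx: "cont2 T Xx"
  unfolding X_def[abs_def] Xx_def[abs_def]
  by (intro cont2_mult cont2_snd cont2_exp cont2_minus cont2_diff cont2_A cont2_C)+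

lemma Xx_V: "Xx t x * V t x = 1"
  by (simp add: Xx_def V_eq flip: exp_add)

lemma Xx_lower: "t \<in> {0..T} \<Longrightarrow> x \<in> {0..1} \<Longrightarrow> 1 / 81 \<le> Xx t x"
  and V_pos: "0 < V t x" and Xx_pos: "0 < Xx t x"
proof -
  show V: "0 < V t x" and "0 < Xx t x" by (auto simp: V_eq Xx_def)
  assume tx: "t \<in> {0..T}" "x \<in> {0..1}"
  have "V t x \<le> 81" using Vfun_bound[OF q_cont q_bound tx] by (simp add: V_def)
  then have "Xx t x * V t x \<le> Xx t x * 81" by (intro mult_left_mono) (simp_all add: Xx_def)
  then show "1 / 81 \<le> Xx t x" using Xx_V[of t x] by simp
qed

lemma X_0 [simp]: "X t 0 = 0" and X_1 [simp]: "X t 1 = 1"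
  by (simp_all add: X_def A_1)

lemma X_expand:
  assumes "t \<in> {0..T}" "a \<in> {0..1}" "b \<in> {0..1}" "a \<le> b"
  shows "(b - a) / 81 \<le> X t b - X t a"
proof -
  have p: "prim 0 1 (X t) (Xx t)"
    by (rule prim_of_deriv[OF X_x_deriv[OF assms(1)] cont2_x[OF cont2_Xx assms(1)]])
  have "integral {a..b} (\<lambda>x. 1 / 81 :: real) \<le> integral {a..b} (Xx t)"
  proof (rule integral_le)
    show "Xx t integrable_on {a..b}"
      by (rule integrable_continuous_real, rule continuous_on_subset[OF cont2_x[OF cont2_Xx assms(1)]])
        (use assms in auto)
    show "1 / 81 \<le> Xx t x" if "x \<in> {a..b}" for x by (rule Xx_lower) (use that assms in auto)
  qed auto
  then show ?thesis using prim_diff[OF p, of a b] assms by auto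
qed

lemma X_expand_abs:
  assumes "t \<in> {0..T}" "a \<in> {0..1}" "b \<in> {0..1}"
  shows "\<bar>b - a\<bar> \<le> 81 * \<bar>X t b - X t a\<bar>"
proof (cases "a \<le> b")
  case True then show ?thesis using X_expand[OF assms] by simp
next
  case False then show ?thesis using X_expand[OF assms(1,3,2)] by simp
qed

lemma X_bij: assumes "t \<in> {0..T}" shows "bij_betw (X t) {0..1} {0..1}"
proof -
  have inj: "inj_on (X t) {0..1}"
  proof (rule inj_onI)
    fix x y assume "x \<in> {0..1}" "y \<in> {0..1}" "X t x = X t y"
    then show "x = y" using X_expand_abs[OF assms, of x y] by simp
  qed
  have "X t ` {0..1} = {0..1}"
  proof
    show "X t ` {0..1} \<subseteq> {0..1}"
    proof (rule image_subsetI)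
      fix x :: real assume x: "x \<in> {0..1}"
      show "X t x \<in> {0..1}" using X_expand[OF assms, of 0 x] X_expand[OF assms, of x 1] x by auto
    qed
    show "{0..1} \<subseteq> X t ` {0..1}"
    proof
      fix y :: real assume "y \<in> {0..1}"
      then have "\<exists>x\<ge>0. x \<le> 1 \<and> X t x = y"
        using IVT'[of "X t" 0 y 1] cont2_x[OF cont2_X assms] by auto
      then show "y \<in> X t ` {0..1}" by force
    qed
  qed
  then show ?thesis using inj by (simp add: bij_betw_def)
qed

section \<open>The inverse flow and its derivatives\<close>

definition Y where "Y t = inv_into {0..1} (X t)"

lemma Y_in: "t \<in> {0..T} \<Longrightarrow> x \<in> {0..1} \<Longrightarrow> Y t x \<in> {0..1}"
  and X_Y: "t \<in> {0..T} \<Longrightarrow> x \<in> {0..1} \<Longrightarrow> X t (Y t x) = x"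
  and Y_X: "t \<in> {0..T} \<Longrightarrow> x \<in> {0..1} \<Longrightarrow> Y t (X t x) = x"
proof -
  assume t: "t \<in> {0..T}" and x: "x \<in> {0..1}"
  note b = X_bij[OF t]
  show "Y t x \<in> {0..1}" unfolding Y_def by (rule bij_betw_apply[OF bij_betw_inv_into[OF b] x])
  show "X t (Y t x) = x" "Y t (X t x) = x"
    unfolding Y_def by (rule bij_betw_inv_into_right[OF b x] bij_betw_inv_into_left[OF b x])+
qed

lemma Y_0: "t \<in> {0..T} \<Longrightarrow> Y t 0 = 0" and Y_1: "t \<in> {0..T} \<Longrightarrow> Y t 1 = 1"
  using Y_X[of t 0] Y_X[of t 1] by auto

lemma Y_interior: "t \<in> {0..T} \<Longrightarrow> x \<in> {0<..<1} \<Longrightarrow> Y t x \<in> {0<..<1}"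
proof -
  assume t: "t \<in> {0..T}" and x: "x \<in> {0<..<1}"
  have "Y t x \<noteq> 0" "Y t x \<noteq> 1" using X_Y[OF t, of x] x by auto
  then show ?thesis using Y_in[OF t, of x] x by auto
qed

text \<open>Both points are mapped by the same X s, whose slope is at least 1/81. The change of X in
  time is controlled by a bound on X \<Omega>.\<close>

lemma Y_lipschitz:
  obtains L where "L > 0" "\<And>s t x y. s \<in> {0..T} \<Longrightarrow> t \<in> {0..T} \<Longrightarrow> x \<in> {0..1} \<Longrightarrow> y \<in> {0..1} \<Longrightarrow>
    \<bar>Y s x - Y t y\<bar> \<le> L * (\<bar>s - t\<bar> + \<bar>x - y\<bar>)"
proof -
  obtain B where B: "B > 0" "\<And>t x. t \<in> {0..T} \<Longrightarrow> x \<in> {0..1} \<Longrightarrow> \<bar>- X t x * Om t x\<bar> \<le> B"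
    using cont2_bounded[OF cont2_mult[OF cont2_minus[OF cont2_X] cont2_Om]] by metis
  have Xt: "\<bar>X s z - X t z\<bar> \<le> B * \<bar>s - t\<bar>" if "s \<in> {0..T}" "t \<in> {0..T}" "z \<in> {0..1}" for s t z
    using field_differentiable_bound[of "{0..T}" "\<lambda>t. X t z" "\<lambda>t. - X t z * Om t z" B s t] X_t_deriv B that
    by auto
  have "\<bar>Y s x - Y t y\<bar> \<le> 81 * (B + 1) * (\<bar>s - t\<bar> + \<bar>x - y\<bar>)"
    if st: "s \<in> {0..T}" "t \<in> {0..T}" "x \<in> {0..1}" "y \<in> {0..1}" for s t x y
  proof -
    have "\<bar>Y s x - Y t y\<bar> \<le> 81 * \<bar>X s (Y s x) - X s (Y t y)\<bar>"
      by (rule X_expand_abs) (use st Y_in in auto)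
    also have "X s (Y s x) - X s (Y t y) = (x - y) + (X t (Y t y) - X s (Y t y))"
      using X_Y st by simp
    also have "\<bar>(x - y) + (X t (Y t y) - X s (Y t y))\<bar> \<le> \<bar>x - y\<bar> + B * \<bar>s - t\<bar>"
      using Xt[OF st(2,1) Y_in[OF st(2,4)]] by (simp add: abs_minus_commute)
    also have "\<dots> \<le> (B + 1) * (\<bar>s - t\<bar> + \<bar>x - y\<bar>)"
      using B(1) by (simp add: algebra_simps)
    finally show ?thesis by (simp only: mult.assoc mult_left_mono)
  qed
  then show ?thesis using that[of "81 * (B + 1)"] B(1) by auto
qed

lemma cont2_Y: "cont2 T Y"
  unfolding cont2_def continuous_on_iff
proof (intro ballI allI impI)
  obtain L where L: "L > 0" "\<And>s t x y. s \<in> {0..T} \<Longrightarrow> t \<in> {0..T} \<Longrightarrow> x \<in> {0..1} \<Longrightarrow> y \<in> {0..1} \<Longrightarrow>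
    \<bar>Y s x - Y t y\<bar> \<le> L * (\<bar>s - t\<bar> + \<bar>x - y\<bar>)" using Y_lipschitz by metis
  fix p :: "real \<times> real" and e :: real assume p: "p \<in> {0..T} \<times> {0..1}" and e: "e > 0"
  show "\<exists>d>0. \<forall>p'\<in>{0..T} \<times> {0..1}. dist p' p < d \<longrightarrow> dist (Y (fst p') (snd p')) (Y (fst p) (snd p)) < e"
  proof (intro exI[of _ "e / (2 * L)"] conjI ballI impI)
    fix p' assume p': "p' \<in> {0..T} \<times> {0..1}" "dist p' p < e / (2 * L)"
    have "\<bar>fst p' - fst p\<bar> < e / (2 * L)" "\<bar>snd p' - snd p\<bar> < e / (2 * L)"
      using dist_fst_le[of p' p] dist_snd_le[of p' p] p'(2) by (auto simp: dist_real_def)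
    then have "L * (\<bar>fst p' - fst p\<bar> + \<bar>snd p' - snd p\<bar>) < L * (e / (2 * L) + e / (2 * L))"
      using L(1) by (intro mult_strict_left_mono) auto
    also have "\<dots> = e" using L(1) by simp
    finally show "dist (Y (fst p') (snd p')) (Y (fst p) (snd p)) < e"
      using L(2)[of "fst p'" "fst p" "snd p'" "snd p"] p p' by (auto simp: dist_real_def mem_Times_iff)
  qed (use e L in simp)
qed

lemma cont2_along_Y: "cont2 T f \<Longrightarrow> cont2 T (\<lambda>t x. f t (Y t x))"
  unfolding cont2_def[of T "\<lambda>t x. f t (Y t x)"]
  by (rule cont2_compose[of T f]) (use cont2_Y Y_in in \<open>auto simp: cont2_def intro!: continuous_intros\<close>)

text \<open>Difference quotients of Y are reciprocals of those of X along Y; injectivity keeps Y t z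
  away from Y t x. Working within [0,1] covers the end points.\<close>

lemma Y_x_deriv:
  assumes t: "t \<in> {0..T}" and x: "x \<in> {0..1}"
  shows "(Y t has_real_derivative V t (Y t x)) (at x within {0..1})"
proof -
  let ?y = "Y t x"
  have lim: "filterlim (Y t) (at ?y within {0..1}) (at x within {0..1})"
    unfolding filterlim_at
  proof
    show "\<forall>\<^sub>F z in at x within {0..1}. Y t z \<in> {0..1} \<and> Y t z \<noteq> ?y"
      unfolding eventually_at_filter
    proof (rule always_eventually, intro allI impI conjI)
      fix z assume z: "z \<noteq> x" "z \<in> {0..1}"
      show "Y t z \<in> {0..1}" by (rule Y_in[OF t z(2)])
      show "Y t z \<noteq> ?y" using X_Y[OF t z(2)] X_Y[OF t x] z(1) by auto
    qed
    show "(Y t \<longlongrightarrow> ?y) (at x within {0..1})"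
      using cont2_x[OF cont2_Y t] x unfolding continuous_on_def by blast
  qed
  have "((\<lambda>z. (X t z - X t ?y) / (z - ?y)) \<longlongrightarrow> Xx t ?y) (at ?y within {0..1})"
    using X_x_deriv[OF t Y_in[OF t x]] unfolding has_field_derivative_iff .
  from filterlim_compose[OF this lim]
  have "((\<lambda>z. inverse ((X t (Y t z) - X t ?y) / (Y t z - ?y))) \<longlongrightarrow> inverse (Xx t ?y)) (at x within {0..1})"
    using Xx_pos[of t ?y] by (intro tendsto_inverse) auto
  moreover have "inverse (Xx t ?y) = V t ?y"
    using Xx_V[of t ?y] by (simp add: inverse_unique)
  ultimately have "((\<lambda>z. inverse ((X t (Y t z) - X t ?y) / (Y t z - ?y))) \<longlongrightarrow> V t ?y) (at x within {0..1})"
    by simp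
  moreover have "\<forall>\<^sub>F z in at x within {0..1}. inverse ((X t (Y t z) - X t ?y) / (Y t z - ?y)) = (Y t z - Y t x) / (z - x)"
    unfolding eventually_at_filter by (rule always_eventually) (auto simp: X_Y[OF t] X_Y[OF t x])
  ultimately show ?thesis unfolding has_field_derivative_iff by (rule Lim_transform_eventually)
qed

text \<open>Differentiation of X s (Y s x) = x in s. The spatial increment is written with its mean
  slope M, which is at least 1/81, so one can divide by it.\<close>

lemma Y_t_deriv:
  assumes t: "t \<in> {0..T}" and x: "x \<in> {0..1}"
  shows "((\<lambda>t. Y t x) has_real_derivative x * Om t (Y t x) * V t (Y t x)) (at t within {0..T})"
proof -
  let ?y = "Y t x"
  have y: "?y \<in> {0..1}" by (rule Y_in[OF t x])
  have yc: "continuous_on {0..T} (\<lambda>s. Y s x)" by (rule cont2_t[OF cont2_Y x])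
  define M where "M s = integral {0..1} (\<lambda>u. Xx s (?y + (Y s x - ?y) * u))" for s
  have "continuous_on {0..T} M"
    unfolding M_def by (rule segment_mean_continuous[OF cont2_Xx yc Y_in[OF _ x] y])
  then have M: "(M \<longlongrightarrow> M t) (at t within {0..T})" using t unfolding continuous_on_def by blast
  have Mt: "M t = Xx t ?y" by (simp add: M_def)
  have Mn: "M s \<noteq> 0" if s: "s \<in> {0..T}" for s
  proof -
    have c: "continuous_on {0..1} (\<lambda>u. Xx s (?y + (Y s x - ?y) * u))"
      by (rule cont2_compose[OF cont2_Xx]) (use s segment01[OF y Y_in[OF s x]] in \<open>auto intro!: continuous_intros\<close>)
    have "integral {0..1} (\<lambda>u::real. 1 / 81 :: real) \<le> M s"
      unfolding M_def using c
      by (intro integral_le) (use Xx_lower[OF s segment01[OF y Y_in[OF s x]]] in \<open>auto intro: integrable_continuous_real\<close>)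
    then show ?thesis by simp
  qed
  have l: "((\<lambda>s. - ((X s ?y - X t ?y) / (s - t)) / M s) \<longlongrightarrow> - (- X t ?y * Om t ?y) / M t) (at t within {0..T})"
    using X_t_deriv[OF t y] Mn[OF t] unfolding has_field_derivative_iff by (intro tendsto_divide tendsto_minus M)
  have "x * Om t ?y = x * Om t ?y * (Xx t ?y * V t ?y)" using Xx_V by simp
  then have "- (- X t ?y * Om t ?y) / M t = x * Om t ?y * V t ?y"
    using Xx_pos[of t ?y] X_Y[OF t x] by (simp add: Mt nonzero_divide_eq_eq mult_ac)
  with l have "((\<lambda>s. - ((X s ?y - X t ?y) / (s - t)) / M s) \<longlongrightarrow> x * Om t ?y * V t ?y) (at t within {0..T})"
    by simp
  moreover have "\<forall>\<^sub>F s in at t within {0..T}. - ((X s ?y - X t ?y) / (s - t)) / M s = (Y s x - Y t x) / (s - t)"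
    unfolding eventually_at_filter
  proof (rule always_eventually, intro allI impI)
    fix s assume s: "s \<noteq> t" "s \<in> {0..T}"
    have "X s (Y s x) - X s ?y = (Y s x - ?y) * M s"
      unfolding M_def
      by (rule ftc_segment[OF X_x_deriv[OF s(2)] cont2_x[OF cont2_Xx s(2)] y Y_in[OF s(2) x]])
    then have "- (X s ?y - X t ?y) = (Y s x - ?y) * M s" using X_Y[OF t x] X_Y[OF s(2) x] by simp
    then have "- ((X s ?y - X t ?y) / (s - t)) = (Y s x - ?y) * M s / (s - t)"
      by (metis minus_divide_left)
    then show "- ((X s ?y - X t ?y) / (s - t)) / M s = (Y s x - Y t x) / (s - t)"
      using Mn[OF s(2)] by simp
  qed
  ultimately show ?thesis unfolding has_field_derivative_iff by (rule Lim_transform_eventually)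
qed

end

section \<open>Weighted spaces of time-Lipschitz functions\<close>

text \<open>Left-endpoint rule: over a step of length \<delta> the integrand deviates by at most L
  \<delta>.\<close>

lemma riemann_step:
  fixes f :: "real \<Rightarrow> real"
  assumes "0 \<le> \<delta>" "real n * \<delta> \<le> t" "0 \<le> L"
    and lip: "\<And>u v. u \<in> {0..t} \<Longrightarrow> v \<in> {0..t} \<Longrightarrow> \<bar>f u - f v\<bar> \<le> L * \<bar>u - v\<bar>"
    and cont: "continuous_on {0..t} f"
  shows "\<bar>integral {0..real n * \<delta>} f - (\<Sum>i<n. \<delta> * f (real i * \<delta>))\<bar> \<le> real n * (\<delta> * (L * \<delta>))"
  using assms(2)
proof (induction n)
  case 0 then show ?case by simp
next
  case (Suc n)
  define u v where "u = real n * \<delta>" and "v = real (Suc n) * \<delta>"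
  have uv: "0 \<le> u" "u \<le> v" "v \<le> t" "v - u = \<delta>"
    using assms(1) Suc.prems by (auto simp: u_def v_def algebra_simps)
  have IH: "\<bar>integral {0..u} f - (\<Sum>i<n. \<delta> * f (real i * \<delta>))\<bar> \<le> real n * (\<delta> * (L * \<delta>))"
    using Suc.IH uv by (simp add: u_def)
  have i: "f integrable_on {a..b}" if "0 \<le> a" "b \<le> t" for a b
    by (rule integrable_continuous_real, rule continuous_on_subset[OF cont]) (use that in auto)
  have c: "integral {0..u} f + integral {u..v} f = integral {0..v} f"
    by (rule Henstock_Kurzweil_Integration.integral_combine[OF uv(1,2) i]) (use uv in auto)
  have e: "integral {u..v} f - \<delta> * f u = integral {u..v} (\<lambda>s. f s - f u)"
    using i[OF uv(1,3)] uv by (subst Henstock_Kurzweil_Integration.integral_diff) auto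
  have "norm (integral {u..v} (\<lambda>s. f s - f u)) \<le> integral {u..v} (\<lambda>s. L * \<delta>)"
  proof (rule integral_norm_bound_integral)
    show "(\<lambda>s. f s - f u) integrable_on {u..v}"
      using i[OF uv(1,3)] by (intro Henstock_Kurzweil_Integration.integrable_diff) auto
    fix s assume s: "s \<in> {u..v}"
    have "\<bar>f s - f u\<bar> \<le> L * \<bar>s - u\<bar>" by (rule lip) (use s uv in auto)
    also have "\<dots> \<le> L * \<delta>" using s uv assms(3) by (intro mult_left_mono) auto
    finally show "norm (f s - f u) \<le> L * \<delta>" by simp
  qed (rule integrable_const_ivl)
  then have "\<bar>integral {u..v} f - \<delta> * f u\<bar> \<le> \<delta> * (L * \<delta>)" using e uv by (simp add: mult_ac)
  moreover have "real (Suc n) * (\<delta> * (L * \<delta>)) = real n * (\<delta> * (L * \<delta>)) + \<delta> * (L * \<delta>)"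
    by (simp add: algebra_simps)
  moreover have "(\<Sum>i<Suc n. \<delta> * f (real i * \<delta>)) = (\<Sum>i<n. \<delta> * f (real i * \<delta>)) + \<delta> * f u"
    by (simp add: u_def)
  ultimately show ?case using IH c unfolding v_def[symmetric] by linarith
qed

text \<open>These sums stand in for Fubini arguments: measurability in space and the relation
  \<open>prim\<close> hold for finite sums and survive the pointwise limit. \<open>Suc n\<close>
  nodes avoid a division by zero.\<close>

definition riemann_sum :: "(real \<Rightarrow> real \<Rightarrow> real) \<Rightarrow> nat \<Rightarrow> real \<Rightarrow> real \<Rightarrow> real" where
  "riemann_sum f n t x = (\<Sum>i<Suc n. (t / real (Suc n)) * f (real i * (t / real (Suc n))) x)"

text \<open>T \<le> 1 lets time integration preserve a majorant, see
  \<open>tlip_time_int\<close>.\<close>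

locale time_interval =
  fixes T :: real
  assumes T_pos: "0 < T" and T_le1: "T \<le> 1"
begin

text \<open>One majorant g controls size and Lipschitz constant in time, and it may be unbounded in
  x. At fixed x all time estimates are elementary, while integrability in x is carried by g.\<close>

definition tlip :: "real set \<Rightarrow> (real \<Rightarrow> real) \<Rightarrow> (real \<Rightarrow> real \<Rightarrow> real) \<Rightarrow> bool" where
  "tlip X g f \<longleftrightarrow> (\<forall>x\<in>X. \<forall>t\<in>{0..T}. \<bar>f t x\<bar> \<le> g x \<and> (\<forall>s\<in>{0..T}. \<bar>f t x - f s x\<bar> \<le> \<bar>t - s\<bar> * g x))"

lemma tlipD:
  assumes "tlip X g f" "x \<in> X" "t \<in> {0..T}"
  shows "\<bar>f t x\<bar> \<le> g x" "s \<in> {0..T} \<Longrightarrow> \<bar>f t x - f s x\<bar> \<le> \<bar>t - s\<bar> * g x"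
  using assms unfolding tlip_def by blast+

lemma tlipI:
  assumes "\<And>x t. x \<in> X \<Longrightarrow> t \<in> {0..T} \<Longrightarrow> \<bar>f t x\<bar> \<le> g x"
    "\<And>x t s. x \<in> X \<Longrightarrow> t \<in> {0..T} \<Longrightarrow> s \<in> {0..T} \<Longrightarrow> \<bar>f t x - f s x\<bar> \<le> \<bar>t - s\<bar> * g x"
  shows "tlip X g f"
  using assms unfolding tlip_def by blast

definition tcont :: "(real \<Rightarrow> real \<Rightarrow> real) \<Rightarrow> real \<Rightarrow> bool" where
  "tcont f x \<longleftrightarrow> continuous_on {0..T} (\<lambda>t. f t x)"

lemma tcont_sub: "tcont f x \<Longrightarrow> t \<in> {0..T} \<Longrightarrow> continuous_on {0..t} (\<lambda>s. f s x)"
  unfolding tcont_def by (rule continuous_on_subset) auto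

lemma tcont_integrable: "tcont f x \<Longrightarrow> t \<in> {0..T} \<Longrightarrow> (\<lambda>s. f s x) integrable_on {0..t}"
  by (rule integrable_continuous_real[OF tcont_sub])

lemma zero_time: "0 \<in> {0..T}" using T_pos by simp

lemma tlip_nonneg: "tlip X g f \<Longrightarrow> x \<in> X \<Longrightarrow> 0 \<le> g x"
  using tlipD(1)[of X g f x 0] zero_time by fastforce

lemma tlip_subset: "tlip X g f \<Longrightarrow> Z \<subseteq> X \<Longrightarrow> tlip Z g f"
  unfolding tlip_def by blast

lemma tlip_mono:
  assumes "tlip X g f" "\<And>x. x \<in> X \<Longrightarrow> g x \<le> g' x" shows "tlip X g' f"
proof (rule tlipI)
  fix x t s assume x: "x \<in> X" and t: "t \<in> {0..T}"
  show "\<bar>f t x\<bar> \<le> g' x" using tlipD(1)[OF assms(1) x t] assms(2)[OF x] by linarith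
  assume s: "s \<in> {0..T}"
  show "\<bar>f t x - f s x\<bar> \<le> \<bar>t - s\<bar> * g' x"
    using tlipD(2)[OF assms(1) x t s] mult_left_mono[OF assms(2)[OF x], of "\<bar>t - s\<bar>"] by simp
qed

lemma tlip_cong:
  assumes "tlip X g f" "\<And>t x. t \<in> {0..T} \<Longrightarrow> x \<in> X \<Longrightarrow> f' t x = f t x" shows "tlip X g f'"
  using assms unfolding tlip_def by simp

lemma tlip_add:
  assumes "tlip X g f" "tlip X g' f'" shows "tlip X (\<lambda>x. g x + g' x) (\<lambda>t x. f t x + f' t x)"
proof (rule tlipI)
  fix x t s assume x: "x \<in> X" and t: "t \<in> {0..T}"
  show "\<bar>f t x + f' t x\<bar> \<le> g x + g' x" using tlipD(1)[OF assms(1) x t] tlipD(1)[OF assms(2) x t] by linarith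
  assume s: "s \<in> {0..T}"
  show "\<bar>f t x + f' t x - (f s x + f' s x)\<bar> \<le> \<bar>t - s\<bar> * (g x + g' x)"
    using tlipD(2)[OF assms(1) x t s] tlipD(2)[OF assms(2) x t s] unfolding distrib_left by linarith
qed

lemma tlip_mult:
  assumes "tlip X g f" "tlip X g' f'" shows "tlip X (\<lambda>x. 2 * (g x * g' x)) (\<lambda>t x. f t x * f' t x)"
proof (rule tlipI)
  fix x t s assume x: "x \<in> X" and t: "t \<in> {0..T}"
  note g = tlip_nonneg[OF assms(1) x] tlip_nonneg[OF assms(2) x]
  have "\<bar>f t x * f' t x\<bar> \<le> g x * g' x"
    unfolding abs_mult using tlipD(1)[OF assms(1) x t] tlipD(1)[OF assms(2) x t] g by (intro mult_mono) auto
  then show "\<bar>f t x * f' t x\<bar> \<le> 2 * (g x * g' x)" using g by (smt (verit) mult_nonneg_nonneg)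
  assume s: "s \<in> {0..T}"
  have 1: "\<bar>(f t x - f s x) * f' t x\<bar> \<le> (\<bar>t - s\<bar> * g x) * g' x"
    unfolding abs_mult using tlipD(2)[OF assms(1) x t s] tlipD(1)[OF assms(2) x t] g by (intro mult_mono) auto
  have 2: "\<bar>f s x * (f' t x - f' s x)\<bar> \<le> g x * (\<bar>t - s\<bar> * g' x)"
    unfolding abs_mult using tlipD(1)[OF assms(1) x s] tlipD(2)[OF assms(2) x t s] g by (intro mult_mono) auto
  have 3: "f t x * f' t x - f s x * f' s x = (f t x - f s x) * f' t x + f s x * (f' t x - f' s x)"
    by (simp add: algebra_simps)
  have 4: "\<bar>t - s\<bar> * (2 * (g x * g' x)) = (\<bar>t - s\<bar> * g x) * g' x + g x * (\<bar>t - s\<bar> * g' x)" by simp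
  show "\<bar>f t x * f' t x - f s x * f' s x\<bar> \<le> \<bar>t - s\<bar> * (2 * (g x * g' x))"
    unfolding 3 4 using 1 2 by linarith
qed

lemma tlip_const_time:
  assumes "\<And>x. x \<in> X \<Longrightarrow> \<bar>c x\<bar> \<le> g x" shows "tlip X g (\<lambda>t x. c x)"
  by (rule tlipI) (use assms in \<open>force intro: mult_nonneg_nonneg order_trans[OF abs_ge_zero]\<close>)+

lemma tlip_scale:
  assumes "tlip X g f" shows "tlip X (\<lambda>x. \<bar>c x\<bar> * g x) (\<lambda>t x. c x * f t x)"
proof (rule tlipI)
  fix x t s assume x: "x \<in> X" and t: "t \<in> {0..T}"
  show "\<bar>c x * f t x\<bar> \<le> \<bar>c x\<bar> * g x"
    unfolding abs_mult using tlipD(1)[OF assms x t] by (intro mult_left_mono) auto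
  assume s: "s \<in> {0..T}"
  have "\<bar>c x * (f t x - f s x)\<bar> \<le> \<bar>c x\<bar> * (\<bar>t - s\<bar> * g x)"
    unfolding abs_mult using tlipD(2)[OF assms x t s] by (intro mult_left_mono) auto
  then show "\<bar>c x * f t x - c x * f s x\<bar> \<le> \<bar>t - s\<bar> * (\<bar>c x\<bar> * g x)"
    by (simp add: right_diff_distrib mult_ac)
qed

lemma tlip_cont:
  assumes "tlip X g f" "x \<in> X" shows "tcont f x"
  unfolding tcont_def
proof (rule continuous_onI)
  fix t e :: real assume t: "t \<in> {0..T}" and e: "e > 0"
  have g: "0 \<le> g x" by (rule tlip_nonneg[OF assms])
  show "\<exists>d>0. \<forall>s\<in>{0..T}. dist s t < d \<longrightarrow> dist (f s x) (f t x) \<le> e"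
  proof (intro exI[of _ "e / (g x + 1)"] conjI ballI impI)
    fix s assume s: "s \<in> {0..T}" "dist s t < e / (g x + 1)"
    have "\<bar>f s x - f t x\<bar> \<le> \<bar>s - t\<bar> * g x" by (rule tlipD(2)[OF assms s(1) t])
    also have "\<dots> \<le> (e / (g x + 1)) * (g x + 1)"
      using s g e by (intro mult_mono) (auto simp: dist_real_def)
    also have "\<dots> = e" using g by simp
    finally show "dist (f s x) (f t x) \<le> e" by (simp add: dist_real_def)
  qed (use e g in simp)
qed

lemma tlip_cont_sub: "tlip X g f \<Longrightarrow> x \<in> X \<Longrightarrow> t \<in> {0..T} \<Longrightarrow> continuous_on {0..t} (\<lambda>t. f t x)"
  by (rule tcont_sub[OF tlip_cont])

lemma time_int_bound:
  assumes "tcont f x" "t \<in> {0..T}" "\<And>s. s \<in> {0..T} \<Longrightarrow> \<bar>f s x\<bar> \<le> B"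
  shows "\<bar>time_int f t x\<bar> \<le> t * B"
proof -
  have "norm (integral {0..t} (\<lambda>s. f s x)) \<le> integral {0..t} (\<lambda>s. B)"
    using assms(3) assms(2) by (intro integral_norm_bound_integral tcont_integrable[OF assms(1,2)]) auto
  then show ?thesis using assms(2) by (simp add: time_int_def)
qed

lemma time_int_lip:
  assumes "tcont f x" "t \<in> {0..T}" "s \<in> {0..T}" "\<And>s. s \<in> {0..T} \<Longrightarrow> \<bar>f s x\<bar> \<le> B"
  shows "\<bar>time_int f t x - time_int f s x\<bar> \<le> \<bar>t - s\<bar> * B"
proof -
  have "((\<lambda>t. time_int f t x) has_real_derivative f t x) (at t within {0..T})" if "t \<in> {0..T}" for t
    unfolding time_int_def by (rule integral_has_real_derivative[OF assms(1)[unfolded tcont_def] that])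
  then show ?thesis
    using field_differentiable_bound[of "{0..T}" "\<lambda>t. time_int f t x" "\<lambda>t. f t x" B t s] assms
    by (simp add: mult.commute)
qed

lemma tlip_time_int:
  assumes "tlip X g f" shows "tlip X g (time_int f)"
proof (rule tlipI)
  fix x t s assume x: "x \<in> X" and t: "t \<in> {0..T}"
  have "\<bar>time_int f t x\<bar> \<le> t * g x"
    by (rule time_int_bound[where f=f and x=x, OF tlip_cont[OF assms x] t]) (rule tlipD(1)[OF assms x])
  also have "\<dots> \<le> 1 * g x" using t T_le1 tlip_nonneg[OF assms x] by (intro mult_right_mono) auto
  finally show "\<bar>time_int f t x\<bar> \<le> g x" by simp
  assume s: "s \<in> {0..T}"
  show "\<bar>time_int f t x - time_int f s x\<bar> \<le> \<bar>t - s\<bar> * g x"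
    by (rule time_int_lip[where f=f and x=x, OF tlip_cont[OF assms x] t s]) (rule tlipD(1)[OF assms x])
qed

lemma riemann_sum_tendsto:
  assumes "tlip X g f" "x \<in> X" "t \<in> {0..T}"
  shows "(\<lambda>n. riemann_sum f n t x) \<longlonglongrightarrow> time_int f t x"
proof -
  have g: "0 \<le> g x" by (rule tlip_nonneg[OF assms(1,2)])
  have b: "\<bar>riemann_sum f n t x - time_int f t x\<bar> \<le> t * (g x * t) * (1 / real (Suc n))" for n
  proof -
    let ?d = "t / real (Suc n)"
    have "\<bar>integral {0..real (Suc n) * ?d} (\<lambda>s. f s x) - (\<Sum>i<Suc n. ?d * f (real i * ?d) x)\<bar>
        \<le> real (Suc n) * (?d * (g x * ?d))"
    proof (rule riemann_step[where t=t])
      show "\<bar>f u x - f v x\<bar> \<le> g x * \<bar>u - v\<bar>" if "u \<in> {0..t}" "v \<in> {0..t}" for u v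
        using tlipD(2)[OF assms(1,2), of u v] that assms(3) by (simp add: mult.commute)
      show "continuous_on {0..t} (\<lambda>s. f s x)" by (rule tlip_cont_sub[OF assms])
    qed (use assms(3) g in auto)
    moreover have n: "real (Suc n) * ?d = t" by simp
    moreover have "real (Suc n) * (?d * (g x * ?d)) = (real (Suc n) * ?d) * (g x * ?d)"
      by (simp only: mult.assoc)
    ultimately have "\<bar>time_int f t x - riemann_sum f n t x\<bar> \<le> t * (g x * ?d)"
      unfolding riemann_sum_def time_int_def by (simp only: n)
    also have "\<dots> = t * (g x * t) * (1 / real (Suc n))" by simp
    finally show ?thesis by (simp only: abs_minus_commute)
  qed
  have "(\<lambda>n. t * (g x * t) * (1 / real (Suc n))) \<longlonglongrightarrow> t * (g x * t) * 0"
    by (intro tendsto_mult tendsto_const LIMSEQ_Suc lim_1_over_n)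
  then have "(\<lambda>n. t * (g x * t) * (1 / real (Suc n))) \<longlonglongrightarrow> 0" by simp
  then have "(\<lambda>n. riemann_sum f n t x - time_int f t x) \<longlonglongrightarrow> 0"
    by (rule Lim_null_comparison[rotated]) (use b in simp)
  then show ?thesis by (simp add: LIM_zero_iff)
qed

lemma riemann_point: "t \<in> {0..T} \<Longrightarrow> i < Suc n \<Longrightarrow> real i * (t / real (Suc n)) \<in> {0..T}"
proof -
  assume t: "t \<in> {0..T}" and i: "i < Suc n"
  have "real i * (t / real (Suc n)) = t * (real i / real (Suc n))" by simp
  also have "\<dots> \<le> t * 1" using t i by (intro mult_left_mono) auto
  finally show ?thesis using t by auto
qed

definition meas :: "(real \<Rightarrow> real \<Rightarrow> real) \<Rightarrow> bool" where
  "meas f \<longleftrightarrow> (\<forall>t\<in>{0..T}. f t \<in> borel_measurable lebesgue01)"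

lemma meas_time_int:
  assumes "meas f" "tlip {0<..1} g f" shows "meas (time_int f)"
  unfolding meas_def
proof
  fix t assume t: "t \<in> {0..T}"
  show "time_int f t \<in> borel_measurable lebesgue01"
  proof (rule borel_measurable_LIMSEQ_real)
    show "(\<lambda>n. riemann_sum f n t x) \<longlonglongrightarrow> time_int f t x" if "x \<in> space lebesgue01" for x
      by (rule riemann_sum_tendsto[OF assms(2) _ t]) (use that in \<open>auto simp: space_restrict_space\<close>)
    show "riemann_sum f n t \<in> borel_measurable lebesgue01" for n
      unfolding riemann_sum_def
    proof (intro borel_measurable_sum borel_measurable_times borel_measurable_const)
      fix i assume "i \<in> {..<Suc n}"
      then have "real i * (t / real (Suc n)) \<in> {0..T}" by (intro riemann_point[OF t]) (simp only: lessThan_iff)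
      then show "(\<lambda>x. f (real i * (t / real (Suc n))) x) \<in> borel_measurable lebesgue01"
        using assms(1) unfolding meas_def by blast
    qed
  qed
qed

text \<open>The relation holds for the Riemann sums, whose densities are dominated by g; dominated
  convergence passes to the limit.\<close>

lemma prim_time_int:
  assumes f: "tlip {a..b} gf f" and h: "tlip {a..b} g h" and g: "g absolutely_integrable_on {a..b}"
    and p: "\<And>t. t \<in> {0..T} \<Longrightarrow> prim a b (f t) (h t)" and t: "t \<in> {0..T}"
  shows "prim a b (time_int f t) (time_int h t)"
proof -
  have pn: "prim a b (riemann_sum f n t) (riemann_sum h n t)" for n
    unfolding riemann_sum_def
    by (intro prim_sum prim_cmult p riemann_point t) auto
  have bd: "\<bar>riemann_sum h n t z\<bar> \<le> g z" if z: "z \<in> {a..b}" for n z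
  proof -
    have "\<bar>riemann_sum h n t z\<bar> \<le> (\<Sum>i<Suc n. (t / real (Suc n)) * g z)"
      unfolding riemann_sum_def
    proof (rule order_trans[OF sum_abs sum_mono])
      fix i assume "i \<in> {..<Suc n}"
      then have "\<bar>h (real i * (t / real (Suc n))) z\<bar> \<le> g z"
        by (intro tlipD(1)[OF h z] riemann_point t) simp
      then show "\<bar>t / real (Suc n) * h (real i * (t / real (Suc n))) z\<bar> \<le> t / real (Suc n) * g z"
        using t by (simp add: abs_mult mult_left_mono divide_right_mono del: of_nat_Suc)
    qed
    also have "\<dots> = t * g z" by (simp del: of_nat_Suc)
    also have "\<dots> \<le> 1 * g z" using t T_le1 tlip_nonneg[OF h z] by (intro mult_right_mono) auto
    finally show ?thesis by simp
  qed
  have gi: "g integrable_on {a..b}" using g set_lebesgue_integral_eq_integral(1) by blast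
  have conv: "time_int h t integrable_on {a..x} \<and>
      (\<lambda>n. integral {a..x} (riemann_sum h n t)) \<longlonglongrightarrow> integral {a..x} (time_int h t)" if x: "x \<le> b" for x
  proof -
    have s: "{a..x} \<subseteq> {a..b}" using x by auto
    have i: "riemann_sum h n t integrable_on {a..x}" for n
      using prim_integrable_sub[OF pn order.refl x] set_lebesgue_integral_eq_integral(1) by blast
    show ?thesis
      using dominated_convergence[of "\<lambda>n. riemann_sum h n t" "{a..x}" g "time_int h t"]
        i integrable_on_subinterval[OF gi, of a x] x bd riemann_sum_tendsto[OF h _ t] s by auto
  qed
  show ?thesis
  proof (rule primI)
    show "time_int h t absolutely_integrable_on {a..b}"
    proof (rule absolutely_integrable_integrable_bound[OF _ _ gi])
      show "norm (time_int h t x) \<le> g x" if "x \<in> {a..b}" for x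
        using tlipD(1)[OF tlip_time_int[OF h] that t] by simp
    qed (use conv in blast)
    fix x assume x: "a \<le> x" "x \<le> b"
    have "(\<lambda>n. riemann_sum f n t x - riemann_sum f n t a) \<longlonglongrightarrow> time_int f t x - time_int f t a"
      by (intro tendsto_diff riemann_sum_tendsto[OF f _ t]) (use x in auto)
    moreover have "riemann_sum f n t x - riemann_sum f n t a = integral {a..x} (riemann_sum h n t)" for n
      using prim_diff[OF pn, of a x] x by simp
    ultimately show "time_int f t x - time_int f t a = integral {a..x} (time_int h t)"
      using conv[OF x(2)] LIMSEQ_unique by force
  qed
qed

lemma time_int_add:
  assumes "tcont f x" "tcont g x" "t \<in> {0..T}"
  shows "time_int (\<lambda>t x. f t x + g t x) t x = time_int f t x + time_int g t x"
  unfolding time_int_def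
  by (rule Henstock_Kurzweil_Integration.integral_add[OF tcont_integrable[OF assms(1,3)] tcont_integrable[OF assms(2,3)]])

lemma time_int_diff:
  assumes "tcont f x" "tcont g x" "t \<in> {0..T}"
  shows "time_int (\<lambda>t x. f t x - g t x) t x = time_int f t x - time_int g t x"
  unfolding time_int_def
  by (rule Henstock_Kurzweil_Integration.integral_diff[OF tcont_integrable[OF assms(1,3)] tcont_integrable[OF assms(2,3)]])

lemma continuous_time_int:
  "tcont f x \<Longrightarrow> tcont (time_int f) x"
  unfolding time_int_def tcont_def by (rule indefinite_integral_continuous_1, rule integrable_continuous_real)

abbreviation time_int2 :: "(real \<Rightarrow> real \<Rightarrow> real) \<Rightarrow> real \<Rightarrow> real \<Rightarrow> real" where
  "time_int2 f \<equiv> time_int (time_int f)"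

lemma time_int2_diff:
  assumes "tcont f x" "tcont g x" "t \<in> {0..T}"
  shows "time_int2 (\<lambda>t x. f t x - g t x) t x = time_int2 f t x - time_int2 g t x"
proof -
  have "time_int2 (\<lambda>t x. f t x - g t x) t x = time_int (\<lambda>t x. time_int f t x - time_int g t x) t x"
    by (rule time_int_cong[OF assms(3)]) (rule time_int_diff[OF assms(1,2)])
  also have "\<dots> = time_int2 f t x - time_int2 g t x"
    by (rule time_int_diff[OF continuous_time_int[OF assms(1)] continuous_time_int[OF assms(2)] assms(3)])
  finally show ?thesis .
qed

lemma time_int2_add:
  assumes "tcont f x" "tcont g x" "t \<in> {0..T}"
  shows "time_int2 (\<lambda>t x. f t x + g t x) t x = time_int2 f t x + time_int2 g t x"
proof -
  have "time_int2 (\<lambda>t x. f t x + g t x) t x = time_int (\<lambda>t x. time_int f t x + time_int g t x) t x"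
    by (rule time_int_cong[OF assms(3)]) (rule time_int_add[OF assms(1,2)])
  also have "\<dots> = time_int2 f t x + time_int2 g t x"
    by (rule time_int_add[OF continuous_time_int[OF assms(1)] continuous_time_int[OF assms(2)] assms(3)])
  finally show ?thesis .
qed

lemma time_int2_bound:
  assumes "tcont f x" "t \<in> {0..T}" "\<And>s. s \<in> {0..T} \<Longrightarrow> \<bar>f s x\<bar> \<le> B"
  shows "\<bar>time_int2 f t x\<bar> \<le> T\<^sup>2 * B"
proof -
  have B: "0 \<le> B" using assms(3)[OF zero_time] by linarith
  have "\<bar>time_int2 f t x\<bar> \<le> t * (T * B)"
  proof (rule time_int_bound[OF continuous_time_int[OF assms(1)] assms(2)])
    fix s assume s: "s \<in> {0..T}"
    have "\<bar>time_int f s x\<bar> \<le> s * B" by (rule time_int_bound[OF assms(1) s assms(3)])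
    also have "\<dots> \<le> T * B" using s B by (intro mult_right_mono) auto
    finally show "\<bar>time_int f s x\<bar> \<le> T * B" .
  qed
  also have "\<dots> \<le> T * (T * B)" using assms(2) B T_pos by (intro mult_right_mono) auto
  finally show ?thesis by (simp add: power2_eq_square mult.assoc)
qed

text \<open>Against the weight e^(l t), time integration gains 1/l. A large l can therefore replace
  smallness of T or of the coefficients, as in \<open>volterra_prim\<close>.\<close>

lemma time_int_exp_bound:
  assumes "tcont f x" "t \<in> {0..T}" "l > 0"
    "\<And>s. s \<in> {0..T} \<Longrightarrow> \<bar>f s x\<bar> \<le> N * exp (l * s)" "0 \<le> N"
  shows "\<bar>time_int f t x\<bar> \<le> N / l * exp (l * t)"
proof -
  have "((\<lambda>s. N * exp (l * s)) has_integral N / l * exp (l * t) - N / l * exp (l * 0)) {0..t}"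
  proof (rule fundamental_theorem_of_calculus[where f="\<lambda>s. N / l * exp (l * s)"])
    fix s
    have "((\<lambda>s. N / l * exp (l * s)) has_real_derivative N * exp (l * s)) (at s within {0..t})"
      using assms(3) by (auto intro!: derivative_eq_intros)
    then show "((\<lambda>s. N / l * exp (l * s)) has_vector_derivative N * exp (l * s)) (at s within {0..t})"
      by (simp add: has_real_derivative_iff_has_vector_derivative)
  qed (use assms in simp)
  then have "integral {0..t} (\<lambda>s. N * exp (l * s)) = N / l * exp (l * t) - N / l * exp (l * 0)"
    and i: "(\<lambda>s. N * exp (l * s)) integrable_on {0..t}"
    by (rule integral_unique, rule has_integral_integrable)
  then have e: "integral {0..t} (\<lambda>s. N * exp (l * s)) = N / l * exp (l * t) - N / l" by simp
  have "norm (integral {0..t} (\<lambda>s. f s x)) \<le> integral {0..t} (\<lambda>s. N * exp (l * s))"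
    using assms(4,2) by (intro integral_norm_bound_integral tcont_integrable[OF assms(1,2)] i) auto
  moreover have "0 \<le> N / l" using assms by simp
  ultimately show ?thesis using e by (simp add: time_int_def)
qed

lemma time_int2_exp_bound:
  assumes "tcont f x" "t \<in> {0..T}" "l > 0"
    "\<And>s. s \<in> {0..T} \<Longrightarrow> \<bar>f s x\<bar> \<le> N * exp (l * s)" "0 \<le> N"
  shows "\<bar>time_int2 f t x\<bar> \<le> N / l / l * exp (l * t)"
proof (rule time_int_exp_bound[where f="time_int f", OF continuous_time_int[OF assms(1)] assms(2,3)])
  show "\<bar>time_int f s x\<bar> \<le> N / l * exp (l * s)" if "s \<in> {0..T}" for s
    by (rule time_int_exp_bound[where f=f, OF assms(1) that assms(3) _ assms(5)]) (rule assms(4))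
qed (use assms in auto)

end

section \<open>A linear Volterra equation\<close>

context time_interval
begin

lemma tcont_mult: "tcont f x \<Longrightarrow> tcont g x \<Longrightarrow> tcont (\<lambda>t x. f t x * g t x) x"
  and tcont_diff: "tcont f x \<Longrightarrow> tcont g x \<Longrightarrow> tcont (\<lambda>t x. f t x - g t x) x"
  unfolding tcont_def by (auto intro!: continuous_intros)

context
  fixes a S Q :: "real \<Rightarrow> real \<Rightarrow> real" and x \<kappa> g :: real
  assumes a: "tcont a x" "\<And>t. t \<in> {0..T} \<Longrightarrow> \<bar>a t x\<bar> \<le> \<kappa>"
    and Q: "tcont Q x"
    and eq: "\<And>t. t \<in> {0..T} \<Longrightarrow> Q t x = S t x + time_int2 (\<lambda>t x. a t x * Q t x) t x"
    and small: "2 * (T\<^sup>2 * \<kappa>) \<le> 1"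
    and S: "\<And>t. t \<in> {0..T} \<Longrightarrow> \<bar>S t x\<bar> \<le> g"
begin

text \<open>At a time where |Q| is maximal the double integral is at most half of that maximum and
  can be absorbed.\<close>

lemma volterra_bound: "t \<in> {0..T} \<Longrightarrow> \<bar>Q t x\<bar> \<le> 2 * g"
proof -
  assume t: "t \<in> {0..T}"
  have k: "0 \<le> \<kappa>" using a(2)[OF zero_time] by linarith
  have "continuous_on {0..T} (\<lambda>t. \<bar>Q t x\<bar>)"
    by (rule continuous_on_rabs[OF Q[unfolded tcont_def]])
  then obtain s where s: "s \<in> {0..T}" "\<And>t. t \<in> {0..T} \<Longrightarrow> \<bar>Q t x\<bar> \<le> \<bar>Q s x\<bar>"
    using continuous_attains_sup[of "{0..T}" "\<lambda>t. \<bar>Q t x\<bar>"] zero_time by blast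
  have "\<bar>time_int2 (\<lambda>t x. a t x * Q t x) s x\<bar> \<le> T\<^sup>2 * (\<kappa> * \<bar>Q s x\<bar>)"
  proof (rule time_int2_bound[OF tcont_mult[OF a(1) Q] s(1)])
    show "\<bar>a u x * Q u x\<bar> \<le> \<kappa> * \<bar>Q s x\<bar>" if "u \<in> {0..T}" for u
      unfolding abs_mult using a(2)[OF that] s(2)[OF that] k by (intro mult_mono) auto
  qed
  moreover have "2 * (T\<^sup>2 * (\<kappa> * \<bar>Q s x\<bar>)) = (2 * (T\<^sup>2 * \<kappa>)) * \<bar>Q s x\<bar>" by simp
  moreover have "(2 * (T\<^sup>2 * \<kappa>)) * \<bar>Q s x\<bar> \<le> 1 * \<bar>Q s x\<bar>" using small by (intro mult_right_mono) auto
  ultimately have "\<bar>Q s x\<bar> \<le> 2 * g" using eq[OF s(1)] S[OF s(1)] by linarith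
  then show ?thesis using s(2)[OF t] by linarith
qed

text \<open>The time derivative of the double integral is a single integral of size at most 2
  \<kappa> g. The summand 2 in the constant also accommodates \<open>volterra_bound\<close>, since
  \<open>tlip\<close> has a single majorant for both estimates.\<close>

lemma volterra_lip:
  assumes "t \<in> {0..T}" "s \<in> {0..T}" "\<bar>S t x - S s x\<bar> \<le> \<bar>t - s\<bar> * g"
  shows "\<bar>Q t x - Q s x\<bar> \<le> \<bar>t - s\<bar> * ((2 + 2 * \<kappa>) * g)"
proof -
  have k: "0 \<le> \<kappa>" using a(2)[OF zero_time] by linarith
  have g: "0 \<le> g" using S[OF zero_time] by linarith
  have c: "tcont (\<lambda>t x. a t x * Q t x) x" by (rule tcont_mult[OF a(1) Q])
  have b: "\<bar>time_int (\<lambda>t x. a t x * Q t x) u x\<bar> \<le> \<kappa> * (2 * g)" if u: "u \<in> {0..T}" for u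
  proof -
    have "\<bar>time_int (\<lambda>t x. a t x * Q t x) u x\<bar> \<le> u * (\<kappa> * (2 * g))"
    proof (rule time_int_bound[OF c u])
      show "\<bar>a s x * Q s x\<bar> \<le> \<kappa> * (2 * g)" if "s \<in> {0..T}" for s
        unfolding abs_mult using a(2)[OF that] volterra_bound[OF that] k by (intro mult_mono) auto
    qed
    also have "\<dots> \<le> 1 * (\<kappa> * (2 * g))" using u T_le1 k g by (intro mult_right_mono) auto
    finally show ?thesis by simp
  qed
  have "\<bar>time_int2 (\<lambda>t x. a t x * Q t x) t x - time_int2 (\<lambda>t x. a t x * Q t x) s x\<bar> \<le> \<bar>t - s\<bar> * (\<kappa> * (2 * g))"
    by (rule time_int_lip[OF continuous_time_int[OF c] assms(1,2) b])
  moreover have "\<bar>t - s\<bar> * ((2 + 2 * \<kappa>) * g) = \<bar>t - s\<bar> * g + \<bar>t - s\<bar> * (\<kappa> * (2 * g)) + \<bar>t - s\<bar> * g"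
    by (simp add: algebra_simps)
  moreover have "0 \<le> \<bar>t - s\<bar> * g" using g by simp
  ultimately show ?thesis using eq[OF assms(1)] eq[OF assms(2)] assms(3) by linarith
qed

end

lemma volterra_exists_at:
  assumes a: "tcont a x" "\<And>t. t \<in> {0..T} \<Longrightarrow> \<bar>a t x\<bar> \<le> \<kappa>" and S: "tcont S x" and small: "2 * (T\<^sup>2 * \<kappa>) \<le> 1"
  shows "\<exists>Q. continuous_on {0..T} Q \<and> (\<forall>t\<in>{0..T}. Q t = S t x + time_int2 (\<lambda>t x. a t x * Q t) t x)"
proof -
  let ?c = "\<lambda>t. max 0 (min T t)"
  have c_in: "?c t \<in> {0..T}" for t using T_pos by auto
  have c_cont: "continuous_on UNIV ?c" by (intro continuous_intros)
  let ?F = "\<lambda>(f :: real \<Rightarrow>\<^sub>C real) t. S t x + time_int2 (\<lambda>t x. a t x * apply_bcontfun f t) t x"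
  have fc: "tcont (\<lambda>t x. apply_bcontfun f t) x" for f :: "real \<Rightarrow>\<^sub>C real" by (simp add: tcont_def)
  have k: "0 \<le> \<kappa>" using a(2)[OF zero_time] by linarith
  have F: "(\<lambda>t. ?F f (?c t)) \<in> bcontfun" for f
  proof -
    have co: "continuous_on {0..T} (?F f)"
      using S continuous_time_int[OF continuous_time_int[OF tcont_mult[OF a(1) fc[of f]]]]
      unfolding tcont_def by (intro continuous_intros)
    have "compact (?F f ` {0..T})" by (rule compact_continuous_image[OF co]) simp
    from compact_imp_bounded[OF this] obtain B where B: "\<And>y. y \<in> ?F f ` {0..T} \<Longrightarrow> norm y \<le> B"
      unfolding bounded_iff by blast
    show ?thesis
    proof (rule bcontfun_normI)
      show "continuous_on UNIV (\<lambda>t. ?F f (?c t))"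
        by (rule continuous_on_compose2[OF co c_cont]) (use c_in in auto)
      show "norm (?F f (?c t)) \<le> B" for t by (rule B) (use c_in in blast)
    qed
  qed
  define \<Phi> where "\<Phi> f = Bcontfun (\<lambda>t. ?F f (?c t))" for f
  have ap: "apply_bcontfun (\<Phi> f) = (\<lambda>t. ?F f (?c t))" for f
    unfolding \<Phi>_def by (rule Bcontfun_inverse[OF F])
  have "\<exists>!f. \<Phi> f = f"
  proof (rule banach_fix_type[of "1/2"])
    show "\<forall>f g. dist (\<Phi> f) (\<Phi> g) \<le> 1 / 2 * dist f g"
    proof (intro allI dist_bound)
      fix f g :: "real \<Rightarrow>\<^sub>C real" and t
      have "?F f (?c t) - ?F g (?c t) = time_int2 (\<lambda>t x. a t x * apply_bcontfun f t - a t x * apply_bcontfun g t) (?c t) x"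
        using time_int2_diff[OF tcont_mult[OF a(1) fc[of f]] tcont_mult[OF a(1) fc[of g]] c_in] by simp
      also have "\<bar>\<dots>\<bar> \<le> T\<^sup>2 * (\<kappa> * dist f g)"
      proof (rule time_int2_bound[OF tcont_diff[OF tcont_mult[OF a(1) fc[of f]] tcont_mult[OF a(1) fc[of g]]] c_in])
        fix s assume s: "s \<in> {0..T}"
        show "\<bar>a s x * apply_bcontfun f s - a s x * apply_bcontfun g s\<bar> \<le> \<kappa> * dist f g"
          unfolding right_diff_distrib[symmetric] abs_mult
          using a(2)[OF s] dist_bounded[of f s g] k by (intro mult_mono) (auto simp: dist_real_def)
      qed
      also have "\<dots> = (T\<^sup>2 * \<kappa>) * dist f g" by simp
      also have "\<dots> \<le> 1 / 2 * dist f g" using small by (intro mult_right_mono) auto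
      finally show "dist (apply_bcontfun (\<Phi> f) t) (apply_bcontfun (\<Phi> g) t) \<le> 1 / 2 * dist f g"
        by (simp only: ap dist_real_def)
    qed
  qed auto
  then obtain f where f: "\<Phi> f = f" by blast
  have "apply_bcontfun f t = ?F f t" if "t \<in> {0..T}" for t
  proof -
    have "?c t = t" using that by auto
    then show ?thesis using fun_cong[OF ap[of f], of t] f by simp
  qed
  then show ?thesis by (intro exI[of _ "apply_bcontfun f"]) auto
qed

text \<open>Solutions are chosen separately at each x, so measurability in x is not visible here and
  has to be recovered in \<open>volterra_meas\<close>.\<close>

lemma volterra_exists:
  assumes a: "tlip {0<..1} (\<lambda>_. \<kappa>) a" and S: "tlip {0<..1} g S" and small: "2 * (T\<^sup>2 * \<kappa>) \<le> 1"
  obtains Q where "\<And>x. x \<in> {0<..1} \<Longrightarrow> tcont Q x"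
    "\<And>t x. x \<in> {0<..1} \<Longrightarrow> t \<in> {0..T} \<Longrightarrow> Q t x = S t x + time_int2 (\<lambda>t x. a t x * Q t x) t x"
proof -
  have "\<forall>x\<in>{0<..1}. \<exists>Q. continuous_on {0..T} Q \<and> (\<forall>t\<in>{0..T}. Q t = S t x + time_int2 (\<lambda>t x. a t x * Q t) t x)"
    using volterra_exists_at[OF tlip_cont[OF a] tlipD(1)[OF a] tlip_cont[OF S] small] by blast
  from bchoice[OF this] obtain Q where Q: "\<And>x. x \<in> {0<..1} \<Longrightarrow> continuous_on {0..T} (Q x)"
    "\<And>t x. x \<in> {0<..1} \<Longrightarrow> t \<in> {0..T} \<Longrightarrow> Q x t = S t x + time_int2 (\<lambda>t z. a t z * Q x t) t x"
    by blast
  have e: "time_int2 (\<lambda>t z. a t z * Q x t) t x = time_int2 (\<lambda>t x. a t x * Q x t) t x" for t x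
    by (simp add: time_int_def)
  show ?thesis
  proof (rule that[of "\<lambda>t x. Q x t"])
    show "tcont (\<lambda>t x. Q x t) x" if "x \<in> {0<..1}" for x using Q(1)[OF that] by (simp add: tcont_def)
    show "Q x t = S t x + time_int2 (\<lambda>t x. a t x * Q x t) t x" if "x \<in> {0<..1}" "t \<in> {0..T}" for t x
      using Q(2)[OF that] unfolding e .
  qed
qed

definition solves_volterra where
  "solves_volterra a S Q \<longleftrightarrow> (\<forall>x\<in>{0<..1}. tcont Q x \<and>
     (\<forall>t\<in>{0..T}. Q t x = S t x + time_int2 (\<lambda>t x. a t x * Q t x) t x))"

lemma volterra_tlip:
  assumes Q: "solves_volterra a S Q" and a: "tlip {0<..1} (\<lambda>_. \<kappa>) a" and S: "tlip X g S"
    and X: "X \<subseteq> {0<..1}" and small: "2 * (T\<^sup>2 * \<kappa>) \<le> 1"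
  shows "tlip X (\<lambda>x. (2 + 2 * \<kappa>) * g x) Q"
proof (rule tlipI)
  fix x t s assume x: "x \<in> X" and t: "t \<in> {0..T}"
  have x': "x \<in> {0<..1}" using x X by blast
  have q: "tcont Q x" "\<And>t. t \<in> {0..T} \<Longrightarrow> Q t x = S t x + time_int2 (\<lambda>t x. a t x * Q t x) t x"
    using Q x' unfolding solves_volterra_def by blast+
  note facts = tlip_cont[OF a x'] tlipD(1)[OF a x'] q small tlipD(1)[OF S x]
  have g: "0 \<le> g x" "0 \<le> \<kappa>" using tlip_nonneg[OF S x] tlip_nonneg[OF a x'] by auto
  have "\<bar>Q t x\<bar> \<le> 2 * g x" by (rule volterra_bound[where a=a and S=S and Q=Q and x=x and \<kappa>=\<kappa> and g="g x", OF facts t])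
  also have "\<dots> \<le> (2 + 2 * \<kappa>) * g x" using g by (intro mult_right_mono) auto
  finally show "\<bar>Q t x\<bar> \<le> (2 + 2 * \<kappa>) * g x" .
  assume s: "s \<in> {0..T}"
  show "\<bar>Q t x - Q s x\<bar> \<le> \<bar>t - s\<bar> * ((2 + 2 * \<kappa>) * g x)"
    by (rule volterra_lip[where a=a and S=S and Q=Q and x=x and \<kappa>=\<kappa> and g="g x", OF facts t s tlipD(2)[OF S x t s]])
qed

lemma meas_add: "meas f \<Longrightarrow> meas g \<Longrightarrow> meas (\<lambda>t x. f t x + g t x)"
  and meas_mult: "meas f \<Longrightarrow> meas g \<Longrightarrow> meas (\<lambda>t x. f t x * g t x)"
  unfolding meas_def by (auto intro!: borel_measurable_add borel_measurable_diff borel_measurable_times)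

text \<open>Measurability in space is inherited from the Picard iterates, which converge pointwise.\<close>

lemma volterra_meas:
  assumes Q: "solves_volterra a S Q" and a: "tlip {0<..1} (\<lambda>_. \<kappa>) a" "meas a" and S: "tlip {0<..1} g S" "meas S"
    and small: "2 * (T\<^sup>2 * \<kappa>) \<le> 1"
  shows "meas Q"
proof -
  define it where "it = rec_nat S (\<lambda>_ f t x. S t x + time_int2 (\<lambda>t x. a t x * f t x) t x)"
  have it: "it 0 = S" "\<And>n. it (Suc n) = (\<lambda>t x. S t x + time_int2 (\<lambda>t x. a t x * it n t x) t x)"
    by (auto simp: it_def)
  have reg: "meas (it n) \<and> (\<exists>G. tlip {0<..1} G (it n))" for n
  proof (induction n)
    case 0 then show ?case using S it(1) by auto
  next
    case (Suc n)
    then obtain G where G: "tlip {0<..1} G (it n)" "meas (it n)" by blast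
    note p = tlip_mult[OF a(1) G(1)]
    have "meas (time_int2 (\<lambda>t x. a t x * it n t x))"
      by (rule meas_time_int[OF meas_time_int[OF meas_mult[OF a(2) G(2)] p] tlip_time_int[OF p]])
    then show ?case
      unfolding it(2) using meas_add[OF S(2)] tlip_add[OF S(1) tlip_time_int[OF tlip_time_int[OF p]]] by blast
  qed
  have close: "\<bar>Q t x - it n t x\<bar> \<le> 2 * g x / 2 ^ n" if x: "x \<in> {0<..1}" and t: "t \<in> {0..T}" for n :: nat and t x
  proof -
    have q: "tcont Q x" "\<And>t. t \<in> {0..T} \<Longrightarrow> Q t x = S t x + time_int2 (\<lambda>t x. a t x * Q t x) t x"
      using Q x unfolding solves_volterra_def by blast+
    note k = tlip_nonneg[OF a(1) x] and g = tlip_nonneg[OF S(1) x]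
    show ?thesis
      using t
    proof (induction n arbitrary: t rule: nat_induct)
      case 0
      have "\<bar>time_int2 (\<lambda>t x. a t x * Q t x) t x\<bar> \<le> T\<^sup>2 * (\<kappa> * (2 * g x))"
      proof (rule time_int2_bound[OF tcont_mult[OF tlip_cont[OF a(1) x] q(1)] 0])
        fix u assume u: "u \<in> {0..T}"
        have "\<bar>Q u x\<bar> \<le> 2 * g x"
          by (rule volterra_bound[where a=a and S=S and Q=Q and x=x and \<kappa>=\<kappa> and g="g x",
              OF tlip_cont[OF a(1) x] tlipD(1)[OF a(1) x] q small tlipD(1)[OF S(1) x] u])
        then show "\<bar>a u x * Q u x\<bar> \<le> \<kappa> * (2 * g x)"
          unfolding abs_mult using tlipD(1)[OF a(1) x u] k by (intro mult_mono) auto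
      qed
      also have "\<dots> = (2 * (T\<^sup>2 * \<kappa>)) * g x" by simp
      also have "\<dots> \<le> 1 * g x" using small g by (intro mult_right_mono) auto
      finally show ?case using q(2)[OF 0] g by (simp add: it(1))
    next
      case (Suc n)
      obtain G where G: "tlip {0<..1} G (it n)" using reg by blast
      note c = tcont_mult[OF tlip_cont[OF a(1) x] q(1)] tcont_mult[OF tlip_cont[OF a(1) x] tlip_cont[OF G x]]
      have "Q t x - it (Suc n) t x = time_int2 (\<lambda>t x. a t x * Q t x - a t x * it n t x) t x"
        using q(2)[OF Suc.prems] time_int2_diff[OF c Suc.prems] by (simp add: it(2))
      also have "\<bar>\<dots>\<bar> \<le> T\<^sup>2 * (\<kappa> * (2 * g x / 2 ^ n))"
      proof (rule time_int2_bound[OF tcont_diff[OF c] Suc.prems])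
        fix u assume u: "u \<in> {0..T}"
        show "\<bar>a u x * Q u x - a u x * it n u x\<bar> \<le> \<kappa> * (2 * g x / 2 ^ n)"
          unfolding right_diff_distrib[symmetric] abs_mult
          using tlipD(1)[OF a(1) x u] Suc.IH[OF u] k by (intro mult_mono) auto
      qed
      also have "\<dots> = (2 * (T\<^sup>2 * \<kappa>)) * (2 * g x / 2 ^ Suc n)" by simp
      also have "\<dots> \<le> 1 * (2 * g x / 2 ^ Suc n)" using small g by (intro mult_right_mono) auto
      finally show ?case by simp
    qed
  qed
  show ?thesis
    unfolding meas_def
  proof
    fix t assume t: "t \<in> {0..T}"
    show "Q t \<in> borel_measurable lebesgue01"
    proof (rule borel_measurable_LIMSEQ_real)
      show "it n t \<in> borel_measurable lebesgue01" for n using reg[of n] t unfolding meas_def by blast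
      fix x assume "x \<in> space lebesgue01"
      then have x: "x \<in> {0<..1}" by (auto simp: space_restrict_space)
      have "(\<lambda>n. 2 * g x * (1 / 2) ^ n) \<longlonglongrightarrow> 2 * g x * 0"
        by (intro tendsto_mult tendsto_const LIMSEQ_power_zero) auto
      then have "(\<lambda>n. 2 * g x / 2 ^ n) \<longlonglongrightarrow> 0" by (simp add: power_one_over)
      then have "(\<lambda>n. it n t x - Q t x) \<longlonglongrightarrow> 0"
        by (rule Lim_null_comparison[rotated]) (use close[OF x t] in \<open>auto simp: abs_minus_commute\<close>)
      then show "(\<lambda>n. it n t x) \<longlonglongrightarrow> Q t x" by (simp add: LIM_zero_iff)
    qed
  qed
qed

lemma halving_zero:
  fixes e M :: real
  assumes "\<And>n. \<bar>e\<bar> \<le> M / 2 ^ n" shows "e = 0"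
proof -
  have "(\<lambda>n. M * (1 / 2) ^ n) \<longlonglongrightarrow> M * 0"
    by (intro tendsto_mult tendsto_const LIMSEQ_power_zero) auto
  moreover have "\<bar>e\<bar> \<le> M * (1 / 2) ^ n" for n using assms[of n] by (simp add: power_one_over)
  ultimately have "\<bar>e\<bar> \<le> M * 0" by (intro LIMSEQ_le_const) auto
  then show ?thesis by simp
qed

text \<open>
  A primitive \<open>P\<close> of the formal derivative \<open>Q1\<close> is compared with \<open>Q\<close>: the difference satisfies a
  homogeneous Volterra inequality, hence vanishes.
\<close>

lemma volterra_prim:
  assumes ab: "a0 \<le> 1"
    and S: "\<And>t. t \<in> {0..T} \<Longrightarrow> prim a0 1 (S t) (S1 t)"
    and al: "\<And>t. t \<in> {0..T} \<Longrightarrow> prim a0 1 (al t) (al1 t)"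
    and al_b: "tlip {a0..1} (\<lambda>_. \<kappa>) al" and al1_b: "tlip {a0..1} g al1" and g: "g absolutely_integrable_on {a0..1}"
    and Q_b: "tlip {a0..1} (\<lambda>_. B) Q" and Q1_b: "tlip {a0..1} gQ Q1" and gQ: "gQ absolutely_integrable_on {a0..1}"
    and Q1i: "\<And>t. t \<in> {0..T} \<Longrightarrow> Q1 t absolutely_integrable_on {a0..1}"
    and Q: "\<And>t x. t \<in> {0..T} \<Longrightarrow> x \<in> {a0..1} \<Longrightarrow> Q t x = S t x + time_int2 (\<lambda>t x. al t x * Q t x) t x"
    and Q1: "\<And>t x. t \<in> {0..T} \<Longrightarrow> x \<in> {a0..1} \<Longrightarrow>
      Q1 t x = S1 t x + time_int2 (\<lambda>t x. al1 t x * Q t x) t x + time_int2 (\<lambda>t x. al t x * Q1 t x) t x"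
    and t: "t \<in> {0..T}"
  shows "prim a0 1 (Q t) (Q1 t)"
proof -
  have int: "h integrable_on {x..y}" if "h absolutely_integrable_on {a0..1}" "a0 \<le> x" "y \<le> 1" for h :: "real \<Rightarrow> real" and x y
    by (rule set_lebesgue_integral_eq_integral(1), rule absolutely_integrable_on_subinterval[OF that(1)]) (use that in auto)
  \<comment> \<open>Normalised at 1, where P and Q agree and the defect \<open>R\<close>
    consequently vanishes.\<close>
  define P where "P t x = Q t 1 - integral {x..1} (Q1 t)" for t x
  define I where "I = integral {a0..1} gQ"
  have one: "1 \<in> {a0..1}" using ab by simp
  have P_prim: "prim a0 1 (P t) (Q1 t)" if t: "t \<in> {0..T}" for t
  proof (rule primI[OF Q1i[OF t]])
    fix x assume x: "a0 \<le> x" "x \<le> 1"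
    have "integral {a0..x} (Q1 t) + integral {x..1} (Q1 t) = integral {a0..1} (Q1 t)"
      by (rule Henstock_Kurzweil_Integration.integral_combine[OF x int[OF Q1i[OF t]]]) auto
    then show "P t x - P t a0 = integral {a0..x} (Q1 t)" by (simp add: P_def)
  qed
  have gQ0: "0 \<le> gQ x" if "x \<in> {a0..1}" for x using tlip_nonneg[OF Q1_b that] .
  have Ix: "integral {x..1} gQ \<le> I" if "x \<in> {a0..1}" for x
    unfolding I_def by (rule integral_subset_le[OF _ int[OF gQ] int[OF gQ]]) (use that gQ0 in auto)
  have P_b: "tlip {a0..1} (\<lambda>_. B + I) P"
  proof (rule tlipI)
    fix x t s assume x: "x \<in> {a0..1}" and t: "t \<in> {0..T}"
    have "norm (integral {x..1} (Q1 t)) \<le> integral {x..1} gQ"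
      by (rule integral_norm_bound_integral[OF int[OF Q1i[OF t]] int[OF gQ]])
        (use x tlipD(1)[OF Q1_b _ t] in auto)
    then show "\<bar>P t x\<bar> \<le> B + I" using Ix[OF x] tlipD(1)[OF Q_b one t] by (simp add: P_def)
    assume s: "s \<in> {0..T}"
    have "integral {x..1} (Q1 t) - integral {x..1} (Q1 s) = integral {x..1} (\<lambda>z. Q1 t z - Q1 s z)"
      by (rule Henstock_Kurzweil_Integration.integral_diff[symmetric, OF int[OF Q1i[OF t]] int[OF Q1i[OF s]]]) (use x in auto)
    moreover have "norm (integral {x..1} (\<lambda>z. Q1 t z - Q1 s z)) \<le> integral {x..1} (\<lambda>z. \<bar>t - s\<bar> * gQ z)"
    proof (rule integral_norm_bound_integral)
      show "(\<lambda>z. Q1 t z - Q1 s z) integrable_on {x..1}"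
        by (rule Henstock_Kurzweil_Integration.integrable_diff[OF int[OF Q1i[OF t]] int[OF Q1i[OF s]]]) (use x in auto)
      show "(\<lambda>z. \<bar>t - s\<bar> * gQ z) integrable_on {x..1}"
        by (rule integrable_on_mult_right[OF int[OF gQ]]) (use x in auto)
      show "norm (Q1 t z - Q1 s z) \<le> \<bar>t - s\<bar> * gQ z" if "z \<in> {x..1}" for z
        using tlipD(2)[OF Q1_b _ t s, of z] that x by auto
    qed
    moreover have "integral {x..1} (\<lambda>z. \<bar>t - s\<bar> * gQ z) \<le> \<bar>t - s\<bar> * I"
      using Ix[OF x] by (simp add: mult_left_mono)
    ultimately show "\<bar>P t x - P s x\<bar> \<le> \<bar>t - s\<bar> * (B + I)"
      using tlipD(2)[OF Q_b one t s] unfolding P_def distrib_left by auto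
  qed
  let ?E = "\<lambda>t x. P t x - Q t x"
  \<comment> \<open>The defect of P in the equation of Q. In its space derivative the terms with
    \<open>al\<close> times \<open>Q1\<close> cancel by the equation of \<open>Q1\<close>, leaving
    only the double integral of \<open>al1\<close> (P - Q).\<close>
  define R where "R t x = S t x + time_int2 (\<lambda>t x. al t x * P t x) t x - P t x" for t x
  let ?R1 = "\<lambda>t x. time_int2 (\<lambda>t x. al1 t x * ?E t x) t x"
  have cal: "tcont al x" "tcont al1 x" "tcont P x" "tcont Q x" "tcont Q1 x" if "x \<in> {a0..1}" for x
    using tlip_cont[OF al_b that] tlip_cont[OF al1_b that] tlip_cont[OF P_b that] tlip_cont[OF Q_b that]
      tlip_cont[OF Q1_b that] by auto
  have h_int: "(\<lambda>x. 2 * (g x * (B + I)) + 2 * (\<kappa> * gQ x)) absolutely_integrable_on {a0..1}"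
    by (intro set_integral_add set_integrable_mult_right set_integrable_mult_left g gQ)
  have R_prim: "prim a0 1 (R t) (?R1 t)" if t: "t \<in> {0..T}" for t
  proof -
    have p: "prim a0 1 (\<lambda>x. al t x * P t x) (\<lambda>x. al1 t x * P t x + al t x * Q1 t x)" if "t \<in> {0..T}" for t
      by (rule prim_mult[OF al[OF that] P_prim[OF that]])
    have tl: "tlip {a0..1} (\<lambda>x. 2 * (g x * (B + I)) + 2 * (\<kappa> * gQ x)) (\<lambda>t x. al1 t x * P t x + al t x * Q1 t x)"
      by (rule tlip_add[OF tlip_mult[OF al1_b P_b] tlip_mult[OF al_b Q1_b]])
    note tp = tlip_mult[OF al_b P_b]
    have "prim a0 1 (time_int2 (\<lambda>t x. al t x * P t x) t) (time_int2 (\<lambda>t x. al1 t x * P t x + al t x * Q1 t x) t)"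
      by (rule prim_time_int[OF tlip_time_int[OF tp] tlip_time_int[OF tl] h_int prim_time_int[OF tp tl h_int p] t])
    then have "prim a0 1 (R t) (\<lambda>x. S1 t x + time_int2 (\<lambda>t x. al1 t x * P t x + al t x * Q1 t x) t x - Q1 t x)"
      unfolding R_def by (intro prim_diff_fun prim_add S[OF t] P_prim[OF t])
    then show ?thesis
    proof (rule prim_cong)
      fix x assume "x \<in> {a0<..<1}"
      then have x: "x \<in> {a0..1}" by auto
      note c = cal[OF x]
      have "time_int2 (\<lambda>t x. al1 t x * ?E t x) t x = time_int2 (\<lambda>t x. al1 t x * P t x - al1 t x * Q t x) t x"
        by (simp add: right_diff_distrib)
      also have "\<dots> = time_int2 (\<lambda>t x. al1 t x * P t x) t x - time_int2 (\<lambda>t x. al1 t x * Q t x) t x"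
        by (rule time_int2_diff[OF tcont_mult[OF c(2,3)] tcont_mult[OF c(2,4)] t])
      finally show "S1 t x + time_int2 (\<lambda>t x. al1 t x * P t x + al t x * Q1 t x) t x - Q1 t x = ?R1 t x"
        using Q1[OF t x] time_int2_add[OF tcont_mult[OF c(2,3)] tcont_mult[OF c(1,5)] t] by simp
    qed simp
  qed
  have R_1: "R t 1 = 0" if t: "t \<in> {0..T}" for t
  proof -
    have P1: "P t 1 = Q t 1" for t by (simp add: P_def)
    have "time_int2 (\<lambda>t x. al t x * P t x) t 1 = time_int2 (\<lambda>t x. al t x * Q t x) t 1"
      by (simp add: time_int_def P1)
    then show ?thesis using Q[OF t one] P1 by (simp add: R_def)
  qed
  define J where "J = integral {a0..1} g"
  have g0: "0 \<le> g x" if "x \<in> {a0..1}" for x using tlip_nonneg[OF al1_b that] .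
  have J0: "0 \<le> J" unfolding J_def by (rule integral_nonneg[OF int[OF g]]) (use g0 in auto)
  have k0: "0 \<le> \<kappa>" using tlip_nonneg[OF al_b one] .
  \<comment> \<open>With this rate one passage through the equations multiplies the weighted bound
    on P - Q by (\<kappa> + J) / l \<le> 1/2. The mass J of the majorant of \<open>al1\<close> can
    be large, hence the exponential weight.\<close>
  define l where "l = 2 * (\<kappa> + J) + 1"
  have l: "1 \<le> l" "2 * (\<kappa> + J) \<le> l" using k0 J0 by (auto simp: l_def)
  have step: "\<bar>?E t x\<bar> \<le> N / 2 * exp (l * t)"
    if N: "\<And>s z. s \<in> {0..T} \<Longrightarrow> z \<in> {a0..1} \<Longrightarrow> \<bar>?E s z\<bar> \<le> N * exp (l * s)"
      and t: "t \<in> {0..T}" and x: "x \<in> {a0..1}" for N t x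
  proof -
    have "0 \<le> N * exp (l * 0)" using N[OF zero_time one] by linarith
    then have N0: "0 \<le> N" by simp
    have tE: "tcont ?E z" if "z \<in> {a0..1}" for z by (rule tcont_diff[OF cal(3,4)[OF that]])
    have conv: "c * N / l / l * exp (l * t) \<le> c * N / l * exp (l * t)" if "0 \<le> c" for c
    proof -
      have "0 \<le> c * N / l" using l(1) N0 that by simp
      then have "c * N / l / l \<le> c * N / l / 1" using l(1) by (intro divide_left_mono) auto
      then show ?thesis by (intro mult_right_mono) auto
    qed
    have b1: "\<bar>time_int2 (\<lambda>t x. al t x * ?E t x) t x\<bar> \<le> (\<kappa> * N) / l / l * exp (l * t)"
    proof (rule time_int2_exp_bound[OF tcont_mult[OF cal(1)[OF x] tE[OF x]] t])
      fix s assume s: "s \<in> {0..T}"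
      have "\<bar>al s x\<bar> * \<bar>?E s x\<bar> \<le> \<kappa> * (N * exp (l * s))"
        using tlipD(1)[OF al_b x s] N[OF s x] k0 by (intro mult_mono) auto
      then show "\<bar>al s x * ?E s x\<bar> \<le> \<kappa> * N * exp (l * s)" by (simp add: abs_mult mult.assoc)
    qed (use l k0 N0 in auto)
    have b2: "\<bar>?R1 t z\<bar> \<le> g z * (N / l * exp (l * t))" if z: "z \<in> {a0..1}" for z
    proof -
      have "\<bar>?R1 t z\<bar> \<le> (g z * N) / l / l * exp (l * t)"
      proof (rule time_int2_exp_bound[OF tcont_mult[OF cal(2)[OF z] tE[OF z]] t])
        fix s assume s: "s \<in> {0..T}"
        have "\<bar>al1 s z\<bar> * \<bar>?E s z\<bar> \<le> g z * (N * exp (l * s))"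
          using tlipD(1)[OF al1_b z s] N[OF s z] g0[OF z] by (intro mult_mono) auto
        then show "\<bar>al1 s z * ?E s z\<bar> \<le> g z * N * exp (l * s)" by (simp add: abs_mult mult.assoc)
      qed (use l g0[OF z] N0 in auto)
      also have "\<dots> \<le> g z * N / l * exp (l * t)" by (rule conv[OF g0[OF z]])
      finally show ?thesis by simp
    qed
    have b3: "\<bar>R t x\<bar> \<le> J * (N / l * exp (l * t))"
    proof -
      have "R t x = - integral {x..1} (?R1 t)"
        using prim_diff[OF R_prim[OF t], of x 1] x R_1[OF t] by auto
      then have "\<bar>R t x\<bar> = norm (integral {x..1} (?R1 t))" by simp
      also have "\<dots> \<le> integral {x..1} (\<lambda>z. g z * (N / l * exp (l * t)))"
        by (rule integral_norm_bound_integral[OF int[OF prim_integrable[OF R_prim[OF t]]] integrable_on_mult_left[OF int[OF g]]])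
           (use x b2 in auto)
      also have "\<dots> = integral {x..1} g * (N / l * exp (l * t))" by simp
      also have "\<dots> \<le> J * (N / l * exp (l * t))"
        unfolding J_def
        by (intro mult_right_mono integral_subset_le int[OF g]) (use x g0 l N0 in auto)
      finally show ?thesis .
    qed
    have "?E t x = time_int2 (\<lambda>t x. al t x * ?E t x) t x - R t x"
    proof -
      have "time_int2 (\<lambda>t x. al t x * ?E t x) t x = time_int2 (\<lambda>t x. al t x * P t x - al t x * Q t x) t x"
        by (simp add: right_diff_distrib)
      also have "\<dots> = time_int2 (\<lambda>t x. al t x * P t x) t x - time_int2 (\<lambda>t x. al t x * Q t x) t x"
        by (rule time_int2_diff[OF tcont_mult[OF cal(1,3)[OF x]] tcont_mult[OF cal(1,4)[OF x]] t])
      finally show ?thesis using Q[OF t x] by (simp add: R_def)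
    qed
    then have "\<bar>?E t x\<bar> \<le> \<kappa> * N / l * exp (l * t) + J * (N / l * exp (l * t))"
      using b1 b3 conv[OF k0] by linarith
    also have "\<dots> = ((\<kappa> + J) / l) * (N * exp (l * t))" by (simp add: add_divide_distrib algebra_simps)
    also have "\<dots> \<le> (1 / 2) * (N * exp (l * t))"
      using l N0 by (intro mult_right_mono) (auto simp: divide_le_eq)
    finally show ?thesis by simp
  qed
  have "\<bar>?E s z\<bar> \<le> (2 * B + I) / 2 ^ n * exp (l * s)" if "s \<in> {0..T}" "z \<in> {a0..1}" for n :: nat and s z
    using that
  proof (induction n arbitrary: s z rule: nat_induct)
    case 0
    have "\<bar>?E s z\<bar> \<le> 2 * B + I" using tlipD(1)[OF P_b 0(2,1)] tlipD(1)[OF Q_b 0(2,1)] by linarith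
    also have "\<dots> \<le> (2 * B + I) * exp (l * s)"
    proof -
      have "0 \<le> 2 * B + I" using tlip_nonneg[OF P_b one] tlip_nonneg[OF Q_b one] by linarith
      moreover have "1 \<le> exp (l * s)" using l 0(1) by simp
      ultimately show ?thesis by (simp add: mult_le_cancel_left1)
    qed
    finally show ?case by simp
  next
    case (Suc n)
    have "\<bar>?E s z\<bar> \<le> (2 * B + I) / 2 ^ n / 2 * exp (l * s)"
      by (rule step[OF Suc.IH Suc.prems])
    then show ?case by (simp add: mult.commute)
  qed
  then have "?E t x = 0" if "x \<in> {a0..1}" for x
    using halving_zero[of "?E t x" "(2 * B + I) * exp (l * t)"] that t by simp
  then show ?thesis by (intro prim_cong[OF P_prim[OF t]]) auto
qed

end

section \<open>Hardy's inequality\<close>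

text \<open>On [e, 1], integrate (H / x)^2 by parts using the primitive - 1/x of 1/x^2. The boundary
  term H(e)^2 / e is bounded by Cauchy-Schwarz, and half of the left side is absorbed. The bound
  does not depend on e, so monotone convergence reaches 0.\<close>

lemma Hardy_L2:
  assumes G: "G \<in> L2"
  shows "(\<lambda>x. integral {0..x} (\<lambda>z. \<bar>G z\<bar>) / x) \<in> L2"
proof -
  define H where "H x = integral {0..x} (\<lambda>z. \<bar>G z\<bar>)" for x
  define N where "N = L2_norm G"
  have GL: "(\<lambda>z. \<bar>G z\<bar>) \<in> L2" by (rule L2_bound[OF G]) (use L2_measurable[OF G] in auto)
  have Gn: "L2_norm (\<lambda>z. \<bar>G z\<bar>) = N" by (simp add: N_def L2_norm_def)
  have Hp: "prim 0 1 H (\<lambda>z. \<bar>G z\<bar>)" unfolding H_def[abs_def] using L2_prim[OF GL, of 0] by simp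
  have Hb: "(H x)\<^sup>2 \<le> x * N\<^sup>2" if x: "x \<in> {0..1}" for x
  proof -
    have "0 \<le> x" "x \<le> 1" using x by auto
    from L2_integral_bound[OF GL order.refl this] have "\<bar>H x\<bar> \<le> sqrt x * N"
      unfolding H_def Gn by simp
    then have "\<bar>H x\<bar>\<^sup>2 \<le> (sqrt x * N)\<^sup>2" by (intro power_mono) auto
    then show ?thesis using x by (simp add: power_mult_distrib)
  qed
  have G2: "(\<lambda>z. (G z)\<^sup>2) absolutely_integrable_on {0..1}" "integral {0..1} (\<lambda>z. (G z)\<^sup>2) = N\<^sup>2"
    using L2_square[OF G] integrable01_iff integral01_eq[OF L2_square[OF G]] by (auto simp: N_def L2_norm_square)
  have bound: "integral {e..1} (\<lambda>x. (H x / x)\<^sup>2) \<le> 6 * N\<^sup>2"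
    and int: "(\<lambda>x. (H x / x)\<^sup>2) integrable_on {e..1}" if e: "0 < e" "e \<le> 1" for e
  proof -
    have Hp': "prim e 1 H (\<lambda>z. \<bar>G z\<bar>)" by (rule prim_sub[OF Hp]) (use e in auto)
    have Hc: "continuous_on {e..1} H" by (rule prim_cont[OF Hp'])
    have "prim e 1 (\<lambda>x. - (1 / x)) (\<lambda>x. 1 / x\<^sup>2)"
      by (rule prim_of_deriv) (use e in \<open>auto intro!: derivative_eq_intros continuous_intros simp: power2_eq_square\<close>)
    note p = prim_mult[OF prim_mult[OF Hp' Hp'] this]
    have i1: "(\<lambda>x. (H x / x)\<^sup>2) integrable_on {e..1}"
      using e by (intro integrable_continuous_real continuous_intros Hc) auto
    then show "(\<lambda>x. (H x / x)\<^sup>2) integrable_on {e..1}" .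
    have i2: "(\<lambda>x. \<bar>G x\<bar> * (H x / x)) integrable_on {e..1}"
      using e by (intro set_lebesgue_integral_eq_integral(1) abs_integrable_cont_mult(1) prim_integrable[OF Hp'] continuous_intros Hc) auto
    have i3: "(\<lambda>x. (G x)\<^sup>2) integrable_on {e..1}"
      using absolutely_integrable_on_subinterval[OF G2(1), of e 1] e set_lebesgue_integral_eq_integral(1) by auto
    have "(H 1 * H 1) * - (1 / 1) - (H e * H e) * - (1 / e) =
        integral {e..1} (\<lambda>x. (\<bar>G x\<bar> * H x + H x * \<bar>G x\<bar>) * - (1 / x) + (H x * H x) * (1 / x\<^sup>2))"
      using prim_diff[OF p, of e 1] e by simp
    also have "\<dots> = integral {e..1} (\<lambda>x. (H x / x)\<^sup>2 - 2 * (\<bar>G x\<bar> * (H x / x)))"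
      by (rule integral_cong) (use e in \<open>auto simp: field_simps power2_eq_square\<close>)
    also have "\<dots> = integral {e..1} (\<lambda>x. (H x / x)\<^sup>2) - 2 * integral {e..1} (\<lambda>x. \<bar>G x\<bar> * (H x / x))"
      by (simp only: Henstock_Kurzweil_Integration.integral_diff[OF i1 integrable_on_mult_right[OF i2]]
          Henstock_Kurzweil_Integration.integral_mult_right)
    finally have I: "integral {e..1} (\<lambda>x. (H x / x)\<^sup>2) = (H e)\<^sup>2 / e - (H 1)\<^sup>2 + 2 * integral {e..1} (\<lambda>x. \<bar>G x\<bar> * (H x / x))"
      by (simp add: power2_eq_square)
    \<comment> \<open>Young's inequality with weight 1/4, so that after doubling only half of the
      integral of (H / x)^2 appears on the right; this gives 6 = 2 (1 + 2).\<close>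
    have "integral {e..1} (\<lambda>x. \<bar>G x\<bar> * (H x / x)) \<le> integral {e..1} (\<lambda>x. 1 / 4 * (H x / x)\<^sup>2 + (G x)\<^sup>2)"
    proof (rule integral_le[OF i2])
      show "(\<lambda>x. 1 / 4 * (H x / x)\<^sup>2 + (G x)\<^sup>2) integrable_on {e..1}"
        by (intro Henstock_Kurzweil_Integration.integrable_add integrable_on_mult_right i1 i3)
      fix x
      have "0 \<le> (\<bar>G x\<bar> - 1 / 2 * (H x / x))\<^sup>2" by simp
      also have "\<dots> = (G x)\<^sup>2 - \<bar>G x\<bar> * (H x / x) + 1 / 4 * (H x / x)\<^sup>2"
        unfolding power2_diff power_mult_distrib by (simp add: power2_eq_square)
      finally show "\<bar>G x\<bar> * (H x / x) \<le> 1 / 4 * (H x / x)\<^sup>2 + (G x)\<^sup>2" by linarith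
    qed
    also have "\<dots> = 1 / 4 * integral {e..1} (\<lambda>x. (H x / x)\<^sup>2) + integral {e..1} (\<lambda>x. (G x)\<^sup>2)"
      by (subst Henstock_Kurzweil_Integration.integral_add[OF integrable_on_mult_right[OF i1] i3]) simp
    also have "integral {e..1} (\<lambda>x. (G x)\<^sup>2) \<le> N\<^sup>2"
      unfolding G2(2)[symmetric] using G2(1) set_lebesgue_integral_eq_integral(1) e
      by (intro integral_subset_le i3) auto
    finally have "2 * integral {e..1} (\<lambda>x. \<bar>G x\<bar> * (H x / x)) \<le> 1 / 2 * integral {e..1} (\<lambda>x. (H x / x)\<^sup>2) + 2 * N\<^sup>2"
      by simp
    moreover have "(H e)\<^sup>2 / e \<le> N\<^sup>2" using Hb[of e] e by (simp add: pos_divide_le_eq mult.commute)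
    moreover have "0 \<le> (H 1)\<^sup>2" by simp
    ultimately show "integral {e..1} (\<lambda>x. (H x / x)\<^sup>2) \<le> 6 * N\<^sup>2" using I by linarith
  qed
  let ?e = "\<lambda>k::nat. 1 / (real k + 1)"
  have e: "0 < ?e k" "?e k \<le> 1" "?e (Suc k) \<le> ?e k" for k by (auto simp: field_simps)
  let ?f = "\<lambda>(k::nat) x. if x \<in> {?e k..1} then (H x / x)\<^sup>2 else 0"
  have res: "{?e k..1} \<inter> {0..1} = {?e k..1}" for k using e(1)[of k] by auto
  have "(\<lambda>x. (H x / x)\<^sup>2) integrable_on {0..1} \<and> (\<lambda>k. integral {0..1} (?f k)) \<longlonglongrightarrow> integral {0..1} (\<lambda>x. (H x / x)\<^sup>2)"
  proof (rule monotone_convergence_increasing)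
    show "?f k integrable_on {0..1}" for k
      using int[OF e(1,2)[of k]] integrable_restrict_Int[of "{?e k..1}" "\<lambda>x. (H x / x)\<^sup>2" "{0..1}"] res[of k] by simp
    show "?f k x \<le> ?f (Suc k) x" for k and x :: real using e(3)[of k] by auto
    show "(\<lambda>k. ?f k x) \<longlonglongrightarrow> (H x / x)\<^sup>2" if x: "x \<in> {0..1}" for x :: real
    proof (cases "x = 0")
      case True
      then have "?f k x = (H x / x)\<^sup>2" for k by simp
      then show ?thesis by simp
    next
      case False
      then obtain n :: nat where n: "1 / x < real n" using reals_Archimedean2 by blast
      show ?thesis
      proof (rule tendsto_eventually, rule eventually_sequentiallyI[of n])
        fix k assume "n \<le> k"
        then have "1 / x \<le> real k + 1" using n by linarith
        then have "?e k \<le> x" using False x by (simp add: field_simps)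
        then show "?f k x = (H x / x)\<^sup>2" using x by auto
      qed
    qed
    show "bounded (range (\<lambda>k. integral {0..1} (?f k)))"
    proof (rule boundedI)
      fix y assume "y \<in> range (\<lambda>k. integral {0..1} (?f k))"
      then obtain k where y: "y = integral {0..1} (?f k)" by blast
      also have "\<dots> = integral {?e k..1} (\<lambda>x. (H x / x)\<^sup>2)"
        using Henstock_Kurzweil_Integration.integral_restrict_Int[of "{0..1}" "{?e k..1}" "\<lambda>x. (H x / x)\<^sup>2"] res[of k] by simp
      finally show "norm y \<le> 6 * N\<^sup>2"
        using bound[OF e(1,2)[of k]] integral_nonneg[OF int[OF e(1,2)[of k]]] by simp
    qed
  qed
  then have "(\<lambda>x. (H x / x)\<^sup>2) absolutely_integrable_on {0..1}"
    by (intro nonnegative_absolutely_integrable_1) auto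
  then have "integrable lebesgue01 (\<lambda>x. (H x / x)\<^sup>2)" by (simp add: integrable01_iff)
  moreover have "continuous_on {0<..<1} H"
    by (rule continuous_on_subset[OF prim_cont[OF Hp]]) auto
  then have "continuous_on {0<..<1} (\<lambda>x. H x / x)" by (intro continuous_intros) auto
  then have "(\<lambda>x. H x / x) \<in> borel_measurable lebesgue01"
    by (intro continuous_imp_measurable_on_sets_lebesgue) auto
  ultimately show ?thesis by (simp add: L2_def H_def)
qed

text \<open>Descending induction on the order. Integration from 0 gains one power of x while the L2
  profile G is replaced by its average, which is in L2 by Hardy. Cauchy-Schwarz gives the pointwise
  version, with half a power less.\<close>

lemma chain_weighted_bound:
  assumes F: "chain m F" and j: "j \<le> m"
  shows "\<exists>G\<in>L2. (\<forall>x\<in>{0<..1}. \<bar>F j x\<bar> \<le> x ^ (m - j) * \<bar>G x\<bar>) \<and>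
    (j < m \<longrightarrow> (\<exists>K. \<forall>x\<in>{0<..1}. \<bar>F j x\<bar> \<le> K * (x ^ (m - j) / sqrt x)))"
  using j
proof (induction j rule: inc_induct)
  case base
  then show ?case using chain_L2[OF F, of m] by (intro bexI[of _ "F m"]) auto
next
  case (step j)
  then obtain G where G: "G \<in> L2" "\<And>x. x \<in> {0<..1} \<Longrightarrow> \<bar>F (Suc j) x\<bar> \<le> x ^ (m - Suc j) * \<bar>G x\<bar>" by blast
  note c = chainD[OF F, of j]
  define H where "H x = integral {0..x} (\<lambda>z. \<bar>G z\<bar>)" for x
  have GL: "(\<lambda>z. \<bar>G z\<bar>) \<in> L2" by (rule L2_bound[OF G(1)]) (use L2_measurable[OF G(1)] in auto)
  have key: "\<bar>F j x\<bar> \<le> x ^ (m - Suc j) * H x" if x: "x \<in> {0<..1}" for x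
  proof -
    have gi: "(\<lambda>z. \<bar>G z\<bar>) integrable_on {0..x}"
      using prim_integrable_sub[OF L2_prim[OF GL, of 0], of 0 x] x set_lebesgue_integral_eq_integral(1) by auto
    have fi: "F (Suc j) integrable_on {0..x}"
      using prim_integrable_sub[OF c(1), of 0 x] x step set_lebesgue_integral_eq_integral(1) by auto
    have "F j x = integral {0..x} (F (Suc j))" using prim_diff[OF c(1), of 0 x] c(2) x step by auto
    also have "norm \<dots> \<le> integral {0..x} (\<lambda>z. x ^ (m - Suc j) * \<bar>G z\<bar>)"
    proof -
      \<comment> \<open>The bound on \<open>F (Suc j)\<close> is available only for z > 0, hence the
        open interval.\<close>
      have "norm (integral {0<..<x} (F (Suc j))) \<le> integral {0<..<x} (\<lambda>z. x ^ (m - Suc j) * \<bar>G z\<bar>)"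
      proof (rule integral_norm_bound_integral)
        show "F (Suc j) integrable_on {0<..<x}" using fi integrable_on_open_interval_real by blast
        show "(\<lambda>z. x ^ (m - Suc j) * \<bar>G z\<bar>) integrable_on {0<..<x}"
          using integrable_on_mult_right[OF gi] integrable_on_open_interval_real by blast
        fix z assume z: "z \<in> {0<..<x}"
        then have "\<bar>F (Suc j) z\<bar> \<le> z ^ (m - Suc j) * \<bar>G z\<bar>" using G(2)[of z] x by auto
        also have "\<dots> \<le> x ^ (m - Suc j) * \<bar>G z\<bar>" using z by (intro mult_right_mono power_mono) auto
        finally show "norm (F (Suc j) z) \<le> x ^ (m - Suc j) * \<bar>G z\<bar>" by simp
      qed
      then show ?thesis by (simp add: integral_open_interval_real)
    qed
    finally show ?thesis by (simp add: H_def)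
  qed
  have m: "m - j = Suc (m - Suc j)" using step by auto
  show ?case
  proof (intro bexI conjI ballI impI exI)
    show "(\<lambda>x. H x / x) \<in> L2" unfolding H_def by (rule Hardy_L2[OF G(1)])
    fix x :: real assume x: "x \<in> {0<..1}"
    have "x ^ (m - Suc j) * H x = x ^ (m - j) * (H x / x)" using x by (simp add: m)
    also have "\<dots> \<le> x ^ (m - j) * \<bar>H x / x\<bar>"
      by (rule mult_left_mono[OF abs_ge_self]) (use x in simp)
    finally show "\<bar>F j x\<bar> \<le> x ^ (m - j) * \<bar>H x / x\<bar>" using key[OF x] by simp
  next
    fix x :: real assume x: "x \<in> {0<..1}"
    have "H x \<le> sqrt x * L2_norm (\<lambda>z. \<bar>G z\<bar>)"
      using L2_integral_bound[OF GL, of 0 x] x by (simp add: H_def)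
    then have "x ^ (m - Suc j) * H x \<le> x ^ (m - Suc j) * (sqrt x * L2_norm (\<lambda>z. \<bar>G z\<bar>))"
      using x by (intro mult_left_mono) auto
    also have "x ^ (m - Suc j) * (sqrt x * L2_norm (\<lambda>z. \<bar>G z\<bar>)) = L2_norm (\<lambda>z. \<bar>G z\<bar>) * (x ^ (m - j) / sqrt x)"
    proof -
      have "x ^ (m - j) / sqrt x = x ^ (m - Suc j) * (x / sqrt x)" by (simp add: m)
      also have "x / sqrt x = sqrt x" using x by (simp add: real_div_sqrt)
      finally show ?thesis by (simp only: mult_ac)
    qed
    finally show "\<bar>F j x\<bar> \<le> L2_norm (\<lambda>z. \<bar>G z\<bar>) * (x ^ (m - j) / sqrt x)" using key[OF x] by simp
  qed
qed

section \<open>Weighted Sobolev classes\<close>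

context time_interval
begin

definition dominated :: "nat \<Rightarrow> (real \<Rightarrow> real \<Rightarrow> real) \<Rightarrow> bool" where
  "dominated l f \<longleftrightarrow> meas f \<and> (\<exists>G\<in>L2. tlip {0<..1} (\<lambda>x. x ^ l * G x) f)"

text \<open>Pointwise counterpart of \<open>dominated\<close> for functions that still have a
  derivative: integrating from 0 a density in the weighted class of order l - 1 yields x^l / sqrt x.
  For l \<ge> 1 this gives boundedness and the limit 0 at 0.\<close>

definition half_bounded :: "nat \<Rightarrow> (real \<Rightarrow> real \<Rightarrow> real) \<Rightarrow> bool" where
  "half_bounded l f \<longleftrightarrow> (\<exists>K. tlip {0<..1} (\<lambda>x. K * (x ^ l / sqrt x)) f)"

definition bounded_tlip :: "(real \<Rightarrow> real \<Rightarrow> real) \<Rightarrow> bool" where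
  "bounded_tlip f \<longleftrightarrow> meas f \<and> (\<exists>K. tlip {0<..1} (\<lambda>_. K) f)"

text \<open>Restricted to [a, 1] with a > 0 because h / z need not be integrable up to 0. The end
  point 0 enters only when Eulerian chains are formed, through
  \<open>prim_from_interior\<close>.\<close>

definition theta :: "(real \<Rightarrow> real \<Rightarrow> real) \<Rightarrow> (real \<Rightarrow> real \<Rightarrow> real) \<Rightarrow> bool" where
  "theta f h \<longleftrightarrow> (\<forall>t\<in>{0..T}. \<forall>a\<in>{0<..<1}. prim a 1 (f t) (\<lambda>z. h t z / z))"

text \<open>
  \<open>Wk k l f\<close>: the iterates \<open>(x \<partial>\<^sub>x)\<^sup>j f\<close>, \<open>j \<le> k\<close>, lie in \<open>x\<^sup>l L\<^sup>2\<close>, Lipschitz in time, and those with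
  \<open>j < k\<close> vanish at \<open>1\<close>; \<open>theta f h\<close> says that \<open>h = x \<partial>\<^sub>xf\<close> weakly. The operator \<open>x \<partial>\<^sub>x\<close> preserves the weight. \<open>Bk k l\<close> consists of multipliers.
\<close>

primrec Wk :: "nat \<Rightarrow> nat \<Rightarrow> (real \<Rightarrow> real \<Rightarrow> real) \<Rightarrow> bool" where
  "Wk 0 l f \<longleftrightarrow> dominated l f"
| "Wk (Suc k) l f \<longleftrightarrow> dominated l f \<and> half_bounded l f \<and> (\<forall>t\<in>{0..T}. f t 1 = 0) \<and> (\<exists>h. Wk k l h \<and> theta f h)"

primrec Bk :: "nat \<Rightarrow> nat \<Rightarrow> (real \<Rightarrow> real \<Rightarrow> real) \<Rightarrow> bool" where
  "Bk 0 l f \<longleftrightarrow> bounded_tlip f"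
| "Bk (Suc k) l f \<longleftrightarrow> bounded_tlip f \<and> (\<exists>h. Wk k l h \<and> theta f h)"

lemma dominatedI: "meas f \<Longrightarrow> G \<in> L2 \<Longrightarrow> tlip {0<..1} (\<lambda>x. x ^ l * G x) f \<Longrightarrow> dominated l f"
  unfolding dominated_def by blast

lemma half_boundedI: "tlip {0<..1} (\<lambda>x. K * (x ^ l / sqrt x)) f \<Longrightarrow> half_bounded l f"
  unfolding half_bounded_def by blast

lemma Wk_dominated: "Wk k l f \<Longrightarrow> dominated l f"
  and Bk_bounded: "Bk k l f \<Longrightarrow> bounded_tlip f"
  by (cases k; simp)+

section \<open>Closure properties of the weighted classes\<close>

lemma dominated_L2:
  assumes "dominated l f" "t \<in> {0..T}" shows "f t \<in> L2"
proof -
  obtain G where G: "G \<in> L2" "tlip {0<..1} (\<lambda>x. x ^ l * G x) f" using assms(1) by (auto simp: dominated_def)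
  show ?thesis
  proof (rule L2_bound[OF G(1)])
    show "f t \<in> borel_measurable lebesgue01" using assms by (auto simp: dominated_def meas_def)
    fix x :: real assume x: "x \<in> {0<..<1}"
    have "\<bar>f t x\<bar> \<le> x ^ l * G x" using tlipD(1)[OF G(2) _ assms(2), of x] x by auto
    also have "\<dots> \<le> x ^ l * \<bar>G x\<bar>" using x by (intro mult_left_mono) auto
    also have "\<dots> \<le> 1 * \<bar>G x\<bar>" using x by (intro mult_right_mono power_le_one) auto
    finally show "\<bar>f t x\<bar> \<le> \<bar>G x\<bar>" by simp
  qed
qed

lemma dominated_add:
  assumes "dominated l f" "dominated l g" shows "dominated l (\<lambda>t x. f t x + g t x)"
proof -
  obtain F where F: "F \<in> L2" "tlip {0<..1} (\<lambda>x. x ^ l * F x) f" "meas f" using assms(1) by (auto simp: dominated_def)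
  obtain G where G: "G \<in> L2" "tlip {0<..1} (\<lambda>x. x ^ l * G x) g" "meas g" using assms(2) by (auto simp: dominated_def)
  show ?thesis
    by (rule dominatedI[OF meas_add[OF F(3) G(3)] L2_add[OF F(1) G(1)] tlip_add[OF F(2) G(2), folded distrib_left]])
qed

lemma dominated_mult:
  assumes "dominated l f" "bounded_tlip g" shows "dominated l (\<lambda>t x. f t x * g t x)"
proof -
  obtain F where F: "F \<in> L2" "tlip {0<..1} (\<lambda>x. x ^ l * F x) f" "meas f" using assms(1) by (auto simp: dominated_def)
  obtain K where K: "tlip {0<..1} (\<lambda>_. K) g" "meas g" using assms(2) by (auto simp: bounded_tlip_def)
  have "tlip {0<..1} (\<lambda>x. x ^ l * ((2 * K) * F x)) (\<lambda>t x. f t x * g t x)"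
    by (rule tlip_mono[OF tlip_mult[OF F(2) K(1)]]) simp
  then show ?thesis
    by (rule dominatedI[OF meas_mult[OF F(3) K(2)] L2_cmult[OF F(1), of "2 * K"]])
qed

lemma dominated_time_int: "dominated l f \<Longrightarrow> dominated l (time_int f)"
  unfolding dominated_def using meas_time_int tlip_time_int by blast

lemma dominated_recip:
  assumes "dominated (Suc l) f" shows "dominated l (\<lambda>t x. (1 / x) * f t x)"
proof -
  obtain F where F: "F \<in> L2" "tlip {0<..1} (\<lambda>x. x ^ Suc l * F x) f" "meas f" using assms by (auto simp: dominated_def)
  have "tlip {0<..1} (\<lambda>x. x ^ l * F x) (\<lambda>t x. (1 / x) * f t x)"
    by (rule tlip_mono[OF tlip_scale[OF F(2)]]) simp
  moreover have "continuous_on {0<..<1} (\<lambda>x::real. 1 / x)" by (intro continuous_intros) auto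
  then have "(\<lambda>x::real. 1 / x) \<in> borel_measurable lebesgue01" by (intro continuous_imp_measurable_on_sets_lebesgue) auto
  then have "meas (\<lambda>t x. (1 / x) * f t x)"
    using F(3) unfolding meas_def by (blast intro: borel_measurable_times)
  ultimately show ?thesis using dominatedI F(1) by blast
qed

lemma power_weight_mono: "l' \<le> l \<Longrightarrow> x \<in> {0<..1} \<Longrightarrow> (x::real) ^ l \<le> x ^ l'"
  by (rule power_decreasing) auto

lemma dominated_mono:
  assumes "dominated l f" "l' \<le> l" shows "dominated l' f"
proof -
  obtain F where F: "F \<in> L2" "tlip {0<..1} (\<lambda>x. x ^ l * F x) f" "meas f" using assms(1) by (auto simp: dominated_def)
  have "tlip {0<..1} (\<lambda>x. x ^ l' * F x) f"
  proof (rule tlip_mono[OF F(2)])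
    fix x :: real assume x: "x \<in> {0<..1}"
    then have "0 < x ^ l" by simp
    then have "0 \<le> F x" using tlip_nonneg[OF F(2) x] by (simp add: zero_le_mult_iff)
    then show "x ^ l * F x \<le> x ^ l' * F x" using power_weight_mono[OF assms(2) x] by (rule mult_right_mono[rotated])
  qed
  then show ?thesis by (rule dominatedI[OF F(3,1)])
qed

lemma half_bounded_add: "half_bounded l f \<Longrightarrow> half_bounded l g \<Longrightarrow> half_bounded l (\<lambda>t x. f t x + g t x)"
proof -
  assume "half_bounded l f" "half_bounded l g"
  then obtain C D where "tlip {0<..1} (\<lambda>x. C * (x ^ l / sqrt x)) f" "tlip {0<..1} (\<lambda>x. D * (x ^ l / sqrt x)) g"
    by (auto simp: half_bounded_def)
  from half_boundedI[OF tlip_add[OF this, folded distrib_right]]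
  show "half_bounded l (\<lambda>t x. f t x + g t x)" .
qed

lemma half_bounded_mult:
  assumes "half_bounded l f" "bounded_tlip g" shows "half_bounded l (\<lambda>t x. f t x * g t x)"
proof -
  obtain C K where C: "tlip {0<..1} (\<lambda>x. C * (x ^ l / sqrt x)) f" and K: "tlip {0<..1} (\<lambda>_. K) g"
    using assms by (auto simp: half_bounded_def bounded_tlip_def)
  have "tlip {0<..1} (\<lambda>x. (2 * K * C) * (x ^ l / sqrt x)) (\<lambda>t x. f t x * g t x)"
    by (rule tlip_mono[OF tlip_mult[OF C K]]) (simp add: mult_ac)
  then show ?thesis by (rule half_boundedI)
qed

lemma half_bounded_time_int: "half_bounded l f \<Longrightarrow> half_bounded l (time_int f)"
  unfolding half_bounded_def using tlip_time_int by blast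

lemma half_bounded_recip:
  assumes "half_bounded (Suc l) f" shows "half_bounded l (\<lambda>t x. (1 / x) * f t x)"
proof -
  obtain C where C: "tlip {0<..1} (\<lambda>x. C * (x ^ Suc l / sqrt x)) f" using assms by (auto simp: half_bounded_def)
  have "tlip {0<..1} (\<lambda>x. C * (x ^ l / sqrt x)) (\<lambda>t x. (1 / x) * f t x)"
    by (rule tlip_mono[OF tlip_scale[OF C]]) simp
  then show ?thesis by (rule half_boundedI)
qed

lemma half_bounded_mono:
  assumes "half_bounded l f" "l' \<le> l" shows "half_bounded l' f"
proof -
  obtain C where C: "tlip {0<..1} (\<lambda>x. C * (x ^ l / sqrt x)) f" using assms by (auto simp: half_bounded_def)
  have "0 \<le> C" using tlip_nonneg[OF C, of 1] by simp
  have "tlip {0<..1} (\<lambda>x. C * (x ^ l' / sqrt x)) f"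
    by (rule tlip_mono[OF C]) (use \<open>0 \<le> C\<close> power_weight_mono[OF assms(2)] in \<open>auto intro!: mult_left_mono divide_right_mono\<close>)
  then show ?thesis by (rule half_boundedI)
qed

lemma half_bounded_bounded:
  assumes "half_bounded l f" "1 \<le> l" "meas f" shows "bounded_tlip f"
proof -
  obtain C where C: "tlip {0<..1} (\<lambda>x. C * (x ^ 1 / sqrt x)) f"
    using half_bounded_mono[OF assms(1,2)] by (auto simp: half_bounded_def)
  have "0 \<le> C" using tlip_nonneg[OF C, of 1] by simp
  have "tlip {0<..1} (\<lambda>_. C) f"
  proof (rule tlip_mono[OF C])
    fix x :: real assume x: "x \<in> {0<..1}"
    have "x ^ 1 / sqrt x = sqrt x" using x by (simp add: real_div_sqrt)
    then show "C * (x ^ 1 / sqrt x) \<le> C" using x \<open>0 \<le> C\<close> by (simp add: mult_left_le)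
  qed
  then show ?thesis using assms(3) unfolding bounded_tlip_def by blast
qed

lemma bounded_tlipE:
  assumes "bounded_tlip f" obtains K where "meas f" "tlip {0<..1} (\<lambda>_. K) f"
  using assms unfolding bounded_tlip_def by auto

lemma bounded_tlipI: "meas f \<Longrightarrow> tlip {0<..1} (\<lambda>_. K) f \<Longrightarrow> bounded_tlip f"
  unfolding bounded_tlip_def by auto

lemma bounded_mult:
  assumes "bounded_tlip f" "bounded_tlip g" shows "bounded_tlip (\<lambda>t x. f t x * g t x)"
proof -
  obtain K where K: "meas f" "tlip {0<..1} (\<lambda>_. K) f" using bounded_tlipE[OF assms(1)] .
  obtain L where L: "meas g" "tlip {0<..1} (\<lambda>_. L) g" using bounded_tlipE[OF assms(2)] .
  show ?thesis by (rule bounded_tlipI[OF meas_mult[OF K(1) L(1)] tlip_mult[OF K(2) L(2)]])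
qed

lemma bounded_const: "bounded_tlip (\<lambda>t x. c)"
proof (rule bounded_tlipI)
  show "meas (\<lambda>t x. c)" unfolding meas_def by simp
  show "tlip {0<..1} (\<lambda>_. \<bar>c\<bar>) (\<lambda>t x. c)" by (rule tlip_const_time) simp
qed

lemma bounded_time_int:
  assumes "bounded_tlip f" shows "bounded_tlip (time_int f)"
proof -
  obtain K where K: "meas f" "tlip {0<..1} (\<lambda>_. K) f" using bounded_tlipE[OF assms] .
  show ?thesis by (rule bounded_tlipI[OF meas_time_int[OF K] tlip_time_int[OF K(2)]])
qed

section \<open>Calculus of the operator x d/dx\<close>

lemma thetaD: "theta f h \<Longrightarrow> t \<in> {0..T} \<Longrightarrow> 0 < a \<Longrightarrow> a < 1 \<Longrightarrow> prim a 1 (f t) (\<lambda>z. h t z / z)"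
  unfolding theta_def by auto

lemma thetaI: "(\<And>t a. t \<in> {0..T} \<Longrightarrow> 0 < a \<Longrightarrow> a < 1 \<Longrightarrow> prim a 1 (f t) (\<lambda>z. h t z / z)) \<Longrightarrow> theta f h"
  unfolding theta_def by auto

lemma theta_add: "theta f h \<Longrightarrow> theta g k \<Longrightarrow> theta (\<lambda>t x. f t x + g t x) (\<lambda>t x. h t x + k t x)"
proof (rule thetaI)
  fix t a :: real assume "theta f h" "theta g k" "t \<in> {0..T}" "0 < a" "a < 1"
  from prim_add[OF thetaD[OF this(1,3-5)] thetaD[OF this(2,3-5)]]
  show "prim a 1 (\<lambda>x. f t x + g t x) (\<lambda>z. (h t z + k t z) / z)" by (simp add: add_divide_distrib)
qed

lemma theta_mult: "theta f h \<Longrightarrow> theta g k \<Longrightarrow> theta (\<lambda>t x. f t x * g t x) (\<lambda>t x. h t x * g t x + f t x * k t x)"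
proof (rule thetaI)
  fix t a :: real assume "theta f h" "theta g k" "t \<in> {0..T}" "0 < a" "a < 1"
  from prim_mult[OF thetaD[OF this(1,3-5)] thetaD[OF this(2,3-5)]]
  show "prim a 1 (\<lambda>x. f t x * g t x) (\<lambda>z. (h t z * g t z + f t z * k t z) / z)" by (simp add: add_divide_distrib)
qed

lemma theta_const: "theta (\<lambda>t x. c) (\<lambda>t x. 0)"
  by (rule thetaI) (simp add: prim_const)

text \<open>x d/dx (f / x) = (x f' - f) / x. The factor -1 is spelled out so that
  \<open>Wk_add\<close> and \<open>Wk_cmult\<close> apply to the right-hand side.\<close>

lemma theta_recip:
  assumes "theta f h" shows "theta (\<lambda>t x. (1 / x) * f t x) (\<lambda>t x. (1 / x) * (h t x + (- 1) * f t x))"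
proof (rule thetaI)
  fix t a :: real assume t: "t \<in> {0..T}" "0 < a" "a < 1"
  have "prim a 1 (\<lambda>x. 1 / x) (\<lambda>x. - 1 / x\<^sup>2)"
    by (rule prim_of_deriv) (use t in \<open>auto intro!: derivative_eq_intros continuous_intros simp: power2_eq_square\<close>)
  from prim_mult[OF this thetaD[OF assms t]]
  show "prim a 1 (\<lambda>x. (1 / x) * f t x) (\<lambda>z. (1 / z) * (h t z + (- 1) * f t z) / z)"
    by (rule prim_cong) (use t in \<open>auto simp: field_simps power2_eq_square\<close>)
qed

lemma dominated_quotient_tlip:
  assumes "dominated l h" "0 < a" "a < 1"
  obtains g where "tlip {a..1} g (\<lambda>t z. h t z / z)" "g absolutely_integrable_on {a..1}"
proof -
  obtain G where G: "G \<in> L2" "tlip {0<..1} (\<lambda>x. x ^ l * G x) h" using assms(1) by (auto simp: dominated_def)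
  have "tlip {a..1} (\<lambda>z. \<bar>1 / z\<bar> * (z ^ l * G z)) (\<lambda>t z. (1 / z) * h t z)"
    by (rule tlip_scale[OF tlip_subset[OF G(2)]]) (use assms in auto)
  then have 1: "tlip {a..1} (\<lambda>z. (\<bar>1 / z\<bar> * z ^ l) * G z) (\<lambda>t z. h t z / z)" by (simp add: mult.assoc)
  have "G absolutely_integrable_on {a..1}"
    by (rule absolutely_integrable_on_subinterval[OF L2_abs_integrable[OF G(1)]]) (use assms in auto)
  then have 2: "(\<lambda>z. (\<bar>1 / z\<bar> * z ^ l) * G z) absolutely_integrable_on {a..1}"
    by (rule abs_integrable_cont_mult) (use assms in \<open>auto intro!: continuous_intros\<close>)
  show ?thesis by (rule that[OF 1 2])
qed

lemma dominated_quotient_integrable: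
  assumes "dominated l h" "0 < a" "a < 1" "t \<in> {0..T}"
  shows "(\<lambda>z. h t z / z) absolutely_integrable_on {a..1}"
proof -
  have "h t absolutely_integrable_on {a..1}"
    by (rule absolutely_integrable_on_subinterval[OF L2_abs_integrable[OF dominated_L2[OF assms(1,4)]]])
       (use assms in auto)
  then have "(\<lambda>z. h t z * (1 / z)) absolutely_integrable_on {a..1}"
    by (rule abs_integrable_cont_mult) (use assms in \<open>auto intro!: continuous_intros\<close>)
  then show ?thesis by simp
qed

lemma theta_time_int:
  assumes "theta f h" "dominated l h" "bounded_tlip f" shows "theta (time_int f) (time_int h)"
proof (rule thetaI)
  fix t a :: real assume t: "t \<in> {0..T}" "0 < a" "a < 1"
  obtain g where g: "tlip {a..1} g (\<lambda>t z. h t z / z)" "g absolutely_integrable_on {a..1}"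
    using dominated_quotient_tlip[OF assms(2) t(2,3)] .
  obtain K where K: "tlip {0<..1} (\<lambda>_. K) f" using assms(3) by (auto simp: bounded_tlip_def)
  have "prim a 1 (time_int f t) (time_int (\<lambda>t z. h t z / z) t)"
    by (rule prim_time_int[OF tlip_subset[OF K] g thetaD[OF assms(1) _ t(2,3)] t(1)]) (use t in auto)
  then show "prim a 1 (time_int f t) (\<lambda>z. time_int h t z / z)"
    by (rule prim_cong) (simp_all add: time_int_def)
qed

lemma Wk_mono: "Wk (Suc k) l f \<Longrightarrow> Wk k l f"
  by (induction k arbitrary: f) auto

lemma Bk_mono: "Bk (Suc k) l f \<Longrightarrow> Bk k l f"
  by (cases k) (auto simp del: Wk.simps dest: Wk_mono)

lemma Wk_weight_mono: "Wk k l f \<Longrightarrow> l' \<le> l \<Longrightarrow> Wk k l' f"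
  by (induction k arbitrary: f) (auto intro: dominated_mono half_bounded_mono)

lemma Bk_weight_mono: "Bk k l f \<Longrightarrow> l' \<le> l \<Longrightarrow> Bk k l' f"
  by (cases k) (auto intro: Wk_weight_mono)

lemma Wk_bounded: "Wk (Suc k) l f \<Longrightarrow> 1 \<le> l \<Longrightarrow> bounded_tlip f"
  using half_bounded_bounded by (auto simp: dominated_def)

lemma Bk_of_Wk: "Wk k l f \<Longrightarrow> bounded_tlip f \<Longrightarrow> Bk k l f"
  by (cases k) auto

lemma Wk_SucI:
  assumes "dominated l f" "half_bounded l f" "\<And>t. t \<in> {0..T} \<Longrightarrow> f t 1 = 0" "Wk k l h" "theta f h"
  shows "Wk (Suc k) l f"
  using assms by auto

lemma Bk_SucI: "bounded_tlip f \<Longrightarrow> Wk k l h \<Longrightarrow> theta f h \<Longrightarrow> Bk (Suc k) l f"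
  by auto

lemma Wk_add: "Wk k l f \<Longrightarrow> Wk k l g \<Longrightarrow> Wk k l (\<lambda>t x. f t x + g t x)"
proof (induction k arbitrary: f g)
  case 0 then show ?case by (simp add: dominated_add)
next
  case (Suc k)
  obtain h where h: "Wk k l h" "theta f h" using Suc.prems(1) by auto
  obtain h' where h': "Wk k l h'" "theta g h'" using Suc.prems(2) by auto
  have f: "dominated l f" "half_bounded l f" "\<forall>t\<in>{0..T}. f t 1 = 0"
    and g: "dominated l g" "half_bounded l g" "\<forall>t\<in>{0..T}. g t 1 = 0" using Suc.prems by auto
  show ?case
    by (rule Wk_SucI[OF dominated_add[OF f(1) g(1)] half_bounded_add[OF f(2) g(2)] _
        Suc.IH[OF h(1) h'(1)] theta_add[OF h(2) h'(2)]]) (use f g in simp)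
qed

text \<open>Each term of the Leibniz rule needs one bounded factor: g in the first, and in the
  second f itself, which is bounded because the weight is at least 1. This is why multipliers need
  only have x g' in the weighted class.\<close>

lemma Wk_mult: "Wk k l f \<Longrightarrow> Bk k l g \<Longrightarrow> 1 \<le> l \<Longrightarrow> Wk k l (\<lambda>t x. f t x * g t x)"
proof (induction k arbitrary: f g)
  case 0 then show ?case by (simp add: dominated_mult)
next
  case (Suc k)
  obtain h where h: "Wk k l h" "theta f h" using Suc.prems(1) by auto
  obtain h' where h': "Wk k l h'" "theta g h'" using Suc.prems(2) by auto
  have "Wk k l (\<lambda>t x. h t x * g t x)" by (rule Suc.IH[OF h(1) Bk_mono[OF Suc.prems(2)] Suc.prems(3)])
  moreover have "Bk k l f" by (rule Bk_of_Wk[OF Wk_mono[OF Suc.prems(1)] Wk_bounded[OF Suc.prems(1,3)]])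
  from Suc.IH[OF h'(1) this Suc.prems(3)] have "Wk k l (\<lambda>t x. f t x * h' t x)" by (simp add: mult.commute)
  ultimately have h3: "Wk k l (\<lambda>t x. h t x * g t x + f t x * h' t x)" by (rule Wk_add)
  note g = Bk_bounded[OF Suc.prems(2)]
  have f: "dominated l f" "half_bounded l f" "\<forall>t\<in>{0..T}. f t 1 = 0" using Suc.prems(1) by auto
  show ?case
    by (rule Wk_SucI[OF dominated_mult[OF f(1) g] half_bounded_mult[OF f(2) g] _ h3 theta_mult[OF h(2) h'(2)]])
       (use f in simp)
qed

lemma Bk_const: "1 \<le> l \<Longrightarrow> Bk k l (\<lambda>t x. c)"
proof (cases k)
  case (Suc n)
  have z: "Wk n l (\<lambda>t x. 0)" for n
  proof (induction n)
    case 0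
    have "tlip {0<..1} (\<lambda>x. x ^ l * 0) (\<lambda>t x. 0)" by (rule tlip_const_time) simp
    then show ?case using continuous_L2[of "\<lambda>x. 0"] unfolding Wk.simps dominated_def meas_def
      by (intro conjI ballI bexI[of _ "\<lambda>x. 0"]) auto
  next
    case (Suc n)
    have hb: "half_bounded l (\<lambda>t x. 0)" unfolding half_bounded_def
      by (intro exI[of _ 0] tlip_const_time) simp
    show ?case by (rule Wk_SucI[OF Wk_dominated[OF Suc] hb _ Suc theta_const]) simp
  qed
  show ?thesis unfolding Suc by (rule Bk_SucI[OF bounded_const z theta_const])
qed (simp add: bounded_const)

lemma Wk_cmult: "Wk k l f \<Longrightarrow> 1 \<le> l \<Longrightarrow> Wk k l (\<lambda>t x. c * f t x)"
  using Wk_mult[OF _ Bk_const, of k l f c] by (simp only: mult.commute[of _ c])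

lemma Wk_time_int: "Wk k l f \<Longrightarrow> 1 \<le> l \<Longrightarrow> Wk k l (time_int f)"
proof (induction k arbitrary: f)
  case 0 then show ?case by (simp add: dominated_time_int)
next
  case (Suc k)
  obtain h where h: "Wk k l h" "theta f h" using Suc.prems(1) by auto
  have "theta (time_int f) (time_int h)"
    by (rule theta_time_int[OF h(2) Wk_dominated[OF h(1)] Wk_bounded[OF Suc.prems]])
  moreover have "time_int f t 1 = 0" if "t \<in> {0..T}" for t
  proof -
    have "time_int f t 1 = time_int (\<lambda>t x. 0) t 1" by (rule time_int_cong[OF that]) (use Suc.prems in auto)
    then show ?thesis by (simp add: time_int_def)
  qed
  moreover have f: "dominated l f" "half_bounded l f" using Suc.prems(1) by auto
  ultimately show ?case
    by (intro Wk_SucI[OF dominated_time_int[OF f(1)] half_bounded_time_int[OF f(2)] _ Suc.IH[OF h(1) Suc.prems(2)]])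
qed

lemma Bk_time_int: "Bk k l f \<Longrightarrow> 1 \<le> l \<Longrightarrow> Bk k l (time_int f)"
proof (cases k)
  case (Suc n)
  assume a: "Bk k l f" "1 \<le> l"
  then obtain h where h: "Wk n l h" "theta f h" using Suc by auto
  note f = Bk_bounded[OF a(1)]
  show ?thesis
    unfolding Suc by (rule Bk_SucI[OF bounded_time_int[OF f] Wk_time_int[OF h(1) a(2)] theta_time_int[OF h(2) Wk_dominated[OF h(1)] f]])
qed (simp add: bounded_time_int)

text \<open>Division by x lowers the weight by one but costs no order, because x d/dx of f / x is
  again a quotient by x of functions in the class.\<close>

lemma Wk_recip: "Wk k (Suc l) f \<Longrightarrow> Wk k l (\<lambda>t x. (1 / x) * f t x)"
proof (induction k arbitrary: f)
  case 0 then show ?case by (simp only: Wk.simps dominated_recip)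
next
  case (Suc k)
  obtain h where h: "Wk k (Suc l) h" "theta f h" using Suc.prems(1) by auto
  have "Wk k l (\<lambda>t x. (1 / x) * (h t x + (- 1) * f t x))"
  proof (rule Suc.IH, rule Wk_add[OF h(1)])
    show "Wk k (Suc l) (\<lambda>t x. - 1 * f t x)" by (rule Wk_cmult[OF Wk_mono[OF Suc.prems]]) simp
  qed
  moreover have f: "dominated (Suc l) f" "half_bounded (Suc l) f" "\<forall>t\<in>{0..T}. f t 1 = 0" using Suc.prems by auto
  ultimately show ?case
    by (intro Wk_SucI[OF dominated_recip[OF f(1)] half_bounded_recip[OF f(2)] _ _ theta_recip[OF h(2)]])
       (use f in simp_all)
qed

lemma volterra_solvable:
  assumes "tlip {0<..1} (\<lambda>_. \<kappa>) a" "tlip {0<..1} g S" "2 * (T\<^sup>2 * \<kappa>) \<le> 1"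
  shows "\<exists>Q. solves_volterra a S Q"
proof (rule volterra_exists[OF assms])
  fix Q assume "\<And>x. x \<in> {0<..1} \<Longrightarrow> tcont Q x"
    "\<And>t x. x \<in> {0<..1} \<Longrightarrow> t \<in> {0..T} \<Longrightarrow> Q t x = S t x + time_int2 (\<lambda>t x. a t x * Q t x) t x"
  then have "solves_volterra a S Q" unfolding solves_volterra_def by simp
  then show ?thesis by (intro exI[of _ Q])
qed

text \<open>Applying x d/dx formally gives an equation with the same coefficient a and a source
  containing only Q and known functions. Solving it yields a candidate Q1, of order k by induction,
  and \<open>volterra_prim\<close> identifies it with x d/dx of Q.\<close>

lemma volterra_Wk:
  assumes "Wk k l S" "Bk k l a" "tlip {0<..1} (\<lambda>_. \<kappa>) a" "2 * (T\<^sup>2 * \<kappa>) \<le> 1" "solves_volterra a S Q" "1 \<le> l"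
  shows "Wk k l Q"
proof -
  have dom: "dominated l Q" if S: "dominated l S" and Q: "solves_volterra a S Q" for S Q
  proof -
    obtain G where G: "G \<in> L2" "tlip {0<..1} (\<lambda>x. x ^ l * G x) S" "meas S" using S by (auto simp: dominated_def)
    have "meas a" using Bk_bounded[OF assms(2)] by (simp add: bounded_tlip_def)
    then have "meas Q" by (rule volterra_meas[OF Q assms(3) _ G(2,3) assms(4)])
    moreover have "tlip {0<..1} (\<lambda>x. x ^ l * ((2 + 2 * \<kappa>) * G x)) Q"
      by (rule tlip_mono[OF volterra_tlip[OF Q assms(3) G(2) order.refl assms(4)]]) simp
    ultimately show ?thesis using dominatedI L2_cmult[OF G(1)] by blast
  qed
  show ?thesis
    using assms
  proof (induction k arbitrary: S Q)
    case 0 then show ?case using dom by simp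
  next
    case (Suc k)
    note small = Suc.prems(3,4) and Q = Suc.prems(5)
    obtain S1 where S1: "Wk k l S1" "theta S S1" using Suc.prems(1) by auto
    obtain a1 where a1: "Wk k l a1" "theta a a1" using Suc.prems(2) by auto
    have dQ: "dominated l Q" using dom Suc.prems by auto
    obtain C where C: "tlip {0<..1} (\<lambda>x. C * (x ^ l / sqrt x)) S" using Suc.prems(1) by (auto simp: half_bounded_def)
    have hQ: "half_bounded l Q"
    proof -
      have "tlip {0<..1} (\<lambda>x. ((2 + 2 * \<kappa>) * C) * (x ^ l / sqrt x)) Q"
        by (rule tlip_mono[OF volterra_tlip[OF Q small(1) C order.refl small(2)]]) simp
      then show ?thesis by (rule half_boundedI)
    qed
    have Q1z: "Q t 1 = 0" if t: "t \<in> {0..T}" for t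
    proof -
      \<comment> \<open>The majorant estimate applied to the single point 1 with majorant 0: Q
        vanishes where the source does.\<close>
      have "tlip {1} (\<lambda>_. 0) S" by (rule tlipI) (use Suc.prems(1) in auto)
      then have "tlip {1} (\<lambda>x. (2 + 2 * \<kappa>) * 0) Q" by (rule volterra_tlip[OF Q small(1) _ _ small(2)]) simp
      from tlipD(1)[OF this _ t] show ?thesis by simp
    qed
    have bQ: "bounded_tlip Q" by (rule half_bounded_bounded[OF hQ Suc.prems(6)]) (use dQ in \<open>simp add: dominated_def\<close>)
    have "Wk k l Q"
      by (rule Suc.IH[OF Wk_mono[OF Suc.prems(1)] Bk_mono[OF Suc.prems(2)] small Q Suc.prems(6)])
    then have "Bk k l Q" by (rule Bk_of_Wk[OF _ bQ])
    from Wk_mult[OF a1(1) this Suc.prems(6)]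
    have a1Q: "Wk k l (\<lambda>t x. a1 t x * Q t x)" .
    define S' where "S' t x = S1 t x + time_int2 (\<lambda>t x. a1 t x * Q t x) t x" for t x
    have S': "Wk k l S'"
      unfolding S'_def by (rule Wk_add[OF S1(1) Wk_time_int[OF Wk_time_int[OF a1Q Suc.prems(6)] Suc.prems(6)]])
    obtain G where G: "tlip {0<..1} (\<lambda>x. x ^ l * G x) S'" using Wk_dominated[OF S'] by (auto simp: dominated_def)
    obtain Q1 where Q1: "solves_volterra a S' Q1"
      using volterra_solvable[OF small(1) G small(2)] by blast
    have WQ1: "Wk k l Q1"
      by (rule Suc.IH[OF S' Bk_mono[OF Suc.prems(2)] small Q1 Suc.prems(6)])
    have Q1': "Q1 t x = S' t x + time_int2 (\<lambda>t x. a t x * Q1 t x) t x" if "x \<in> {0<..1}" "t \<in> {0..T}" for t x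
      using Q1 that unfolding solves_volterra_def by blast
    have "theta Q Q1"
    proof (rule thetaI)
      fix t a0 :: real assume t: "t \<in> {0..T}" and a0: "0 < a0" "a0 < 1"
      have sub: "{a0..1} \<subseteq> {0<..1}" using a0 by auto
      obtain g where g: "tlip {a0..1} g (\<lambda>t z. a1 t z / z)" "g absolutely_integrable_on {a0..1}"
        using dominated_quotient_tlip[OF Wk_dominated[OF a1(1)] a0] .
      obtain gQ where gQ: "tlip {a0..1} gQ (\<lambda>t z. Q1 t z / z)" "gQ absolutely_integrable_on {a0..1}"
        using dominated_quotient_tlip[OF Wk_dominated[OF WQ1] a0] .
      obtain B where B: "tlip {0<..1} (\<lambda>_. B) Q" using bQ by (auto simp: bounded_tlip_def)
      show "prim a0 1 (Q t) (\<lambda>z. Q1 t z / z)"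
      proof (rule volterra_prim[OF less_imp_le[OF a0(2)] thetaD[OF S1(2) _ a0] thetaD[OF a1(2) _ a0]
            tlip_subset[OF small(1) sub] g tlip_subset[OF B sub] gQ
            dominated_quotient_integrable[OF Wk_dominated[OF WQ1] a0] _ _ t])
        fix t x assume t: "t \<in> {0..T}" and "x \<in> {a0..1}"
        then have x: "x \<in> {0<..1}" using sub by blast
        show "Q t x = S t x + time_int2 (\<lambda>t x. a t x * Q t x) t x"
          using Q x t unfolding solves_volterra_def by blast
        have e: "time_int2 (\<lambda>t z. a1 t z / z * Q t z) t x = time_int2 (\<lambda>t z. a1 t z * Q t z) t x / x"
          "time_int2 (\<lambda>t z. a t z * (Q1 t z / z)) t x = time_int2 (\<lambda>t z. a t z * Q1 t z) t x / x"
          by (simp_all add: time_int_def)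
        show "Q1 t x / x = S1 t x / x + time_int2 (\<lambda>t x. a1 t x / x * Q t x) t x + time_int2 (\<lambda>t x. a t x * (Q1 t x / x)) t x"
          unfolding e Q1'[OF x t] S'_def by (simp add: add_divide_distrib)
      qed
    qed
    from Wk_SucI[OF dQ hQ Q1z WQ1 this] show ?case .
  qed
qed

text \<open>The family x^i F j is closed under x d/dx, which gives i x^i F j + x^(i+1) F (j+1), and
  both terms carry the same weight m - j + i. This is why the powers x^i are included.\<close>

lemma chain_Wk:
  assumes F: "chain m F"
  shows "j + k \<le> m \<Longrightarrow> 1 \<le> m - j + i \<Longrightarrow> Wk k (m - j + i) (\<lambda>t x. x ^ i * F j x)"
proof -
  have dom: "dominated (m - j + i) (\<lambda>t x. x ^ i * F j x)" if j: "j \<le> m" for i j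
  proof -
    obtain G where G: "G \<in> L2" "\<And>x. x \<in> {0<..1} \<Longrightarrow> \<bar>F j x\<bar> \<le> x ^ (m - j) * \<bar>G x\<bar>"
      using chain_weighted_bound[OF F j] by blast
    have "tlip {0<..1} (\<lambda>x. x ^ (m - j + i) * \<bar>G x\<bar>) (\<lambda>t x. x ^ i * F j x)"
    proof (rule tlip_const_time)
      fix x :: real assume x: "x \<in> {0<..1}"
      have "\<bar>x ^ i * F j x\<bar> \<le> x ^ i * (x ^ (m - j) * \<bar>G x\<bar>)"
        using G(2)[OF x] x by (simp add: abs_mult mult_left_mono)
      then show "\<bar>x ^ i * F j x\<bar> \<le> x ^ (m - j + i) * \<bar>G x\<bar>" by (simp add: power_add mult_ac)
    qed
    moreover have "(\<lambda>x. \<bar>G x\<bar>) \<in> L2" by (rule L2_bound[OF G(1)]) (use L2_measurable[OF G(1)] in auto)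
    moreover have "(\<lambda>x. x ^ i * F j x) \<in> borel_measurable lebesgue01"
      by (intro borel_measurable_times L2_measurable[OF chain_L2[OF F j]] L2_measurable continuous_L2 continuous_intros)
    ultimately show ?thesis using dominatedI[of "\<lambda>t x. x ^ i * F j x"] by (simp add: meas_def)
  qed
  show "j + k \<le> m \<Longrightarrow> 1 \<le> m - j + i \<Longrightarrow> Wk k (m - j + i) (\<lambda>t x. x ^ i * F j x)"
  proof (induction k arbitrary: i j)
    case 0 then show ?case using dom by simp
  next
    case (Suc k)
    then have j: "j < m" by simp
    note c = chainD[OF F j]
    obtain K where K: "\<And>x. x \<in> {0<..1} \<Longrightarrow> \<bar>F j x\<bar> \<le> K * (x ^ (m - j) / sqrt x)"
      using chain_weighted_bound[OF F less_imp_le[OF j]] j by blast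
    have half: "half_bounded (m - j + i) (\<lambda>t x. x ^ i * F j x)"
      unfolding half_bounded_def
    proof (intro exI tlip_const_time)
      fix x :: real assume x: "x \<in> {0<..1}"
      have "\<bar>x ^ i * F j x\<bar> \<le> x ^ i * (K * (x ^ (m - j) / sqrt x))"
        unfolding abs_mult using mult_left_mono[OF K[OF x], of "x ^ i"] x by simp
      then show "\<bar>x ^ i * F j x\<bar> \<le> K * (x ^ (m - j + i) / sqrt x)" by (simp add: power_add mult_ac)
    qed
    let ?h = "\<lambda>t::real. \<lambda>x. real i * (x ^ i * F j x) + x ^ Suc i * F (Suc j) x"
    have "Wk k (m - j + i) (\<lambda>t x. x ^ i * F j x)"
      by (rule Suc.IH) (use Suc.prems in auto)
    then have k1: "Wk k (m - j + i) (\<lambda>t x. real i * (x ^ i * F j x))"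
      using Suc.prems(2) by (rule Wk_cmult)
    have "Wk k (m - Suc j + Suc i) (\<lambda>t x. x ^ Suc i * F (Suc j) x)"
      by (rule Suc.IH) (use Suc.prems in auto)
    moreover have "m - Suc j + Suc i = m - j + i" using j by simp
    ultimately have "Wk k (m - j + i) (\<lambda>t x. x ^ Suc i * F (Suc j) x)" by (simp only:)
    from Wk_add[OF k1 this] have Wh: "Wk k (m - j + i) ?h" .
    have th: "theta (\<lambda>t x. x ^ i * F j x) ?h"
    proof (rule thetaI)
      fix t a :: real assume a: "0 < a" "a < 1"
      have "prim a 1 (\<lambda>x. x ^ i) (\<lambda>x. real i * x ^ (i - 1))"
        by (rule prim_of_deriv) (auto intro!: derivative_eq_intros continuous_intros)
      from prim_mult[OF this prim_sub[OF c(1) less_imp_le[OF a(1)] order.refl]]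
      have "prim a 1 (\<lambda>x. x ^ i * F j x) (\<lambda>x. real i * x ^ (i - 1) * F j x + x ^ i * F (Suc j) x)"
        .
      then show "prim a 1 (\<lambda>x. x ^ i * F j x) (\<lambda>z. (real i * (z ^ i * F j z) + z ^ Suc i * F (Suc j) z) / z)"
      proof (rule prim_cong)
        fix x assume "x \<in> {a<..<1}"
        then have x: "x \<noteq> 0" using a by auto
        \<comment> \<open>For i = 0 the subtraction truncates, but the factor i is then 0 on both
          sides.\<close>
        have e: "real i * x ^ (i - 1) * x = real i * x ^ i" by (cases i) auto
        then have "(real i * x ^ (i - 1) * F j x + x ^ i * F (Suc j) x) * x = real i * (x ^ i * F j x) + x ^ Suc i * F (Suc j) x"
        proof -
          have "(real i * x ^ (i - 1) * F j x + x ^ i * F (Suc j) x) * x = (real i * x ^ (i - 1) * x) * F j x + x ^ Suc i * F (Suc j) x"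
            by (simp only: algebra_simps power_Suc)
          then show ?thesis unfolding e by (simp only: mult.assoc)
        qed
        then show "real i * x ^ (i - 1) * F j x + x ^ i * F (Suc j) x = (real i * (x ^ i * F j x) + x ^ Suc i * F (Suc j) x) / x"
          unfolding nonzero_eq_divide_eq[OF x] .
      qed simp
    qed
    show ?case by (rule Wk_SucI[OF dom[OF less_imp_le[OF j]] half _ Wh th]) (simp add: c(3))
  qed
qed

end

section \<open>Regularity in Lagrangian coordinates\<close>

context time_interval
begin

lemma dominated_cong:
  assumes "dominated l f" "\<And>t x. t \<in> {0..T} \<Longrightarrow> x \<in> {0<..1} \<Longrightarrow> g t x = f t x" shows "dominated l g"
proof -
  obtain G where G: "G \<in> L2" "tlip {0<..1} (\<lambda>x. x ^ l * G x) f" "meas f" using assms(1) by (auto simp: dominated_def)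
  have "meas g"
    unfolding meas_def
  proof
    fix t assume t: "t \<in> {0..T}"
    have "f t \<in> borel_measurable lebesgue01" using G(3) t by (simp add: meas_def)
    then show "g t \<in> borel_measurable lebesgue01"
      by (rule measurable_cong[THEN iffD1, rotated]) (use assms(2)[OF t] in \<open>simp add: space_restrict_space\<close>)
  qed
  then show ?thesis using dominatedI[OF _ G(1) tlip_cong[OF G(2) assms(2)]] by blast
qed

lemma half_bounded_cong:
  assumes "half_bounded l f" "\<And>t x. t \<in> {0..T} \<Longrightarrow> x \<in> {0<..1} \<Longrightarrow> g t x = f t x" shows "half_bounded l g"
proof -
  obtain K where "tlip {0<..1} (\<lambda>x. K * (x ^ l / sqrt x)) f" using assms(1) by (auto simp: half_bounded_def)
  from tlip_cong[OF this assms(2)] show ?thesis by (rule half_boundedI)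
qed

lemma Bk_mono_le: "Bk k l f \<Longrightarrow> j \<le> k \<Longrightarrow> Bk j l f"
  by (induction k) (auto simp: le_Suc_eq dest: Bk_mono simp del: Bk.simps)

text \<open>The \<open>fs j\<close> are the Eulerian derivatives pulled back along the flow: f
  composed with Y has derivative V f' composed with Y. Writing V f' as x^(-1) V (x f') shows that
  each derivative costs one order and one power of the weight, so order and weight fall together
  from k to 0.\<close>

lemma Wk_iterated_derivatives:
  assumes V: "Bk m m V" "\<And>t x. t \<in> {0..T} \<Longrightarrow> x \<in> {0..1} \<Longrightarrow> V t x \<noteq> 0"
  shows "Wk k k f \<Longrightarrow> k \<le> m \<Longrightarrow> \<exists>fs. fs 0 = f \<and> (\<forall>j\<le>k. Wk (k - j) (k - j) (fs j)) \<and>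
    (\<forall>j<k. \<forall>t\<in>{0..T}. \<forall>a\<in>{0<..<1}. prim a 1 (fs j t) (\<lambda>z. fs (Suc j) t z / V t z))"
proof (induction k arbitrary: f)
  case 0 then show ?case by (intro exI[of _ "\<lambda>_. f"]) auto
next
  case (Suc k)
  obtain h where h: "Wk k (Suc k) h" "theta f h" using Suc.prems(1) by auto
  define f1 where "f1 t x = (1 / x) * (h t x * V t x)" for t x
  have "Bk k (Suc k) V" by (rule Bk_weight_mono[OF Bk_mono_le[OF V(1)]]) (use Suc.prems in auto)
  then have "Wk k (Suc k) (\<lambda>t x. h t x * V t x)" by (rule Wk_mult[OF h(1)]) simp
  then have "Wk k k f1" unfolding f1_def[abs_def] by (rule Wk_recip)
  from Suc.IH[OF this] Suc.prems(2) obtain fs where fs: "fs 0 = f1" "\<forall>j\<le>k. Wk (k - j) (k - j) (fs j)"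
    "\<forall>j<k. \<forall>t\<in>{0..T}. \<forall>a\<in>{0<..<1}. prim a 1 (fs j t) (\<lambda>z. fs (Suc j) t z / V t z)" by auto
  define gs where "gs = case_nat f fs"
  have gs: "gs 0 = f" "gs (Suc j) = fs j" for j by (simp_all add: gs_def)
  show ?case
  proof (intro exI[of _ gs] conjI allI impI ballI)
    fix j assume j: "j \<le> Suc k"
    show "Wk (Suc k - j) (Suc k - j) (gs j)"
    proof (cases j)
      case 0 then show ?thesis using Suc.prems(1) gs by (simp del: Wk.simps)
    next
      case (Suc i) then show ?thesis using fs(2) j gs by simp
    qed
  next
    fix j t a assume j: "j < Suc k" and t: "t \<in> {0..T}" and a: "a \<in> {0<..<1::real}"
    show "prim a 1 (gs j t) (\<lambda>z. gs (Suc j) t z / V t z)"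
    proof (cases j)
      case 0
      have "prim a 1 (f t) (\<lambda>z. f1 t z / V t z)"
      proof (rule prim_cong[OF thetaD[OF h(2) t]])
        fix z assume "z \<in> {a<..<1}"
        then have "V t z \<noteq> 0" using V(2)[OF t, of z] a by auto
        then show "h t z / z = f1 t z / V t z" by (simp add: f1_def)
      qed (use a in auto)
      then show ?thesis using 0 gs fs(1) by simp
    next
      case (Suc i) then show ?thesis using fs(3) j gs t a by simp
    qed
  qed (simp add: gs)
qed

end

sublocale lagrangian_data \<subseteq> ti?: time_interval T
  by unfold_locales (use T_pos T_le in auto)

context lagrangian_data
begin

lemma tlip_of_deriv:
  assumes "\<And>t x. t \<in> {0..T} \<Longrightarrow> x \<in> {0..1} \<Longrightarrow> ((\<lambda>t. f t x) has_real_derivative f' t x) (at t within {0..T})"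
    "\<And>t x. t \<in> {0..T} \<Longrightarrow> x \<in> {0..1} \<Longrightarrow> \<bar>f t x\<bar> \<le> B" "\<And>t x. t \<in> {0..T} \<Longrightarrow> x \<in> {0..1} \<Longrightarrow> \<bar>f' t x\<bar> \<le> B"
  shows "tlip {0<..1} (\<lambda>_. B) f"
proof (rule tlipI)
  fix x t s assume "x \<in> {0<..1::real}" and t: "t \<in> {0..T}"
  then have x: "x \<in> {0..1}" by auto
  show "\<bar>f t x\<bar> \<le> B" by (rule assms(2)[OF t x])
  assume s: "s \<in> {0..T}"
  show "\<bar>f t x - f s x\<bar> \<le> \<bar>t - s\<bar> * B"
    using field_differentiable_bound[of "{0..T}" "\<lambda>t. f t x" "\<lambda>t. f' t x" B t s] assms(1,3)[OF _ x] t s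
    by (simp add: mult.commute)
qed

lemma bounded_tlip_of_deriv:
  assumes f: "cont2 T f" and f': "cont2 T f'"
    and d: "\<And>t x. t \<in> {0..T} \<Longrightarrow> x \<in> {0..1} \<Longrightarrow> ((\<lambda>t. f t x) has_real_derivative f' t x) (at t within {0..T})"
  shows "bounded_tlip f"
proof -
  obtain B where B: "B > 0" "\<And>t x. t \<in> {0..T} \<Longrightarrow> x \<in> {0..1} \<Longrightarrow> \<bar>f t x\<bar> \<le> B"
    using cont2_bounded[OF f] by metis
  obtain B' where B': "B' > 0" "\<And>t x. t \<in> {0..T} \<Longrightarrow> x \<in> {0..1} \<Longrightarrow> \<bar>f' t x\<bar> \<le> B'"
    using cont2_bounded[OF f'] by metis
  have "tlip {0<..1} (\<lambda>_. B + B') f"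
    by (rule tlip_of_deriv[OF d]) (use B B' in \<open>force+\<close>)
  moreover have "meas f"
    unfolding meas_def
  proof
    fix t assume "t \<in> {0..T}"
    then have "continuous_on {0<..<1} (f t)"
      using continuous_on_subset[OF cont2_x[OF f], of t "{0<..<1}"] by fastforce
    then show "f t \<in> borel_measurable lebesgue01" by (intro continuous_imp_measurable_on_sets_lebesgue) auto
  qed
  ultimately show ?thesis using bounded_tlipI by blast
qed

end

context lagrangian_solution
begin

lemma C_t_deriv:
  assumes "t \<in> {0..T}" "x \<in> {0..1}" shows "((\<lambda>t. C t x) has_real_derivative W t x) (at t within {0..T})"
proof -
  have "((\<lambda>t. t * w x + r x * time_int (time_int V) t x) has_real_derivative W t x) (at t within {0..T})"
    unfolding W_def by (auto intro!: derivative_eq_intros time_int_deriv[OF cont2_time_int[OF cont2_V] assms])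
  then show ?thesis by (rule has_real_derivative_transform[OF _ assms(1)]) (use C_eq assms(2) in auto)
qed

lemma V_t_deriv:
  assumes "t \<in> {0..T}" "x \<in> {0..1}"
  shows "((\<lambda>t. V t x) has_real_derivative V t x * (Om t x - W t x)) (at t within {0..T})"
  unfolding V_eq by (auto intro!: derivative_eq_intros A_t_deriv[OF assms] C_t_deriv[OF assms])

lemma bounded_expC: "bounded_tlip (\<lambda>t x. exp (C t x))"
  by (rule bounded_tlip_of_deriv[OF cont2_exp[OF cont2_C] cont2_mult[OF cont2_exp[OF cont2_C] cont2_W]])
     (auto intro!: derivative_eq_intros C_t_deriv)

lemma bounded_V: "bounded_tlip V"
  by (rule bounded_tlip_of_deriv[OF cont2_V cont2_mult[OF cont2_V cont2_diff[OF cont2_Om cont2_W]] V_t_deriv])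

lemma V_bound: "t \<in> {0..T} \<Longrightarrow> x \<in> {0..1} \<Longrightarrow> \<bar>V t x\<bar> \<le> 81"
  using Vfun_bound[OF q_cont q_bound, of t x] V_pos[of t x] by (simp add: V_def)

lemma time_int_V_bound: assumes "t \<in> {0..T}" "x \<in> {0..1}" shows "\<bar>time_int V t x\<bar> \<le> T * 81"
proof -
  have "\<bar>time_int V t x\<bar> \<le> t * 81"
    by (rule time_int_bound[where f=V and x=x, OF _ assms(1) V_bound[OF _ assms(2)]])
       (simp add: tcont_def cont2_t[OF cont2_V assms(2)])
  also have "\<dots> \<le> T * 81" using assms(1) by simp
  finally show ?thesis .
qed

lemma abs_C_le: assumes "t \<in> {0..T}" "x \<in> {0..1}" shows "\<bar>C t x\<bar> \<le> 1"
proof -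
  have "\<bar>mean q t x\<bar> \<le> 1" by (rule mean_bound[OF q_cont q_bound assms])
  then have "\<bar>x\<bar> * \<bar>mean q t x\<bar> \<le> 1 * 1" using assms(2) by (intro mult_mono) auto
  then show ?thesis by (simp add: C_def abs_mult)
qed

lemma W_Om_bounds:
  assumes t: "t \<in> {0..T}" and x: "x \<in> {0..1}"
  shows "\<bar>W t x\<bar> \<le> 1 + K" "\<bar>Om t x\<bar> \<le> 3 * (1 + K)"
proof -
  have m: "\<bar>mean (\<lambda>_. f) 0 x\<bar> \<le> K"
    if "continuous_on {0..1} f" "\<And>x. x \<in> {0..1} \<Longrightarrow> \<bar>f x\<bar> \<le> K" "x \<in> {0..1}" for f x
    unfolding mean_def by (rule integral01_bound[OF cont_mean_arg[OF cont2_of_x[OF that(1)] T0 that(3)]])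
      (use that(2,3) scaled01 in blast)
  have TK: "K * (T * 81) \<le> 1" using TK_le by (simp add: mult_ac)
  have Wq: "\<bar>Wq t x\<bar> \<le> 1 + K" if x: "x \<in> {0..1}" for x
  proof -
    have "\<bar>mean (\<lambda>_. r1) 0 x * time_int V t x\<bar> \<le> K * (T * 81)"
      unfolding abs_mult by (intro mult_mono m[OF r1_cont r1_bound x] time_int_V_bound[OF t x] K_nonneg) auto
    then show ?thesis using m[OF w1_cont w1_bound x] TK unfolding Wq_def by linarith
  qed
  have "\<bar>x * Wq t x\<bar> \<le> 1 * (1 + K)"
    unfolding abs_mult using x Wq[OF x] by (intro mult_mono) auto
  then show "\<bar>W t x\<bar> \<le> 1 + K" using W_factor[OF x] by simp
  have "norm (integral {x..1} (\<lambda>z. exp (C t z) * Wq t z)) \<le> integral {x..1} (\<lambda>z. 3 * (1 + K))"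
  proof (rule integral_norm_bound_integral)
    show "(\<lambda>z. exp (C t z) * Wq t z) integrable_on {x..1}"
      by (rule integrable_continuous_real, rule continuous_on_subset[OF cont2_x[OF cont2_Om_integrand t]]) (use x in auto)
    fix z assume "z \<in> {x..1}"
    then have z: "z \<in> {0..1}" using x by auto
    have "exp (C t z) \<le> exp 1" using abs_C_le[OF t z] by simp
    then have "exp (C t z) \<le> 3" using exp_le by linarith
    then show "norm (exp (C t z) * Wq t z) \<le> 3 * (1 + K)"
      unfolding real_norm_def abs_mult using Wq[OF z] by (intro mult_mono) auto
  qed auto
  also have "\<dots> = (1 - x) * (3 * (1 + K))" using x by simp
  also have "\<dots> \<le> 1 * (3 * (1 + K))" using x K_nonneg by (intro mult_right_mono) auto
  finally show "\<bar>Om t x\<bar> \<le> 3 * (1 + K)" unfolding Om_def by simp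
qed

text \<open>The coefficient in the Volterra equation of x C_x. Here 81 bounds V, K bounds r, and 4
  (1 + K) bounds \<Omega> - W, where V_t = V (\<Omega> - W).\<close>

lemma a_tlip: "tlip {0<..1} (\<lambda>_. 81 * (K * (4 * (1 + K)))) (\<lambda>t x. - 1 * (r x * V t x))"
proof (rule tlip_of_deriv)
  fix t x :: real assume t: "t \<in> {0..T}" and x: "x \<in> {0..1}"
  show "((\<lambda>t. - 1 * (r x * V t x)) has_real_derivative - 1 * (r x * (V t x * (Om t x - W t x)))) (at t within {0..T})"
    by (auto intro!: derivative_eq_intros V_t_deriv[OF t x])
  have "0 \<le> K * K" by simp
  then have k: "0 \<le> K * (4 * (1 + K))" "K \<le> K * (4 * (1 + K))"
    using K_nonneg unfolding distrib_left by linarith+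
  have "\<bar>r x * V t x\<bar> \<le> K * 81"
    unfolding abs_mult by (intro mult_mono r_bound V_bound t x K_nonneg) auto
  then show "\<bar>- 1 * (r x * V t x)\<bar> \<le> 81 * (K * (4 * (1 + K)))" using k(2) by (simp add: mult.commute)
  have "\<bar>Om t x - W t x\<bar> \<le> 4 * (1 + K)"
    using W_Om_bounds[OF t x] abs_triangle_ineq4[of "Om t x" "W t x"] by argo
  then have "\<bar>r x * (V t x * (Om t x - W t x))\<bar> \<le> K * (81 * (4 * (1 + K)))"
    unfolding abs_mult by (intro mult_mono r_bound V_bound t x K_nonneg) auto
  then show "\<bar>- 1 * (r x * (V t x * (Om t x - W t x)))\<bar> \<le> 81 * (K * (4 * (1 + K)))"
    by (simp add: mult.left_commute)
qed

text \<open>648 = 2 * 81 * 4. The time interval of the fixed point is thus short enough for every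
  order of regularity.\<close>

lemma a_small: "2 * (T\<^sup>2 * (81 * (K * (4 * (1 + K))))) \<le> 1"
proof -
  have "2 * (T\<^sup>2 * (81 * (K * (4 * (1 + K))))) = 648 * ((T * K) * (T * (1 + K)))"
    by (simp add: power2_eq_square mult_ac)
  also have "\<dots> \<le> 648 * ((1 / 1000) * (1 / 1000))"
  proof (intro mult_left_mono mult_mono)
    show "T * K \<le> 1 / 1000" using TK_le by simp
    show "T * (1 + K) \<le> 1 / 1000" using T_small by (simp only: mult.left_commute[of T 1000])
  qed (use T_pos K_nonneg in auto)
  finally show ?thesis by linarith
qed

text \<open>Since |C| \<le> 1, the exponential has slope at most e \<le> 3 here. Hence e^C - 1
  inherits the weight of C, whereas e^C is treated as a multiplier.\<close>

lemma expm1_tlip: assumes "tlip {0<..1} g C" shows "tlip {0<..1} (\<lambda>x. 3 * g x) (\<lambda>t x. exp (C t x) - 1)"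
proof (rule tlipI)
  have e: "\<bar>exp a - exp b\<bar> \<le> 3 * \<bar>a - b\<bar>" if "\<bar>a\<bar> \<le> 1" "\<bar>b\<bar> \<le> 1" for a b :: real
  proof -
    have *: "\<bar>exp a - exp b\<bar> \<le> 3 * \<bar>a - b\<bar>" if "\<bar>a\<bar> \<le> 1" "a \<le> 1" "b \<le> a" for a b :: real
    proof -
      have "exp b = exp a * exp (b - a)" by (simp flip: exp_add)
      moreover have "exp a * (1 + (b - a)) \<le> exp a * exp (b - a)"
        using exp_ge_add_one_self[of "b - a"] by (intro mult_left_mono) auto
      ultimately have "exp a - exp b \<le> exp a * (a - b)" by (simp add: algebra_simps)
      also have "exp a \<le> exp 1" using that by simp
      then have "exp a * (a - b) \<le> 3 * (a - b)" using that exp_le by (intro mult_right_mono) linarith+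
      finally show ?thesis using that by simp
    qed
    show ?thesis using *[of a b] *[of b a] that by (cases "b \<le> a") (auto simp: abs_minus_commute)
  qed
  fix x t s :: real assume x: "x \<in> {0<..1}" and t: "t \<in> {0..T}"
  then have x': "x \<in> {0..1}" by auto
  show "\<bar>exp (C t x) - 1\<bar> \<le> 3 * g x"
    using e[of "C t x" 0] abs_C_le[OF t x'] tlipD(1)[OF assms x t] by simp
  assume s: "s \<in> {0..T}"
  show "\<bar>exp (C t x) - 1 - (exp (C s x) - 1)\<bar> \<le> \<bar>t - s\<bar> * (3 * g x)"
    using e[OF abs_C_le[OF t x'] abs_C_le[OF s x']] tlipD(2)[OF assms x t s] by simp
qed

lemma mult_h: "x * h t x = exp (C t x) - 1"
  using mult_expm1_quot[of x "mean q t x"] by (simp add: h_def hfun_def C_def)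

text \<open>This is x C_x, because C_x = q.\<close>

abbreviation Q where "Q t x \<equiv> x * q t x"

lemma theta_expC: "theta (\<lambda>t x. exp (C t x)) (\<lambda>t x. Q t x * exp (C t x))"
  and theta_E: "theta (\<lambda>t x. exp (C t x) - 1) (\<lambda>t x. Q t x * exp (C t x))"
  and theta_V: "theta V (\<lambda>t x. (- 1 * (exp (C t x) - 1) + - 1 * Q t x) * V t x)"
proof -
  have *: "prim a 1 f (\<lambda>z. g z / z)"
    if "0 < a" "a < 1" "\<And>x. x \<in> {0..1} \<Longrightarrow> (f has_real_derivative f' x) (at x within {0..1})"
      "continuous_on {0..1} f'" "\<And>z. z \<in> {0..1} \<Longrightarrow> g z = z * f' z" for a f f' g
  proof (rule prim_cong)
    show "prim a 1 f f'"
      by (rule prim_sub[OF prim_of_deriv[OF that(3,4)]]) (use that in auto)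
    fix z assume "z \<in> {a<..<1}"
    then have "z \<noteq> 0" "z \<in> {0..1}" using that(1) by auto
    then show "f' z = g z / z" using that(5)[of z] by simp
  qed simp
  have c: "continuous_on {0..1} (\<lambda>x. q t x * exp (C t x))" if "t \<in> {0..T}" for t
    by (intro continuous_intros cont2_x[OF q_cont that] cont2_x[OF cont2_C that])
  show "theta (\<lambda>t x. exp (C t x)) (\<lambda>t x. Q t x * exp (C t x))"
  proof (rule thetaI)
    fix t a :: real assume t: "t \<in> {0..T}" and a: "0 < a" "a < 1"
    show "prim a 1 (\<lambda>x. exp (C t x)) (\<lambda>z. Q t z * exp (C t z) / z)"
      by (rule *[OF a _ c[OF t]]) (auto intro!: derivative_eq_intros C_deriv[OF t])
  qed
  show "theta (\<lambda>t x. exp (C t x) - 1) (\<lambda>t x. Q t x * exp (C t x))"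
  proof (rule thetaI)
    fix t a :: real assume t: "t \<in> {0..T}" and a: "0 < a" "a < 1"
    show "prim a 1 (\<lambda>x. exp (C t x) - 1) (\<lambda>z. Q t z * exp (C t z) / z)"
      by (rule *[OF a _ c[OF t]]) (auto intro!: derivative_eq_intros C_deriv[OF t])
  qed
  show "theta V (\<lambda>t x. (- 1 * (exp (C t x) - 1) + - 1 * Q t x) * V t x)"
  proof (rule thetaI)
    fix t a :: real assume t: "t \<in> {0..T}" and a: "0 < a" "a < 1"
    show "prim a 1 (V t) (\<lambda>z. (- 1 * (exp (C t z) - 1) + - 1 * Q t z) * V t z / z)"
    proof (rule *[OF a V_deriv[OF t] cont2_x[OF cont2_Vx t]])
      show "(- 1 * (exp (C t z) - 1) + - 1 * Q t z) * V t z = z * Vx t z" for z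
        unfolding Vx_def mult_h[symmetric] by (simp add: algebra_simps)
    qed
  qed
qed

end

section \<open>Bootstrap on the order of differentiation\<close>

locale lagrangian_chains = lagrangian_solution +
  fixes m :: nat and Fw Fr :: "nat \<Rightarrow> real \<Rightarrow> real"
  assumes m: "2 \<le> m" and Fw: "chain m Fw" and Fr: "chain m Fr"
    and Fw_eq: "Fw 0 = w" "Fw (Suc 0) = w1" and Fr_eq: "Fr 0 = r" "Fr (Suc 0) = r1"
begin

lemma m1: "1 \<le> m" using m by simp

lemma Wk_w: "k \<le> m \<Longrightarrow> Wk k m (\<lambda>t x. w x)" and Wk_r: "k \<le> m \<Longrightarrow> Wk k m (\<lambda>t x. r x)"
  using chain_Wk[OF Fw, of 0 k 0] chain_Wk[OF Fr, of 0 k 0] m1 by (simp_all add: Fw_eq Fr_eq)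

lemma Wk_w1: "Suc k \<le> m \<Longrightarrow> Wk k m (\<lambda>t x. x * w1 x)" and Wk_r1: "Suc k \<le> m \<Longrightarrow> Wk k m (\<lambda>t x. x * r1 x)"
  using chain_Wk[OF Fw, of "Suc 0" k "Suc 0"] chain_Wk[OF Fr, of "Suc 0" k "Suc 0"] m1 by (simp_all add: Fw_eq Fr_eq)

lemma C_split: "t \<in> {0..T} \<Longrightarrow> x \<in> {0<..1} \<Longrightarrow> C t x = time_int (\<lambda>t x. w x) t x + r x * time_int2 V t x"
  using C_eq[of t x] by (simp add: time_int_def)

lemma expm1_dominated: "dominated m (\<lambda>t x. exp (C t x) - 1)"
  and expm1_half_bounded: "half_bounded m (\<lambda>t x. exp (C t x) - 1)"
proof -
  have w: "dominated m (\<lambda>t x. w x)" "half_bounded m (\<lambda>t x. w x)"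
    and r: "dominated m (\<lambda>t x. r x)" "half_bounded m (\<lambda>t x. r x)"
    using Wk_w[of 1] Wk_r[of 1] m1 by auto
  note V = bounded_time_int[OF bounded_time_int[OF bounded_V]]
  have "dominated m C"
    by (rule dominated_cong[OF dominated_add[OF dominated_time_int[OF w(1)] dominated_mult[OF r(1) V]] C_split])
  then obtain G where G: "G \<in> L2" "tlip {0<..1} (\<lambda>x. x ^ m * G x) C" by (auto simp: dominated_def)
  have "tlip {0<..1} (\<lambda>x. x ^ m * (3 * G x)) (\<lambda>t x. exp (C t x) - 1)"
    by (rule tlip_mono[OF expm1_tlip[OF G(2)]]) simp
  moreover have "meas (\<lambda>t x. exp (C t x) - 1)"
    using bounded_expC unfolding bounded_tlip_def meas_def by (auto intro: borel_measurable_diff)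
  ultimately show "dominated m (\<lambda>t x. exp (C t x) - 1)"
    using dominatedI[OF _ L2_cmult[OF G(1), of 3]] by blast
  have "half_bounded m C"
    by (rule half_bounded_cong[OF half_bounded_add[OF half_bounded_time_int[OF w(2)] half_bounded_mult[OF r(2) V]] C_split])
  then obtain D where D: "tlip {0<..1} (\<lambda>x. D * (x ^ m / sqrt x)) C" by (auto simp: half_bounded_def)
  have "tlip {0<..1} (\<lambda>x. (3 * D) * (x ^ m / sqrt x)) (\<lambda>t x. exp (C t x) - 1)"
    by (rule tlip_mono[OF expm1_tlip[OF D]]) simp
  then show "half_bounded m (\<lambda>t x. exp (C t x) - 1)" by (rule half_boundedI)
qed

lemma expm1_1: "t \<in> {0..T} \<Longrightarrow> exp (C t 1) - 1 = 0"
  using C_eq[of t 1] w_1 r_1 by simp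

text \<open>x d/dx of e^C and of V is built by products and sums from Q, e^C, e^C - 1 and V, so
  order k for all of these gives order k + 1 for the last three.\<close>

lemma bootstrap_multipliers:
  assumes "Bk k m (\<lambda>t x. exp (C t x))" "Bk k m V" "Wk k m (\<lambda>t x. exp (C t x) - 1)" "Wk k m Q"
  shows "Bk (Suc k) m (\<lambda>t x. exp (C t x))" "Bk (Suc k) m V" "Wk (Suc k) m (\<lambda>t x. exp (C t x) - 1)"
proof -
  note W = Wk_mult[OF assms(4,1) m1]
  show "Bk (Suc k) m (\<lambda>t x. exp (C t x))" by (rule Bk_SucI[OF bounded_expC W theta_expC])
  show "Wk (Suc k) m (\<lambda>t x. exp (C t x) - 1)"
    by (rule Wk_SucI[OF expm1_dominated expm1_half_bounded expm1_1 W theta_E])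
  show "Bk (Suc k) m V"
    by (rule Bk_SucI[OF bounded_V _ theta_V])
       (rule Wk_mult[OF Wk_add[OF Wk_cmult[OF assms(3) m1] Wk_cmult[OF assms(4) m1]] assms(2) m1])
qed

text \<open>By x V_x = - V (e^C - 1 + Q), this is x d/dx of the right-hand side of
  \<open>C_eq\<close> without the term linear in Q, which becomes the Volterra kernel.\<close>

definition S where "S t x = time_int (\<lambda>t x. x * w1 x) t x +
  time_int2 (\<lambda>t x. (x * r1 x) * V t x + - 1 * ((exp (C t x) - 1) * (r x * V t x))) t x"

lemma Q_volterra: "solves_volterra (\<lambda>t x. - 1 * (r x * V t x)) S Q"
  unfolding solves_volterra_def
proof (intro ballI conjI)
  fix x :: real assume x: "x \<in> {0<..1}"
  then have x': "x \<in> {0..1}" by auto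
  have tc: "tcont f x" if "cont2 T f" for f using cont2_t[OF that x'] by (simp add: tcont_def)
  have c: "cont2 T (\<lambda>t x. (x * r1 x) * V t x + - 1 * ((exp (C t x) - 1) * (r x * V t x)))"
    "cont2 T (\<lambda>t x. - 1 * (r x * V t x) * Q t x)" "cont2 T (\<lambda>t x. x * w1 x)" "cont2 T Q"
    "cont2 T (\<lambda>t x. x * r1 x * V t x)" "cont2 T (\<lambda>t x. x * r x * Vx t x)"
    by (intro cont2_add cont2_mult cont2_snd cont2_of_x w1_cont r1_cont r_cont cont2_diff cont2_const
        cont2_exp cont2_C cont2_V cont2_Vx q_cont)+
  show "tcont Q x" by (rule tc[OF c(4)])
  fix t assume t: "t \<in> {0..T}"
  let ?f = "\<lambda>t x. (x * r1 x) * V t x + - 1 * ((exp (C t x) - 1) * (r x * V t x))"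
  let ?g = "\<lambda>t x. - 1 * (r x * V t x) * Q t x"
  have "Q t x = t * (x * w1 x) + (x * r1 x * time_int2 V t x + x * r x * time_int2 Vx t x)"
    unfolding q_eq[OF t x'] by (simp add: algebra_simps)
  also have "t * (x * w1 x) = time_int (\<lambda>t x. x * w1 x) t x" using t by (simp add: time_int_def)
  also have "x * r1 x * time_int2 V t x = time_int2 (\<lambda>t x. x * r1 x * V t x) t x"
    by (simp add: time_int_def)
  also have "x * r x * time_int2 Vx t x = time_int2 (\<lambda>t x. x * r x * Vx t x) t x"
    by (simp add: time_int_def)
  also have "time_int2 (\<lambda>t x. x * r1 x * V t x) t x + time_int2 (\<lambda>t x. x * r x * Vx t x) t x =
      time_int2 (\<lambda>t x. x * r1 x * V t x + x * r x * Vx t x) t x"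
    by (rule time_int2_add[symmetric, OF tc[OF c(5)] tc[OF c(6)] t])
  also have "(\<lambda>t x. x * r1 x * V t x + x * r x * Vx t x) = (\<lambda>t x. ?f t x + ?g t x)"
    by (intro ext) (simp add: Vx_def mult_h[symmetric] algebra_simps)
  also have "time_int2 (\<lambda>t x. ?f t x + ?g t x) t x = time_int2 ?f t x + time_int2 ?g t x"
    by (rule time_int2_add[OF tc[OF c(1)] tc[OF c(2)] t])
  finally show "Q t x = S t x + time_int2 ?g t x" by (simp add: S_def)
qed

text \<open>The source contains the derivatives \<open>w1\<close> and \<open>r1\<close> of the data,
  hence the requirement that one order be left over.\<close>

lemma Q_Wk:
  assumes "Suc k \<le> m" "Bk k m V" "Wk k m (\<lambda>t x. exp (C t x) - 1)" shows "Wk k m Q"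
proof -
  have k: "k \<le> m" using assms(1) by simp
  have rV: "Wk k m (\<lambda>t x. r x * V t x)" by (rule Wk_mult[OF Wk_r[OF k] assms(2) m1])
  have brV: "Bk k m (\<lambda>t x. r x * V t x)"
  proof (rule Bk_of_Wk[OF rV])
    have "half_bounded m (\<lambda>t x. r x)" "dominated m (\<lambda>t x. r x)" using Wk_r[of 1] m1 by auto
    then have "bounded_tlip (\<lambda>t x. r x)" by (auto intro: half_bounded_bounded[OF _ m1] simp: dominated_def)
    from bounded_mult[OF this bounded_V] show "bounded_tlip (\<lambda>t x. r x * V t x)" .
  qed
  have a: "Bk k m (\<lambda>t x. - 1 * (r x * V t x))"
    by (rule Bk_of_Wk[OF Wk_cmult[OF rV m1] bounded_mult[OF bounded_const Bk_bounded[OF brV]]])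
  have "Wk k m S"
    unfolding S_def[abs_def]
    by (rule Wk_add[OF Wk_time_int[OF Wk_w1[OF assms(1)] m1] Wk_time_int[OF Wk_time_int[OF Wk_add m1] m1]])
       (rule Wk_mult[OF Wk_r1[OF assms(1)] assms(2) m1], rule Wk_cmult[OF Wk_mult[OF assms(3) brV m1] m1])
  then show ?thesis by (rule volterra_Wk[OF _ a a_tlip a_small Q_volterra m1])
qed

text \<open>The loop closes because Q at order k needs V and e^C - 1 only at order k, and then
  raises both to order k + 1.\<close>

lemma V_multiplier: "Bk m m V"
proof -
  have "Bk k m (\<lambda>t x. exp (C t x)) \<and> Bk k m V \<and> Wk k m (\<lambda>t x. exp (C t x) - 1)" if "k \<le> m" for k
    using that
  proof (induction k)
    case 0 then show ?case using bounded_expC bounded_V expm1_dominated by simp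
  next
    case (Suc k)
    then have IH: "Bk k m (\<lambda>t x. exp (C t x))" "Bk k m V" "Wk k m (\<lambda>t x. exp (C t x) - 1)" by auto
    have q: "Wk k m Q" by (rule Q_Wk[OF Suc.prems IH(2,3)])
    have B: "Bk (Suc k) m (\<lambda>t x. exp (C t x))" by (rule bootstrap_multipliers(1)[OF IH q])
    have B2: "Bk (Suc k) m V" by (rule bootstrap_multipliers(2)[OF IH q])
    have B3: "Wk (Suc k) m (\<lambda>t x. exp (C t x) - 1)" by (rule bootstrap_multipliers(3)[OF IH q])
    show ?case by (rule conjI[OF B conjI[OF B2 B3]])
  qed
  then show ?thesis by blast
qed

lemma Wk_W: "Wk m m W" and Wk_rV: "Wk m m (\<lambda>t x. r x * V t x)"
  unfolding W_def[abs_def]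
  by (rule Wk_add[OF Wk_w[OF order.refl] Wk_mult[OF Wk_r[OF order.refl] Bk_time_int[OF V_multiplier m1] m1]],
      rule Wk_mult[OF Wk_r[OF order.refl] V_multiplier m1])

end

section \<open>Regularity in Eulerian coordinates\<close>

text \<open>Integrability up to 0 determines F on (0, 1) as a continuous primitive; the limit
  condition excludes a jump at 0.\<close>

lemma prim_from_interior:
  assumes F: "\<And>a. 0 < a \<Longrightarrow> a < 1 \<Longrightarrow> prim a 1 F f" and f: "f absolutely_integrable_on {0..1}"
    and lim: "(F \<longlongrightarrow> F 0) (at_right 0)"
  shows "prim 0 1 F f"
proof -
  define G where "G x = F 1 - integral {0..1} f + integral {0..x} f" for x
  have G: "prim 0 1 G f" by (rule primI[OF f]) (simp add: G_def)
  have eq: "F x = G x" if "0 < x" "x < 1" for x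
    using prim_diff[OF F[OF that], of x 1] prim_diff[OF G, of x 1] that by (simp add: G_def)
  have "(G \<longlongrightarrow> G 0) (at 0 within {0..1})"
    using prim_cont[OF G] unfolding continuous_on_def by auto
  then have "(G \<longlongrightarrow> G 0) (at_right 0)" by (simp add: at_within_Icc_at_right)
  moreover have "\<forall>\<^sub>F x in at_right 0. G x = F x"
    unfolding eventually_at_right_field by (rule exI[of _ 1]) (use eq in auto)
  ultimately have "(F \<longlongrightarrow> G 0) (at_right 0)"
    by (rule Lim_transform_eventually)
  then have "F 0 = G 0" using tendsto_unique[OF _ lim] by simp
  show ?thesis
  proof (rule prim_cong[OF G])
    fix x :: real assume "x \<in> {0..1}"
    then consider "x = 0" | "x = 1" | "0 < x" "x < 1" by fastforce
    then show "G x = F x" by cases (use eq \<open>F 0 = G 0\<close> in \<open>auto simp: G_def\<close>)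
  qed simp
qed

lemma L2_cong:
  assumes "f \<in> L2" "\<And>x. x \<in> {0<..<1} \<Longrightarrow> g x = f x" shows "g \<in> L2" "L2_norm g = L2_norm f"
proof -
  have m: "g \<in> borel_measurable lebesgue01"
    by (rule measurable_cong[THEN iffD1, rotated, OF L2_measurable[OF assms(1)]])
       (simp add: space_restrict_space assms(2))
  show "g \<in> L2" by (rule L2_bound[OF assms(1) m]) (simp add: assms(2))
  show "L2_norm g = L2_norm f"
    by (rule L2_norm_cong_AE[OF m L2_measurable[OF assms(1)]], rule AE_I2) (simp add: space_restrict_space assms(2))
qed

context lagrangian_solution
begin

section \<open>Composition with the inverse flow\<close>

lemma Y_mono:
  assumes "t \<in> {0..T}" "s \<in> {0..1}" "x \<in> {0..1}" "s \<le> x" shows "Y t s \<le> Y t x"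
proof (rule ccontr)
  assume "\<not> Y t s \<le> Y t x"
  then show False
    using X_expand[OF assms(1) Y_in[OF assms(1,3)] Y_in[OF assms(1,2)]] X_Y[OF assms(1,2)] X_Y[OF assms(1,3)] assms(4)
    by simp
qed

lemma Y_image: assumes "t \<in> {0..T}" "x \<in> {0..1}" shows "Y t ` {0..x} = {0..Y t x}"
proof
  show "Y t ` {0..x} \<subseteq> {0..Y t x}" using Y_mono[OF assms(1)] Y_in[OF assms(1)] assms(2) by force
  show "{0..Y t x} \<subseteq> Y t ` {0..x}"
  proof
    fix y assume y: "y \<in> {0..Y t x}"
    have yx: "Y t x \<in> {0..1}" by (rule Y_in[OF assms])
    have y': "y \<in> {0..1}" using y yx by auto
    have "X t y \<le> x" using X_expand[OF assms(1) y' yx] y X_Y[OF assms] by simp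
    moreover have "0 \<le> X t y" using X_expand[OF assms(1) _ y', of 0] y by simp
    ultimately have "X t y \<in> {0..x}" by simp
    moreover have "Y t (X t y) = y" by (rule Y_X[OF assms(1) y'])
    ultimately show "y \<in> Y t ` {0..x}" by force
  qed
qed

lemma Y_change_of_variables:
  assumes t: "t \<in> {0..T}" and x: "x \<in> {0..1}" and f: "f absolutely_integrable_on {0..Y t x}"
  shows "(\<lambda>s. V t (Y t s) * f (Y t s)) absolutely_integrable_on {0..x}"
    "integral {0..x} (\<lambda>s. V t (Y t s) * f (Y t s)) = integral {0..Y t x} f"
proof -
  have inj: "inj_on (Y t) {0..x}"
    by (rule inj_on_inverseI[where g="X t"]) (rule X_Y[OF t], use x in auto)
  have d: "(Y t has_field_derivative V t (Y t s)) (at s within {0..x})" if "s \<in> {0..x}" for s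
    by (rule DERIV_subset[OF Y_x_deriv[OF t]]) (use that x in auto)
  have "(\<lambda>s. \<bar>V t (Y t s)\<bar> * f (Y t s)) absolutely_integrable_on {0..x} \<and>
      integral {0..x} (\<lambda>s. \<bar>V t (Y t s)\<bar> * f (Y t s)) = integral {0..Y t x} f"
    using has_absolute_integral_change_of_variables_1'[of "{0..x}" "Y t" "\<lambda>s. V t (Y t s)" f "integral {0..Y t x} f", OF _ d inj]
      f unfolding Y_image[OF t x] by simp
  moreover have "\<bar>V t y\<bar> = V t y" for y using V_pos[of t y] by simp
  ultimately show "(\<lambda>s. V t (Y t s) * f (Y t s)) absolutely_integrable_on {0..x}"
    "integral {0..x} (\<lambda>s. V t (Y t s) * f (Y t s)) = integral {0..Y t x} f" by simp_all
qed

lemma V_nz: "V t x \<noteq> 0" using V_pos[of t x] by simp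

text \<open>Y has slope V evaluated along Y, so a density written as f / V becomes exactly f
  composed with Y.\<close>

lemma prim_along_Y:
  assumes t: "t \<in> {0..T}" and F: "prim 0 1 F (\<lambda>z. f z / V t z)"
  shows "prim 0 1 (\<lambda>x. F (Y t x)) (\<lambda>x. f (Y t x))"
proof (rule primI)
  have one: "(1::real) \<in> {0..1}" by simp
  have i: "(\<lambda>z. f z / V t z) absolutely_integrable_on {0..Y t x}" if "x \<in> {0..1}" for x
    using Y_in[OF t that] by (intro prim_integrable_sub[OF F]) auto
  show "(\<lambda>x. f (Y t x)) absolutely_integrable_on {0..1}"
    using Y_change_of_variables(1)[OF t one i[OF one]] V_nz by simp
  fix x :: real assume "0 \<le> x" "x \<le> 1"
  then have x: "x \<in> {0..1}" by simp
  show "F (Y t x) - F (Y t 0) = integral {0..x} (\<lambda>x. f (Y t x))"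
    using Y_change_of_variables(2)[OF t x i[OF x]] V_nz prim_diff[OF F, of 0 "Y t x"] Y_in[OF t x] Y_0[OF t] by simp
qed

text \<open>The change of variables has Jacobian X_x, bounded uniformly in time; hence one constant
  for all t.\<close>

lemma Y_L2:
  obtains c where "c > 0" "\<And>t f. t \<in> {0..T} \<Longrightarrow> f \<in> L2 \<Longrightarrow> (\<lambda>x. f (Y t x)) \<in> L2"
    "\<And>t f. t \<in> {0..T} \<Longrightarrow> f \<in> L2 \<Longrightarrow> L2_norm (\<lambda>x. f (Y t x)) \<le> c * L2_norm f"
proof -
  obtain B where B: "B > 0" "\<And>t x. t \<in> {0..T} \<Longrightarrow> x \<in> {0..1} \<Longrightarrow> \<bar>Xx t x\<bar> \<le> B"
    using cont2_bounded[OF cont2_Xx] by metis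
  have cv: "integrable lebesgue01 (\<lambda>x. g (Y t x)) \<and> (LINT x|lebesgue01. g (Y t x)) = integral {0..1} (\<lambda>z. Xx t z * g z)
      \<and> (\<lambda>z. Xx t z * g z) absolutely_integrable_on {0..1}"
    if t: "t \<in> {0..T}" and g: "integrable lebesgue01 g" for t and g :: "real \<Rightarrow> real"
  proof -
    have one: "(1::real) \<in> {0..1}" by simp
    have i: "(\<lambda>z. Xx t z * g z) absolutely_integrable_on {0..1}"
      using abs_integrable_cont_mult(2)[OF g[unfolded integrable01_iff] cont2_x[OF cont2_Xx t]] .
    have e: "V t y * (Xx t y * g y) = g y" for y
    proof -
      have "V t y * (Xx t y * g y) = (Xx t y * V t y) * g y" by (simp only: mult_ac)
      then show ?thesis by (simp add: Xx_V)
    qed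
    have "(\<lambda>x. g (Y t x)) absolutely_integrable_on {0..1}"
      "integral {0..1} (\<lambda>x. g (Y t x)) = integral {0..1} (\<lambda>z. Xx t z * g z)"
      using Y_change_of_variables[OF t one, of "\<lambda>z. Xx t z * g z"] i unfolding Y_1[OF t] e by auto
    then show ?thesis using i integral01_eq[of "\<lambda>x. g (Y t x)"] integrable01_iff[of "\<lambda>x. g (Y t x)"] by simp
  qed
  have mem: "(\<lambda>x. f (Y t x)) \<in> L2" if t: "t \<in> {0..T}" and f: "f \<in> L2" for t and f :: "real \<Rightarrow> real"
    using cv[OF t L2_integrable[OF f]] cv[OF t L2_square[OF f]] unfolding L2_def by auto
  have norm: "L2_norm (\<lambda>x. f (Y t x)) \<le> sqrt B * L2_norm f" if t: "t \<in> {0..T}" and f: "f \<in> L2" for t and f :: "real \<Rightarrow> real"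
  proof -
    note c = cv[OF t L2_square[OF f]]
    have fi: "(\<lambda>z. (f z)\<^sup>2) absolutely_integrable_on {0..1}" using L2_square[OF f] integrable01_iff by blast
    have "(L2_norm (\<lambda>x. f (Y t x)))\<^sup>2 = integral {0..1} (\<lambda>z. Xx t z * (f z)\<^sup>2)"
      using c by (simp add: L2_norm_square)
    also have "\<dots> \<le> integral {0..1} (\<lambda>z. B * (f z)\<^sup>2)"
    proof (rule integral_le)
      show "(\<lambda>z. Xx t z * (f z)\<^sup>2) integrable_on {0..1}" using c set_lebesgue_integral_eq_integral(1) by blast
      show "(\<lambda>z. B * (f z)\<^sup>2) integrable_on {0..1}"
        by (rule integrable_on_mult_right) (use fi set_lebesgue_integral_eq_integral(1) in blast)
      show "Xx t z * (f z)\<^sup>2 \<le> B * (f z)\<^sup>2" if "z \<in> {0..1}" for z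
        using B(2)[OF t that] by (intro mult_right_mono) auto
    qed
    also have "\<dots> = B * (L2_norm f)\<^sup>2"
      using integral01_eq[OF L2_square[OF f]] by (simp add: L2_norm_square)
    finally have "sqrt ((L2_norm (\<lambda>x. f (Y t x)))\<^sup>2) \<le> sqrt (B * (L2_norm f)\<^sup>2)" by (rule real_sqrt_le_mono)
    then show ?thesis by (simp add: real_sqrt_mult)
  qed
  show ?thesis by (rule that[OF _ mem norm]) (use B in auto)
qed

text \<open>The weighted classes live on (0, 1] and say nothing about values at 0. Setting the
  function to 0 off (0, 1) builds in the boundary values.\<close>

definition eul where "eul f t x = (if x \<in> {0<..<1} then f t (Y t x) else 0)"

lemma eul_L2:
  assumes "t \<in> {0..T}" "f t \<in> L2" shows "eul f t \<in> L2"
proof -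
  obtain c where c: "c > 0" "\<And>t f. t \<in> {0..T} \<Longrightarrow> f \<in> L2 \<Longrightarrow> (\<lambda>x. f (Y t x)) \<in> L2"
    "\<And>t f. t \<in> {0..T} \<Longrightarrow> f \<in> L2 \<Longrightarrow> L2_norm (\<lambda>x. f (Y t x)) \<le> c * L2_norm f" using Y_L2 by metis
  show ?thesis by (rule L2_cong(1)[OF c(2)[OF assms]]) (simp add: eul_def)
qed

text \<open>Composition with Y s converges strongly but not in operator norm. The difference is
  split by the Lipschitz bound in time, two approximations of f t by a test function, and the
  uniform continuity of that function together with that of Y; each part costs a quarter of
  e.\<close>

lemma eul_L2_continuous:
  assumes f: "dominated 0 f" and t: "t \<in> {0..T}"
  shows "((\<lambda>s. L2_norm (\<lambda>x. eul f s x - eul f t x)) \<longlongrightarrow> 0) (at t within {0..T})"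
proof (rule tendstoI)
  fix e :: real assume e: "e > 0"
  obtain c where c: "c > 0" "\<And>t f. t \<in> {0..T} \<Longrightarrow> f \<in> L2 \<Longrightarrow> (\<lambda>x. f (Y t x)) \<in> L2"
    "\<And>t f. t \<in> {0..T} \<Longrightarrow> f \<in> L2 \<Longrightarrow> L2_norm (\<lambda>x. f (Y t x)) \<le> c * L2_norm f" using Y_L2 by metis
  obtain G where G: "G \<in> L2" "tlip {0<..1} (\<lambda>x. x ^ 0 * G x) f" using f by (auto simp: dominated_def)
  have fL: "f s \<in> L2" if "s \<in> {0..T}" for s by (rule dominated_L2[OF f that])
  obtain \<phi> where \<phi>: "\<phi> \<in> test_functions" "L2_norm (\<lambda>x. f t x - \<phi> x) < e / (4 * c)"
    using L2_approx_test[OF fL[OF t], of "e / (4 * c)"] e c(1) by auto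
  have "uniformly_continuous_on {0..1} \<phi>"
    by (rule compact_uniformly_continuous[OF test_continuous[OF \<phi>(1)]]) simp
  then obtain \<delta> where \<delta>: "\<delta> > 0" "\<And>y y'. y \<in> {0..1} \<Longrightarrow> y' \<in> {0..1} \<Longrightarrow> \<bar>y - y'\<bar> < \<delta> \<Longrightarrow> \<bar>\<phi> y - \<phi> y'\<bar> < e / 4"
    using e unfolding uniformly_continuous_on_def dist_real_def by (metis zero_less_divide_iff zero_less_numeral abs_minus_commute)
  obtain L where L: "L > 0" "\<And>s t x y. s \<in> {0..T} \<Longrightarrow> t \<in> {0..T} \<Longrightarrow> x \<in> {0..1} \<Longrightarrow> y \<in> {0..1} \<Longrightarrow>
      \<bar>Y s x - Y t y\<bar> \<le> L * (\<bar>s - t\<bar> + \<bar>x - y\<bar>)" using Y_lipschitz by metis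
  define N where "N = c * L2_norm G + 1"
  have N: "N > 0" using c(1) by (simp add: N_def add_nonneg_pos)
  define d where "d = min (\<delta> / L) (e / (4 * N))"
  have d: "d > 0" using \<delta> L N e by (simp add: d_def)
  have "dist (L2_norm (\<lambda>x. eul f s x - eul f t x)) 0 < e" if s: "s \<in> {0..T}" and st: "dist s t < d" for s
  proof -
    have st': "\<bar>s - t\<bar> < \<delta> / L" "\<bar>s - t\<bar> < e / (4 * N)" using st by (auto simp: d_def dist_real_def)
    let ?a = "\<lambda>x. f s (Y s x)" and ?b = "\<lambda>x. f t (Y s x)" and ?p = "\<lambda>x. \<phi> (Y s x)"
      and ?p' = "\<lambda>x. \<phi> (Y t x)" and ?b' = "\<lambda>x. f t (Y t x)"
    have pL: "\<phi> \<in> L2" by (rule test_L2[OF \<phi>(1)])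
    note mem = c(2)[OF s fL[OF s]] c(2)[OF s fL[OF t]] c(2)[OF s pL] c(2)[OF t pL] c(2)[OF t fL[OF t]]
    have "L2_norm (\<lambda>x. ?a x - ?b x) \<le> c * L2_norm (\<lambda>x. f s x - f t x)"
      by (rule c(3)[OF s L2_diff[OF fL[OF s] fL[OF t]]])
    also have "L2_norm (\<lambda>x. f s x - f t x) \<le> L2_norm (\<lambda>x. \<bar>s - t\<bar> * G x)"
    proof (rule L2_norm_mono[OF L2_cmult[OF G(1)] L2_measurable[OF L2_diff[OF fL[OF s] fL[OF t]]]])
      fix x :: real assume "x \<in> {0<..<1}"
      then have "\<bar>f s x - f t x\<bar> \<le> \<bar>s - t\<bar> * (x ^ 0 * G x)" by (intro tlipD(2)[OF G(2) _ s t]) auto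
      then show "\<bar>f s x - f t x\<bar> \<le> \<bar>\<bar>s - t\<bar> * G x\<bar>" by simp
    qed
    also have "\<dots> = \<bar>s - t\<bar> * L2_norm G" by (simp add: L2_norm_cmult)
    finally have "L2_norm (\<lambda>x. ?a x - ?b x) \<le> \<bar>s - t\<bar> * (c * L2_norm G)"
      using c(1) by (simp add: mult_left_mono mult.left_commute)
    also have "\<dots> \<le> \<bar>s - t\<bar> * N" by (intro mult_left_mono) (auto simp: N_def)
    also have "\<dots> < e / 4" using st'(2) N by (simp add: field_simps)
    finally have 1: "L2_norm (\<lambda>x. ?a x - ?b x) < e / 4" .
    have small: "c * L2_norm (\<lambda>x. f t x - \<phi> x) < e / 4" using \<phi>(2) c(1) by (simp add: field_simps)
    have 2: "L2_norm (\<lambda>x. ?b x - ?p x) < e / 4"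
      using c(3)[OF s L2_diff[OF fL[OF t] pL]] small by simp
    have 4: "L2_norm (\<lambda>x. ?p' x - ?b' x) < e / 4"
      using c(3)[OF t L2_diff[OF fL[OF t] pL]] small by (subst L2_norm_minus_commute) simp
    have 3: "L2_norm (\<lambda>x. ?p x - ?p' x) \<le> e / 4"
    proof (rule L2_norm_le_bound[OF L2_measurable[OF L2_diff[OF mem(3,4)]]])
      fix x :: real assume "x \<in> {0<..<1}"
      then have x: "x \<in> {0..1}" by auto
      have "\<bar>Y s x - Y t x\<bar> \<le> L * \<bar>s - t\<bar>" using L(2)[OF s t x x] by simp
      also have "\<dots> < \<delta>" using st'(1) L(1) by (simp add: field_simps)
      finally show "\<bar>?p x - ?p' x\<bar> \<le> e / 4" using \<delta>(2)[OF Y_in[OF s x] Y_in[OF t x]] by simp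
    qed (use e in simp)
    have "L2_norm (\<lambda>x. eul f s x - eul f t x) = L2_norm (\<lambda>x. ?a x - ?b' x)"
      by (rule L2_cong(2)[OF L2_diff[OF mem(1,5)]]) (simp add: eul_def)
    then show ?thesis
      using 1 2 3 4 L2_norm_triangle3[OF mem(1,2,5)] L2_norm_triangle3[OF mem(2,3,5)] L2_norm_triangle3[OF mem(3,4,5)]
      by simp
  qed
  then show "\<forall>\<^sub>F s in at t within {0..T}. dist (L2_norm (\<lambda>x. eul f s x - eul f t x)) 0 < e"
    unfolding eventually_at using d by blast
qed

lemma eul_C_sobolev0:
  assumes ch: "\<And>t. t \<in> {0..T} \<Longrightarrow> chain k (\<lambda>j. eul (fs j) t)" and dom: "\<And>j. j \<le> k \<Longrightarrow> dominated 0 (fs j)"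
  shows "eul (fs 0) \<in> C_sobolev0 T k"
  unfolding C_sobolev0_def
proof (intro CollectI ballI conjI)
  fix t assume t: "t \<in> {0..T}"
  show "eul (fs 0) t \<in> sobolev0 k" by (rule chain_sobolev0[OF ch[OF t]])
  let ?n = "\<lambda>j s. L2_norm (\<lambda>x. eul (fs j) s x - eul (fs j) t x)"
  have "((\<lambda>s. sqrt (\<Sum>j\<le>k. (?n j s)\<^sup>2)) \<longlongrightarrow> sqrt (\<Sum>j\<le>k. 0\<^sup>2)) (at t within {0..T})"
    by (intro tendsto_real_sqrt tendsto_sum tendsto_power eul_L2_continuous dom t) simp
  moreover have "\<forall>\<^sub>F s in at t within {0..T}. sqrt (\<Sum>j\<le>k. (?n j s)\<^sup>2) = sobolev_norm k (\<lambda>x. eul (fs 0) s x - eul (fs 0) t x)"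
    unfolding eventually_at_filter
  proof (rule always_eventually, intro allI impI)
    fix s assume "s \<in> {0..T}"
    from chain_sobolev(2)[OF chain_diff[OF ch[OF this] ch[OF t]]]
    show "sqrt (\<Sum>j\<le>k. (?n j s)\<^sup>2) = sobolev_norm k (\<lambda>x. eul (fs 0) s x - eul (fs 0) t x)" by simp
  qed
  ultimately show "((\<lambda>s. sobolev_norm k (\<lambda>x. eul (fs 0) s x - eul (fs 0) t x)) \<longlongrightarrow> 0) (at t within {0..T})"
    using Lim_transform_eventually by fastforce
qed

text \<open>For j < k the weight is still at least 1, so the pointwise bound gives |fs j| \<le> D
  sqrt x and the limit 0 at 0; vanishing at 1 is part of \<open>Wk\<close>. The density fs (j+1) / V
  equals fs (j+1) X_x and is integrable.\<close>

lemma eul_chain: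
  assumes W: "\<And>j. j \<le> k \<Longrightarrow> Wk (k - j) (k - j) (fs j)"
    and p: "\<And>j t a. j < k \<Longrightarrow> t \<in> {0..T} \<Longrightarrow> a \<in> {0<..<1} \<Longrightarrow> prim a 1 (fs j t) (\<lambda>z. fs (Suc j) t z / V t z)"
    and t: "t \<in> {0..T}"
  shows "chain k (\<lambda>j. eul (fs j) t)"
proof -
  define g where "g j z = (if z \<in> {0<..<1} then fs j t z else 0)" for j z
  have L: "fs j t \<in> L2" if "j \<le> k" for j by (rule dominated_L2[OF Wk_dominated[OF W[OF that]] t])
  have gL: "g j \<in> L2" if "j \<le> k" for j by (rule L2_cong(1)[OF L[OF that]]) (simp add: g_def)
  have gp: "prim 0 1 (g j) (\<lambda>z. g (Suc j) z / V t z)" if j: "j < k" for j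
  proof (rule prim_from_interior)
    obtain n where n: "k - j = Suc n" using j by (cases "k - j") auto
    have Wj: "half_bounded (k - j) (fs j)" "\<forall>t\<in>{0..T}. fs j t 1 = 0"
      using W[of j] j unfolding n by auto
    show "prim a 1 (g j) (\<lambda>z. g (Suc j) z / V t z)" if a: "0 < a" "a < 1" for a
    proof (rule prim_cong[OF p[OF j t]])
      fix x assume "x \<in> {a..1}"
      then show "fs j t x = g j x" using Wj(2) t a by (cases "x = 1") (auto simp: g_def)
    qed (use a in \<open>auto simp: g_def\<close>)
    have "(\<lambda>z. g (Suc j) z * Xx t z) absolutely_integrable_on {0..1}"
      by (rule abs_integrable_cont_mult(1)[OF L2_abs_integrable[OF gL] cont2_x[OF cont2_Xx t]]) (use j in simp)
    moreover have "g (Suc j) z * Xx t z = g (Suc j) z / V t z" for z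
      using Xx_V[of t z] V_nz[of t z] by (simp add: field_simps)
    ultimately show "(\<lambda>z. g (Suc j) z / V t z) absolutely_integrable_on {0..1}" by simp
    obtain D where D: "tlip {0<..1} (\<lambda>x. D * (x ^ 1 / sqrt x)) (fs j)"
      using half_bounded_mono[OF Wj(1), of 1] n by (auto simp: half_bounded_def)
    have b: "\<bar>g j x\<bar> \<le> D * sqrt x" if "0 < x" "x < 1" for x
      using tlipD(1)[OF D _ t, of x] that by (simp add: g_def real_div_sqrt)
    have "((\<lambda>x. D * sqrt x) \<longlongrightarrow> D * sqrt 0) (at_right 0)" by (intro tendsto_intros)
    then have "((\<lambda>x. D * sqrt x) \<longlongrightarrow> 0) (at_right 0)" by simp
    moreover have "\<forall>\<^sub>F x in at_right 0. norm (g j x) \<le> D * sqrt x"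
      unfolding eventually_at_right_field by (rule exI[of _ 1]) (use b in auto)
    ultimately have "(g j \<longlongrightarrow> 0) (at_right 0)" by (rule Lim_null_comparison[rotated])
    then show "(g j \<longlongrightarrow> g j 0) (at_right 0)" by (simp add: g_def)
  qed
  have eq: "g j (Y t x) = eul (fs j) t x" if "x \<in> {0..1}" for j x
    using that Y_interior[OF t, of x] Y_0[OF t] Y_1[OF t] by (cases "x = 0"; cases "x = 1") (auto simp: g_def eul_def)
  show ?thesis
    unfolding chain_def
  proof (intro conjI allI impI)
    show "eul (fs k) t \<in> L2" by (rule eul_L2[where f="fs k", OF t L]) simp
    fix j assume j: "j < k"
    show "prim 0 1 (eul (fs j) t) (eul (fs (Suc j)) t)"
      by (rule prim_cong[OF prim_along_Y[OF t gp[OF j]]]) (use eq in auto)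
  qed (simp_all add: eul_def)
qed

end

section \<open>The solution of the initial value problem\<close>

locale lagrangian_ivp = lagrangian_chains +
  fixes R :: "real \<Rightarrow> real"
  assumes R_prim: "prim 0 1 R r" and R_0: "R 0 = 0" and R_1: "R 1 = 0"
begin

definition om where "om = eul W"
definition rho where "rho = eul (\<lambda>t. R)"

lemma W_ends: "t \<in> {0..T} \<Longrightarrow> W t 0 = 0" "t \<in> {0..T} \<Longrightarrow> W t 1 = 0"
  by (simp_all add: W_def w_0 r_0 w_1 r_1)

lemma om_eq: assumes "t \<in> {0..T}" "x \<in> {0..1}" shows "om t x = W t (Y t x)"
  using assms Y_0[OF assms(1)] Y_1[OF assms(1)] W_ends[OF assms(1)]
  by (cases "x = 0"; cases "x = 1") (auto simp: om_def eul_def)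

lemma rho_eq: assumes "t \<in> {0..T}" "x \<in> {0..1}" shows "rho t x = R (Y t x)"
  using assms Y_0[OF assms(1)] Y_1[OF assms(1)] R_0 R_1
  by (cases "x = 0"; cases "x = 1") (auto simp: rho_def eul_def)

lemma om_C_sobolev0: "om \<in> C_sobolev0 T m"
proof -
  obtain fs where fs: "fs 0 = W" "\<forall>j\<le>m. Wk (m - j) (m - j) (fs j)"
    "\<forall>j<m. \<forall>t\<in>{0..T}. \<forall>a\<in>{0<..<1}. prim a 1 (fs j t) (\<lambda>z. fs (Suc j) t z / V t z)"
    using Wk_iterated_derivatives[OF V_multiplier V_nz Wk_W order.refl] by blast
  have dom: "dominated 0 (fs j)" if "j \<le> m" for j
    using dominated_mono[OF Wk_dominated, of "m - j" "m - j" "fs j" 0] fs(2) that by simp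
  have ch: "chain m (\<lambda>j. eul (fs j) t)" if "t \<in> {0..T}" for t
    by (rule eul_chain[OF _ _ that]) (use fs in auto)
  have "eul (fs 0) \<in> C_sobolev0 T m" by (rule eul_C_sobolev0[OF ch dom])
  then show ?thesis by (simp add: fs(1) om_def)
qed

text \<open>The extra derivative of the density comes for free: its slope along the flow is r V,
  which has full order m, and the chain of this slope is prolonged by \<open>R\<close> at the
  bottom.\<close>

lemma rho_C_sobolev0: "rho \<in> C_sobolev0 T (m + 1)"
proof -
  obtain fs where fs: "fs 0 = (\<lambda>t x. r x * V t x)" "\<forall>j\<le>m. Wk (m - j) (m - j) (fs j)"
    "\<forall>j<m. \<forall>t\<in>{0..T}. \<forall>a\<in>{0<..<1}. prim a 1 (fs j t) (\<lambda>z. fs (Suc j) t z / V t z)"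
    using Wk_iterated_derivatives[OF V_multiplier V_nz Wk_rV order.refl] by blast
  define gs where "gs = case_nat (\<lambda>t::real. R) fs"
  have gs: "gs 0 = (\<lambda>t. R)" "gs (Suc j) = fs j" for j by (simp_all add: gs_def)
  have dom: "dominated 0 (gs j)" if "j \<le> m + 1" for j
  proof (cases j)
    case 0
    have Rc: "continuous_on {0..1} R" by (rule prim_cont[OF R_prim])
    then have R: "R \<in> L2" by (rule continuous_L2)
    have "(\<lambda>x. \<bar>R x\<bar>) \<in> L2" by (rule continuous_L2) (intro continuous_intros Rc)
    moreover have "tlip {0<..1} (\<lambda>x. x ^ 0 * \<bar>R x\<bar>) (\<lambda>t. R)" by (rule tlip_const_time) simp
    moreover have "meas (\<lambda>t. R)" using L2_measurable[OF R] by (simp add: meas_def)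
    ultimately show ?thesis using dominatedI 0 gs(1) by metis
  next
    case (Suc i)
    then show ?thesis
      using dominated_mono[OF Wk_dominated, of "m - i" "m - i" "fs i" 0] fs(2) that gs(2) by simp
  qed
  have chain: "chain (m + 1) (\<lambda>j. eul (gs j) t)" if t: "t \<in> {0..T}" for t
    unfolding chain_def
  proof (intro conjI allI impI)
    have ch: "chain m (\<lambda>j. eul (fs j) t)" by (rule eul_chain[OF _ _ t]) (use fs in auto)
    show "eul (gs (m + 1)) t \<in> L2" using chain_L2[OF ch order.refl] by (simp add: gs)
    fix j assume j: "j < m + 1"
    show "eul (gs j) t 0 = 0" "eul (gs j) t 1 = 0" by (simp_all add: eul_def)
    show "prim 0 1 (eul (gs j) t) (eul (gs (Suc j)) t)"
    proof (cases j)
      case 0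
      have "prim 0 1 R (\<lambda>z. fs 0 t z / V t z)" using R_prim by (simp add: fs(1) V_nz)
      from prim_along_Y[OF t this] have "prim 0 1 (\<lambda>x. R (Y t x)) (\<lambda>x. fs 0 t (Y t x))" .
      then have "prim 0 1 (eul (gs 0) t) (eul (gs (Suc 0)) t)"
        by (rule prim_cong) (use rho_eq[OF t] in \<open>auto simp: gs rho_def eul_def\<close>)
      then show ?thesis using 0 by simp
    next
      case (Suc i)
      then show ?thesis using chainD(1)[OF ch, of i] j by (simp add: gs)
    qed
  qed
  have "eul (gs 0) \<in> C_sobolev0 T (m + 1)" by (rule eul_C_sobolev0[OF chain dom])
  then show ?thesis by (simp add: gs rho_def)
qed

section \<open>Verification of the equations\<close>

lemma deriv_compose_Y:
  assumes t: "t \<in> {0..T}" and x: "x \<in> {0..1}"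
    and f: "\<And>y. y \<in> {0..1} \<Longrightarrow> (f has_real_derivative f' y) (at y within {0..1})"
    and g: "\<And>y. y \<in> {0..1} \<Longrightarrow> g y = f (Y t y)"
  shows "(g has_real_derivative f' (Y t x) * V t (Y t x)) (at x within {0..1})"
proof (rule has_real_derivative_transform[OF _ x g])
  have "(f has_real_derivative f' (Y t x)) (at (Y t x) within Y t ` {0..1})"
    by (rule DERIV_subset[OF f[OF Y_in[OF t x]]]) (use Y_in[OF t] in auto)
  from DERIV_image_chain[OF this Y_x_deriv[OF t x]]
  show "((\<lambda>y. f (Y t y)) has_real_derivative f' (Y t x) * V t (Y t x)) (at x within {0..1})"
    by (simp add: o_def)
qed

text \<open>From y = z e^(-A) and W = z \<open>Wq\<close> with z = Y t y, the two factors z cancel,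
  so \<omega> / y is regular up to 0 and equals minus the y-derivative of \<Omega>.\<close>

lemma om_quotient:
  assumes t: "t \<in> {0..T}" and y: "y \<in> {0<..<1}"
  shows "om t y / y = exp (C t (Y t y)) * Wq t (Y t y) * V t (Y t y)"
proof -
  have y': "y \<in> {0..1}" using y by auto
  let ?z = "Y t y"
  have "y = ?z * exp (- A t ?z)" using X_Y[OF t y'] by (simp add: X_def)
  then have z: "?z = y * exp (A t ?z)" by (simp add: exp_minus field_simps)
  have "om t y = ?z * Wq t ?z" using om_eq[OF t y'] W_factor[OF Y_in[OF t y']] by simp
  also have "\<dots> = y * (exp (A t ?z) * Wq t ?z)" by (subst (1) z) (simp add: mult.assoc)
  also have "exp (A t ?z) = exp (C t ?z) * V t ?z" by (simp add: V_eq flip: exp_add)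
  finally show ?thesis using y by (simp add: mult_ac)
qed

lemma Omega_prim: "t \<in> {0..T} \<Longrightarrow> prim 0 1 (\<lambda>y. Om t (Y t y)) (\<lambda>y. - 1 * (om t y / y))"
proof -
  assume t: "t \<in> {0..T}"
  have "prim 0 1 (\<lambda>y. Om t (Y t y)) (\<lambda>y. - (exp (C t (Y t y)) * Wq t (Y t y)) * V t (Y t y))"
  proof (rule prim_of_deriv)
    show "((\<lambda>y. Om t (Y t y)) has_real_derivative - (exp (C t (Y t x)) * Wq t (Y t x)) * V t (Y t x)) (at x within {0..1})"
      if "x \<in> {0..1}" for x
      by (rule deriv_compose_Y[OF t that Om_x_deriv[OF t] refl])
    show "continuous_on {0..1} (\<lambda>y. - (exp (C t (Y t y)) * Wq t (Y t y)) * V t (Y t y))"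
      by (rule cont2_x[OF cont2_along_Y[OF cont2_mult[OF cont2_minus[OF cont2_Om_integrand] cont2_V]] t])
  qed
  then show ?thesis by (rule prim_cong) (use om_quotient[OF t] in auto)
qed

lemma om_quotient_integrable: "t \<in> {0..T} \<Longrightarrow> (\<lambda>y. om t y / y) absolutely_integrable_on {0..1}"
  using prim_integrable[OF prim_cmult[OF Omega_prim, of t "- 1"]] by simp

lemma Omega_om: assumes t: "t \<in> {0..T}" and x: "x \<in> {0..1}" shows "Omega_of (om t) x = Om t (Y t x)"
proof -
  have "(\<lambda>y. om t y / y) absolutely_integrable_on {x..1}"
    by (rule absolutely_integrable_on_subinterval[OF om_quotient_integrable[OF t]]) (use x in auto)
  then have "Omega_of (om t) x = integral {x..1} (\<lambda>y. om t y / y)"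
    unfolding Omega_of_def by (rule set_lebesgue_integral_eq_integral(2))
  moreover have "Om t (Y t 1) - Om t (Y t x) = integral {x..1} (\<lambda>y. - 1 * (om t y / y))"
    by (rule prim_diff[OF Omega_prim[OF t]]) (use x in auto)
  ultimately show ?thesis using Y_1[OF t] Om_1 by simp
qed

lemma Y_initial: "x \<in> {0..1} \<Longrightarrow> Y 0 x = x"
proof -
  have h0: "h 0 y = 0" if y: "y \<in> {0..1}" for y
  proof -
    have q0: "q 0 z = 0" if "z \<in> {0..1}" for z using q_eq[OF T0 that] by (simp add: time_int_def)
    have "mean q 0 y = integral {0..1} (\<lambda>s::real. 0)"
      unfolding mean_def by (rule Henstock_Kurzweil_Integration.integral_cong) (rule q0[OF scaled01[OF y]])
    then show ?thesis by (simp add: h_def hfun_def)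
  qed
  have "A 0 y = 0" if y: "y \<in> {0..1}" for y
  proof -
    have "integral {y..1} (h 0) = integral {y..1} (\<lambda>_. 0)"
      by (rule Henstock_Kurzweil_Integration.integral_cong) (use y in \<open>simp add: h0\<close>)
    then show ?thesis using A_eq[OF T0 y] by simp
  qed
  then have X: "X 0 y = y" if "y \<in> {0..1}" for y using that by (simp add: X_def)
  assume "x \<in> {0..1}"
  then show ?thesis using Y_X[OF T0, of x] X by simp
qed

lemma classical: "classical_solution T om rho"
proof -
  define omt where "omt t x = r (Y t x) * V t (Y t x) + x * Om t (Y t x) * V t (Y t x) * Wx t (Y t x)" for t x
  define omx where "omx t x = Wx t (Y t x) * V t (Y t x)" for t x
  \<comment> \<open>The leading 0 is the time derivative of R at a fixed point, kept to match
    \<open>has_derivative_along_path\<close>.\<close>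
  define rhot where "rhot t x = 0 + x * Om t (Y t x) * V t (Y t x) * r (Y t x)" for t x
  define rhox where "rhox t x = r (Y t x) * V t (Y t x)" for t x
  have Rd: "(R has_real_derivative r y) (at y within {0..1})" if "y \<in> {0..1}" for y
    by (rule prim_deriv[OF R_prim r_cont that])
  have Rc: "continuous_on {0..1} R" by (rule prim_cont[OF R_prim])
  have vel: "velocity (om t) x = - x * Om t (Y t x)" if "t \<in> {0..T}" "x \<in> {0..1}" for t x
    using Omega_om[OF that] by (simp add: velocity_def)
  note Yc = cont2_along_Y[OF cont2_of_x[OF r_cont]] cont2_along_Y[OF cont2_V] cont2_along_Y[OF cont2_Om] cont2_along_Y[OF cont2_Wx]
  have c: "cont2 T om" "cont2 T rho" "cont2 T omt" "cont2 T omx" "cont2 T rhot" "cont2 T rhox"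
    "cont2 T (\<lambda>t. Omega_of (om t))" "cont2 T (\<lambda>t. velocity (om t))"
  proof -
    show "cont2 T om" by (rule cont2_cong[OF cont2_along_Y[OF cont2_W]]) (simp add: om_eq)
    show "cont2 T rho" by (rule cont2_cong[OF cont2_along_Y[OF cont2_of_x[OF Rc]]]) (simp add: rho_eq)
    show "cont2 T omt" "cont2 T omx" "cont2 T rhot" "cont2 T rhox"
      unfolding omt_def[abs_def] omx_def[abs_def] rhot_def[abs_def] rhox_def[abs_def]
      by (intro cont2_add cont2_mult cont2_snd cont2_const Yc)+
    show "cont2 T (\<lambda>t. Omega_of (om t))" by (rule cont2_cong[OF Yc(3)]) (simp add: Omega_om)
    show "cont2 T (\<lambda>t. velocity (om t))"
      by (rule cont2_cong[OF cont2_mult[OF cont2_minus[OF cont2_snd] Yc(3)]]) (simp add: vel)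
  qed
  show ?thesis
    unfolding classical_solution_def
  proof (rule exI[of _ omt], rule exI[of _ omx], rule exI[of _ rhot], rule exI[of _ rhox], intro conjI ballI)
    fix g assume "g \<in> {om, rho, omt, omx, rhot, rhox, \<lambda>t. Omega_of (om t), \<lambda>t. velocity (om t)}"
    then have "cont2 T g" using c by auto
    then show "continuous_on ({0..T} \<times> {0..1}) (\<lambda>(t, x). g t x)" by (simp add: cont2_def split_beta')
  next
    fix t assume t: "t \<in> {0..T}"
    show "set_integrable lebesgue {0..1} (\<lambda>y. om t y / y)" by (rule om_quotient_integrable[OF t])
    fix x :: real assume x: "x \<in> {0..1}"
    have yc: "continuous_on {0..T} (\<lambda>s. Y s x)" by (rule cont2_t[OF cont2_Y x])
    have yi: "Y s x \<in> {0..1}" if "s \<in> {0..T}" for s by (rule Y_in[OF that x])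
    have "((\<lambda>s. W s (Y s x)) has_real_derivative omt t x) (at t within {0..T})"
      unfolding omt_def
      by (rule has_derivative_along_path[where f=W, OF cont2_Wx W_x_deriv W_t_deriv[OF t Y_in[OF t x]] yc yi Y_t_deriv[OF t x] t])
    then show "((\<lambda>s. om s x) has_real_derivative omt t x) (at t within {0..T})"
      by (rule has_real_derivative_transform[OF _ t]) (rule om_eq[OF _ x])
    show "((\<lambda>y. om t y) has_real_derivative omx t x) (at x within {0..1})"
      unfolding omx_def by (rule deriv_compose_Y[OF t x W_x_deriv[OF t] om_eq[OF t]])
    have "((\<lambda>s. R (Y s x)) has_real_derivative rhot t x) (at t within {0..T})"
      unfolding rhot_def
      by (rule has_derivative_along_path[where f="\<lambda>_. R" and f'="\<lambda>_. r", OF cont2_of_x[OF r_cont] Rd DERIV_const yc yi Y_t_deriv[OF t x] t])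
    then show "((\<lambda>s. rho s x) has_real_derivative rhot t x) (at t within {0..T})"
      by (rule has_real_derivative_transform[OF _ t]) (rule rho_eq[OF _ x])
    show "((\<lambda>y. rho t y) has_real_derivative rhox t x) (at x within {0..1})"
      unfolding rhox_def by (rule deriv_compose_Y[OF t x Rd rho_eq[OF t]])
    show "rhot t x + velocity (om t) x * rhox t x = 0"
      by (simp add: vel[OF t x] rhot_def rhox_def)
    show "omt t x + velocity (om t) x * omx t x = rhox t x"
      by (simp add: vel[OF t x] omt_def omx_def rhox_def)
  qed
qed

lemma solves:
  assumes "AE x in lebesgue01. \<omega>\<^sub>0 x = w x" "AE x in lebesgue01. \<rho>\<^sub>0 x = R x"
  shows "solves_ivp m T \<omega>\<^sub>0 \<rho>\<^sub>0 om rho"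
  unfolding solves_ivp_def
proof (intro conjI ballI om_C_sobolev0 rho_C_sobolev0 classical)
  have "AE x in lebesgue01. x \<in> space lebesgue01" by (rule AE_space)
  then show "AE x in lebesgue01. om 0 x = \<omega>\<^sub>0 x \<and> rho 0 x = \<rho>\<^sub>0 x"
    using assms
  proof eventually_elim
    case (elim x)
    then have x: "x \<in> {0<..<1}" by (simp add: space_restrict_space)
    then have x': "x \<in> {0..1}" by auto
    have "om 0 x = w x" "rho 0 x = R x"
      using om_eq[OF T0 x'] rho_eq[OF T0 x'] by (simp_all add: Y_initial[OF x'] W_def time_int_def)
    then show ?case using elim by simp
  qed
qed (simp_all add: om_def rho_def eul_def)

end

lemma sobolev_norm_nonneg: "0 \<le> sobolev_norm m f"
  by (simp add: sobolev_norm_def sum_nonneg)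

text \<open>This is where m \<ge> 2 enters: the first derivative of \<omega>_0 and the second of
  \<rho>_0 are then below top order, hence continuous and bounded by the Sobolev norms, which gives
  K.\<close>

lemma local_existence:
  assumes m: "2 \<le> m" and w: "\<omega>\<^sub>0 \<in> sobolev0 m" and p: "\<rho>\<^sub>0 \<in> sobolev0 (m + 1)"
    and T: "0 < T" "T * (1000 * (1 + (sobolev_norm m \<omega>\<^sub>0 + sobolev_norm (m + 1) \<rho>\<^sub>0))) \<le> 1"
  shows "\<exists>\<omega> \<rho>. solves_ivp m T \<omega>\<^sub>0 \<rho>\<^sub>0 \<omega> \<rho>"
proof -
  obtain Gw where Gw: "chain m Gw" "AE x in lebesgue01. \<omega>\<^sub>0 x = Gw 0 x"
    "\<And>j x. j < m \<Longrightarrow> x \<in> {0..1} \<Longrightarrow> \<bar>Gw j x\<bar> \<le> sobolev_norm m \<omega>\<^sub>0"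
    using sobolev0_chain[OF w] by metis
  obtain Gp where Gp: "chain (m + 1) Gp" "AE x in lebesgue01. \<rho>\<^sub>0 x = Gp 0 x"
    "\<And>j x. j < m + 1 \<Longrightarrow> x \<in> {0..1} \<Longrightarrow> \<bar>Gp j x\<bar> \<le> sobolev_norm (m + 1) \<rho>\<^sub>0"
    using sobolev0_chain[OF p] by metis
  define K where "K = sobolev_norm m \<omega>\<^sub>0 + sobolev_norm (m + 1) \<rho>\<^sub>0"
  note nn = sobolev_norm_nonneg[of m "\<omega>\<^sub>0"] sobolev_norm_nonneg[of "m + 1" "\<rho>\<^sub>0"]
  note c = chainD[OF Gw(1), of 0] chainD[OF Gp(1), of "Suc 0"] chainD[OF Gp(1), of 0]
  have data: "lagrangian_data T K (Gw 0) (Gw (Suc 0)) (Gp (Suc 0)) (Gp (Suc (Suc 0)))"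
  proof
    show "continuous_on {0..1} (Gw (Suc 0))" "continuous_on {0..1} (Gp (Suc (Suc 0)))"
      using chain_continuous[OF Gw(1), of "Suc 0"] chain_continuous[OF Gp(1), of "Suc (Suc 0)"] m by auto
    show "\<bar>Gw (Suc 0) x\<bar> \<le> K" "\<bar>Gp (Suc (Suc 0)) x\<bar> \<le> K" if "x \<in> {0..1}" for x
      using Gw(3)[of "Suc 0" x] Gp(3)[of "Suc (Suc 0)" x] that m nn by (auto simp: K_def)
  qed (use T nn c m in \<open>auto simp: K_def\<close>)
  obtain q where q: "cont2 T q" "\<And>t x. t \<in> {0..T} \<Longrightarrow> x \<in> {0..1} \<Longrightarrow> \<bar>q t x\<bar> \<le> 1"
    "\<And>t x. t \<in> {0..T} \<Longrightarrow> x \<in> {0..1} \<Longrightarrow>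
      q t x = lagrangian_data.picard (Gw (Suc 0)) (Gp (Suc 0)) (Gp (Suc (Suc 0))) q t x"
    using lagrangian_data.picard_fixed_point[OF data] by metis
  interpret lagrangian_data T K "Gw 0" "Gw (Suc 0)" "Gp (Suc 0)" "Gp (Suc (Suc 0))" by (rule data)
  interpret lagrangian_ivp T K "Gw 0" "Gw (Suc 0)" "Gp (Suc 0)" "Gp (Suc (Suc 0))" q m Gw "\<lambda>j. Gp (Suc j)" "Gp 0"
    by unfold_locales (use q m Gw(1) Gp(1) c in \<open>auto intro: chain_Suc\<close>)
  show ?thesis using solves[OF Gw(2) Gp(2)] by blast
qed

section \<open>Uniqueness\<close>

text \<open>
  At a positive maximum of \<open>e\<^sup>-\<^sup>l\<^sup>t f\<close> the transport term vanishes: in the interior because \<open>f\<^sub>x = 0\<close>,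
  at the end points because the velocity \<open>b\<close> does.
\<close>

lemma transport_maximum_principle:
  fixes f fx ft :: "nat \<Rightarrow> real \<Rightarrow> real \<Rightarrow> real"
  assumes T: "0 \<le> T" and f: "\<And>i. cont2 T (f i)"
    and ft: "\<And>i t x. t \<in> {0..T} \<Longrightarrow> x \<in> {0..1} \<Longrightarrow> ((\<lambda>s. f i s x) has_real_derivative ft i t x) (at t within {0..T})"
    and fx: "\<And>i t x. t \<in> {0..T} \<Longrightarrow> x \<in> {0..1} \<Longrightarrow> ((\<lambda>y. f i t y) has_real_derivative fx i t x) (at x within {0..1})"
    and b: "\<And>t. t \<in> {0..T} \<Longrightarrow> b t 0 = 0" "\<And>t. t \<in> {0..T} \<Longrightarrow> b t 1 = 0"
    and eq: "\<And>i t x B. t \<in> {0..T} \<Longrightarrow> x \<in> {0..1} \<Longrightarrow> (\<And>j y. y \<in> {0..1} \<Longrightarrow> j < 2 \<Longrightarrow> \<bar>f j t y\<bar> \<le> B) \<Longrightarrow> i < 2 \<Longrightarrow>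
      \<bar>ft i t x + b t x * fx i t x\<bar> \<le> M * B"
    and init: "\<And>i x. i < 2 \<Longrightarrow> x \<in> {0..1} \<Longrightarrow> f i 0 x = 0"
    and t: "t \<in> {0..T}" and x: "x \<in> {0..1}" and i: "i < 2"
  shows "f i t x = 0"
proof -
  \<comment> \<open>The excess over M turns the inequality at the maximum into a strict
    contradiction.\<close>
  define l where "l = M + 1"
  define \<Phi> where "\<Phi> p = exp (- l * fst p) * max \<bar>f 0 (fst p) (snd p)\<bar> \<bar>f 1 (fst p) (snd p)\<bar>" for p :: "real \<times> real"
  have "continuous_on ({0..T} \<times> {0..1}) \<Phi>"
    unfolding \<Phi>_def using f[of 0] f[of 1] unfolding cont2_def by (intro continuous_intros) auto
  moreover have "compact ({0..T} \<times> {0..1::real})" by (intro compact_Times) auto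
  moreover have "(t, x) \<in> {0..T} \<times> {0..1}" using t x by auto
  ultimately obtain p where p: "p \<in> {0..T} \<times> {0..1}" "\<And>p'. p' \<in> {0..T} \<times> {0..1} \<Longrightarrow> \<Phi> p' \<le> \<Phi> p"
    using continuous_attains_sup[of "{0..T} \<times> {0..1}" \<Phi>] by blast
  obtain s y where sy: "p = (s, y)" by (cases p)
  have s: "s \<in> {0..T}" and y: "y \<in> {0..1}" using p(1) sy by auto
  have all: "exp (- l * s') * \<bar>f j s' y'\<bar> \<le> \<Phi> (s, y)" if "s' \<in> {0..T}" "y' \<in> {0..1}" "j < 2" for s' y' j
  proof -
    have "j = 0 \<or> j = 1" using that(3) by auto
    then have "\<bar>f j s' y'\<bar> \<le> max \<bar>f 0 s' y'\<bar> \<bar>f 1 s' y'\<bar>" by auto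
    then have "exp (- l * s') * \<bar>f j s' y'\<bar> \<le> \<Phi> (s', y')" unfolding \<Phi>_def by (simp add: mult_left_mono)
    then show ?thesis using p(2)[of "(s', y')"] that sy by simp
  qed
  have "\<Phi> (s, y) \<le> 0"
  proof (rule ccontr)
    assume "\<not> \<Phi> (s, y) \<le> 0"
    then have pos: "0 < \<Phi> (s, y)" by simp
    obtain j where j: "j < 2" "max \<bar>f 0 s y\<bar> \<bar>f 1 s y\<bar> = \<bar>f j s y\<bar>"
      by (metis max_def one_less_numeral_iff semiring_norm(76) zero_less_numeral)
    define N where "N = \<bar>f j s y\<bar>"
    have \<Phi>: "\<Phi> (s, y) = exp (- l * s) * N" using j by (simp add: \<Phi>_def N_def)
    have N: "0 < N" using pos \<Phi> by (simp add: zero_less_mult_iff)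
    have B: "\<bar>f j' s y'\<bar> \<le> N" if "y' \<in> {0..1}" "j' < 2" for y' j'
      using all[OF s that] \<Phi> by simp
    \<comment> \<open>The sign of the maximal component is frozen: \<sigma> f is differentiable,
      lies below |f| and touches it at the maximum.\<close>
    define \<sigma> where "\<sigma> = sgn (f j s y)"
    have \<sigma>: "\<sigma> * f j s y = N" "\<bar>\<sigma>\<bar> = 1"
      using N by (auto simp: \<sigma>_def N_def sgn_if abs_if split: if_splits)
    have s0: "0 < s"
    proof (rule ccontr)
      assume "\<not> 0 < s"
      then have "s = 0" using s by simp
      then show False using init[OF j(1) y] N by (simp add: N_def)
    qed
    have le: "\<sigma> * z \<le> \<bar>z\<bar>" for z using \<sigma>(2) abs_ge_self[of "\<sigma> * z"] by (simp add: abs_mult)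
    have time: "0 \<le> \<sigma> * ft j s y - l * N"
    proof -
      let ?g = "\<lambda>t. exp (- l * t) * (\<sigma> * f j t y)"
      have d: "(?g has_real_derivative exp (- l * s) * (\<sigma> * ft j s y - l * N)) (at s within {0..T})"
        unfolding \<sigma>(1)[symmetric] by (auto intro!: derivative_eq_intros ft[OF s y] simp: algebra_simps)
      have max: "?g t \<le> ?g s" if "t \<in> {0..T}" for t
      proof -
        have "?g t \<le> exp (- l * t) * \<bar>f j t y\<bar>" by (intro mult_left_mono le) simp
        also have "\<dots> \<le> ?g s" using all[OF that y j(1)] unfolding \<Phi> \<sigma>(1) .
        finally show ?thesis .
      qed
      have "((\<lambda>t. (?g t - ?g s) / (t - s)) \<longlongrightarrow> exp (- l * s) * (\<sigma> * ft j s y - l * N)) (at s within {0..T})"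
        using d unfolding has_field_derivative_iff .
      \<comment> \<open>Only earlier times are used: there the quotient is non-negative, and for s =
        T there are no later ones.\<close>
      then have lim: "((\<lambda>t. (?g t - ?g s) / (t - s)) \<longlongrightarrow> exp (- l * s) * (\<sigma> * ft j s y - l * N)) (at s within {0..<s})"
        by (rule tendsto_within_subset) (use s in auto)
      have "at s within {0..<s} \<noteq> bot"
        using s0 by (simp add: at_within_eq_bot_iff closure_insert islimpt_def)
      moreover have "\<forall>\<^sub>F t in at s within {0..<s}. 0 \<le> (?g t - ?g s) / (t - s)"
        unfolding eventually_at_filter
        by (rule always_eventually) (use max s in \<open>auto intro!: divide_nonpos_neg\<close>)
      ultimately have "0 \<le> exp (- l * s) * (\<sigma> * ft j s y - l * N)"
        using tendsto_lowerbound[OF lim] by blast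
      then show ?thesis by (simp add: zero_le_mult_iff)
    qed
    have space: "b s y * fx j s y = 0"
    proof (cases "y = 0 \<or> y = 1")
      case True then show ?thesis using b s by auto
    next
      case False
      then have yi: "y \<in> {0<..<1}" using y by auto
      have "((\<lambda>z. f j s z) has_real_derivative fx j s y) (at y)"
        using fx[OF s y] yi at_within_interior[of y "{0..1}"] by simp
      then have "((\<lambda>z. \<sigma> * f j s z) has_real_derivative \<sigma> * fx j s y) (at y)" by (rule DERIV_cmult)
      moreover have "0 < min y (1 - y)" using yi by simp
      moreover have "\<forall>z. \<bar>y - z\<bar> < min y (1 - y) \<longrightarrow> \<sigma> * f j s z \<le> \<sigma> * f j s y"
      proof (intro allI impI)
        fix z assume "\<bar>y - z\<bar> < min y (1 - y)"
        then have "z \<in> {0..1}" by auto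
        from B[OF this j(1)] le[of "f j s z"] show "\<sigma> * f j s z \<le> \<sigma> * f j s y" using \<sigma>(1) by simp
      qed
      ultimately have "\<sigma> * fx j s y = 0" by (rule DERIV_local_max)
      then show ?thesis using \<sigma>(2) by auto
    qed
    have "\<sigma> * ft j s y \<le> \<bar>ft j s y\<bar>" by (rule le)
    also have "\<dots> \<le> M * N" using eq[OF s y B j(1)] space by simp
    finally show False using time N by (simp add: l_def algebra_simps)
  qed
  then have "exp (- l * t) * \<bar>f i t x\<bar> \<le> 0" using all[OF t x i] by linarith
  then show ?thesis by (simp add: mult_le_0_iff)
qed

section \<open>Comparison of two classical solutions\<close>

locale classical_system =
  fixes T :: real and w wt wx p pt px :: "real \<Rightarrow> real \<Rightarrow> real"
  assumes cont: "cont2 T w" "cont2 T wt" "cont2 T wx" "cont2 T p" "cont2 T (\<lambda>t. Omega_of (w t))"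
    and quot_int: "\<And>t. t \<in> {0..T} \<Longrightarrow> (\<lambda>y. w t y / y) absolutely_integrable_on {0..1}"
    and w_t: "\<And>t x. t \<in> {0..T} \<Longrightarrow> x \<in> {0..1} \<Longrightarrow> ((\<lambda>s. w s x) has_real_derivative wt t x) (at t within {0..T})"
    and w_x: "\<And>t x. t \<in> {0..T} \<Longrightarrow> x \<in> {0..1} \<Longrightarrow> ((\<lambda>y. w t y) has_real_derivative wx t x) (at x within {0..1})"
    and p_t: "\<And>t x. t \<in> {0..T} \<Longrightarrow> x \<in> {0..1} \<Longrightarrow> ((\<lambda>s. p s x) has_real_derivative pt t x) (at t within {0..T})"
    and p_x: "\<And>t x. t \<in> {0..T} \<Longrightarrow> x \<in> {0..1} \<Longrightarrow> ((\<lambda>y. p t y) has_real_derivative px t x) (at x within {0..1})"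
    and px_cont: "cont2 T px"
    and p_eq: "\<And>t x. t \<in> {0..T} \<Longrightarrow> x \<in> {0..1} \<Longrightarrow> pt t x + velocity (w t) x * px t x = 0"
    and w_eq: "\<And>t x. t \<in> {0..T} \<Longrightarrow> x \<in> {0..1} \<Longrightarrow> wt t x + velocity (w t) x * wx t x = px t x"
    and bc: "\<And>t. t \<in> {0..T} \<Longrightarrow> w t 0 = 0" "\<And>t. t \<in> {0..T} \<Longrightarrow> w t 1 = 0" "\<And>t. t \<in> {0..T} \<Longrightarrow> p t 1 = 0"
begin

abbreviation Om where "Om t x \<equiv> Omega_of (w t) x"

lemma Om_integral: "t \<in> {0..T} \<Longrightarrow> x \<in> {0..1} \<Longrightarrow> Om t x = integral {x..1} (\<lambda>y. w t y / y)"
  unfolding Omega_of_def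
  by (rule set_lebesgue_integral_eq_integral(2), rule absolutely_integrable_on_subinterval[OF quot_int]) auto

lemma Om_1: "t \<in> {0..T} \<Longrightarrow> Om t 1 = 0"
  using Om_integral[of t 1] by simp

lemma Om_deriv:
  assumes t: "t \<in> {0..T}" and a: "0 < a" and x: "x \<in> {a..1}"
  shows "(Om t has_real_derivative - (w t x / x)) (at x within {a..1})"
proof -
  let ?g = "\<lambda>y. w t y / y"
  have gi: "?g integrable_on {0..1}" using quot_int[OF t] set_lebesgue_integral_eq_integral(1) by blast
  have "prim 0 1 (\<lambda>x. - 1 * Om t x) ?g"
  proof (rule primI[OF quot_int[OF t]])
    fix x :: real assume x: "0 \<le> x" "x \<le> 1"
    have "integral {0..x} ?g + integral {x..1} ?g = integral {0..1} ?g"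
      by (rule Henstock_Kurzweil_Integration.integral_combine[OF x gi])
    then show "- 1 * Om t x - - 1 * Om t 0 = integral {0..x} ?g"
      using Om_integral[OF t] x by simp
  qed
  then have "prim a 1 (\<lambda>x. - 1 * Om t x) ?g" by (rule prim_sub) (use a in auto)
  from prim_cmult[OF this, of "- 1"] have "prim a 1 (Om t) (\<lambda>x. - 1 * ?g x)" by simp
  moreover have "continuous_on {a..1} (\<lambda>x. - 1 * ?g x)"
    using continuous_on_subset[OF cont2_x[OF cont(1) t], of "{a..1}"] a by (intro continuous_intros) auto
  ultimately have "(Om t has_real_derivative - 1 * ?g x) (at x within {a..1})"
    using prim_deriv x by blast
  then show ?thesis by simp
qed

lemma w_quot_bound:
  assumes t: "t \<in> {0..T}" and x: "x \<in> {0<..1}" and D: "\<And>y. y \<in> {0..1} \<Longrightarrow> \<bar>wx t y\<bar> \<le> D"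
  shows "\<bar>w t x / x\<bar> \<le> D"
proof -
  have "\<bar>w t x - w t 0\<bar> \<le> D * \<bar>x - 0\<bar>"
    using field_differentiable_bound[of "{0..1}" "w t" "wx t" D x 0] w_x[OF t] D x by auto
  then show ?thesis using bc(1)[OF t] x by (simp add: pos_divide_le_eq)
qed

end

locale two_classical_systems =
  s: classical_system T w wt wx p pt px + s': classical_system T w' wt' wx' p' pt' px'
  for T :: real and w wt wx p pt px w' wt' wx' p' pt' px' :: "real \<Rightarrow> real \<Rightarrow> real" +
  assumes T_pos: "0 < T"
    and initial: "\<And>x. x \<in> {0..1} \<Longrightarrow> w 0 x = w' 0 x" "\<And>x. x \<in> {0..1} \<Longrightarrow> p 0 x = p' 0 x"
begin

definition z where "z t x = integral {x..1} (\<lambda>y. w t y - w' t y)"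
definition zt where "zt t x = integral {x..1} (\<lambda>y. wt t y - wt' t y)"

lemma dw_cont: "cont2 T (\<lambda>t x. w t x - w' t x)" and dwt_cont: "cont2 T (\<lambda>t x. wt t x - wt' t x)"
  by (intro cont2_diff s.cont s'.cont)+

lemma z_x: "t \<in> {0..T} \<Longrightarrow> x \<in> {0..1} \<Longrightarrow> (z t has_real_derivative - (w t x - w' t x)) (at x within {0..1})"
  and zt_x: "t \<in> {0..T} \<Longrightarrow> x \<in> {0..1} \<Longrightarrow> (zt t has_real_derivative - (wt t x - wt' t x)) (at x within {0..1})"
  unfolding z_def[abs_def] zt_def[abs_def]
  using integral_tail[OF dw_cont] integral_tail[OF dwt_cont] by auto

lemma z_t:
  assumes t: "t \<in> {0..T}" and x: "x \<in> {0..1}"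
  shows "((\<lambda>t. z t x) has_real_derivative zt t x) (at t within {0..T})"
proof -
  have "((\<lambda>t. integral (cbox x 1) (\<lambda>y. w t y - w' t y)) has_field_derivative integral (cbox x 1) (\<lambda>y. wt t y - wt' t y)) (at t within {0..T})"
  proof (rule leibniz_rule_field_derivative[OF _ _ _ t])
    show "continuous_on ({0..T} \<times> cbox x 1) (\<lambda>(t, y). wt t y - wt' t y)"
      unfolding split_beta' by (rule cont2_compose[OF dwt_cont]) (use x in \<open>auto intro!: continuous_intros\<close>)
    show "(\<lambda>y. w t y - w' t y) integrable_on cbox x 1" if "t \<in> {0..T}" for t
      using continuous_on_subset[OF cont2_x[OF dw_cont that], of "{x..1}"] x by (auto intro: integrable_continuous_real)
    show "((\<lambda>t. w t y - w' t y) has_field_derivative wt t y - wt' t y) (at t within {0..T})"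
      if "t \<in> {0..T}" "y \<in> cbox x 1" for t y
      using that x by (intro DERIV_diff s.w_t s'.w_t) auto
  qed simp
  then show ?thesis by (simp add: z_def zt_def cbox_interval)
qed

lemma z_cont: "cont2 T z"
  unfolding z_def[abs_def] by (rule cont2_integral_tail[OF dw_cont])

text \<open>Integration by parts moves the difference of vorticities onto its primitive z: the
  difference of \<Omega> minus z / y has derivative z / y^2, whose integral over [x, 1] is at most B
  / x - B. The factor x in the velocity compensates the 1 / x.\<close>

lemma velocity_difference:
  assumes t: "t \<in> {0..T}" and x: "x \<in> {0..1}" and B: "\<And>y. y \<in> {0..1} \<Longrightarrow> \<bar>z t y\<bar> \<le> B"
  shows "\<bar>velocity (w t) x - velocity (w' t) x\<bar> \<le> 2 * B"
proof (cases "x = 0")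
  case True then show ?thesis using B[OF x] by (simp add: velocity_def)
next
  case False
  then have x0: "0 < x" using x by simp
  define J where "J y = s.Om t y - s'.Om t y - z t y / y" for y
  have zx: "(z t has_real_derivative - (w t y - w' t y)) (at y within {x..1})" if "y \<in> {x..1}" for y
    by (rule DERIV_subset[OF z_x[OF t]]) (use that x0 in auto)
  have J: "prim x 1 J (\<lambda>y. z t y / y\<^sup>2)"
  proof (rule prim_of_deriv)
    fix y assume y: "y \<in> {x..1}"
    then have y0: "y \<noteq> 0" using x0 by auto
    have "(J has_real_derivative - (w t y / y) - - (w' t y / y) - ((- (w t y - w' t y)) * y - z t y * 1) / (y * y)) (at y within {x..1})"
      unfolding J_def[abs_def]
      by (intro DERIV_diff s.Om_deriv[OF t x0 y] s'.Om_deriv[OF t x0 y] DERIV_divide zx[OF y] DERIV_ident y0)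
    moreover have "- (w t y / y) - - (w' t y / y) - ((- (w t y - w' t y)) * y - z t y * 1) / (y * y) = z t y / y\<^sup>2"
      using y0 by (simp add: field_simps power2_eq_square)
    ultimately show "(J has_real_derivative z t y / y\<^sup>2) (at y within {x..1})" by simp
  next
    show "continuous_on {x..1} (\<lambda>y. z t y / y\<^sup>2)"
      using continuous_on_subset[OF cont2_x[OF z_cont t], of "{x..1}"] x0 by (intro continuous_intros) auto
  qed
  have L: "prim x 1 (\<lambda>y. - B / y) (\<lambda>y. B / y\<^sup>2)"
    by (rule prim_of_deriv) (use x0 in \<open>auto intro!: derivative_eq_intros continuous_intros simp: power2_eq_square\<close>)
  have x1: "x \<le> 1" using x by simp
  have "norm (integral {x..1} (\<lambda>y. z t y / y\<^sup>2)) \<le> integral {x..1} (\<lambda>y. B / y\<^sup>2)"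
  proof (rule integral_norm_bound_integral)
    show "(\<lambda>y. z t y / y\<^sup>2) integrable_on {x..1}" "(\<lambda>y. B / y\<^sup>2) integrable_on {x..1}"
      using prim_integrable[OF J] prim_integrable[OF L] set_lebesgue_integral_eq_integral(1) by auto
    show "norm (z t y / y\<^sup>2) \<le> B / y\<^sup>2" if "y \<in> {x..1}" for y
      using B[of y] that x0 by (simp add: divide_right_mono)
  qed
  then have "\<bar>J 1 - J x\<bar> \<le> - B / 1 - - B / x"
    using prim_diff[OF J order.refl x1 order.refl] prim_diff[OF L order.refl x1 order.refl] by simp
  moreover have "J 1 = 0" using s.Om_1[OF t] s'.Om_1[OF t] by (simp add: J_def z_def)
  ultimately have "\<bar>J x\<bar> \<le> B / x - B" by simp
  then have "x * \<bar>J x\<bar> \<le> x * (B / x - B)" using x0 by (intro mult_left_mono) auto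
  then have "\<bar>x * J x\<bar> \<le> B - x * B" using x0 by (simp add: abs_mult right_diff_distrib)
  moreover have "0 \<le> x * B" using B[OF x] x0 by (intro mult_nonneg_nonneg) auto
  moreover have "velocity (w t) x - velocity (w' t) x = - (x * J x) - z t x"
    using x0 by (simp add: velocity_def J_def right_diff_distrib)
  ultimately show ?thesis using B[OF x] by linarith
qed

text \<open>With u' the second velocity, g = z_t + u' z_x is the transported primitive. The
  combination H integrates the difference of the vorticity equations by parts: its derivative
  contains z and the difference of velocities, but no derivative of the difference of the solutions,
  and H vanishes at 1. The forcing survives only as the difference of densities itself.\<close>

lemma vorticity_estimate:
  assumes t: "t \<in> {0..T}" and D: "0 \<le> D" "\<And>y. y \<in> {0..1} \<Longrightarrow> \<bar>wx t y\<bar> \<le> D" "\<And>y. y \<in> {0..1} \<Longrightarrow> \<bar>wx' t y\<bar> \<le> D"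
      "\<And>y. y \<in> {0..1} \<Longrightarrow> \<bar>w' t y\<bar> \<le> D" "\<And>y. y \<in> {0..1} \<Longrightarrow> \<bar>s'.Om t y\<bar> \<le> D"
    and B: "\<And>y. y \<in> {0..1} \<Longrightarrow> \<bar>z t y\<bar> \<le> B" "\<And>y. y \<in> {0..1} \<Longrightarrow> \<bar>p t y - p' t y\<bar> \<le> B"
    and x: "x \<in> {0..1}"
  shows "\<bar>zt t x + velocity (w' t) x * - (w t x - w' t x)\<bar> \<le> (1 + 6 * D) * B"
proof -
  define u' where "u' y = velocity (w' t) y" for y
  define g where "g y = zt t y + u' y * - (w t y - w' t y)" for y
  have B0: "0 \<le> B" using B(1)[OF x] by linarith
  have pos: "\<bar>g x\<bar> \<le> (1 + 6 * D) * B" if x: "x \<in> {0<..1}" for x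
  proof -
    have sub: "{x..1} \<subseteq> {0..1}" and x0: "0 < x" and x1: "x \<in> {x..1}" "1 \<in> {x..1}" using x by auto
    define H where "H y = g y + (p t y - p' t y) - (w' t y - s'.Om t y) * z t y" for y
    define H' where "H' y = (velocity (w t) y - u' y) * wx t y - (wx' t y + w' t y / y) * z t y" for y
    have d: "(H has_real_derivative H' y) (at y within {x..1})" if y: "y \<in> {x..1}" for y
    proof -
      have y': "y \<in> {0..1}" and y0: "y \<noteq> 0" using y sub x0 by auto
      note ds = s.w_x[OF t y', THEN DERIV_subset, OF sub] s'.w_x[OF t y', THEN DERIV_subset, OF sub]
        s.p_x[OF t y', THEN DERIV_subset, OF sub] s'.p_x[OF t y', THEN DERIV_subset, OF sub]
        z_x[OF t y', THEN DERIV_subset, OF sub] zt_x[OF t y', THEN DERIV_subset, OF sub] s'.Om_deriv[OF t x0 y]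
      have ud: "(u' has_real_derivative - s'.Om t y + w' t y) (at y within {x..1})"
        unfolding u'_def[abs_def] velocity_def
        by (rule derivative_eq_intros ds refl)+ (use y0 in simp)
      have "(H has_real_derivative (- (wt t y - wt' t y) + ((- s'.Om t y + w' t y) * - (w t y - w' t y) + - (wx t y - wx' t y) * u' y))
          + (px t y - px' t y) - ((wx' t y - - (w' t y / y)) * z t y + - (w t y - w' t y) * (w' t y - s'.Om t y))) (at y within {x..1})"
        unfolding H_def[abs_def] g_def[abs_def]
        by (intro DERIV_add DERIV_diff DERIV_mult DERIV_minus ud ds)
      moreover have "px t y = wt t y + velocity (w t) y * wx t y" "px' t y = wt' t y + u' y * wx' t y"
        using s.w_eq[OF t y'] s'.w_eq[OF t y'] by (simp_all add: u'_def)
      ultimately show ?thesis by (simp add: H'_def algebra_simps)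
    qed
    have b: "\<bar>H' y\<bar> \<le> 4 * (D * B)" if y: "y \<in> {x..1}" for y
    proof -
      have y': "y \<in> {0..1}" "y \<in> {0<..1}" using y x by auto
      have "\<bar>(velocity (w t) y - u' y) * wx t y\<bar> \<le> (2 * B) * D"
        unfolding abs_mult u'_def using velocity_difference[OF t y'(1) B(1)] D(2)[OF y'(1)] B0 by (intro mult_mono) auto
      moreover have "\<bar>wx' t y + w' t y / y\<bar> \<le> 2 * D"
        using D(3)[OF y'(1)] s'.w_quot_bound[OF t y'(2) D(3)] by linarith
      then have "\<bar>(wx' t y + w' t y / y) * z t y\<bar> \<le> (2 * D) * B"
        unfolding abs_mult using B(1)[OF y'(1)] D(1) by (intro mult_mono) auto
      moreover have "(2 * B) * D + (2 * D) * B = 4 * (D * B)" by simp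
      ultimately show ?thesis unfolding H'_def by linarith
    qed
    have "\<bar>H x - H 1\<bar> \<le> 4 * (D * B) * \<bar>x - 1\<bar>"
      using field_differentiable_bound[of "{x..1}" H H' "4 * (D * B)" x 1] d b x1 by auto
    also have "\<dots> \<le> 4 * (D * B) * 1" using x D(1) B0 by (intro mult_left_mono) auto
    finally have "\<bar>H x - H 1\<bar> \<le> 4 * (D * B)" by simp
    moreover have "H 1 = 0"
      using s.bc[OF t] s'.bc[OF t] by (simp add: H_def g_def z_def zt_def)
    ultimately have Hx: "\<bar>H x\<bar> \<le> 4 * (D * B)" by simp
    have x': "x \<in> {0..1}" using x by auto
    have "\<bar>w' t x - s'.Om t x\<bar> \<le> 2 * D" using D(4,5)[OF x'] by linarith
    then have "\<bar>(w' t x - s'.Om t x) * z t x\<bar> \<le> (2 * D) * B"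
      unfolding abs_mult using B(1)[OF x'] D(1) by (intro mult_mono) auto
    moreover have "(1 + 6 * D) * B = B + 4 * (D * B) + (2 * D) * B" by (simp add: algebra_simps)
    moreover have "g x = H x - (p t x - p' t x) + (w' t x - s'.Om t x) * z t x" by (simp add: H_def)
    ultimately show ?thesis using Hx B(2)[OF x'] by linarith
  qed
  \<comment> \<open>\<Omega> is differentiated only away from 0, so the case x = 0 follows by
    continuity.\<close>
  have "continuous_on {0..1} g"
  proof -
    have "continuous_on {0..1} (zt t)" by (rule DERIV_continuous_on[OF zt_x[OF t]])
    moreover have "continuous_on {0..1} u'"
      unfolding u'_def[abs_def] velocity_def by (intro continuous_intros cont2_x[OF s'.cont(5) t])
    ultimately show ?thesis
      unfolding g_def[abs_def] by (intro continuous_intros cont2_x[OF s.cont(1) t] cont2_x[OF s'.cont(1) t])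
  qed
  then have "continuous_on (closure {0<..1}) (\<lambda>y. \<bar>g y\<bar>)"
    by (simp add: closure_greaterThanAtMost continuous_on_rabs)
  from continuous_le_on_closure[OF this, of x "(1 + 6 * D) * B"] pos x
  show ?thesis by (simp add: closure_greaterThanAtMost g_def u'_def)
qed

text \<open>Index 0 is the primitive z, index 1 the difference of densities, both transported by the
  second velocity. The source of the latter is minus the difference of velocities times \<rho>_x,
  bounded by z. The vorticities agree because z_x is minus their difference.\<close>

lemma solutions_agree:
  assumes t: "t \<in> {0..T}" and x: "x \<in> {0..1}"
  shows "w t x = w' t x" "p t x = p' t x"
proof -
  obtain D1 where D1: "D1 > 0" "\<And>t x. t \<in> {0..T} \<Longrightarrow> x \<in> {0..1} \<Longrightarrow> \<bar>wx t x\<bar> \<le> D1" using cont2_bounded[OF s.cont(3)] by metis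
  obtain D2 where D2: "D2 > 0" "\<And>t x. t \<in> {0..T} \<Longrightarrow> x \<in> {0..1} \<Longrightarrow> \<bar>wx' t x\<bar> \<le> D2" using cont2_bounded[OF s'.cont(3)] by metis
  obtain D3 where D3: "D3 > 0" "\<And>t x. t \<in> {0..T} \<Longrightarrow> x \<in> {0..1} \<Longrightarrow> \<bar>w' t x\<bar> \<le> D3" using cont2_bounded[OF s'.cont(1)] by metis
  obtain D4 where D4: "D4 > 0" "\<And>t x. t \<in> {0..T} \<Longrightarrow> x \<in> {0..1} \<Longrightarrow> \<bar>s'.Om t x\<bar> \<le> D4" using cont2_bounded[OF s'.cont(5)] by metis
  obtain D5 where D5: "D5 > 0" "\<And>t x. t \<in> {0..T} \<Longrightarrow> x \<in> {0..1} \<Longrightarrow> \<bar>px t x\<bar> \<le> D5" using cont2_bounded[OF s.px_cont] by metis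
  define D where "D = D1 + D2 + D3 + D4 + D5"
  have D: "0 \<le> D" "D1 \<le> D" "D2 \<le> D" "D3 \<le> D" "D4 \<le> D" "D5 \<le> D"
    using D1 D2 D3 D4 D5 by (simp_all add: D_def)
  define f where "f i = (if i = 0 then z else (\<lambda>t x. p t x - p' t x))" for i :: nat
  define ft where "ft i = (if i = 0 then zt else (\<lambda>t x. pt t x - pt' t x))" for i :: nat
  define fx where "fx i = (if i = 0 then (\<lambda>t x. - (w t x - w' t x)) else (\<lambda>t x. px t x - px' t x))" for i :: nat
  have agree: "f i t x = 0" if tx: "t \<in> {0..T}" "x \<in> {0..1}" and i: "i < 2" for i t x
  proof (rule transport_maximum_principle[where f=f and ft=ft and fx=fx and b="\<lambda>t. velocity (w' t)" and T=T and M="1 + 6 * D"])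
    show "cont2 T (f i)" for i using z_cont cont2_diff[OF s.cont(4) s'.cont(4)] by (cases "i = 0") (simp_all add: f_def)
    show "((\<lambda>s. f i s x) has_real_derivative ft i t x) (at t within {0..T})" if "t \<in> {0..T}" "x \<in> {0..1}" for i t x
      using z_t[OF that] DERIV_diff[OF s.p_t[OF that] s'.p_t[OF that]] by (cases "i = 0") (simp_all add: f_def ft_def)
    show "((\<lambda>y. f i t y) has_real_derivative fx i t x) (at x within {0..1})" if "t \<in> {0..T}" "x \<in> {0..1}" for i t x
      using z_x[OF that] DERIV_diff[OF s.p_x[OF that] s'.p_x[OF that]] by (cases "i = 0") (simp_all add: f_def fx_def)
    show "velocity (w' t) 0 = 0" for t by (simp add: velocity_def)
    show "velocity (w' t) 1 = 0" if "t \<in> {0..T}" for t using s'.Om_1[OF that] by (simp add: velocity_def)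
    show "f i 0 x = 0" if x: "x \<in> {0..1}" for i x
    proof -
      have "z 0 x = integral {x..1} (\<lambda>y. 0)"
        unfolding z_def by (rule Henstock_Kurzweil_Integration.integral_cong) (use initial(1) x in auto)
      then show ?thesis using initial(2)[OF x] by (simp add: f_def)
    qed
    show "\<bar>ft i t x + velocity (w' t) x * fx i t x\<bar> \<le> (1 + 6 * D) * B"
      if t: "t \<in> {0..T}" and x: "x \<in> {0..1}" and B: "\<And>j y. y \<in> {0..1} \<Longrightarrow> j < 2 \<Longrightarrow> \<bar>f j t y\<bar> \<le> B" for i t x B
    proof -
      have B': "\<And>y. y \<in> {0..1} \<Longrightarrow> \<bar>z t y\<bar> \<le> B" "\<And>y. y \<in> {0..1} \<Longrightarrow> \<bar>p t y - p' t y\<bar> \<le> B"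
        using B[of _ 0] B[of _ 1] by (auto simp: f_def)
      have B0: "0 \<le> B" using B'(1)[OF x] by linarith
      have 1: "\<bar>zt t x + velocity (w' t) x * - (w t x - w' t x)\<bar> \<le> (1 + 6 * D) * B"
        by (rule vorticity_estimate[OF t D(1) order_trans[OF D1(2)[OF t] D(2)] order_trans[OF D2(2)[OF t] D(3)]
            order_trans[OF D3(2)[OF t] D(4)] order_trans[OF D4(2)[OF t] D(5)] B' x])
      have "pt t x - pt' t x + velocity (w' t) x * (px t x - px' t x) = - ((velocity (w t) x - velocity (w' t) x) * px t x)"
        using s.p_eq[OF t x] s'.p_eq[OF t x] by (simp add: algebra_simps)
      moreover have "\<bar>(velocity (w t) x - velocity (w' t) x) * px t x\<bar> \<le> (2 * B) * D"
        unfolding abs_mult using velocity_difference[OF t x B'(1)] D5(2)[OF t x] D(6) B0 by (intro mult_mono) auto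
      moreover have "(2 * B) * D \<le> (1 + 6 * D) * B" using B0 D(1) by (simp add: algebra_simps)
      ultimately have 2: "\<bar>pt t x - pt' t x + velocity (w' t) x * (px t x - px' t x)\<bar> \<le> (1 + 6 * D) * B" by simp
      show ?thesis using 1 2 by (simp add: ft_def fx_def)
    qed
  qed (use T_pos tx i in auto)
  show "p t x = p' t x" using agree[OF t x, of 1] by (simp add: f_def)
  have "(z t has_real_derivative 0) (at x within {0..1})"
    by (rule has_real_derivative_transform[OF DERIV_const[of 0] x]) (use agree[OF t, of _ 0] in \<open>simp add: f_def\<close>)
  moreover have "at x within {0..1} \<noteq> bot"
    using x by (simp add: trivial_limit_within)
  ultimately have "0 = - (w t x - w' t x)"
    by (intro vector_derivative_unique_within[of x "{0..1}" "z t"]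
        z_x[OF t x, unfolded has_real_derivative_iff_has_vector_derivative])
       (simp_all add: has_real_derivative_iff_has_vector_derivative)
  then show "w t x = w' t x" by simp
qed

end

text \<open>Turns the almost-everywhere initial condition into a pointwise one for classical
  solutions.\<close>

lemma continuous_AE_zero:
  fixes f :: "real \<Rightarrow> real"
  assumes f: "continuous_on {0..1} f" and ae: "AE x in lebesgue01. f x = 0" and x: "x \<in> {0..1}"
  shows "f x = 0"
proof -
  have "f \<in> L2" by (rule continuous_L2[OF f])
  have "(LINT x|lebesgue01. (f x)\<^sup>2) = 0"
    by (rule integral_eq_zero_AE) (use ae in eventually_elim, simp)
  then have "integral {0..1} (\<lambda>x. (f x)\<^sup>2) = 0"
    using integral01_eq[OF L2_square[OF \<open>f \<in> L2\<close>]] by simp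
  moreover have "continuous_on {0..1} (\<lambda>x. (f x)\<^sup>2)" by (intro continuous_intros f)
  ultimately have "(f x)\<^sup>2 = 0" using integral_eq_0_iff[of 0 1 "\<lambda>x. (f x)\<^sup>2"] x by simp
  then show ?thesis by simp
qed

lemma solves_ivp_system:
  assumes "solves_ivp m T \<omega>\<^sub>0 \<rho>\<^sub>0 w p"
  obtains wt wx pt px where "classical_system T w wt wx p pt px"
proof -
  have cl: "classical_solution T w p" and bc: "\<forall>t\<in>{0..T}. w t 0 = 0 \<and> w t 1 = 0 \<and> p t 0 = 0 \<and> p t 1 = 0"
    using assms unfolding solves_ivp_def by auto
  from cl obtain wt wx pt px where
    c: "\<forall>g \<in> {w, p, wt, wx, pt, px, \<lambda>t. Omega_of (w t), \<lambda>t. velocity (w t)}.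
         continuous_on ({0..T} \<times> {0..1}) (\<lambda>(t, x). g t x)"
    and i: "\<forall>t \<in> {0..T}. set_integrable lebesgue {0..1} (\<lambda>y. w t y / y)"
    and d: "\<forall>t \<in> {0..T}. \<forall>x \<in> {0..1}.
         ((\<lambda>s. w s x) has_real_derivative wt t x) (at t within {0..T}) \<and>
         ((\<lambda>y. w t y) has_real_derivative wx t x) (at x within {0..1}) \<and>
         ((\<lambda>s. p s x) has_real_derivative pt t x) (at t within {0..T}) \<and>
         ((\<lambda>y. p t y) has_real_derivative px t x) (at x within {0..1}) \<and>
         pt t x + velocity (w t) x * px t x = 0 \<and>
         wt t x + velocity (w t) x * wx t x = px t x"
    unfolding classical_solution_def by blast
  have c': "cont2 T w" "cont2 T wt" "cont2 T wx" "cont2 T p" "cont2 T px" "cont2 T (\<lambda>t. Omega_of (w t))"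
    using c by (simp_all add: cont2_def split_beta')
  have "classical_system T w wt wx p pt px"
    by unfold_locales (use c' i d bc in auto)
  then show ?thesis by (rule that)
qed

lemma solves_ivp_unique:
  assumes T: "0 < T" and s: "solves_ivp m T \<omega>\<^sub>0 \<rho>\<^sub>0 w p" and s': "solves_ivp m T \<omega>\<^sub>0 \<rho>\<^sub>0 w' p'"
    and t: "t \<in> {0..T}" and x: "x \<in> {0..1}"
  shows "w' t x = w t x \<and> p' t x = p t x"
proof -
  obtain wt wx pt px where c: "classical_system T w wt wx p pt px" using solves_ivp_system[OF s] .
  obtain wt' wx' pt' px' where c': "classical_system T w' wt' wx' p' pt' px'" using solves_ivp_system[OF s'] .
  interpret a: classical_system T w wt wx p pt px by (rule c)
  interpret b: classical_system T w' wt' wx' p' pt' px' by (rule c')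
  have T0: "0 \<in> {0..T}" using T by simp
  have ae: "AE x in lebesgue01. w 0 x = \<omega>\<^sub>0 x \<and> p 0 x = \<rho>\<^sub>0 x" "AE x in lebesgue01. w' 0 x = \<omega>\<^sub>0 x \<and> p' 0 x = \<rho>\<^sub>0 x"
    using s s' unfolding solves_ivp_def by auto
  have iw: "w 0 x - w' 0 x = 0" if "x \<in> {0..1}" for x
  proof (rule continuous_AE_zero[OF _ _ that])
    show "continuous_on {0..1} (\<lambda>x. w 0 x - w' 0 x)" by (intro continuous_intros cont2_x[OF a.cont(1) T0] cont2_x[OF b.cont(1) T0])
    show "AE x in lebesgue01. w 0 x - w' 0 x = 0" using ae by eventually_elim simp
  qed
  have ip: "p 0 x - p' 0 x = 0" if "x \<in> {0..1}" for x
  proof (rule continuous_AE_zero[OF _ _ that])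
    show "continuous_on {0..1} (\<lambda>x. p 0 x - p' 0 x)" by (intro continuous_intros cont2_x[OF a.cont(4) T0] cont2_x[OF b.cont(4) T0])
    show "AE x in lebesgue01. p 0 x - p' 0 x = 0" using ae by eventually_elim simp
  qed
  interpret two_classical_systems T w wt wx p pt px w' wt' wx' p' pt' px'
    by unfold_locales (use T iw ip in auto)
  show ?thesis using solutions_agree[OF t x] by simp
qed

theorem proposition2p2:
  fixes m :: nat
  assumes "m \<ge> 2"
  shows "\<exists>lifespan :: real \<Rightarrow> real. (\<forall>r\<ge>0. lifespan r > 0) \<and>
    (\<forall>\<omega>\<^sub>0 \<in> sobolev0 m. \<forall>\<rho>\<^sub>0 \<in> sobolev0 (m + 1). \<forall>T.
      T = lifespan (sobolev_norm m \<omega>\<^sub>0 + sobolev_norm (m + 1) \<rho>\<^sub>0) \<longrightarrow>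
      (\<exists>\<omega> \<rho>. solves_ivp m T \<omega>\<^sub>0 \<rho>\<^sub>0 \<omega> \<rho> \<and>
        (\<forall>\<omega>' \<rho>'. solves_ivp m T \<omega>\<^sub>0 \<rho>\<^sub>0 \<omega>' \<rho>' \<longrightarrow>
          (\<forall>t \<in> {0..T}. \<forall>x \<in> {0..1}. \<omega>' t x = \<omega> t x \<and> \<rho>' t x = \<rho> t x))))"
proof (intro exI[of _ "\<lambda>r. 1 / (1000 * (1 + r))"] conjI ballI allI impI)
  fix r :: real assume "0 \<le> r"
  then show "1 / (1000 * (1 + r)) > 0" by simp
next
  fix \<omega>\<^sub>0 \<rho>\<^sub>0 T
  assume data: "\<omega>\<^sub>0 \<in> sobolev0 m" "\<rho>\<^sub>0 \<in> sobolev0 (m + 1)"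
    and T: "T = 1 / (1000 * (1 + (sobolev_norm m \<omega>\<^sub>0 + sobolev_norm (m + 1) \<rho>\<^sub>0)))"
  have "0 < 1000 * (1 + (sobolev_norm m \<omega>\<^sub>0 + sobolev_norm (m + 1) \<rho>\<^sub>0))"
    by (intro mult_pos_pos add_pos_nonneg add_nonneg_nonneg sobolev_norm_nonneg) simp_all
  \<comment> \<open>For the chosen life span the smallness condition of
    \<open>lagrangian_data\<close> holds with equality.\<close>
  then have T': "0 < T" "T * (1000 * (1 + (sobolev_norm m \<omega>\<^sub>0 + sobolev_norm (m + 1) \<rho>\<^sub>0))) \<le> 1"
    unfolding T by simp_all
  obtain \<omega> \<rho> where sol: "solves_ivp m T \<omega>\<^sub>0 \<rho>\<^sub>0 \<omega> \<rho>"
    using local_existence[OF assms data T'] by blast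
  show "\<exists>\<omega> \<rho>. solves_ivp m T \<omega>\<^sub>0 \<rho>\<^sub>0 \<omega> \<rho> \<and>
        (\<forall>\<omega>' \<rho>'. solves_ivp m T \<omega>\<^sub>0 \<rho>\<^sub>0 \<omega>' \<rho>' \<longrightarrow>
          (\<forall>t \<in> {0..T}. \<forall>x \<in> {0..1}. \<omega>' t x = \<omega> t x \<and> \<rho>' t x = \<rho> t x))"
  proof (rule exI[of _ \<omega>], rule exI[of _ \<rho>], intro conjI allI impI)
    show "solves_ivp m T \<omega>\<^sub>0 \<rho>\<^sub>0 \<omega> \<rho>" by (rule sol)
    fix \<omega>' \<rho>' assume sol': "solves_ivp m T \<omega>\<^sub>0 \<rho>\<^sub>0 \<omega>' \<rho>'"
    show "\<forall>t \<in> {0..T}. \<forall>x \<in> {0..1}. \<omega>' t x = \<omega> t x \<and> \<rho>' t x = \<rho> t x"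
      using solves_ivp_unique[OF T'(1) sol sol'] by blast
  qed
qed

end
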